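(* Let $f:(\mathbb{R}^n,0)\to(\mathbb{R}^n,0)$ be a tame continuous map-germ. Then $f$ is a homeomorphism if there are coordinate systems $(x_1,\dots,x_n)$ of the source and $(y_1,\dots,y_n)$ of the target such that, writing $f_j=y_j\circ f$, the following conditions hold: (1) for each $j=1,\dots,n-1$ there are positive constants $K_j,L_j$ such that $$K_j\le\det\frac{\partial(f_1,\dots,f_j)}{\partial(x_1,\dots,x_j)}\le L_j\qquad\text{except on }B(f);$$ (2) there is a positive constant $K_n$ such that $$K_n\le\det\frac{\partial(f_1,\dots,f_n)}{\partial(x_1,\dots,x_n)}\qquad\text{except on }B(f).$$
   Context: $B(f)$ is the set of points where $f$ is not differentiable. $\partial(f_1,\dots,f_j)/\partial(x_1,\dots,x_j)$ is the $j\times j$ matrix of partial derivatives. A continuous map from an open subset of $\mathbb{R}^m$ to $\mathbb{R}^n$ is tame if its graph is subanalytic or is definable in some o-minimal structure on $(\mathbb{R},+,\cdot,<)$. The statement concerns germs at $0$: the hypotheses are understood for a representative of $f$ near $0$, and the conclusion is that $f$ is a homeomorphism germ. *)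

theory Defs
  imports "HOL-Analysis.Analysis" "Jordan_Normal_Form.Determinant"
begin

section \<open>Tame maps\<close>

text \<open>
  Subanalytic sets and o-minimal structures involve all the spaces \<open>\<real>\<^sup>m\<close> at once, with \<open>m\<close>
  quantified inside the definitions; their points are represented by real lists of length \<open>m\<close>.
\<close>

definition Rn :: "nat \<Rightarrow> real list set" where
  "Rn m = {xs. length xs = m}"

definition cube :: "nat \<Rightarrow> real list \<Rightarrow> real \<Rightarrow> real list set" where
  "cube m a r = {xs \<in> Rn m. \<forall>i<m. \<bar>xs ! i - a ! i\<bar> < r}"

text \<open>
  \<open>g\<close> is near \<open>a\<close> the sum of an absolutely convergent power series in \<open>m\<close> variables, indexed by
  the multi-indices \<open>\<alpha> \<in> \<nat>\<^sup>m\<close>.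
\<close>

definition real_analytic_at :: "nat \<Rightarrow> (real list \<Rightarrow> real) \<Rightarrow> real list \<Rightarrow> bool" where
  "real_analytic_at m g a \<longleftrightarrow>
     (\<exists>r>0. \<exists>c :: nat list \<Rightarrow> real. \<forall>xs \<in> cube m a r.
        ((\<lambda>\<alpha>. c \<alpha> * (\<Prod>i<m. (xs ! i - a ! i) ^ (\<alpha> ! i))) has_sum g xs) {\<alpha>. length \<alpha> = m})"

definition semianalytic :: "nat \<Rightarrow> real list set \<Rightarrow> bool" where
  "semianalytic m A \<longleftrightarrow> A \<subseteq> Rn m \<and>
     (\<forall>a \<in> Rn m. \<exists>r>0. \<exists>F :: ((real list \<Rightarrow> real) set \<times> (real list \<Rightarrow> real) set) set.
        finite F \<and>
        (\<forall>(G, H) \<in> F. finite G \<and> finite H \<and>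
           (\<forall>g \<in> G \<union> H. \<forall>b \<in> cube m a r. real_analytic_at m g b)) \<and>
        A \<inter> cube m a r =
          (\<Union>(G, H) \<in> F. {xs \<in> cube m a r. (\<forall>g \<in> G. g xs = 0) \<and> (\<forall>h \<in> H. h xs > 0)}))"

text \<open>
  Locally the projection, along some \<open>\<real>\<^sup>l\<close>, of a relatively compact (that is, bounded)
  semianalytic set.
\<close>

definition subanalytic :: "nat \<Rightarrow> real list set \<Rightarrow> bool" where
  "subanalytic m A \<longleftrightarrow> A \<subseteq> Rn m \<and>
     (\<forall>a \<in> Rn m. \<exists>r>0. \<exists>l B R. semianalytic (m + l) B \<and>
        (\<forall>xs \<in> B. \<forall>i < m + l. \<bar>xs ! i\<bar> \<le> R) \<and>
        A \<inter> cube m a r = take m ` B)"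

text \<open>
  \<open>S m\<close> is the collection of definable subsets of \<open>\<real>\<^sup>m\<close>. Intervals in \<open>o_minimal\<close> may be
  unbounded, degenerate or empty. As all of their finite unions are definable, so is every
  singleton, and definability is with real parameters.
\<close>

locale o_minimal_structure =
  fixes S :: "nat \<Rightarrow> real list set set"
  assumes dim: "A \<in> S m \<Longrightarrow> A \<subseteq> Rn m"
    and empty: "{} \<in> S m"
    and union: "A \<in> S m \<Longrightarrow> B \<in> S m \<Longrightarrow> A \<union> B \<in> S m"
    and compl: "A \<in> S m \<Longrightarrow> Rn m - A \<in> S m"
    and prod_left: "A \<in> S m \<Longrightarrow> {t # xs | t xs. xs \<in> A} \<in> S (Suc m)"
    and prod_right: "A \<in> S m \<Longrightarrow> {xs @ [t] | t xs. xs \<in> A} \<in> S (Suc m)"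
    and diagonal: "i < m \<Longrightarrow> j < m \<Longrightarrow> {xs \<in> Rn m. xs ! i = xs ! j} \<in> S m"
    and proj: "A \<in> S (Suc m) \<Longrightarrow> take m ` A \<in> S m"
    and less: "{[s, t] | s t. s < t} \<in> S 2"
    and add: "{[s, t, s + t] | s t. True} \<in> S 3"
    and mult: "{[s, t, s * t] | s t. True} \<in> S 3"
    and o_minimal: "A \<in> S 1 \<longleftrightarrow>
      (\<exists>F :: real set set. finite F \<and> (\<forall>I \<in> F. is_interval I) \<and> A = (\<lambda>t. [t]) ` \<Union>F)"

text \<open>
  \<open>\<real>\<^sup>n\<close> is \<open>real ^ 'n\<close> for a linearly ordered index type of cardinality \<open>n\<close>. The order
  serves only to number the coordinates: \<open>idx 1, \<dots>, idx n\<close> are the indices in increasing order.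
\<close>

definition idx :: "nat \<Rightarrow> 'n::{finite, linorder}" where
  "idx k = sorted_list_of_set UNIV ! (k - 1)"

definition vec_list :: "real ^ 'n::{finite, linorder} \<Rightarrow> real list" where
  "vec_list v = map (\<lambda>k. vec_nth v (idx k)) [1..<Suc CARD('n)]"

definition graph_on :: "(real ^ 'm::{finite, linorder}) set \<Rightarrow>
    (real ^ 'm::_ \<Rightarrow> real ^ 'n::{finite, linorder}) \<Rightarrow> real list set" where
  "graph_on U f = (\<lambda>p. vec_list p @ vec_list (f p)) ` U"

definition tame_on :: "(real ^ 'm::{finite, linorder}) set \<Rightarrow>
    (real ^ 'm::_ \<Rightarrow> real ^ 'n::{finite, linorder}) \<Rightarrow> bool" where
  "tame_on U f \<longleftrightarrow> open U \<and> continuous_on U f \<and>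
     (subanalytic (CARD('m) + CARD('n)) (graph_on U f) \<or>
      (\<exists>S. o_minimal_structure S \<and> graph_on U f \<in> S (CARD('m) + CARD('n))))"


section \<open>Coordinate systems and Jacobian minors\<close>

definition nondiff_set :: "(real ^ 'm) set \<Rightarrow> (real ^ 'm \<Rightarrow> real ^ 'n) \<Rightarrow> (real ^ 'm) set" where
  "nondiff_set U f = {p \<in> U. \<not> f differentiable (at p)}"

definition C1_on :: "(real ^ 'm) set \<Rightarrow> (real ^ 'm \<Rightarrow> real ^ 'n) \<Rightarrow> bool" where
  "C1_on U f \<longleftrightarrow> (\<exists>f' :: real ^ 'm \<Rightarrow> ((real ^ 'm) \<Rightarrow>\<^sub>L (real ^ 'n)).
     (\<forall>p \<in> U. (f has_derivative blinfun_apply (f' p)) (at p)) \<and> continuous_on U f')"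

text \<open>
  A coordinate system at \<open>a\<close> is a \<open>C\<^sup>1\<close> diffeomorphism \<open>x\<close> of an open neighbourhood \<open>V\<close> of \<open>a\<close>
  onto an open set; the \<open>k\<close>-th coordinate function is the \<open>idx k\<close> component of \<open>x\<close>.
  Neither more smoothness nor \<open>x a = 0\<close> is required.
\<close>

definition coordinate_system ::
    "real ^ 'n \<Rightarrow> (real ^ 'n) set \<Rightarrow> (real ^ 'n \<Rightarrow> real ^ 'n) \<Rightarrow> bool" where
  "coordinate_system a V x \<longleftrightarrow> open V \<and> a \<in> V \<and> inj_on x V \<and> open (x ` V) \<and>
     C1_on V x \<and> C1_on (x ` V) (the_inv_into V x)"

text \<open>
  \<open>\<partial>g/\<partial>x\<^sub>k\<close> at \<open>p \<in> V\<close>: all coordinates but the \<open>k\<close>-th are kept fixed.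
\<close>

definition coord_partial ::
    "(real ^ 'n::{finite, linorder}) set \<Rightarrow> (real ^ 'n::_ \<Rightarrow> real ^ 'n::_) \<Rightarrow> nat \<Rightarrow>
     (real ^ 'n::_ \<Rightarrow> real) \<Rightarrow> real ^ 'n::_ \<Rightarrow> real" where
  "coord_partial V x k g p =
     deriv (\<lambda>t. g (the_inv_into V x (x p + t *\<^sub>R axis (idx k) 1))) 0"

text \<open>
  The determinant of \<open>\<partial>(f\<^sub>1,\<dots>,f\<^sub>j)/\<partial>(x\<^sub>1,\<dots>,x\<^sub>j)\<close> at \<open>p\<close>, where \<open>f\<^sub>i = y\<^sub>i \<circ> f\<close>. Rows and columns
  of \<^typ>\<open>real mat\<close> are numbered from \<open>0\<close>.
\<close>

definition jacobian_minor ::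
    "(real ^ 'n::{finite, linorder}) set \<Rightarrow> (real ^ 'n::_ \<Rightarrow> real ^ 'n::_) \<Rightarrow>
     (real ^ 'n::_ \<Rightarrow> real ^ 'n::_) \<Rightarrow> (real ^ 'n::_ \<Rightarrow> real ^ 'n::_) \<Rightarrow> nat \<Rightarrow> real ^ 'n::_ \<Rightarrow> real" where
  "jacobian_minor V x y f j p =
     Determinant.det (Matrix.mat j j (\<lambda>(i, k).
       coord_partial V x (Suc k) (\<lambda>q. vec_nth (y (f q)) (idx (Suc i))) p))"

end

theory Submission
  imports Defs "HOL-Complex_Analysis.Complex_Analysis"
begin

text \<open>
  Write \<open>F = y \<circ> f \<circ> x\<^sup>-\<^sup>1\<close> and \<open>\<Psi>\<^sub>j = (F\<^sub>1, \<dots>, F\<^sub>j, x\<^sub>j\<^sub>+\<^sub>1, \<dots>, x\<^sub>n)\<close>. By induction on \<open>j\<close>, each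
  \<open>\<Psi>\<^sub>j\<close> is injective near \<open>0\<close>, hence open by invariance of domain. By Cramer's rule the derivative of
  \<open>F\<^sub>j \<circ> \<Psi>\<^sub>j\<^sub>-\<^sub>1\<^sup>-\<^sup>1\<close> along the \<open>j\<close>-th axis is a quotient of consecutive leading minors, so at good
  points it exceeds some \<open>c > 0\<close>. If \<open>F\<^sub>j \<circ> \<Psi>\<^sub>j\<^sub>-\<^sub>1\<^sup>-\<^sup>1 - c z\<^sub>j\<close> decreased somewhere along that axis, it would
  cross a whole open set of (line, value) pairs downwards. Since the bad part of the graph is mapped
  to a null set, some crossing takes place at a good point, a contradiction.

  This needs only that the bad part \<open>{(p, f p) | p \<in> B(f)}\<close> is small: every map into \<open>\<real>\<^sup>n\<close>
  that is differentiable at its points sends it to a null set. Smallness is a \<open>\<sigma>\<close>-ideal, and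
  images of subsets of \<open>\<real>\<^sup>r\<close>, \<open>r < n\<close>, under differentiable parametrizations are small.
  In the o-minimal case \<open>B(f)\<close> has empty interior, and definable sets with empty interior are countable unions
  of pieces parametrized by fewer coordinates, on which the graph map is again generically
  differentiable. In the subanalytic case the graph is locally a projection of a semianalytic set;
  the equations are removed one at a time, each nonflat one eliminating a coordinate by the implicit
  function theorem, until the source coordinates are coordinates of the parametrization, where \<open>f\<close>
  is analytic.
\<close>

section \<open>Small subsets of the graph\<close>

text \<open>Almost everywhere positive minors alone prove nothing: \<open>t - 2 * C t\<close>, with
  \<open>C\<close> the Cantor function, is continuous with derivative 1 off a null set and is not
  injective. So it is the image of the bad set that must be null, under the maps sending
  \<open>q\<close> to \<open>\<Psi>\<^sub>j q\<close> minus \<open>c * q\<^sub>j\<close> along axis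
  \<open>j\<close>, which depend on the coordinate systems and on \<open>c\<close>. All of them
  factor through the graph: they are \<open>(p, f p)\<close> followed by a map built from
  \<open>x\<close> and \<open>y\<close> alone. This is why smallness concerns the bad part of the
  graph and is tested against all maps at once, and only where they are differentiable,
  \<open>x\<close> and \<open>y\<close> being controlled near 0 only. The upper bounds serve as
  denominators: \<open>K\<^sub>j / L\<^sub>j\<^sub>-\<^sub>1\<close> bounds a quotient of
  consecutive minors from below, and half of it is the \<open>c\<close> that turns weak into strict
  monotonicity. The last minor is never a denominator. Countable covers and null sets take the place
  of cell decomposition and stratification: a piece only has to be determined by fewer than
  \<open>n\<close> coordinates, with the graph map pointwise Lipschitz in them.\<close>

definition small :: "((real ^ 'n::finite) \<times> (real ^ 'n::_)) set \<Rightarrow> bool" where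
  "small A \<longleftrightarrow> (\<forall>\<Psi> :: (real ^ 'n::_) \<times> (real ^ 'n::_) \<Rightarrow> real ^ 'n::_.
     negligible (\<Psi> ` {z \<in> A. \<Psi> differentiable (at z)}))"

lemma smallD:
  fixes \<Psi> :: "(real ^ 'n::finite) \<times> (real ^ 'n::_) \<Rightarrow> real ^ 'n::_"
  shows "small A \<Longrightarrow> negligible (\<Psi> ` {z \<in> A. \<Psi> differentiable (at z)})"
  by (simp add: small_def)

lemma small_subset:
  fixes A :: "((real ^ 'n::finite) \<times> (real ^ 'n::_)) set"
  assumes A: "small A" and B: "B \<subseteq> A"
  shows "small B"
  unfolding small_def
proof
  fix \<Psi> :: "(real ^ 'n) \<times> (real ^ 'n) \<Rightarrow> real ^ 'n"
  have "\<Psi> ` {z \<in> B. \<Psi> differentiable (at z)} \<subseteq> \<Psi> ` {z \<in> A. \<Psi> differentiable (at z)}"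
    using B by blast
  then show "negligible (\<Psi> ` {z \<in> B. \<Psi> differentiable (at z)})"
    using smallD[OF A, of \<Psi>] negligible_subset by blast
qed

lemma small_empty [simp]: "small {}"
  by (simp add: small_def)

lemma small_UN:
  fixes A :: "'i \<Rightarrow> ((real ^ 'n::finite) \<times> (real ^ 'n::_)) set"
  assumes "countable I" and "\<And>i. i \<in> I \<Longrightarrow> small (A i)"
  shows "small (\<Union>i\<in>I. A i)"
  unfolding small_def
proof
  fix \<Psi> :: "(real ^ 'n) \<times> (real ^ 'n) \<Rightarrow> real ^ 'n"
  have "negligible (\<Union>i\<in>I. \<Psi> ` {z \<in> A i. \<Psi> differentiable (at z)})"
    using assms by (intro negligible_countable_Union) (auto intro: smallD)
  moreover have "\<Psi> ` {z \<in> (\<Union>i\<in>I. A i). \<Psi> differentiable (at z)} \<subseteq>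
      (\<Union>i\<in>I. \<Psi> ` {z \<in> A i. \<Psi> differentiable (at z)})" by auto
  ultimately show "negligible (\<Psi> ` {z \<in> (\<Union>i\<in>I. A i). \<Psi> differentiable (at z)})"
    by (rule negligible_subset)
qed

lemma small_Un: "small A \<Longrightarrow> small B \<Longrightarrow> small (A \<union> B)"
  using small_UN[of "UNIV :: bool set" "\<lambda>b. if b then A else B"]
  by (auto simp: UNIV_bool Un_commute)

text \<open>One end point stays fixed, so differentiability at \<open>x\<close> alone is enough;
  bounds of this kind already preserve null sets.\<close>

lemma differentiable_imp_pointwise_lipschitz:
  fixes f :: "'a::real_normed_vector \<Rightarrow> 'b::real_normed_vector"
  assumes "f differentiable (at x)"
  obtains B d where "d > 0" "B \<ge> 0" "\<And>y. norm (y - x) < d \<Longrightarrow> norm (f y - f x) \<le> B * norm (y - x)"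
proof -
  obtain f' where f': "(f has_derivative f') (at x)"
    using assms by (auto simp: differentiable_def)
  obtain B where B: "B > 0" "\<And>h. norm (f' h) \<le> norm h * B"
    using bounded_linear.pos_bounded[OF has_derivative_bounded_linear[OF f']] by blast
  have alt: "\<forall>e>0. \<exists>d>0. \<forall>y. norm (y - x) < d \<longrightarrow> norm (f y - f x - f' (y - x)) \<le> e * norm (y - x)"
    using f' unfolding has_derivative_at_alt by blast
  then obtain d where d: "d > 0" "\<And>y. norm (y - x) < d \<Longrightarrow> norm (f y - f x - f' (y - x)) \<le> 1 * norm (y - x)"
    using alt[rule_format, of 1] by auto
  show ?thesis
  proof (rule that[of d "B + 1"])
    fix y assume y: "norm (y - x) < d"
    have "norm (f y - f x) \<le> norm (f y - f x - f' (y - x)) + norm (f' (y - x))"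
      using norm_triangle_ineq[of "f y - f x - f' (y - x)" "f' (y - x)"] by simp
    also have "\<dots> \<le> norm (y - x) + norm (y - x) * B"
      using d(2)[OF y] B(2)[of "y - x"] by linarith
    finally show "norm (f y - f x) \<le> (B + 1) * norm (y - x)"
      by (simp add: algebra_simps)
  qed (use d B in auto)
qed

text \<open>At each point of \<open>N\<close> the composite \<open>\<Psi> \<circ> \<theta>\<close>
  is Lipschitz relative to \<open>N\<close>, with constants that may depend on the point, and such a
  map keeps null sets null. Comparing points of \<open>N\<close> only allows \<open>\<theta>\<close>
  to be the inverse of a parametrization, extended arbitrarily.\<close>

lemma small_image:
  fixes \<theta> :: "real ^ 'n::finite \<Rightarrow> (real ^ 'n::_) \<times> (real ^ 'n::_)"
  assumes N: "negligible N"
    and lip: "\<And>x. x \<in> N \<Longrightarrow> \<exists>d>0. \<exists>B. \<forall>y\<in>N. norm (y - x) < d \<longrightarrow> norm (\<theta> y - \<theta> x) \<le> B * norm (y - x)"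
  shows "small (\<theta> ` N)"
  unfolding small_def
proof
  fix \<Psi> :: "(real ^ 'n::_) \<times> (real ^ 'n::_) \<Rightarrow> real ^ 'n::_"
  let ?N = "{x \<in> N. \<Psi> differentiable (at (\<theta> x))}"
  have "negligible ((\<Psi> \<circ> \<theta>) ` ?N)"
  proof (rule negligible_locally_Lipschitz_image)
    show "negligible ?N" by (rule negligible_subset[OF N]) auto
    fix x assume x: "x \<in> ?N"
    obtain d B where dB: "d > 0" "\<And>y. y \<in> N \<Longrightarrow> norm (y - x) < d \<Longrightarrow> norm (\<theta> y - \<theta> x) \<le> B * norm (y - x)"
      using lip x by blast
    obtain d' B' where dB': "d' > 0" "B' \<ge> 0"
      "\<And>z. norm (z - \<theta> x) < d' \<Longrightarrow> norm (\<Psi> z - \<Psi> (\<theta> x)) \<le> B' * norm (z - \<theta> x)"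
      using x differentiable_imp_pointwise_lipschitz[of \<Psi> "\<theta> x"] by blast
    \<comment> \<open>The factor \<open>\<bar>B\<bar> + 1\<close> is positive whatever the sign of
      \<open>B\<close>; within distance \<open>e\<close> the map \<open>\<theta>\<close> moves by
      less than \<open>d'\<close>.\<close>
    define e where "e = min d (d' / (\<bar>B\<bar> + 1))"
    have e: "e > 0" using dB dB' by (simp add: e_def)
    show "\<exists>T B. open T \<and> x \<in> T \<and> (\<forall>y\<in>?N \<inter> T. norm ((\<Psi> \<circ> \<theta>) y - (\<Psi> \<circ> \<theta>) x) \<le> B * norm (y - x))"
    proof (intro exI conjI ballI)
      fix y assume y: "y \<in> ?N \<inter> ball x e"
      then have yx: "norm (y - x) < e" by (simp add: dist_norm norm_minus_commute)
      have 1: "norm (\<theta> y - \<theta> x) \<le> B * norm (y - x)" using dB(2)[of y] y yx by (simp add: e_def)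
      also have "\<dots> \<le> (\<bar>B\<bar> + 1) * norm (y - x)" by (intro mult_right_mono) auto
      also have "\<dots> < (\<bar>B\<bar> + 1) * (d' / (\<bar>B\<bar> + 1))"
        using yx by (intro mult_strict_left_mono) (auto simp: e_def)
      also have "\<dots> = d'" by simp
      finally have "norm (\<Psi> (\<theta> y) - \<Psi> (\<theta> x)) \<le> B' * norm (\<theta> y - \<theta> x)" by (rule dB'(3))
      also have "\<dots> \<le> B' * (B * norm (y - x))" using 1 dB' by (intro mult_left_mono) auto
      finally show "norm ((\<Psi> \<circ> \<theta>) y - (\<Psi> \<circ> \<theta>) x) \<le> (B' * B) * norm (y - x)" by simp
    qed (use e in auto)
  qed simp
  then show "negligible (\<Psi> ` {z \<in> \<theta> ` N. \<Psi> differentiable (at z)})"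
    by (rule negligible_subset) auto
qed


section \<open>Injectivity from bounds on the leading minors\<close>

lemma idx_bij: "bij_betw (idx :: nat \<Rightarrow> 'n::{finite, linorder}) {1..CARD('n)} UNIV"
proof -
  let ?l = "sorted_list_of_set (UNIV :: 'n set)"
  have l: "length ?l = CARD('n)" "distinct ?l" "set ?l = UNIV" by auto
  have "bij_betw (\<lambda>k. ?l ! k) {..<CARD('n)} UNIV"
    using bij_betw_nth[OF l(2), of "{..<CARD('n)}" UNIV] l by simp
  moreover have "bij_betw (\<lambda>k. k - 1) {1..CARD('n)} {..<CARD('n)}"
    by (rule bij_betwI[where g = Suc]) auto
  ultimately have "bij_betw ((\<lambda>k. ?l ! k) \<circ> (\<lambda>k. k - 1)) {1..CARD('n)} UNIV"
    using bij_betw_trans by blast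
  then show ?thesis by (simp add: idx_def[abs_def] comp_def)
qed

definition rk :: "'n::{finite, linorder} \<Rightarrow> nat" where
  "rk = the_inv_into {1..CARD('n)} idx"

lemma idx_rk [simp]: "idx (rk i) = i"
  using f_the_inv_into_f_bij_betw[OF idx_bij, of i] by (simp add: rk_def)

lemma rk_idx [simp]: "1 \<le> k \<Longrightarrow> k \<le> CARD('n) \<Longrightarrow> rk (idx k :: 'n::{finite, linorder}) = k"
  unfolding rk_def using the_inv_into_f_f[OF bij_betw_imp_inj_on[OF idx_bij]] by auto

lemma rk_range: "1 \<le> rk (i :: 'n::{finite, linorder})" "rk (i :: 'n::_) \<le> CARD('n)"
proof -
  have "rk i \<in> {1..CARD('n)}"
    unfolding rk_def using bij_betwE[OF bij_betw_the_inv_into[OF idx_bij]] by blast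
  then show "1 \<le> rk i" "rk i \<le> CARD('n)" by auto
qed

lemma rk_inject [simp]: "rk i = rk j \<longleftrightarrow> i = j"
  by (metis idx_rk)

lemma sum_idx:
  fixes g :: "'n::{finite, linorder} \<Rightarrow> 'b::comm_monoid_add"
  shows "(\<Sum>i\<in>UNIV. g i) = (\<Sum>k<CARD('n). g (idx (Suc k)))"
proof -
  have "(\<Sum>i\<in>UNIV. g i) = (\<Sum>k\<in>{1..CARD('n)}. g (idx k))"
    using sum.reindex_bij_betw[OF idx_bij, of g] by simp
  also have "\<dots> = (\<Sum>k<CARD('n). g (idx (Suc k)))"
    by (rule sum.reindex_bij_witness[where i = Suc and j = "\<lambda>k. k - 1"]) auto
  finally show ?thesis .
qed

text \<open>The entries of \<open>v\<close> beyond \<open>m\<close> vanish, so only the first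
  \<open>m\<close> columns of the matrix of \<open>F'\<close> contribute.\<close>

lemma linear_leading_sum:
  fixes F' :: "real ^ 'n::{finite, linorder} \<Rightarrow> real ^ 'n::_"
  assumes F': "linear F'" and m: "m \<le> CARD('n)" and v: "\<And>i. rk i > m \<Longrightarrow> vec_nth v i = 0"
  shows "vec_nth (F' v) i =
    (\<Sum>k<m. vec_nth (F' (axis (idx (Suc k)) 1)) i * vec_nth v (idx (Suc k)))"
proof -
  have "v = (\<Sum>k\<in>UNIV. vec_nth v k *\<^sub>R axis k 1)"
    by (simp add: Finite_Cartesian_Product.vec_eq_iff axis_def if_distrib cong: if_cong)
  then have "F' v = (\<Sum>k\<in>UNIV. vec_nth v k *\<^sub>R F' (axis k 1))"
    using F' by (metis (no_types, lifting) linear_cmul linear_sum sum.cong)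
  then have "vec_nth (F' v) i = (\<Sum>k\<in>UNIV. vec_nth (F' (axis k 1)) i * vec_nth v k)"
    by (simp add: mult.commute)
  also have "\<dots> = (\<Sum>k<CARD('n). vec_nth (F' (axis (idx (Suc k)) 1)) i * vec_nth v (idx (Suc k)))"
    by (rule sum_idx)
  also have "\<dots> = (\<Sum>k<m. vec_nth (F' (axis (idx (Suc k)) 1)) i * vec_nth v (idx (Suc k)))"
    using m v by (intro sum.mono_neutral_right) auto
  finally show ?thesis .
qed

definition minor :: "(real ^ 'n::{finite, linorder} \<Rightarrow> real ^ 'n::_) \<Rightarrow> nat \<Rightarrow> real" where
  "minor F' j = Determinant.det (Matrix.mat j j (\<lambda>(i, k).
     vec_nth (F' (axis (idx (Suc k)) 1)) (idx (Suc i))))"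

text \<open>The empty determinant is the denominator in the first step of the induction on
  \<open>j\<close>.\<close>

lemma minor_0 [simp]: "minor F' 0 = 1"
  by (simp add: minor_def)

text \<open>Multiply \<open>A v\<close> by the adjugate: the result is \<open>det A\<close> times
  \<open>v\<close>, with last entry \<open>det A\<close>. Only the last entry of \<open>A v\<close>
  contributes, and the last diagonal entry of the adjugate is the preceding leading minor, with sign
  \<open>+\<close>.\<close>

lemma cramer_last:
  fixes A :: "real Matrix.mat"
  assumes A: "A \<in> carrier_mat (Suc m) (Suc m)" and v: "v \<in> carrier_vec (Suc m)"
    and v1: "vec_index v m = 1" and z: "\<And>i. i < m \<Longrightarrow> vec_index (mult_mat_vec A v) i = 0"
  shows "vec_index (mult_mat_vec A v) m * Determinant.det (mat_delete A m m) = Determinant.det A"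
proof -
  let ?w = "mult_mat_vec A v"
  have w: "?w \<in> carrier_vec (Suc m)" using A v by simp
  have adj: "adj_mat A \<in> carrier_mat (Suc m) (Suc m)" "adj_mat A * A = Determinant.det A \<cdot>\<^sub>m 1\<^sub>m (Suc m)"
    using adj_mat[OF A] by auto
  have "mult_mat_vec (adj_mat A) ?w = mult_mat_vec (adj_mat A * A) v"
    using assoc_mult_mat_vec[OF adj(1) A v] by simp
  also have "\<dots> = Determinant.det A \<cdot>\<^sub>v v"
    by (rule eq_vecI) (use adj(2) v in auto)
  finally have "vec_index (mult_mat_vec (adj_mat A) ?w) m = Determinant.det A"
    using v v1 by simp
  moreover have "vec_index (mult_mat_vec B w) m = (\<Sum>k<Suc m. B $$ (m, k) * vec_index w k)"
    if "B \<in> carrier_mat (Suc m) (Suc m)" "w \<in> carrier_vec (Suc m)" for B and w :: "real Matrix.vec"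
    using that by (auto simp: scalar_prod_def atLeast0LessThan intro!: sum.cong)
  then have "vec_index (mult_mat_vec (adj_mat A) ?w) m =
      (\<Sum>k<Suc m. adj_mat A $$ (m, k) * vec_index ?w k)"
    using adj(1) w by blast
  moreover have "\<dots> = adj_mat A $$ (m, m) * vec_index ?w m"
    using z by simp
  moreover have "adj_mat A $$ (m, m) = Determinant.det (mat_delete A m m)"
    using A by (simp add: adj_mat_def cofactor_def)
  ultimately show ?thesis by (simp add: mult.commute)
qed

lemma mult_minor_mat:
  fixes F' :: "real ^ 'n::{finite, linorder} \<Rightarrow> real ^ 'n::_"
  assumes F': "linear F'" and m: "m \<le> CARD('n)" and v: "\<And>i. rk i > m \<Longrightarrow> vec_nth v i = 0"
    and i: "i < m"
  shows "vec_index (mult_mat_vec (Matrix.mat m m (\<lambda>(i, k).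
     vec_nth (F' (axis (idx (Suc k)) 1)) (idx (Suc i)))) (Matrix.vec m (\<lambda>k. vec_nth v (idx (Suc k))))) i =
     vec_nth (F' v) (idx (Suc i))"
  using i by (simp add: scalar_prod_def linear_leading_sum[OF F' m v] atLeast0LessThan)

text \<open>Cramer's rule for the direction \<open>v\<close> in which the first \<open>m\<close>
  components of \<open>F\<close> do not change to first order while coordinate \<open>m + 1\<close>
  has speed 1: component \<open>m + 1\<close> then changes at the quotient of consecutive
  minors.\<close>

lemma minor_ratio:
  fixes F' :: "real ^ 'n::{finite, linorder} \<Rightarrow> real ^ 'n::_"
  assumes F': "linear F'" and m: "m < CARD('n)" and v: "\<And>i. rk i > Suc m \<Longrightarrow> vec_nth v i = 0"
    and v1: "vec_nth v (idx (Suc m)) = 1"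
    and z: "\<And>i. rk i \<le> m \<Longrightarrow> vec_nth (F' v) i = 0"
  shows "vec_nth (F' v) (idx (Suc m)) * minor F' m = minor F' (Suc m)"
proof -
  let ?A = "Matrix.mat (Suc m) (Suc m) (\<lambda>(i, k). vec_nth (F' (axis (idx (Suc k)) 1)) (idx (Suc i)))"
  let ?v = "Matrix.vec (Suc m) (\<lambda>k. vec_nth v (idx (Suc k)))"
  have *: "vec_index (mult_mat_vec ?A ?v) i = vec_nth (F' v) (idx (Suc i))" if "i < Suc m" for i
    using mult_minor_mat[OF F', of "Suc m" v i] m v that by auto
  have "vec_index (mult_mat_vec ?A ?v) m * Determinant.det (mat_delete ?A m m) = Determinant.det ?A"
  proof (rule cramer_last)
    fix i assume "i < m"
    then show "vec_index (mult_mat_vec ?A ?v) i = 0" using *[of i] z[of "idx (Suc i)"] m by simp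
  qed (use v1 in auto)
  moreover have "mat_delete ?A m m = Matrix.mat m m (\<lambda>(i, k). vec_nth (F' (axis (idx (Suc k)) 1)) (idx (Suc i)))"
    by (rule eq_matI) (auto simp: mat_delete_def)
  ultimately show ?thesis using *[of m] by (simp add: minor_def)
qed

text \<open>The hypotheses on \<open>v\<close> describe the kernel of the derivative of
  \<open>mix F m\<close>, which is thereby trivial: the leading block alone acts on
  \<open>v\<close>.\<close>

lemma minor_injective:
  fixes F' :: "real ^ 'n::{finite, linorder} \<Rightarrow> real ^ 'n::_"
  assumes F': "linear F'" and m: "m \<le> CARD('n)" and v: "\<And>i. rk i > m \<Longrightarrow> vec_nth v i = 0"
    and z: "\<And>i. rk i \<le> m \<Longrightarrow> vec_nth (F' v) i = 0" and nz: "minor F' m \<noteq> 0"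
  shows "v = 0"
proof -
  let ?A = "Matrix.mat m m (\<lambda>(i, k). vec_nth (F' (axis (idx (Suc k)) 1)) (idx (Suc i)))"
  let ?v = "Matrix.vec m (\<lambda>k. vec_nth v (idx (Suc k)))"
  have "mult_mat_vec ?A ?v = 0\<^sub>v m"
  proof (rule eq_vecI)
    fix i assume i: "i < dim_vec (0\<^sub>v m :: real Matrix.vec)"
    then show "vec_index (mult_mat_vec ?A ?v) i = vec_index (0\<^sub>v m) i"
      using mult_minor_mat[OF F' m v, of i] z[of "idx (Suc i)"] m by simp
  qed auto
  moreover have "?A \<in> carrier_mat m m" "?v \<in> carrier_vec m" by auto
  ultimately have v0: "?v = 0\<^sub>v m"
    using nz det_0_iff_vec_prod_zero_field[of ?A m] unfolding minor_def by blast
  have "vec_nth v i = 0" for i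
  proof (cases "rk i \<le> m")
    case True
    have "vec_index ?v (rk i - 1) = 0" using True v0 rk_range(1)[of i] by simp
    then show ?thesis using True rk_range(1)[of i] by simp
  qed (use v in auto)
  then show ?thesis by (simp add: Finite_Cartesian_Product.vec_eq_iff)
qed

text \<open>The level set is compact, so it has a last point; a later value above \<open>w\<close>
  would produce a later crossing. That the function stays below \<open>w\<close> afterwards is what
  a positive derivative at \<open>\<tau>\<close> contradicts.\<close>

lemma last_crossing:
  fixes \<psi> :: "real \<Rightarrow> real"
  assumes c: "continuous_on {0..t} \<psi>" and t: "0 < t" and w: "\<psi> 0 > w" "w > \<psi> t"
  obtains \<tau> where "0 \<le> \<tau>" "\<tau> < t" "\<psi> \<tau> = w" "\<And>s. \<tau> < s \<Longrightarrow> s \<le> t \<Longrightarrow> \<psi> s < w"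
proof -
  let ?S = "{\<tau> \<in> {0..t}. \<psi> \<tau> = w}"
  have "compact ?S"
  proof -
    have "closed ?S" using continuous_closed_preimage_constant[OF c] by simp
    moreover have "bounded ?S" by (rule bounded_subset[of "{0..t}"]) auto
    ultimately show ?thesis by (simp add: compact_eq_bounded_closed)
  qed
  moreover have "?S \<noteq> {}"
    using IVT2'[of \<psi> t w 0] assms by auto
  ultimately obtain \<tau> where \<tau>: "\<tau> \<in> ?S" "\<And>s. s \<in> ?S \<Longrightarrow> s \<le> \<tau>"
    using compact_attains_sup[of ?S] by blast
  show ?thesis
  proof (rule that[of \<tau>])
    show "0 \<le> \<tau>" "\<psi> \<tau> = w" using \<tau> by auto
    show "\<tau> < t" using \<tau> w by (cases "\<tau> = t") auto
    fix s assume s: "\<tau> < s" "s \<le> t"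
    show "\<psi> s < w"
    proof (rule ccontr)
      assume "\<not> \<psi> s < w"
      moreover have "continuous_on {s..t} \<psi>"
        by (rule continuous_on_subset[OF c]) (use s \<tau> in auto)
      ultimately obtain s' where "s \<le> s'" "s' \<le> t" "\<psi> s' = w"
        using IVT2'[of \<psi> t w s] s w by auto
      then show False using \<tau>(2)[of s'] \<tau>(1) s by auto
    qed
  qed
qed

text \<open>A vector \<open>v\<close> names both a line parallel to axis \<open>k\<close> and a
  level, and \<open>G z = v\<close> says that on this line the level is attained at
  \<open>z\<close>. Downward crossings of an open set of levels and lines therefore cannot all take
  place in \<open>Z\<close>, whose image is null.\<close>

lemma monotone_coordinate:
  fixes G :: "real ^ 'n::finite \<Rightarrow> real ^ 'n::_"
  assumes P: "open P" "convex P" and G: "continuous_on P G"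
    and keep: "\<And>z i. z \<in> P \<Longrightarrow> i \<noteq> k \<Longrightarrow> vec_nth (G z) i = vec_nth z i"
    and Z: "negligible (G ` Z)"
    and der: "\<And>z. z \<in> P \<Longrightarrow> z \<notin> Z \<Longrightarrow> \<exists>D>0.
      ((\<lambda>t. vec_nth (G (z + t *\<^sub>R axis k 1)) k) has_real_derivative D) (at 0)"
    and z: "z \<in> P" "z + t *\<^sub>R axis k 1 \<in> P" and t: "t > 0"
  shows "vec_nth (G z) k \<le> vec_nth (G (z + t *\<^sub>R axis k 1)) k"
proof (rule ccontr)
  assume *: "\<not> ?thesis"
  \<comment> \<open>A level strictly between the two values; nearby levels are still crossed on
    nearby lines.\<close>
  define w0 where "w0 = (vec_nth (G z) k + vec_nth (G (z + t *\<^sub>R axis k 1)) k) / 2"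
  \<comment> \<open>The coordinates of \<open>v\<close> other than \<open>k\<close> name the line,
    coordinate \<open>k\<close> the level; \<open>b v\<close> is the point of that line at the
    height of \<open>z\<close>.\<close>
  define b :: "real ^ 'n::_ \<Rightarrow> real ^ 'n::_" where "b v = v + (vec_nth z k - vec_nth v k) *\<^sub>R axis k 1" for v
  define v0 where "v0 = z + (w0 - vec_nth z k) *\<^sub>R axis k 1"
  have bv0: "b v0 = z"
    by (simp add: b_def v0_def Finite_Cartesian_Product.vec_eq_iff axis_def)
  have cb: "isCont b v" "isCont (\<lambda>v. b v + t *\<^sub>R axis k 1) v" for v
    unfolding b_def by (intro continuous_intros)+
  have cG: "isCont G x" if "x \<in> P" for x
    using G P that by (simp add: continuous_on_eq_continuous_at)
  have c1: "isCont (\<lambda>v. G (b v)) v0"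
    using isCont_o2[OF cb(1)] cG[OF z(1)] bv0 by metis
  have c2: "isCont (\<lambda>v. G (b v + t *\<^sub>R axis k 1)) v0"
    using isCont_o2[OF cb(2)] cG[OF z(2)] bv0 by metis
  have c1': "isCont (\<lambda>v. vec_nth (G (b v)) k - vec_nth v k) v0"
    using c1 by (intro continuous_intros)
  have c2': "isCont (\<lambda>v. vec_nth v k - vec_nth (G (b v + t *\<^sub>R axis k 1)) k) v0"
    using c2 by (intro continuous_intros)
  have v0k: "vec_nth v0 k = w0" by (simp add: v0_def axis_def)
  have "\<forall>\<^sub>F v in nhds v0. b v \<in> P"
  proof -
    have "\<forall>\<^sub>F v in at v0. b v \<in> P"
      using cb(1)[of v0] P(1) z(1) bv0 unfolding isCont_def by (intro topological_tendstoD) auto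
    then show ?thesis using z(1) bv0 by (simp add: eventually_nhds_conv_at)
  qed
  moreover have "\<forall>\<^sub>F v in nhds v0. b v + t *\<^sub>R axis k 1 \<in> P"
  proof -
    have "\<forall>\<^sub>F v in at v0. b v + t *\<^sub>R axis k 1 \<in> P"
      using cb(2)[of v0] P(1) z(2) bv0 unfolding isCont_def by (intro topological_tendstoD) auto
    then show ?thesis using z(2) bv0 by (simp add: eventually_nhds_conv_at)
  qed
  moreover have "\<forall>\<^sub>F v in nhds v0. vec_nth (G (b v)) k - vec_nth v k > 0"
  proof -
    have pos: "vec_nth (G (b v0)) k - vec_nth v0 k > 0"
      using * v0k bv0 by (simp add: w0_def field_simps)
    have "\<forall>\<^sub>F v in at v0. vec_nth (G (b v)) k - vec_nth v k > 0"
      using c1' pos unfolding isCont_def by (rule order_tendstoD(1))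
    then show ?thesis using pos by (simp add: eventually_nhds_conv_at)
  qed
  moreover have "\<forall>\<^sub>F v in nhds v0. vec_nth v k - vec_nth (G (b v + t *\<^sub>R axis k 1)) k > 0"
  proof -
    have pos: "vec_nth v0 k - vec_nth (G (b v0 + t *\<^sub>R axis k 1)) k > 0"
      using * v0k bv0 by (simp add: w0_def field_simps)
    have "\<forall>\<^sub>F v in at v0. vec_nth v k - vec_nth (G (b v + t *\<^sub>R axis k 1)) k > 0"
      using c2' pos unfolding isCont_def by (rule order_tendstoD(1))
    then show ?thesis using pos by (simp add: eventually_nhds_conv_at)
  qed
  ultimately have "\<forall>\<^sub>F v in nhds v0. b v \<in> P \<and> b v + t *\<^sub>R axis k 1 \<in> P \<and>
     vec_nth (G (b v)) k > vec_nth v k \<and> vec_nth v k > vec_nth (G (b v + t *\<^sub>R axis k 1)) k"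
    by eventually_elim simp
  then obtain S where S: "open S" "v0 \<in> S" and SP: "\<And>v. v \<in> S \<Longrightarrow> b v \<in> P \<and> b v + t *\<^sub>R axis k 1 \<in> P \<and>
     vec_nth (G (b v)) k > vec_nth v k \<and> vec_nth v k > vec_nth (G (b v + t *\<^sub>R axis k 1)) k"
    unfolding eventually_nhds by blast
  \<comment> \<open>Every pair of line and level in \<open>S\<close> is crossed downwards; an open
    set is not null, so some pair is not attained in \<open>Z\<close>.\<close>
  have "\<not> S \<subseteq> G ` Z"
    using S Z by (metis empty_iff negligible_subset open_not_negligible)
  then obtain v where v: "v \<in> S" "v \<notin> G ` Z" by blast
  let ?w = "vec_nth v k"
  define \<psi> where "\<psi> \<tau> = vec_nth (G (b v + \<tau> *\<^sub>R axis k 1)) k" for \<tau>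
  have inP: "b v + \<tau> *\<^sub>R axis k 1 \<in> P" if "0 \<le> \<tau>" "\<tau> \<le> t" for \<tau>
  proof -
    have "(1 - \<tau> / t) *\<^sub>R b v + (\<tau> / t) *\<^sub>R (b v + t *\<^sub>R axis k 1) \<in> P"
      using P(2) SP[OF v(1)] that t by (intro convexD) auto
    then show ?thesis using t by (simp add: algebra_simps)
  qed
  have "continuous_on {0..t} \<psi>"
    unfolding \<psi>_def using inP
    by (intro continuous_intros continuous_on_compose2[OF G]) auto
  moreover have "\<psi> 0 > ?w" "?w > \<psi> t" using SP[OF v(1)] by (auto simp: \<psi>_def)
  ultimately obtain \<tau> where \<tau>: "0 \<le> \<tau>" "\<tau> < t" "\<psi> \<tau> = ?w" "\<And>s. \<tau> < s \<Longrightarrow> s \<le> t \<Longrightarrow> \<psi> s < ?w"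
    using last_crossing[of t \<psi> ?w] t by blast
  define z1 where "z1 = b v + \<tau> *\<^sub>R axis k 1"
  have z1: "z1 \<in> P" using inP \<tau> by (simp add: z1_def)
  \<comment> \<open>\<open>G\<close> keeps the other coordinates, so the crossing point is sent
    exactly to the chosen \<open>v\<close> and hence lies outside \<open>Z\<close>.\<close>
  have "vec_nth (G z1) i = vec_nth v i" for i
  proof (cases "i = k")
    case True then show ?thesis using \<tau>(3) by (simp add: \<psi>_def z1_def)
  next
    case False then show ?thesis using keep[OF z1 False] by (simp add: z1_def b_def axis_def)
  qed
  then have "G z1 = v" by (simp add: Finite_Cartesian_Product.vec_eq_iff)
  then have "z1 \<notin> Z" using v by blast
  then obtain D where D: "D > 0" "((\<lambda>t. vec_nth (G (z1 + t *\<^sub>R axis k 1)) k) has_real_derivative D) (at 0)"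
    using der[OF z1] by blast
  obtain d where d: "d > 0" "\<And>h. 0 < h \<Longrightarrow> h < d \<Longrightarrow> vec_nth (G (z1 + 0 *\<^sub>R axis k 1)) k < vec_nth (G (z1 + (0 + h) *\<^sub>R axis k 1)) k"
    using DERIV_pos_inc_right[OF D(2) D(1)] by blast
  define h where "h = min (d / 2) (t - \<tau>)"
  have h: "0 < h" "h < d" "\<tau> + h \<le> t" using d \<tau> by (auto simp: h_def)
  have "\<psi> \<tau> < \<psi> (\<tau> + h)"
    using d(2)[OF h(1,2)] by (simp add: \<psi>_def z1_def algebra_simps)
  then show False using \<tau>(3) \<tau>(4)[of "\<tau> + h"] h by simp
qed

section \<open>The maps \<open>\<Psi>\<^sub>j\<close> of the overview in the source coordinates, and
  their derivatives\<close>

definition mix :: "(real ^ 'n::{finite, linorder} \<Rightarrow> real ^ 'n::_) \<Rightarrow> nat \<Rightarrow> real ^ 'n::_ \<Rightarrow> real ^ 'n::_" where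
  "mix F j q = (\<chi> i. if rk i \<le> j then vec_nth (F q) i else vec_nth q i)"

lemma vec_lambda_sum_axis:
  "vec_lambda g = (\<Sum>i\<in>UNIV. g i *\<^sub>R axis i (1::real))"
  by (simp add: Finite_Cartesian_Product.vec_eq_iff axis_def if_distrib cong: if_cong)

lemma has_derivative_vec_lambda:
  fixes f :: "'n::finite \<Rightarrow> 'a::real_normed_vector \<Rightarrow> real"
  assumes "\<And>i. (f i has_derivative f' i) F"
  shows "((\<lambda>x. \<chi> i. f i x) has_derivative (\<lambda>h. \<chi> i. f' i h)) F"
  unfolding vec_lambda_sum_axis
  by (intro has_derivative_sum has_derivative_scaleR_left assms)

lemma has_derivative_vec_nth:
  assumes "(f has_derivative f') F"
  shows "((\<lambda>x. vec_nth (f x) i) has_derivative (\<lambda>h. vec_nth (f' h) i)) F"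
  by (rule bounded_linear.has_derivative[OF bounded_linear_vec_nth assms])

lemma has_derivative_mix:
  assumes "(F has_derivative F') (at q)"
  shows "(mix F j has_derivative (\<lambda>h. \<chi> i. if rk i \<le> j then vec_nth (F' h) i else vec_nth h i)) (at q)"
  unfolding mix_def[abs_def]
proof (rule has_derivative_vec_lambda)
  fix i
  show "((\<lambda>q. if rk i \<le> j then vec_nth (F q) i else vec_nth q i) has_derivative
      (\<lambda>h. if rk i \<le> j then vec_nth (F' h) i else vec_nth h i)) (at q)"
    by (cases "rk i \<le> j") (simp_all add: has_derivative_vec_nth assms has_derivative_ident)
qed

lemma continuous_on_mix:
  assumes "continuous_on Q F"
  shows "continuous_on Q (mix F j)"
  unfolding mix_def[abs_def]
proof (rule continuous_on_vec_lambda)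
  fix i
  show "continuous_on Q (\<lambda>q. if rk i \<le> j then vec_nth (F q) i else vec_nth q i)"
    by (cases "rk i \<le> j") (auto intro!: continuous_intros assms)
qed

text \<open>The derivative \<open>M\<close> of \<open>mix F j\<close> is injective because the minor
  is nonzero, so the continuous inverse \<open>H\<close> is differentiable with derivative the
  inverse of \<open>M\<close>; the chain rule then reduces the claim to
  \<open>minor_ratio\<close>.\<close>

lemma mix_directional:
  fixes F :: "real ^ 'n::{finite, linorder} \<Rightarrow> real ^ 'n::_"
  assumes "open Q" and O: "open O'" and H: "homeomorphism Q O' (mix F j) H" and q: "q \<in> Q"
    and F': "(F has_derivative F') (at q)" and nz: "minor F' j \<noteq> 0" and j: "j < CARD('n)"
  shows "((\<lambda>t. vec_nth (F (H (mix F j q + t *\<^sub>R axis (idx (Suc j)) 1))) (idx (Suc j)))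
    has_real_derivative (minor F' (Suc j) / minor F' j)) (at 0)"
proof -
  let ?k = "idx (Suc j) :: 'n" and ?z = "mix F j q"
  define M where "M h = (\<chi> i. if rk i \<le> j then vec_nth (F' h) i else vec_nth h i)" for h
  have der: "(mix F j has_derivative M) (at q)"
    unfolding M_def by (rule has_derivative_mix[OF F'])
  have linF: "linear F'" using F' by (rule has_derivative_linear)
  have linM: "linear M" using der by (rule has_derivative_linear)
  have "inj M"
  proof (subst linear_injective_0[OF linM], intro allI impI)
    fix v assume v: "M v = 0"
    have Mi: "vec_nth (M v) i = 0" for i using v by simp
    show "v = 0"
    proof (rule minor_injective[OF linF _ _ _ nz])
      fix i show "vec_nth v i = 0" if "rk i > j" using Mi[of i] that by (simp add: M_def)
      show "vec_nth (F' v) i = 0" if "rk i \<le> j" using Mi[of i] that by (simp add: M_def)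
    qed (use j in auto)
  qed
  then obtain g where g: "linear g" "g \<circ> M = id"
    using linear_injective_left_inverse[OF linM] by blast
  have Mg: "M \<circ> g = id" using eucl.linear_inverse_left[OF linM g(1)] g(2) by simp
  have z: "?z \<in> O'" and Hz: "H ?z = q"
    using H q by (auto simp: homeomorphism_def)
  have cont: "continuous (at ?z) H"
    using homeomorphism_cont2[OF H] O z by (simp add: continuous_on_eq_continuous_at)
  have derH: "(H has_derivative g) (at ?z)"
  proof (rule has_derivative_inverse_basic)
    show "(mix F j has_derivative M) (at (H ?z))" using der Hz by simp
    show "bounded_linear g" using g(1) by (simp add: linear_conv_bounded_linear)
    show "g \<circ> M = id" by (rule g)
    show "continuous (at ?z) H" by (rule cont)
    show "\<And>z. z \<in> O' \<Longrightarrow> mix F j (H z) = z" using H by (simp add: homeomorphism_def)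
  qed (use O z in auto)
  \<comment> \<open>The source direction that \<open>mix F j\<close> straightens to axis
    \<open>j + 1\<close>; the equation \<open>M v = axis ?k 1\<close> lists exactly the properties
    needed for \<open>minor_ratio\<close>.\<close>
  define v where "v = g (axis ?k 1)"
  have Mv: "M v = axis ?k 1" using Mg by (simp add: v_def fun_eq_iff)
  have Mvi: "vec_nth (M v) i = (if i = ?k then 1 else 0)" for i using Mv by (simp add: axis_def)
  have rkk: "rk ?k = Suc j" using j by simp
  have v1: "vec_nth v ?k = 1"
    using Mvi[of ?k] rkk by (simp add: M_def)
  have v0: "vec_nth v i = 0" if "rk i > Suc j" for i
    using Mvi[of i] that rkk by (auto simp: M_def split: if_splits)
  have Fv0: "vec_nth (F' v) i = 0" if "rk i \<le> j" for i
    using Mvi[of i] that rkk by (auto simp: M_def split: if_splits)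
  have ratio: "vec_nth (F' v) ?k = minor F' (Suc j) / minor F' j"
    using minor_ratio[OF linF j v0 v1 Fv0] nz by (simp add: field_simps)
  have line: "((\<lambda>t. ?z + t *\<^sub>R axis ?k 1) has_derivative (\<lambda>t. t *\<^sub>R axis ?k 1)) (at 0)"
    by (auto intro!: derivative_eq_intros)
  have z0: "?z + 0 *\<^sub>R axis ?k 1 = ?z" by simp
  have "((\<lambda>t. H (?z + t *\<^sub>R axis ?k 1)) has_derivative (\<lambda>t. g (t *\<^sub>R axis ?k 1))) (at 0)"
    using has_derivative_compose[OF line, of H g] derH z0 by simp
  from has_derivative_compose[OF this, of F F']
  have "((\<lambda>t. F (H (?z + t *\<^sub>R axis ?k 1))) has_derivative (\<lambda>t. F' (g (t *\<^sub>R axis ?k 1)))) (at 0)"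
    using F' Hz by simp
  from has_derivative_vec_nth[OF this, of ?k]
  have "((\<lambda>t. vec_nth (F (H (?z + t *\<^sub>R axis ?k 1))) ?k) has_derivative
      (\<lambda>t. vec_nth (F' (g (t *\<^sub>R axis ?k 1))) ?k)) (at 0)" .
  moreover have "(\<lambda>t. vec_nth (F' (g (t *\<^sub>R axis ?k 1))) ?k) = (*) (vec_nth (F' v) ?k)"
    by (simp add: fun_eq_iff linear_cmul[OF g(1)] linear_cmul[OF linF] v_def)
  ultimately show ?thesis
    unfolding has_field_derivative_def ratio by simp
qed

text \<open>Smallness of the bad part enters as the hypothesis \<open>neg\<close>. Minor
  \<open>j\<close> has an upper bound for \<open>j < n\<close> only, since it is divided by when
  coordinate \<open>j + 1\<close> is treated.\<close>

lemma local_injective: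
  fixes F :: "real ^ 'n::{finite, linorder} \<Rightarrow> real ^ 'n::_"
  assumes Q: "open Q" "a \<in> Q" and F: "continuous_on Q F"
    and D: "\<And>q. q \<in> Q \<Longrightarrow> q \<notin> N \<Longrightarrow> F differentiable (at q)"
    and lower: "\<And>j. 1 \<le> j \<Longrightarrow> j \<le> CARD('n) \<Longrightarrow>
      \<exists>K>0. \<forall>q\<in>Q-N. K \<le> minor (frechet_derivative F (at q)) j"
    and upper: "\<And>j. 1 \<le> j \<Longrightarrow> j < CARD('n) \<Longrightarrow>
      \<exists>L>0. \<forall>q\<in>Q-N. minor (frechet_derivative F (at q)) j \<le> L"
    and neg: "\<And>j c. 1 \<le> j \<Longrightarrow> j \<le> CARD('n) \<Longrightarrow>
      negligible ((\<lambda>q. mix F j q - (c * vec_nth q (idx j)) *\<^sub>R axis (idx j) 1) ` (Q \<inter> N))"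
  shows "\<exists>Q'. open Q' \<and> a \<in> Q' \<and> Q' \<subseteq> Q \<and> inj_on F Q'"
proof -
  have "\<exists>Q'. open Q' \<and> a \<in> Q' \<and> Q' \<subseteq> Q \<and> inj_on (mix F j) Q'" if "j \<le> CARD('n)" for j
    using that
  proof (induction j)
    case 0
    \<comment> \<open>Ranks start at 1, so \<open>mix F 0\<close> replaces no coordinate.\<close>
    have z: "(rk (i :: 'n) \<le> 0) = False" for i using rk_range(1)[of i] by simp
    have "mix F 0 = (\<lambda>q. q)"
      unfolding mix_def[abs_def] z by (simp add: Finite_Cartesian_Product.vec_eq_iff)
    then show ?case using Q by auto
  next
    case (Suc j)
    then obtain Q1 where Q1: "open Q1" "a \<in> Q1" "Q1 \<subseteq> Q" "inj_on (mix F j) Q1" by auto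
    let ?k = "idx (Suc j) :: 'n"
    have rkk: "rk ?k = Suc j" using Suc.prems by simp
    have contmix: "continuous_on Q1 (mix F j)"
      by (rule continuous_on_mix[OF continuous_on_subset[OF F Q1(3)]])
    define R where "R = mix F j ` Q1"
    have R: "open R" unfolding R_def by (rule invariance_of_domain[OF contmix Q1(1,4)])
    obtain H where H: "homeomorphism Q1 R (mix F j) H"
      using invariance_of_domain_homeomorphism[OF Q1(1) contmix _ Q1(4)] R_def by auto
    have "mix F j a \<in> R" using Q1(2) by (simp add: R_def)
    \<comment> \<open>A ball is convex, so segments parallel to the axis stay in the domain of
      \<open>H\<close>.\<close>
    then obtain e where e: "e > 0" "ball (mix F j a) e \<subseteq> R"
      using R openE by blast
    let ?P = "ball (mix F j a) e"
    obtain K where K: "K > 0" "\<And>q. q \<in> Q - N \<Longrightarrow> K \<le> minor (frechet_derivative F (at q)) (Suc j)"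
      using lower[of "Suc j"] Suc.prems by auto
    \<comment> \<open>For \<open>j = 0\<close> the denominator is the empty minor, and
      \<open>L = 1\<close> bounds it.\<close>
    obtain L where L: "L > 0" "\<And>q. q \<in> Q - N \<Longrightarrow> minor (frechet_derivative F (at q)) j \<le> L"
    proof (cases "j = 0")
      case True then show ?thesis using that[of 1] by simp
    next
      case False then show ?thesis using that upper[of j] Suc.prems by auto
    qed
    have posj: "minor (frechet_derivative F (at q)) j > 0" if "q \<in> Q - N" for q
    proof (cases "j = 0")
      case False then show ?thesis using lower[of j] Suc.prems that by force
    qed simp
    \<comment> \<open>Half of the lower bound \<open>K / L\<close> of the derivative along the axis:
      subtracting the slope \<open>c\<close> leaves it positive.\<close>
    define c where "c = K / L / 2"
    have c: "0 < c" "c < K / L" using K(1) L(1) by (auto simp: c_def field_simps)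
    \<comment> \<open>The point \<open>z\<close> with its coordinate \<open>?k\<close> replaced by
      component \<open>?k\<close> of \<open>F (H z)\<close> minus \<open>c\<close> times the
      height.\<close>
    define G where "G z = z + (vec_nth (F (H z)) ?k - c * vec_nth z ?k - vec_nth z ?k) *\<^sub>R axis ?k 1" for z
    define Z where "Z = mix F j ` (Q1 \<inter> N)"
    have contH: "continuous_on ?P H"
      using homeomorphism_cont2[OF H] e(2) continuous_on_subset by blast
    have HQ: "H z \<in> Q1" "mix F j (H z) = z" if "z \<in> ?P" for z
      using H e(2) that by (auto simp: homeomorphism_def)
    have Hk: "vec_nth (H z) ?k = vec_nth z ?k" if "z \<in> ?P" for z
    proof -
      have "vec_nth (mix F j (H z)) ?k = vec_nth z ?k" using HQ(2)[OF that] by simp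
      then show ?thesis using rkk by (simp add: mix_def)
    qed
    \<comment> \<open>\<open>H\<close> keeps coordinate \<open>j + 1\<close>, which
      \<open>mix F j\<close> does not touch; so \<open>G\<close> after \<open>mix F j\<close> is the
      map of \<open>neg\<close> for \<open>j + 1\<close>, and the image of the bad set under
      \<open>G\<close> is null.\<close>
    have GH: "G z = mix F (Suc j) (H z) - (c * vec_nth (H z) ?k) *\<^sub>R axis ?k 1" if z: "z \<in> ?P" for z
    proof -
      have "vec_nth (G z) i = vec_nth (mix F (Suc j) (H z)) i - c * vec_nth (H z) ?k * vec_nth (axis ?k 1) i" for i
      proof (cases "i = ?k")
        case True
        then show ?thesis using rkk Hk[OF z] by (simp add: G_def mix_def)
      next
        case False
        then have ne: "rk i \<noteq> Suc j" using rkk by (metis rk_inject)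
        have "vec_nth (mix F j (H z)) i = vec_nth z i" using HQ(2)[OF z] by simp
        then show ?thesis using ne False by (auto simp: G_def mix_def axis_def)
      qed
      then show ?thesis by (simp add: Finite_Cartesian_Product.vec_eq_iff)
    qed
    have mono: "vec_nth (G z) ?k \<le> vec_nth (G (z + t *\<^sub>R axis ?k 1)) ?k"
      if z: "z \<in> ?P" "z + t *\<^sub>R axis ?k 1 \<in> ?P" and t: "t > 0" for z t
    proof (rule monotone_coordinate[where P = ?P and Z = "Z \<inter> ?P"])
      have cFH: "continuous_on ?P (\<lambda>z. F (H z))"
        by (rule continuous_on_compose2[OF F contH]) (use HQ Q1 in blast)
      show "continuous_on ?P G"
        unfolding G_def by (intro continuous_intros cFH)
      have "G ` (Z \<inter> ?P) \<subseteq> (\<lambda>q. mix F (Suc j) q - (c * vec_nth q ?k) *\<^sub>R axis ?k 1) ` (Q \<inter> N)"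
      proof
        fix y assume "y \<in> G ` (Z \<inter> ?P)"
        then obtain q where q: "q \<in> Q1" "q \<in> N" "mix F j q \<in> ?P" "y = G (mix F j q)"
          by (auto simp: Z_def)
        have "H (mix F j q) = q" using H q(1) by (simp add: homeomorphism_def)
        then show "y \<in> (\<lambda>q. mix F (Suc j) q - (c * vec_nth q ?k) *\<^sub>R axis ?k 1) ` (Q \<inter> N)"
          using GH[OF q(3)] q Q1(3) by auto
      qed
      then show "negligible (G ` (Z \<inter> ?P))"
        using negligible_subset[OF neg[of "Suc j" c]] Suc.prems by simp
      fix z assume z: "z \<in> ?P" "z \<notin> Z \<inter> ?P"
      define q where "q = H z"
      have q: "q \<in> Q1" "mix F j q = z" using HQ[OF z(1)] by (auto simp: q_def)
      have qN: "q \<in> Q - N" using z q Q1(3) by (auto simp: Z_def)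
      define F' where "F' = frechet_derivative F (at q)"
      have F': "(F has_derivative F') (at q)"
        using D[of q] qN by (simp add: F'_def frechet_derivative_works)
      have pos: "minor F' j > 0" using posj[OF qN] by (simp add: F'_def)
      have "((\<lambda>t. vec_nth (F (H (z + t *\<^sub>R axis ?k 1))) ?k) has_real_derivative
          minor F' (Suc j) / minor F' j) (at 0)"
        using mix_directional[OF Q1(1) R H q(1) F'] pos Suc.prems q(2) by simp
      then have "((\<lambda>t. vec_nth (F (H (z + t *\<^sub>R axis ?k 1))) ?k - c * (vec_nth z ?k + t)) has_real_derivative
          minor F' (Suc j) / minor F' j - c) (at 0)"
        by (auto intro!: derivative_eq_intros)
      moreover have "(\<lambda>t. vec_nth (G (z + t *\<^sub>R axis ?k 1)) ?k) =
          (\<lambda>t. vec_nth (F (H (z + t *\<^sub>R axis ?k 1))) ?k - c * (vec_nth z ?k + t))"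
        by (auto simp: G_def fun_eq_iff)
      moreover have "minor F' (Suc j) / minor F' j - c > 0"
      proof -
        have "K / L \<le> minor F' (Suc j) / minor F' j"
          using K(2)[OF qN] L(2)[OF qN] K(1) pos by (intro frac_le) (auto simp: F'_def)
        then show ?thesis using c by simp
      qed
      ultimately show "\<exists>D>0. ((\<lambda>t. vec_nth (G (z + t *\<^sub>R axis ?k 1)) ?k) has_real_derivative D) (at 0)"
        by (intro exI[of _ "minor F' (Suc j) / minor F' j - c"]) simp
    qed (use z t in \<open>auto simp: G_def axis_def\<close>)
    define Q2 where "Q2 = Q1 \<inter> mix F j -` ?P"
    have "open Q2"
      unfolding Q2_def by (rule continuous_open_preimage[OF contmix Q1(1)]) simp
    moreover have "a \<in> Q2" using Q1 e by (simp add: Q2_def)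
    moreover have "inj_on (mix F (Suc j)) Q2"
    proof (rule inj_onI, rule ccontr)
      \<comment> \<open>Their images under \<open>mix F j\<close> lie on one line parallel to axis
        \<open>?k\<close>; along it the component \<open>?k\<close> of \<open>F \<circ> H\<close>
        grows at least at rate \<open>c\<close>, so it separates distinct points.\<close>
      fix q q' assume q: "q \<in> Q2" "q' \<in> Q2" "mix F (Suc j) q = mix F (Suc j) q'" "q \<noteq> q'"
      let ?z = "mix F j q" and ?z' = "mix F j q'"
      have Hq: "H ?z = q" "H ?z' = q'" using H q by (auto simp: homeomorphism_def Q2_def)
      have P: "?z \<in> ?P" "?z' \<in> ?P" using q by (auto simp: Q2_def)
      have same: "vec_nth ?z i = vec_nth ?z' i" if "i \<noteq> ?k" for i
      proof -
        have ne: "rk i \<noteq> Suc j" using rkk that by (metis rk_inject)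
        have "vec_nth (mix F (Suc j) q) i = vec_nth (mix F (Suc j) q') i" using q by simp
        then show ?thesis using ne by (auto simp: mix_def split: if_splits)
      qed
      have Fk: "vec_nth (F q) ?k = vec_nth (F q') ?k"
      proof -
        have "vec_nth (mix F (Suc j) q) ?k = vec_nth (mix F (Suc j) q') ?k" using q by simp
        then show ?thesis using rkk by (simp add: mix_def)
      qed
      have key: "False" if P: "u \<in> ?P" "u' \<in> ?P" and same: "\<And>i. i \<noteq> ?k \<Longrightarrow> vec_nth u i = vec_nth u' i"
        and lt: "vec_nth u ?k < vec_nth u' ?k" and Fk: "vec_nth (F (H u)) ?k = vec_nth (F (H u')) ?k" for u u'
      proof -
        let ?t = "vec_nth u' ?k - vec_nth u ?k"
        have u': "u + ?t *\<^sub>R axis ?k 1 = u'"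
          using same by (auto simp: Finite_Cartesian_Product.vec_eq_iff axis_def)
        have "vec_nth (G u) ?k \<le> vec_nth (G u') ?k"
          using mono[of u ?t] P lt u' by simp
        then have "vec_nth (F (H u)) ?k - c * vec_nth u ?k \<le> vec_nth (F (H u')) ?k - c * vec_nth u' ?k"
          by (simp add: G_def)
        then have "c * vec_nth u' ?k \<le> c * vec_nth u ?k" using Fk by simp
        then show False using lt c by simp
      qed
      have "?z \<noteq> ?z'" using Hq q by metis
      then have "vec_nth ?z ?k \<noteq> vec_nth ?z' ?k"
        using same by (metis Finite_Cartesian_Product.vec_eq_iff)
      then consider "vec_nth ?z ?k < vec_nth ?z' ?k" | "vec_nth ?z' ?k < vec_nth ?z ?k" by linarith
      then show False
      proof cases
        case 1 then show False using key[OF P same] Fk Hq by simp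
      next
        case 2 then show False using key[OF P(2,1) same[symmetric]] Fk Hq by simp
      qed
    qed
    ultimately show ?case using Q1(3) by (auto simp: Q2_def)
  qed
  from this[of "CARD('n)"] obtain Q' where Q': "open Q'" "a \<in> Q'" "Q' \<subseteq> Q" "inj_on (mix F CARD('n)) Q'"
    by auto
  have "mix F CARD('n) = F"
    using rk_range(2) by (auto simp: mix_def[abs_def] fun_eq_iff Finite_Cartesian_Product.vec_eq_iff)
  then show ?thesis using Q' by auto
qed

section \<open>Passage to the given coordinate systems\<close>

lemma C1_on_imp:
  assumes "C1_on V x"
  shows "p \<in> V \<Longrightarrow> x differentiable (at p)" and "continuous_on V x"
proof -
  show *: "p \<in> V \<Longrightarrow> x differentiable (at p)" for p
    using assms by (auto simp: C1_on_def differentiable_def)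
  show "continuous_on V x"
    using * by (meson continuous_at_imp_continuous_on differentiable_imp_continuous_within)
qed

text \<open>Read in \<open>x\<close> and \<open>y\<close> the map becomes \<open>F\<close>, whose
  leading minors are the given Jacobian minors. Injectivity of \<open>F\<close> near
  \<open>x 0\<close> is carried back to \<open>f\<close>, and invariance of domain makes
  \<open>f\<close> open with continuous inverse.\<close>

lemma homeomorphism_germ_if_small:
  fixes f :: "real ^ 'n::{finite, linorder} \<Rightarrow> real ^ 'n::_"
  assumes U: "open U" "0 \<in> U" and f: "continuous_on U f" "f 0 = 0"
    and sm: "\<rho> > 0" "small {(p, f p) | p. p \<in> nondiff_set U f \<and> norm p < \<rho>}"
    and x: "coordinate_system 0 V x" and y: "coordinate_system 0 W y"
    and minors: "\<forall>j \<in> {1..<CARD('n)}. \<exists>K L. K > 0 \<and> L > 0 \<and>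
           (\<forall>\<^sub>F p in nhds 0. p \<notin> nondiff_set U f \<longrightarrow>
              K \<le> jacobian_minor V x y f j p \<and> jacobian_minor V x y f j p \<le> L)"
    and det: "\<exists>K>0. \<forall>\<^sub>F p in nhds 0. p \<notin> nondiff_set U f \<longrightarrow>
           K \<le> jacobian_minor V x y f CARD('n) p"
  shows "\<exists>U' W' g. open U' \<and> 0 \<in> U' \<and> U' \<subseteq> U \<and> open W' \<and> 0 \<in> W' \<and> homeomorphism U' W' f g"
proof -
  let ?n = "CARD('n)" and ?B = "nondiff_set U f"
  define \<xi> where "\<xi> = the_inv_into V x"
  have V: "open V" "0 \<in> V" "inj_on x V" "open (x ` V)" "C1_on V x" "C1_on (x ` V) \<xi>"
    using x by (auto simp: coordinate_system_def \<xi>_def)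
  have W: "open W" "0 \<in> W" "inj_on y W" "C1_on W y"
    using y by (auto simp: coordinate_system_def)
  have \<xi>x: "\<xi> (x p) = p" if "p \<in> V" for p
    using that V(3) by (simp add: \<xi>_def the_inv_into_f_f)
  obtain KK where KK: "\<And>j. j \<in> {1..?n} \<Longrightarrow> KK j > 0"
      "\<And>j. j \<in> {1..?n} \<Longrightarrow> \<forall>\<^sub>F p in nhds 0. p \<notin> ?B \<longrightarrow> KK j \<le> jacobian_minor V x y f j p"
  proof -
    have "\<forall>j\<in>{1..?n}. \<exists>K>0. \<forall>\<^sub>F p in nhds 0. p \<notin> ?B \<longrightarrow> K \<le> jacobian_minor V x y f j p"
    proof
      fix j assume j: "j \<in> {1..?n}"
      show "\<exists>K>0. \<forall>\<^sub>F p in nhds 0. p \<notin> ?B \<longrightarrow> K \<le> jacobian_minor V x y f j p"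
      proof (cases "j = ?n")
        case False
        with j have "j \<in> {1..<?n}" by auto
        from minors[rule_format, OF this] obtain K L where
          K: "K > 0" "\<forall>\<^sub>F p in nhds 0. p \<notin> ?B \<longrightarrow>
              K \<le> jacobian_minor V x y f j p \<and> jacobian_minor V x y f j p \<le> L"
          by blast
        from K(2) have "\<forall>\<^sub>F p in nhds 0. p \<notin> ?B \<longrightarrow> K \<le> jacobian_minor V x y f j p"
          by (rule eventually_mono) blast
        with K(1) show ?thesis by blast
      qed (use det in simp)
    qed
    from bchoice[OF this] obtain KK where "\<forall>j\<in>{1..?n}. KK j > 0 \<and>
      (\<forall>\<^sub>F p in nhds 0. p \<notin> ?B \<longrightarrow> KK j \<le> jacobian_minor V x y f j p)" by blast
    then show ?thesis by (intro that[of KK]) simp_all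
  qed
  obtain LL where LL: "\<And>j. j \<in> {1..<?n} \<Longrightarrow> LL j > 0"
      "\<And>j. j \<in> {1..<?n} \<Longrightarrow> \<forall>\<^sub>F p in nhds 0. p \<notin> ?B \<longrightarrow> jacobian_minor V x y f j p \<le> LL j"
  proof -
    have "\<forall>j\<in>{1..<?n}. \<exists>L>0. \<forall>\<^sub>F p in nhds 0. p \<notin> ?B \<longrightarrow> jacobian_minor V x y f j p \<le> L"
    proof
      fix j assume "j \<in> {1..<?n}"
      from minors[rule_format, OF this] obtain K L where
        L: "L > 0" "\<forall>\<^sub>F p in nhds 0. p \<notin> ?B \<longrightarrow>
            K \<le> jacobian_minor V x y f j p \<and> jacobian_minor V x y f j p \<le> L"
        by blast
      from L(2) have "\<forall>\<^sub>F p in nhds 0. p \<notin> ?B \<longrightarrow> jacobian_minor V x y f j p \<le> L"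
        by (rule eventually_mono) blast
      with L(1) show "\<exists>L>0. \<forall>\<^sub>F p in nhds 0. p \<notin> ?B \<longrightarrow> jacobian_minor V x y f j p \<le> L"
        by blast
    qed
    from bchoice[OF this] obtain LL where "\<forall>j\<in>{1..<?n}. LL j > 0 \<and>
      (\<forall>\<^sub>F p in nhds 0. p \<notin> ?B \<longrightarrow> jacobian_minor V x y f j p \<le> LL j)" by blast
    then show ?thesis by (intro that[of LL]) simp_all
  qed
  have "\<forall>\<^sub>F p in nhds 0. \<forall>j\<in>{1..?n}. p \<notin> ?B \<longrightarrow> KK j \<le> jacobian_minor V x y f j p"
    using KK(2) by (intro eventually_ball_finite) auto
  moreover have "\<forall>\<^sub>F p in nhds 0. \<forall>j\<in>{1..<?n}. p \<notin> ?B \<longrightarrow> jacobian_minor V x y f j p \<le> LL j"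
    using LL(2) by (intro eventually_ball_finite) auto
  ultimately have "\<forall>\<^sub>F p in nhds 0. (\<forall>j\<in>{1..?n}. p \<notin> ?B \<longrightarrow> KK j \<le> jacobian_minor V x y f j p) \<and>
      (\<forall>j\<in>{1..<?n}. p \<notin> ?B \<longrightarrow> jacobian_minor V x y f j p \<le> LL j)"
    by (rule eventually_conj)
  then obtain S where S: "open S" "0 \<in> S"
    "\<And>p j. p \<in> S \<Longrightarrow> p \<notin> ?B \<Longrightarrow> j \<in> {1..?n} \<Longrightarrow> KK j \<le> jacobian_minor V x y f j p"
    "\<And>p j. p \<in> S \<Longrightarrow> p \<notin> ?B \<Longrightarrow> j \<in> {1..<?n} \<Longrightarrow> jacobian_minor V x y f j p \<le> LL j"
    unfolding eventually_nhds by blast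
  \<comment> \<open>All finitely many bounds hold on \<open>P\<close>, both coordinate systems are
    available there, and the bad points of \<open>P\<close> are covered by the smallness
    hypothesis.\<close>
  define P where "P = (U \<inter> f -` W) \<inter> V \<inter> S \<inter> ball 0 \<rho>"
  have P: "open P" "0 \<in> P"
    unfolding P_def using U W V S sm f continuous_open_preimage[OF f(1) U(1) W(1)] by auto
  have PS: "P \<subseteq> U" "P \<subseteq> V" "P \<subseteq> S" "f ` P \<subseteq> W" "\<And>p. p \<in> P \<Longrightarrow> norm p < \<rho>"
    by (auto simp: P_def)
  define Q where "Q = x ` P"
  define F where "F = (\<lambda>q. y (f (\<xi> q)))"
  define N where "N = x ` (?B \<inter> P)"
  have contx: "continuous_on V x" by (rule C1_on_imp(2)[OF V(5)])
  have Q: "open Q" unfolding Q_def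
    by (rule invariance_of_domain[OF _ P(1)]) (use contx V PS in \<open>auto intro: continuous_on_subset inj_on_subset\<close>)
  have \<xi>Q: "\<xi> q \<in> P" "x (\<xi> q) = q" if "q \<in> Q" for q
    using that \<xi>x PS by (auto simp: Q_def subset_iff)
  have QV: "Q \<subseteq> x ` V" using PS by (auto simp: Q_def)
  have cont\<xi>: "continuous_on Q \<xi>"
    by (rule continuous_on_subset[OF C1_on_imp(2)[OF V(6)] QV])
  have contF: "continuous_on Q F"
    unfolding F_def
    by (rule continuous_on_compose2[OF C1_on_imp(2)[OF W(4)] continuous_on_compose2[OF f(1) cont\<xi>]])
      (use \<xi>Q PS in blast)+
  have good: "\<xi> q \<notin> ?B" if "q \<in> Q" "q \<notin> N" for q
    using that \<xi>Q[OF that(1)] by (auto simp: N_def intro!: image_eqI[of q x "\<xi> q"])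
  have diffF: "F differentiable (at q)" if q: "q \<in> Q" "q \<notin> N" for q
  proof -
    have 1: "\<xi> differentiable (at q)" using C1_on_imp(1)[OF V(6)] q QV by blast
    have 2: "f differentiable (at (\<xi> q))"
      using good[OF q] \<xi>Q[OF q(1)] PS by (auto simp: nondiff_set_def)
    have 3: "y differentiable (at (f (\<xi> q)))"
      using C1_on_imp(1)[OF W(4)] \<xi>Q[OF q(1)] PS by blast
    from differentiable_chain_at[OF 1 2] have "f \<circ> \<xi> differentiable (at q)" .
    from differentiable_chain_at[OF this, of y] 3 have "y \<circ> (f \<circ> \<xi>) differentiable (at q)" by simp
    then show ?thesis by (simp add: F_def comp_def)
  qed
  \<comment> \<open>\<open>coord_partial\<close> differentiates \<open>F\<close> along an axis
    through \<open>q = x p\<close>; at a good point this is an entry of the total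
    derivative.\<close>
  have minor_eq: "jacobian_minor V x y f j (\<xi> q) = minor (frechet_derivative F (at q)) j"
    if q: "q \<in> Q" "q \<notin> N" for q j
  proof -
    let ?F' = "frechet_derivative F (at q)"
    have F': "(F has_derivative ?F') (at q)"
      using diffF[OF q] by (simp add: frechet_derivative_works)
    have "coord_partial V x (Suc k) (\<lambda>q. vec_nth (y (f q)) (idx (Suc i))) (\<xi> q) =
        vec_nth (?F' (axis (idx (Suc k)) 1)) (idx (Suc i))" for i k
    proof -
      let ?e = "axis (idx (Suc k)) 1 :: real ^ 'n::_"
      have line: "((\<lambda>t. q + t *\<^sub>R ?e) has_derivative (\<lambda>t. t *\<^sub>R ?e)) (at 0)"
        by (auto intro!: derivative_eq_intros)
      have "((\<lambda>t. F (q + t *\<^sub>R ?e)) has_derivative (\<lambda>t. ?F' (t *\<^sub>R ?e))) (at 0)"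
        using has_derivative_compose[OF line, of F ?F'] F' by simp
      from has_derivative_vec_nth[OF this, of "idx (Suc i)"]
      have "((\<lambda>t. vec_nth (F (q + t *\<^sub>R ?e)) (idx (Suc i))) has_derivative
        (\<lambda>t. vec_nth (?F' (t *\<^sub>R ?e)) (idx (Suc i)))) (at 0)" .
      moreover have "(\<lambda>t. vec_nth (?F' (t *\<^sub>R ?e)) (idx (Suc i))) = (*) (vec_nth (?F' ?e) (idx (Suc i)))"
        by (simp add: fun_eq_iff linear_cmul[OF has_derivative_linear[OF F']])
      ultimately have "((\<lambda>t. vec_nth (F (q + t *\<^sub>R ?e)) (idx (Suc i))) has_real_derivative
          vec_nth (?F' ?e) (idx (Suc i))) (at 0)"
        by (simp add: has_field_derivative_def)
      then show ?thesis
        using \<xi>Q(2)[OF q(1)] by (simp add: coord_partial_def F_def \<xi>_def[symmetric] DERIV_imp_deriv)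
    qed
    then show ?thesis by (simp add: jacobian_minor_def minor_def)
  qed
  have "\<exists>Q'. open Q' \<and> x 0 \<in> Q' \<and> Q' \<subseteq> Q \<and> inj_on F Q'"
  proof (rule local_injective[OF Q _ contF diffF])
    show "x 0 \<in> Q" using P by (simp add: Q_def)
    fix j :: nat assume j: "1 \<le> j"
    have SQ: "\<xi> q \<in> S" "\<xi> q \<notin> ?B" if "q \<in> Q - N" for q
      using that \<xi>Q(1)[of q] PS(3) good[of q] by auto
    show "\<exists>K>0. \<forall>q\<in>Q-N. K \<le> minor (frechet_derivative F (at q)) j" if jn: "j \<le> ?n"
    proof (intro exI conjI ballI)
      have "j \<in> {1..?n}" using j jn by simp
      then show "KK j > 0" by (rule KK(1))
      fix q assume q: "q \<in> Q - N"
      show "KK j \<le> minor (frechet_derivative F (at q)) j"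
        using S(3)[OF SQ[OF q] \<open>j \<in> {1..?n}\<close>] minor_eq[of q j] q by simp
    qed
    show "\<exists>L>0. \<forall>q\<in>Q-N. minor (frechet_derivative F (at q)) j \<le> L" if jn: "j < ?n"
    proof (intro exI conjI ballI)
      have "j \<in> {1..<?n}" using j jn by simp
      then show "LL j > 0" by (rule LL(1))
      fix q assume q: "q \<in> Q - N"
      show "minor (frechet_derivative F (at q)) j \<le> LL j"
        using S(4)[OF SQ[OF q] \<open>j \<in> {1..<?n}\<close>] minor_eq[of q j] q by simp
    qed
    fix c :: real
    let ?A = "{(p, f p) | p. p \<in> ?B \<and> norm p < \<rho>}"
    \<comment> \<open>The map of \<open>neg\<close> with the value of \<open>f\<close> made an
      independent second argument. It is built from \<open>x\<close> and \<open>y\<close> alone,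
      hence differentiable over \<open>P\<close>, and gives back the map of \<open>neg\<close> on
      the graph.\<close>
    define \<Psi> where "\<Psi> z = (\<chi> i. if rk i \<le> j then vec_nth (y (snd z)) i else vec_nth (x (fst z)) i)
      - (c * vec_nth (x (fst z)) (idx j)) *\<^sub>R axis (idx j) 1" for z :: "(real ^ 'n::_) \<times> (real ^ 'n::_)"
    have diff\<Psi>: "\<Psi> differentiable (at (p, f p))" if p: "p \<in> P" for p
    proof -
      obtain x' where x': "(x has_derivative x') (at p)"
        using C1_on_imp(1)[OF V(5), of p] p PS by (auto simp: differentiable_def)
      have "f p \<in> W" using p PS(4) by blast
      then obtain y' where y': "(y has_derivative y') (at (f p))"
        using C1_on_imp(1)[OF W(4), of "f p"] by (auto simp: differentiable_def)
      have fx: "((\<lambda>z. x (fst z)) has_derivative (\<lambda>h. x' (fst h))) (at (p, f p))"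
        using has_derivative_compose[OF has_derivative_fst[OF has_derivative_ident], of x x' "(p, f p)"] x' by simp
      have fy: "((\<lambda>z. y (snd z)) has_derivative (\<lambda>h. y' (snd h))) (at (p, f p))"
        using has_derivative_compose[OF has_derivative_snd[OF has_derivative_ident], of y y' "(p, f p)"] y' by simp
      have "((\<lambda>z. \<chi> i. if rk i \<le> j then vec_nth (y (snd z)) i else vec_nth (x (fst z)) i) has_derivative
        (\<lambda>h. \<chi> i. if rk i \<le> j then vec_nth (y' (snd h)) i else vec_nth (x' (fst h)) i)) (at (p, f p))"
      proof (rule has_derivative_vec_lambda)
        fix i :: 'n
        show "((\<lambda>z. if rk i \<le> j then vec_nth (y (snd z)) i else vec_nth (x (fst z)) i) has_derivative
          (\<lambda>h. if rk i \<le> j then vec_nth (y' (snd h)) i else vec_nth (x' (fst h)) i)) (at (p, f p))"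
          by (cases "rk i \<le> j") (simp_all add: has_derivative_vec_nth fx fy)
      qed
      moreover have "((\<lambda>z. (c * vec_nth (x (fst z)) (idx j)) *\<^sub>R (axis (idx j) 1 :: real ^ 'n::_)) has_derivative
        (\<lambda>h. (c * vec_nth (x' (fst h)) (idx j)) *\<^sub>R axis (idx j) 1)) (at (p, f p))"
        by (intro has_derivative_scaleR_left has_derivative_mult_right has_derivative_vec_nth fx)
      ultimately show ?thesis
        unfolding \<Psi>_def[abs_def] by (rule differentiableI[OF has_derivative_diff])
    qed
    have "(\<lambda>q. mix F j q - (c * vec_nth q (idx j)) *\<^sub>R axis (idx j) 1) ` (Q \<inter> N) \<subseteq>
        \<Psi> ` {z \<in> ?A. \<Psi> differentiable (at z)}"
    proof
      fix v assume "v \<in> (\<lambda>q. mix F j q - (c * vec_nth q (idx j)) *\<^sub>R axis (idx j) 1) ` (Q \<inter> N)"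
      then obtain p where p: "p \<in> ?B" "p \<in> P" "v = mix F j (x p) - (c * vec_nth (x p) (idx j)) *\<^sub>R axis (idx j) 1"
        by (auto simp: N_def)
      have "\<xi> (x p) = p" using \<xi>x p PS by auto
      then have "v = \<Psi> (p, f p)" using p(3) by (simp add: \<Psi>_def mix_def F_def cong: if_cong)
      moreover have "(p, f p) \<in> {z \<in> ?A. \<Psi> differentiable (at z)}"
        using diff\<Psi>[OF p(2)] p PS by auto
      ultimately show "v \<in> \<Psi> ` {z \<in> ?A. \<Psi> differentiable (at z)}" by blast
    qed
    then show "negligible ((\<lambda>q. mix F j q - (c * vec_nth q (idx j)) *\<^sub>R axis (idx j) 1) ` (Q \<inter> N))"
      using smallD[OF sm(2)] negligible_subset by blast
  qed
  then obtain Q' where Q': "open Q'" "x 0 \<in> Q'" "Q' \<subseteq> Q" "inj_on F Q'" by blast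
  define U' where "U' = \<xi> ` Q'"
  have "inj_on \<xi> Q'" using \<xi>Q(2) Q'(3) by (metis inj_onI subsetD)
  then have U': "open U'" unfolding U'_def
    using invariance_of_domain[of Q' \<xi>] continuous_on_subset[OF cont\<xi> Q'(3)] Q'(1) by blast
  have U'P: "U' \<subseteq> P" using \<xi>Q(1) Q'(3) by (auto simp: U'_def)
  have "0 \<in> U'" using \<xi>x[OF V(2)] Q'(2) by (metis U'_def image_eqI)
  moreover have inj: "inj_on f U'"
  proof (rule inj_onI)
    fix p p' assume p: "p \<in> U'" "p' \<in> U'" "f p = f p'"
    then obtain q q' where q: "q \<in> Q'" "q' \<in> Q'" "p = \<xi> q" "p' = \<xi> q'" by (auto simp: U'_def)
    then have "F q = F q'" using p by (simp add: F_def)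
    then show "p = p'" using Q'(4) q by (auto dest: inj_onD)
  qed
  have contf: "continuous_on U' f" using f(1) U'P PS continuous_on_subset by blast
  obtain g where "homeomorphism U' (f ` U') f g"
    using invariance_of_domain_homeomorphism[OF U' contf _ inj] by auto
  moreover have "open (f ` U')" by (rule invariance_of_domain[OF contf U' inj])
  moreover have "0 \<in> f ` U'" using \<open>0 \<in> U'\<close> f(2) by (metis image_eqI)
  ultimately show ?thesis using U' U'P PS by blast
qed

section \<open>Definable sets\<close>

lemma in_Rn [simp]: "xs \<in> Rn m \<longleftrightarrow> length xs = m"
  by (simp add: Rn_def)

context o_minimal_structure
begin

text \<open>Formulas in place of sets: the free variables are the list positions, so that
  definability can be proved along the shape of a formula by introduction rules.\<close>

definition Df :: "nat \<Rightarrow> (real list \<Rightarrow> bool) \<Rightarrow> bool" where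
  "Df m P \<longleftrightarrow> {xs \<in> Rn m. P xs} \<in> S m"

definition Fn :: "nat \<Rightarrow> (real list \<Rightarrow> real) \<Rightarrow> bool" where
  "Fn m g \<longleftrightarrow> Df (Suc m) (\<lambda>xs. xs ! m = g (take m xs))"

section \<open>Closure of definable predicates under connectives, quantifiers and
  substitution\<close>

lemma Df_cong: "(\<And>xs. length xs = m \<Longrightarrow> P xs = Q xs) \<Longrightarrow> Df m P = Df m Q"
proof -
  assume "\<And>xs. length xs = m \<Longrightarrow> P xs = Q xs"
  then have "{xs \<in> Rn m. P xs} = {xs \<in> Rn m. Q xs}" by auto
  then show ?thesis by (simp add: Df_def)
qed

lemma Df_imp_cong: "Df m Q \<Longrightarrow> (\<And>xs. length xs = m \<Longrightarrow> P xs = Q xs) \<Longrightarrow> Df m P"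
  using Df_cong by blast

lemma Fn_cong: "(\<And>xs. length xs = m \<Longrightarrow> g xs = h xs) \<Longrightarrow> Fn m g = Fn m h"
  unfolding Fn_def by (rule Df_cong) simp

lemma Fn_imp_cong: "Fn m h \<Longrightarrow> (\<And>xs. length xs = m \<Longrightarrow> g xs = h xs) \<Longrightarrow> Fn m g"
  using Fn_cong by blast

lemma Df_in: "A \<in> S m \<Longrightarrow> Df m (\<lambda>xs. xs \<in> A)"
proof -
  assume A: "A \<in> S m"
  then have "{xs \<in> Rn m. xs \<in> A} = A" using dim by blast
  then show ?thesis using A by (simp add: Df_def)
qed

lemma Df_not: "Df m P \<Longrightarrow> Df m (\<lambda>xs. \<not> P xs)"
proof -
  assume "Df m P"
  then have "Rn m - {xs \<in> Rn m. P xs} \<in> S m" unfolding Df_def by (rule compl)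
  also have "Rn m - {xs \<in> Rn m. P xs} = {xs \<in> Rn m. \<not> P xs}" by auto
  finally show ?thesis by (simp add: Df_def)
qed

lemma Df_disj: "Df m P \<Longrightarrow> Df m Q \<Longrightarrow> Df m (\<lambda>xs. P xs \<or> Q xs)"
proof -
  assume "Df m P" "Df m Q"
  then have "{xs \<in> Rn m. P xs} \<union> {xs \<in> Rn m. Q xs} \<in> S m" unfolding Df_def by (rule union)
  also have "{xs \<in> Rn m. P xs} \<union> {xs \<in> Rn m. Q xs} = {xs \<in> Rn m. P xs \<or> Q xs}" by auto
  finally show ?thesis by (simp add: Df_def)
qed

lemma Df_conj: "Df m P \<Longrightarrow> Df m Q \<Longrightarrow> Df m (\<lambda>xs. P xs \<and> Q xs)"
proof -
  assume "Df m P" "Df m Q"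
  then have "Df m (\<lambda>xs. \<not> (\<not> P xs \<or> \<not> Q xs))" by (intro Df_disj Df_not)
  then show ?thesis by simp
qed

lemma Df_imp: "Df m P \<Longrightarrow> Df m Q \<Longrightarrow> Df m (\<lambda>xs. P xs \<longrightarrow> Q xs)"
  unfolding imp_conv_disj by (intro Df_disj Df_not)

lemma Df_const: "Df m (\<lambda>xs. c)"
proof (cases c)
  case True
  have "Df m (\<lambda>xs. \<not> False)" by (rule Df_not) (simp add: Df_def empty)
  then show ?thesis using True by simp
qed (simp add: Df_def empty)

lemma Df_ball_less: "(\<And>j. j < (k::nat) \<Longrightarrow> Df m (P j)) \<Longrightarrow> Df m (\<lambda>xs. \<forall>j<k. P j xs)"
proof (induction k)
  case 0 then show ?case using Df_const[of m True] by simp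
next
  case (Suc k)
  then have "Df m (\<lambda>xs. (\<forall>j<k. P j xs) \<and> P k xs)" by (intro Df_conj) auto
  then show ?case by (simp add: All_less_Suc conj_commute)
qed

lemma Df_take_Suc: "Df m P \<Longrightarrow> Df (Suc m) (\<lambda>xs. P (take m xs))"
proof -
  assume "Df m P"
  then have "{xs @ [t] | t xs. xs \<in> {xs \<in> Rn m. P xs}} \<in> S (Suc m)" unfolding Df_def by (rule prod_right)
  also have "{xs @ [t] | t xs. xs \<in> {xs \<in> Rn m. P xs}} = {xs \<in> Rn (Suc m). P (take m xs)}"
  proof (intro equalityI subsetI)
    fix xs assume "xs \<in> {xs \<in> Rn (Suc m). P (take m xs)}"
    then have l: "length xs = Suc m" "P (take m xs)" by auto
    then have e: "xs = take m xs @ [xs ! m]" by (simp add: take_Suc_conv_app_nth[symmetric])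
    show "xs \<in> {xs @ [t] | t xs. xs \<in> {xs \<in> Rn m. P xs}}"
      by (intro CollectI exI conjI, rule e) (use l in auto)
  qed auto
  finally show ?thesis by (simp add: Df_def)
qed

lemma Df_drop: "Df m P \<Longrightarrow> Df (k + m) (\<lambda>xs. P (drop k xs))"
proof (induction k)
  case (Suc k)
  have "Df (k + m) (\<lambda>xs. P (drop k xs))" using Suc by simp
  then have "{t # xs | t xs. xs \<in> {xs \<in> Rn (k + m). P (drop k xs)}} \<in> S (Suc (k + m))" unfolding Df_def by (rule prod_left)
  also have "{t # xs | t xs. xs \<in> {xs \<in> Rn (k + m). P (drop k xs)}} = {xs \<in> Rn (Suc (k + m)). P (drop (Suc k) xs)}"
  proof (intro equalityI subsetI)
    fix xs assume "xs \<in> {xs \<in> Rn (Suc (k + m)). P (drop (Suc k) xs)}"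
    then show "xs \<in> {t # xs | t xs. xs \<in> {xs \<in> Rn (k + m). P (drop k xs)}}" by (cases xs) auto
  qed auto
  finally show ?case by (simp add: Df_def)
qed simp

lemma Df_ex:
  assumes "Df (Suc m) (\<lambda>ys. P (take m ys) (ys ! m))"
  shows "Df m (\<lambda>xs. \<exists>t. P xs t)"
proof -
  have "take m ` {ys \<in> Rn (Suc m). P (take m ys) (ys ! m)} \<in> S m"
    using assms unfolding Df_def by (rule proj)
  also have "take m ` {ys \<in> Rn (Suc m). P (take m ys) (ys ! m)} = {xs \<in> Rn m. \<exists>t. P xs t}"
  proof (intro equalityI subsetI)
    fix xs assume "xs \<in> {xs \<in> Rn m. \<exists>t. P xs t}"
    then obtain t where "length xs = m" "P xs t" by auto
    then show "xs \<in> take m ` {ys \<in> Rn (Suc m). P (take m ys) (ys ! m)}"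
      by (intro image_eqI[of _ _ "xs @ [t]"]) (auto simp: nth_append)
  qed auto
  finally show ?thesis by (simp add: Df_def)
qed

lemma Df_all:
  assumes "Df (Suc m) (\<lambda>ys. P (take m ys) (ys ! m))"
  shows "Df m (\<lambda>xs. \<forall>t. P xs t)"
proof -
  have "Df m (\<lambda>xs. \<not> (\<exists>t. \<not> P xs t))" by (intro Df_not Df_ex assms)
  then show ?thesis by simp
qed

text \<open>Bound variables sit at the end of the list, so a block of \<open>k\<close> quantifiers
  is removed by projecting \<open>k\<close> times, innermost last entry first.\<close>

lemma Df_ex_list:
  assumes "Df (m + k) (\<lambda>ys. P (take m ys) (drop m ys))"
  shows "Df m (\<lambda>xs. \<exists>ys. length ys = k \<and> P xs ys)"
  using assms
proof (induction k arbitrary: P)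
  case 0
  have "Df m (\<lambda>xs. \<exists>ys. length ys = 0 \<and> P xs ys) = Df m (\<lambda>ys. P (take m ys) (drop m ys))"
    by (rule Df_cong) simp
  then show ?case using 0 by simp
next
  case (Suc k)
  have "Df (m + k) (\<lambda>zs. \<exists>t. P (take m zs) (drop m zs @ [t]))"
  proof (rule Df_ex)
    have "Df (Suc (m + k)) (\<lambda>ys. P (take m (take (m + k) ys)) (drop m (take (m + k) ys) @ [ys ! (m + k)]))
      = Df (Suc (m + k)) (\<lambda>ys. P (take m ys) (drop m ys))"
    proof (rule Df_cong)
      fix ys :: "real list" assume l: "length ys = Suc (m + k)"
      have "drop m ys = drop m (take (m + k) ys @ [ys ! (m + k)])"
        using l by (simp add: take_Suc_conv_app_nth[symmetric])
      then have "drop m (take (m + k) ys) @ [ys ! (m + k)] = drop m ys" using l by simp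
      then show "P (take m (take (m + k) ys)) (drop m (take (m + k) ys) @ [ys ! (m + k)]) = P (take m ys) (drop m ys)"
        by (simp add: min_def)
    qed
    then show "Df (Suc (m + k)) (\<lambda>ys. P (take m (take (m + k) ys)) (drop m (take (m + k) ys) @ [ys ! (m + k)]))"
      using Suc.prems by simp
  qed
  from Suc.IH[of "\<lambda>xs ys. \<exists>t. P xs (ys @ [t])", OF this]
  have "Df m (\<lambda>xs. \<exists>ys. length ys = k \<and> (\<exists>t. P xs (ys @ [t])))" .
  moreover have "(\<exists>ys. length ys = Suc k \<and> P xs ys) = (\<exists>ys. length ys = k \<and> (\<exists>t. P xs (ys @ [t])))" for xs
    by (auto simp: length_Suc_conv_rev)
  ultimately show ?case by simp
qed

lemma Df_all_list:
  assumes "Df (m + k) (\<lambda>ys. P (take m ys) (drop m ys))"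
  shows "Df m (\<lambda>xs. \<forall>ys. length ys = k \<longrightarrow> P xs ys)"
proof -
  have "Df m (\<lambda>xs. \<not> (\<exists>ys. length ys = k \<and> \<not> P xs ys))"
    by (rule Df_not[OF Df_ex_list[OF Df_not[OF assms]]])
  then show ?thesis by simp
qed

text \<open>Permuting, repeating or omitting variables: a fresh block \<open>ys\<close> is tied to
  the entries \<open>xs ! \<sigma> j\<close> by diagonals and then projected away.\<close>

lemma Df_reindex:
  assumes P: "Df k P" and \<sigma>: "\<And>j. j < k \<Longrightarrow> \<sigma> j < m"
  shows "Df m (\<lambda>xs. P (map (\<lambda>j. xs ! \<sigma> j) [0..<k]))"
proof -
  have "Df m (\<lambda>xs. \<exists>ys. length ys = k \<and> (P ys \<and> (\<forall>j<k. ys ! j = xs ! \<sigma> j)))"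
  proof (rule Df_ex_list, rule Df_conj)
    show "Df (m + k) (\<lambda>ys. P (drop m ys))" by (rule Df_drop[OF P])
    show "Df (m + k) (\<lambda>ys. \<forall>j<k. drop m ys ! j = take m ys ! \<sigma> j)"
    proof (rule Df_ball_less)
      fix j assume j: "j < k"
      have "Df (m + k) (\<lambda>ys. ys ! (m + j) = ys ! \<sigma> j)"
        unfolding Df_def using diagonal[of "m + j" "m + k" "\<sigma> j"] j \<sigma>[OF j] by simp
      moreover have "Df (m + k) (\<lambda>ys. ys ! (m + j) = ys ! \<sigma> j) = Df (m + k) (\<lambda>ys. drop m ys ! j = take m ys ! \<sigma> j)"
        using j \<sigma>[OF j] by (intro Df_cong) simp
      ultimately show "Df (m + k) (\<lambda>ys. drop m ys ! j = take m ys ! \<sigma> j)" by simp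
    qed
  qed
  moreover have "(\<exists>ys. length ys = k \<and> (P ys \<and> (\<forall>j<k. ys ! j = xs ! \<sigma> j))) = P (map (\<lambda>j. xs ! \<sigma> j) [0..<k])" for xs :: "real list"
  proof
    assume "\<exists>ys. length ys = k \<and> (P ys \<and> (\<forall>j<k. ys ! j = xs ! \<sigma> j))"
    then obtain ys where "length ys = k" "P ys" "\<forall>j<k. ys ! j = xs ! \<sigma> j" by blast
    moreover then have "ys = map (\<lambda>j. xs ! \<sigma> j) [0..<k]" by (intro nth_equalityI) auto
    ultimately show "P (map (\<lambda>j. xs ! \<sigma> j) [0..<k])" by simp
  next
    assume "P (map (\<lambda>j. xs ! \<sigma> j) [0..<k])"
    then show "\<exists>ys. length ys = k \<and> (P ys \<and> (\<forall>j<k. ys ! j = xs ! \<sigma> j))"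
      by (intro exI[of _ "map (\<lambda>j. xs ! \<sigma> j) [0..<k]"]) auto
  qed
  ultimately show ?thesis by simp
qed

text \<open>Reindexing copies entry \<open>i\<close> to position \<open>k\<close>, the place of the
  value in the graph of \<open>g\<close>.\<close>

lemma Df_graph:
  assumes "Fn k g" "k \<le> m" "i < m"
  shows "Df m (\<lambda>ys. ys ! i = g (take k ys))"
proof -
  have "Df m (\<lambda>xs. (\<lambda>xs. xs ! k = g (take k xs)) (map (\<lambda>j. xs ! (if j = k then i else j)) [0..<Suc k]))"
    using assms by (intro Df_reindex) (auto simp: Fn_def)
  then show ?thesis
  proof (rule Df_imp_cong)
    fix xs :: "real list" assume "length xs = m"
    then have "take k (map (\<lambda>j. xs ! (if j = k then i else j)) [0..<Suc k]) = take k xs"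
      using assms by (intro nth_equalityI) auto
    moreover have "map (\<lambda>j. xs ! (if j = k then i else j)) [0..<Suc k] ! k = xs ! i"
      by (subst nth_map) (simp_all del: upt_Suc)
    ultimately show "(xs ! i = g (take k xs)) = (map (\<lambda>j. xs ! (if j = k then i else j)) [0..<Suc k] ! k =
        g (take k (map (\<lambda>j. xs ! (if j = k then i else j)) [0..<Suc k])))"
      by (simp only:)
  qed
qed

text \<open>The intermediate values \<open>g j xs\<close> are introduced as a quantified block, each
  tied by the graph of its function.\<close>

lemma Df_subst:
  assumes P: "Df k P" and g: "\<And>j. j < k \<Longrightarrow> Fn m (g j)"
  shows "Df m (\<lambda>xs. P (map (\<lambda>j. g j xs) [0..<k]))"
proof -
  have "Df m (\<lambda>xs. \<exists>ys. length ys = k \<and> (P ys \<and> (\<forall>j<k. ys ! j = g j xs)))"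
  proof (rule Df_ex_list, rule Df_conj)
    show "Df (m + k) (\<lambda>ys. P (drop m ys))" by (rule Df_drop[OF P])
    show "Df (m + k) (\<lambda>ys. \<forall>j<k. drop m ys ! j = g j (take m ys))"
    proof (rule Df_ball_less)
      fix j assume j: "j < k"
      have "Df (m + k) (\<lambda>ys. ys ! (m + j) = g j (take m ys))"
        using j by (intro Df_graph g) auto
      then show "Df (m + k) (\<lambda>ys. drop m ys ! j = g j (take m ys))"
        by (rule Df_imp_cong) (use j in simp)
    qed
  qed
  moreover have "(\<exists>ys. length ys = k \<and> (P ys \<and> (\<forall>j<k. ys ! j = g j xs))) = P (map (\<lambda>j. g j xs) [0..<k])" for xs
  proof
    assume "\<exists>ys. length ys = k \<and> (P ys \<and> (\<forall>j<k. ys ! j = g j xs))"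
    then obtain ys where "length ys = k" "P ys" "\<forall>j<k. ys ! j = g j xs" by blast
    moreover then have "ys = map (\<lambda>j. g j xs) [0..<k]" by (intro nth_equalityI) auto
    ultimately show "P (map (\<lambda>j. g j xs) [0..<k])" by simp
  next
    assume "P (map (\<lambda>j. g j xs) [0..<k])"
    then show "\<exists>ys. length ys = k \<and> (P ys \<and> (\<forall>j<k. ys ! j = g j xs))"
      by (intro exI[of _ "map (\<lambda>j. g j xs) [0..<k]"]) auto
  qed
  ultimately show ?thesis by simp
qed

lemma Fn_var: "i < m \<Longrightarrow> Fn m (\<lambda>xs. xs ! i)"
proof -
  assume i: "i < m"
  have "Df (Suc m) (\<lambda>xs. xs ! m = xs ! i)"
    unfolding Df_def using diagonal[of m "Suc m" i] i by simp
  then show ?thesis unfolding Fn_def by (rule Df_imp_cong) (use i in simp)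
qed

lemma Fn_take: assumes "Fn k g" "k \<le> m" shows "Fn m (\<lambda>xs. g (take k xs))"
proof -
  have "Df (Suc m) (\<lambda>ys. ys ! m = g (take k ys))" using assms by (intro Df_graph) auto
  then show ?thesis unfolding Fn_def by (rule Df_imp_cong) (use assms in \<open>simp add: min_def\<close>)
qed

text \<open>Substitution into the graph of \<open>h\<close>: the functions \<open>g j\<close> fill
  the first \<open>k\<close> places and the value variable, entry \<open>m\<close>, fills place
  \<open>k\<close>.\<close>

lemma Fn_subst:
  assumes h: "Fn k h" and g: "\<And>j. j < k \<Longrightarrow> Fn m (g j)"
  shows "Fn m (\<lambda>xs. h (map (\<lambda>j. g j xs) [0..<k]))"
proof -
  let ?g = "\<lambda>j xs. if j < k then g j (take m xs) else xs ! m"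
  have "Df (Suc m) (\<lambda>xs. (\<lambda>xs. xs ! k = h (take k xs)) (map (\<lambda>j. ?g j xs) [0..<Suc k]))"
  proof (rule Df_subst)
    show "Df (Suc k) (\<lambda>xs. xs ! k = h (take k xs))" using h by (simp add: Fn_def)
    fix j assume "j < Suc k"
    then show "Fn (Suc m) (?g j)"
      by (cases "j < k") (auto intro: Fn_var Fn_take g)
  qed
  then show ?thesis unfolding Fn_def
  proof (rule Df_imp_cong)
    fix xs :: "real list"
    have "take k (map (\<lambda>j. ?g j xs) [0..<Suc k]) = map (\<lambda>j. g j (take m xs)) [0..<k]"
      by (intro nth_equalityI) auto
    moreover have "map (\<lambda>j. ?g j xs) [0..<Suc k] ! k = xs ! m"
      by (subst nth_map) (simp_all del: upt_Suc)
    ultimately show "(xs ! m = h (map (\<lambda>j. g j (take m xs)) [0..<k])) = (map (\<lambda>j. ?g j xs) [0..<Suc k] ! k =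
        h (take k (map (\<lambda>j. ?g j xs) [0..<Suc k])))" by (simp only:)
  qed
qed

lemma Df_interval: "is_interval I \<Longrightarrow> Df 1 (\<lambda>xs. xs ! 0 \<in> I)"
proof -
  assume I: "is_interval I"
  have "{xs \<in> Rn 1. xs ! 0 \<in> I} = (\<lambda>t. [t]) ` \<Union>{I}"
    by (auto simp: length_Suc_conv)
  moreover have "(\<lambda>t. [t]) ` \<Union>{I} \<in> S 1"
    unfolding o_minimal using I by (intro exI[of _ "{I}"]) auto
  ultimately show ?thesis by (simp add: Df_def)
qed

text \<open>A singleton is a degenerate interval, so every real may serve as a parameter.\<close>

lemma Fn_const: "Fn m (\<lambda>xs. c)"
proof -
  have "Df (Suc m) (\<lambda>xs. (\<lambda>xs. xs ! 0 \<in> {c}) (map (\<lambda>j. xs ! m) [0..<1]))"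
    by (rule Df_reindex[OF Df_interval]) (auto simp: is_interval_1)
  then show ?thesis by (simp add: Fn_def)
qed

lemma Df2:
  assumes P: "Df 2 (\<lambda>xs. R (xs ! 0) (xs ! 1))" and a: "Fn m a" and b: "Fn m b"
  shows "Df m (\<lambda>xs. R (a xs) (b xs))"
proof -
  have "Df m (\<lambda>xs. (\<lambda>xs. R (xs ! 0) (xs ! 1)) (map (\<lambda>j. (if j = 0 then a else b) xs) [0..<2]))"
    using a b by (intro Df_subst[OF P]) auto
  then show ?thesis by simp
qed

lemma Df3:
  assumes P: "Df 3 (\<lambda>xs. R (xs ! 0) (xs ! 1) (xs ! 2))" and a: "Fn m a" and b: "Fn m b" and c: "Fn m c"
  shows "Df m (\<lambda>xs. R (a xs) (b xs) (c xs))"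
proof -
  have "Df m (\<lambda>xs. (\<lambda>xs. R (xs ! 0) (xs ! 1) (xs ! 2)) (map (\<lambda>j. (if j = 0 then a else if j = 1 then b else c) xs) [0..<3]))"
    using a b c by (intro Df_subst[OF P]) auto
  then show ?thesis by simp
qed

section \<open>Order and arithmetic\<close>

lemma Df_less: "Fn m a \<Longrightarrow> Fn m b \<Longrightarrow> Df m (\<lambda>xs. a xs < b xs)"
proof (rule Df2)
  have "{xs \<in> Rn 2. xs ! 0 < xs ! 1} = {[s, t] | s t :: real. s < t}"
    by (auto simp: numeral_2_eq_2 length_Suc_conv)
  then show "Df 2 (\<lambda>xs. xs ! 0 < xs ! 1)" using less by (simp add: Df_def)
qed

lemma Df_eq: "Fn m a \<Longrightarrow> Fn m b \<Longrightarrow> Df m (\<lambda>xs. a xs = b xs)"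
  by (rule Df2) (use diagonal[of 0 2 1] in \<open>simp_all add: Df_def\<close>)

lemma Df_le: "Fn m a \<Longrightarrow> Fn m b \<Longrightarrow> Df m (\<lambda>xs. a xs \<le> b xs)"
  unfolding not_less[symmetric] by (intro Df_not Df_less)

lemma Fn_lift: "Fn m a \<Longrightarrow> Fn (Suc m) (\<lambda>xs. a (take m xs))"
  by (rule Fn_take) auto

lemma Df_add3: "Df 3 (\<lambda>xs. xs ! 2 = xs ! 0 + xs ! 1)"
proof -
  have "{xs \<in> Rn 3. xs ! 2 = xs ! 0 + xs ! 1} = {[s, t, s + t] | s t :: real. True}"
    by (auto simp: numeral_3_eq_3 length_Suc_conv)
  then show ?thesis using add by (simp add: Df_def)
qed

lemma Df_mult3: "Df 3 (\<lambda>xs. xs ! 2 = xs ! 0 * xs ! 1)"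
proof -
  have "{xs \<in> Rn 3. xs ! 2 = xs ! 0 * xs ! 1} = {[s, t, s * t] | s t :: real. True}"
    by (auto simp: numeral_3_eq_3 length_Suc_conv)
  then show ?thesis using mult by (simp add: Df_def)
qed

lemma Fn_add: "Fn m a \<Longrightarrow> Fn m b \<Longrightarrow> Fn m (\<lambda>xs. a xs + b xs)"
  unfolding Fn_def[of _ "\<lambda>xs. a xs + b xs"]
  by (rule Df3[of "\<lambda>s t u. u = s + t", OF Df_add3 Fn_lift Fn_lift Fn_var]) auto

lemma Fn_mult: "Fn m a \<Longrightarrow> Fn m b \<Longrightarrow> Fn m (\<lambda>xs. a xs * b xs)"
  unfolding Fn_def[of _ "\<lambda>xs. a xs * b xs"]
  by (rule Df3[of "\<lambda>s t u. u = s * t", OF Df_mult3 Fn_lift Fn_lift Fn_var]) auto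

lemma Fn_uminus: "Fn m a \<Longrightarrow> Fn m (\<lambda>xs. - a xs)"
proof -
  assume "Fn m a"
  then have "Fn m (\<lambda>xs. -1 * a xs)" by (intro Fn_mult Fn_const)
  then show ?thesis by simp
qed

lemma Fn_diff: "Fn m a \<Longrightarrow> Fn m b \<Longrightarrow> Fn m (\<lambda>xs. a xs - b xs)"
  unfolding diff_conv_add_uminus by (intro Fn_add Fn_uminus)

lemmas Df_intros = Df_not Df_disj Df_conj Df_imp Df_const Df_less Df_eq Df_le
  Fn_const Fn_add Fn_mult Fn_uminus Fn_diff

text \<open>For functions given by a case distinction or a description instead of
  arithmetic.\<close>

lemma Fn_Df_graph:
  assumes "Df (Suc m) (\<lambda>xs. Q (take m xs) (xs ! m))" and "\<And>xs y. length xs = m \<Longrightarrow> Q xs y \<longleftrightarrow> y = g xs"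
  shows "Fn m g"
  unfolding Fn_def by (rule Df_imp_cong[OF assms(1)]) (use assms(2) in auto)

end

section \<open>Thin definable sets\<close>

text \<open>
  Having countable fibres, unlike being a null set, needs no measurability and is meaningful for all sets;
  a definable set of reals is countable iff it is finite iff it has no interior.
\<close>

primrec thin :: "nat \<Rightarrow> real list set \<Rightarrow> bool" where
  "thin 0 A \<longleftrightarrow> [] \<notin> A"
| "thin (Suc d) A \<longleftrightarrow> thin d {xs \<in> Rn d. uncountable {t. xs @ [t] \<in> A}}"

lemma thin_mono: "thin d B \<Longrightarrow> A \<subseteq> B \<Longrightarrow> thin d A"
proof (induction d arbitrary: A B)
  case (Suc d)
  have "{xs \<in> Rn d. uncountable {t. xs @ [t] \<in> A}} \<subseteq> {xs \<in> Rn d. uncountable {t. xs @ [t] \<in> B}}"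
  proof clarify
    fix xs assume "countable {t. xs @ [t] \<in> B}" "uncountable {t. xs @ [t] \<in> A}"
    moreover have "{t. xs @ [t] \<in> A} \<subseteq> {t. xs @ [t] \<in> B}" using Suc.prems(2) by auto
    ultimately show False using countable_subset by blast
  qed
  then show ?case using Suc.IH Suc.prems(1) by simp
qed auto

text \<open>If a fibre of a countable union is uncountable, so is the fibre of some member; hence
  the exceptional base points of the union are covered by those of the members.\<close>

lemma thin_UN:
  assumes "countable I"
  shows "(\<And>i. i \<in> I \<Longrightarrow> thin d (A i)) \<Longrightarrow> thin d (\<Union>i\<in>I. A i)"
proof (induction d arbitrary: A)
  case (Suc d)
  let ?U = "\<lambda>A. {xs \<in> Rn d. uncountable {t. xs @ [t] \<in> A}}"
  have "?U (\<Union>i\<in>I. A i) \<subseteq> (\<Union>i\<in>I. ?U (A i))"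
  proof
    fix xs assume xs: "xs \<in> ?U (\<Union>i\<in>I. A i)"
    have "{t. xs @ [t] \<in> (\<Union>i\<in>I. A i)} = (\<Union>i\<in>I. {t. xs @ [t] \<in> A i})" by auto
    then have "\<not> (\<forall>i\<in>I. countable {t. xs @ [t] \<in> A i})" using xs assms by auto
    then show "xs \<in> (\<Union>i\<in>I. ?U (A i))" using xs by auto
  qed
  moreover have "thin d (\<Union>i\<in>I. ?U (A i))" using Suc by simp
  ultimately show ?case using thin_mono by simp
qed auto

lemma cube_snoc:
  "length xs = d \<Longrightarrow> length b = d \<Longrightarrow> xs @ [t] \<in> cube (Suc d) (b @ [c]) r \<longleftrightarrow> xs \<in> cube d b r \<and> \<bar>t - c\<bar> < r"
  by (auto simp: cube_def All_less_Suc nth_append)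

lemma interval_cases:
  fixes I :: "real set"
  assumes "is_interval I"
  shows "(\<exists>a b. a < b \<and> {a<..<b} \<subseteq> I) \<or> finite I"
proof (cases "\<exists>a\<in>I. \<exists>b\<in>I. a < b")
  case True
  then show ?thesis using assms unfolding is_interval_1 by (meson greaterThanLessThan_iff less_imp_le subsetI)
next
  case False
  then have "\<forall>a\<in>I. \<forall>b\<in>I. a = b" by (metis linorder_neqE)
  then have "I = {} \<or> (\<exists>a. I = {a})" by blast
  then show ?thesis by auto
qed

section \<open>Removing and inserting a list entry\<close>

definition dropi :: "nat \<Rightarrow> 'a list \<Rightarrow> 'a list" where
  "dropi i xs = take i xs @ drop (Suc i) xs"

definition ins :: "nat \<Rightarrow> 'a \<Rightarrow> 'a list \<Rightarrow> 'a list" where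
  "ins i t xs = take i xs @ t # drop i xs"

lemma length_dropi: "i < length xs \<Longrightarrow> length (dropi i xs) = length xs - 1"
  by (simp add: dropi_def)

lemma length_ins: "length (ins i t xs) = Suc (length xs)"
  by (simp add: ins_def)

lemma ins_dropi: "i < length xs \<Longrightarrow> ins i (xs ! i) (dropi i xs) = xs"
  by (simp add: ins_def dropi_def id_take_nth_drop[symmetric])

lemma dropi_ins: "i \<le> length xs \<Longrightarrow> dropi i (ins i t xs) = xs"
  by (simp add: ins_def dropi_def)

lemma nth_ins: "i \<le> length xs \<Longrightarrow> j \<le> length xs \<Longrightarrow>
    ins i t xs ! j = (if j < i then xs ! j else if j = i then t else xs ! (j - 1))"
  by (auto simp: ins_def nth_append nth_Cons')

definition interior_list :: "nat \<Rightarrow> real list set \<Rightarrow> real list set" where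
  "interior_list d A = {xs \<in> Rn d. \<exists>r>0. cube d xs r \<subseteq> A}"

context o_minimal_structure
begin

section \<open>Thin sets against sets with interior\<close>

lemma Df_snoc:
  assumes A: "A \<in> S (Suc m)" and "m \<le> M" "i < M"
  shows "Df M (\<lambda>ys. take m ys @ [ys ! i] \<in> A)"
proof -
  have "Df M (\<lambda>ys. map (\<lambda>j. ys ! (if j < m then j else i)) [0..<Suc m] \<in> A)"
    using assms by (intro Df_reindex[OF Df_in]) auto
  then show ?thesis
  proof (rule Df_imp_cong)
    fix ys :: "real list" assume "length ys = M"
    then have "map (\<lambda>j. ys ! (if j < m then j else i)) [0..<Suc m] = take m ys @ [ys ! i]"
      using assms by (intro nth_equalityI) (auto simp: nth_append less_Suc_eq simp del: upt_Suc)
    then show "(take m ys @ [ys ! i] \<in> A) = (map (\<lambda>j. ys ! (if j < m then j else i)) [0..<Suc m] \<in> A)"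
      by (simp only:)
  qed
qed

lemma Df1_intervals:
  assumes "Df 1 (\<lambda>ys. P (ys ! 0))"
  obtains F where "finite F" "\<And>I. I \<in> F \<Longrightarrow> is_interval I" "{t. P t} = \<Union>F"
proof -
  obtain F where F: "finite F" "\<forall>I \<in> F. is_interval I" "{ys \<in> Rn 1. P (ys ! 0)} = (\<lambda>t. [t]) ` \<Union>F"
    using assms unfolding Df_def o_minimal by blast
  have "{t. P t} = \<Union>F"
  proof (intro equalityI subsetI)
    fix t assume "t \<in> {t. P t}"
    then have "[t] \<in> {ys \<in> Rn 1. P (ys ! 0)}" by simp
    then show "t \<in> \<Union>F" unfolding F(3) by auto
  next
    fix t assume "t \<in> \<Union>F"
    then have "[t] \<in> {ys \<in> Rn 1. P (ys ! 0)}" unfolding F(3) by blast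
    then show "t \<in> {t. P t}" by simp
  qed
  then show ?thesis using that F by blast
qed

text \<open>A finite union of intervals without a proper interval is finite. Rational end points
  keep the number of possible intervals countable, as \<open>thin_UN\<close> requires.\<close>

lemma Df1_uncountable:
  assumes "Df 1 (\<lambda>ys. P (ys ! 0))" "uncountable {t. P t}"
  shows "\<exists>p\<in>\<rat>. \<exists>q\<in>\<rat>. p < q \<and> (\<forall>t. p < t \<and> t < q \<longrightarrow> P t)"
proof -
  obtain F where F: "finite F" "\<And>I. I \<in> F \<Longrightarrow> is_interval I" "{t. P t} = \<Union>F"
    using Df1_intervals[OF assms(1)] by blast
  have "\<exists>I\<in>F. infinite I"
  proof (rule ccontr)
    assume "\<not> (\<exists>I\<in>F. infinite I)"
    then have "finite (\<Union>F)" using F(1) by (intro finite_Union) auto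
    then show False using assms(2) F(3) countable_finite by auto
  qed
  then obtain I where "I \<in> F" "infinite I" by blast
  with interval_cases[OF F(2), of I] obtain a b where I: "I \<in> F" "a < b" "{a<..<b} \<subseteq> I"
    by blast
  obtain p where p: "p \<in> \<rat>" "a < p" "p < b" using Rats_dense_in_real I(2) by blast
  obtain q where q: "q \<in> \<rat>" "p < q" "q < b" using Rats_dense_in_real p(3) by blast
  have "\<forall>t. p < t \<and> t < q \<longrightarrow> P t"
  proof (intro allI impI)
    fix t assume "p < t \<and> t < q"
    then have "t \<in> \<Union>F" using I p q by (intro UnionI[OF I(1)] subsetD[OF I(3)]) auto
    then show "P t" using F(3) by blast
  qed
  then show ?thesis using p q by blast
qed

lemma Df1_countable:
  assumes "Df 1 (\<lambda>ys. P (ys ! 0))" "countable {t. P t}"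
  shows "finite {t. P t}"
proof -
  obtain F where F: "finite F" "\<And>I. I \<in> F \<Longrightarrow> is_interval I" "{t. P t} = \<Union>F"
    using Df1_intervals[OF assms(1)] by blast
  have "finite I" if "I \<in> F" for I
  proof -
    have "\<not> (\<exists>a b. a < b \<and> {a<..<b} \<subseteq> I)"
    proof
      assume "\<exists>a b. a < b \<and> {a<..<b} \<subseteq> I"
      then obtain a b where ab: "a < b" "{a<..<b} \<subseteq> I" by blast
      then have "{a<..<b} \<subseteq> {t. P t}" using F(3) that by blast
      then have "countable {a<..<b}" using assms(2) by (rule countable_subset)
      then show False using uncountable_open_interval[of a b] ab(1) by simp
    qed
    then show ?thesis using interval_cases[OF F(2)[OF that]] by blast
  qed
  then show ?thesis using F by simp
qed

text \<open>The fixed entries \<open>xs\<close> are substituted as constants, which needs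
  definability with parameters.\<close>

lemma Df_fibre:
  assumes "A \<in> S (Suc m)" "length xs = m"
  shows "Df 1 (\<lambda>ys. xs @ [ys ! 0] \<in> A)"
proof -
  have "Df 1 (\<lambda>ys. map (\<lambda>j. (if j < m then (\<lambda>ys. xs ! j) else (\<lambda>ys. ys ! 0)) ys) [0..<Suc m] \<in> A)"
    by (intro Df_subst[OF Df_in[OF assms(1)]]) (auto intro: Fn_const Fn_var)
  then show ?thesis
  proof (rule Df_imp_cong)
    fix ys :: "real list"
    have "map (\<lambda>j. (if j < m then (\<lambda>ys. xs ! j) else (\<lambda>ys. ys ! 0)) ys) [0..<Suc m] = xs @ [ys ! 0]"
      using assms by (intro nth_equalityI) (auto simp: nth_append less_Suc_eq simp del: upt_Suc)
    then show "(xs @ [ys ! 0] \<in> A) = (map (\<lambda>j. (if j < m then (\<lambda>ys. xs ! j) else (\<lambda>ys. ys ! 0)) ys) [0..<Suc m] \<in> A)"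
      by (simp only:)
  qed
qed

text \<open>If \<open>A\<close> is not thin, uncountably large fibres, hence fibres containing an
  interval, lie over a base set that is not thin. One rational interval works over a part that is
  still not thin and so contains a cube by induction; the product is a cube in
  \<open>A\<close>.\<close>

lemma thin_or_cube:
  "A \<in> S d \<Longrightarrow> thin d A \<or> (\<exists>a r. length a = d \<and> r > 0 \<and> cube d a r \<subseteq> A)"
proof (induction d arbitrary: A)
  case 0
  have "cube 0 [] 1 = {[]}" by (auto simp: cube_def)
  show ?case
  proof (cases "[] \<in> A")
    case True
    then have "cube 0 [] 1 \<subseteq> A" using \<open>cube 0 [] 1 = {[]}\<close> by simp
    then show ?thesis by (intro disjI2 exI[of _ "[]"] exI[of _ 1]) simp
  qed simp
next
  case (Suc d)
  let ?T = "\<lambda>p q. {xs \<in> Rn d. \<forall>t. p < t \<and> t < q \<longrightarrow> xs @ [t] \<in> A}"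
  show ?case
  proof (cases "thin (Suc d) A")
    case False
    \<comment> \<open>Countably many sets \<open>?T p q\<close> cover the exceptional base points,
      so they cannot all be thin.\<close>
    have "{xs \<in> Rn d. uncountable {t. xs @ [t] \<in> A}} \<subseteq> (\<Union>(p, q)\<in>{(p, q). p \<in> \<rat> \<and> q \<in> \<rat> \<and> p < q}. ?T p q)"
      using Df1_uncountable[OF Df_fibre[OF Suc.prems]] by fastforce
    then have "\<not> thin d (\<Union>(p, q)\<in>{(p, q). p \<in> \<rat> \<and> q \<in> \<rat> \<and> p < q}. ?T p q)"
      using False thin_mono by auto
    moreover have "countable {(p, q). p \<in> \<rat> \<and> q \<in> \<rat> \<and> p < (q :: real)}"
      by (rule countable_subset[OF _ countable_SIGMA[OF countable_rat, of "\<lambda>_. \<rat>"]]) (auto simp: countable_rat)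
    ultimately obtain p q where pq: "p < q" "\<not> thin d (?T p q)"
      using thin_UN[of "{(p, q). p \<in> \<rat> \<and> q \<in> \<rat> \<and> p < (q :: real)}" d "\<lambda>(p, q). ?T p q"] by auto
    have "Df d (\<lambda>xs. \<forall>t. p < t \<and> t < q \<longrightarrow> xs @ [t] \<in> A)"
      by (intro Df_all Df_imp Df_conj Df_less Fn_const Fn_var Df_snoc Suc.prems) auto
    then have "?T p q \<in> S d" by (simp add: Df_def)
    then obtain a r where a: "length a = d" "r > 0" "cube d a r \<subseteq> ?T p q"
      using Suc.IH pq(2) by blast
    \<comment> \<open>Half the length keeps the last entry between \<open>p\<close> and
      \<open>q\<close> when it is centred at their midpoint.\<close>
    let ?r = "min r ((q - p) / 2)"
    have "cube (Suc d) (a @ [(p + q) / 2]) ?r \<subseteq> A"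
    proof
      fix ys assume ys: "ys \<in> cube (Suc d) (a @ [(p + q) / 2]) ?r"
      then obtain xs t where xs: "ys = xs @ [t]" "length xs = d" by (auto simp: cube_def length_Suc_conv_rev)
      then have "xs \<in> cube d a ?r" "\<bar>t - (p + q) / 2\<bar> < ?r" using ys a by (auto simp: cube_snoc)
      then have "xs \<in> cube d a r" "p < t" "t < q" by (auto simp: cube_def abs_less_iff field_simps)
      then show "ys \<in> A" using a(3) xs by blast
    qed
    then show ?thesis using a pq by (intro disjI2 exI[of _ "a @ [(p + q) / 2]"] exI[of _ ?r]) auto
  qed auto
qed

text \<open>Absolute values and inclusion are spelled out so that the rules for definable formulas
  apply.\<close>

lemma interior_list_def': "interior_list d A = {xs \<in> Rn d. \<exists>r. 0 < r \<and>
    (\<forall>ys. length ys = d \<longrightarrow> ((\<forall>i<d. ys ! i - xs ! i < r \<and> xs ! i - ys ! i < r) \<longrightarrow> ys \<in> A))}"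
  unfolding interior_list_def cube_def by (auto simp: abs_less_iff subset_iff)

lemma interior_list_definable:
  assumes A: "A \<in> S d"
  shows "interior_list d A \<in> S d"
proof -
  \<comment> \<open>The list \<open>ws\<close> consists of \<open>xs\<close>, the radius at position
    \<open>d\<close>, and then \<open>ys\<close>.\<close>
  have "Df (Suc d + d) (\<lambda>ws. (\<forall>i<d. drop (Suc d) ws ! i - take d (take (Suc d) ws) ! i < take (Suc d) ws ! d
      \<and> take d (take (Suc d) ws) ! i - drop (Suc d) ws ! i < take (Suc d) ws ! d) \<longrightarrow> drop (Suc d) ws \<in> A)"
  proof (rule Df_imp)
    show "Df (Suc d + d) (\<lambda>ws. \<forall>i<d. drop (Suc d) ws ! i - take d (take (Suc d) ws) ! i < take (Suc d) ws ! d
      \<and> take d (take (Suc d) ws) ! i - drop (Suc d) ws ! i < take (Suc d) ws ! d)"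
    proof (rule Df_ball_less)
      fix i assume i: "i < d"
      have "Df (Suc d + d) (\<lambda>ws. ws ! (Suc d + i) - ws ! i < ws ! d \<and> ws ! i - ws ! (Suc d + i) < ws ! d)"
        using i by (intro Df_conj Df_less Fn_diff Fn_var) auto
      then show "Df (Suc d + d) (\<lambda>ws. drop (Suc d) ws ! i - take d (take (Suc d) ws) ! i < take (Suc d) ws ! d
        \<and> take d (take (Suc d) ws) ! i - drop (Suc d) ws ! i < take (Suc d) ws ! d)"
        by (rule Df_imp_cong) (use i in simp)
    qed
    show "Df (Suc d + d) (\<lambda>ws. drop (Suc d) ws \<in> A)" by (rule Df_drop[OF Df_in[OF A]])
  qed
  then have "Df d (\<lambda>xs. \<exists>r. 0 < r \<and>
    (\<forall>ys. length ys = d \<longrightarrow> ((\<forall>i<d. ys ! i - xs ! i < r \<and> xs ! i - ys ! i < r) \<longrightarrow> ys \<in> A)))"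
    by (intro Df_ex Df_conj Df_less Fn_const Fn_var Df_all_list) simp_all
  then show ?thesis unfolding interior_list_def' Df_def .
qed

text \<open>A cube inside the difference would consist of interior points of \<open>A\<close>, so
  the second alternative of \<open>thin_or_cube\<close> is impossible.\<close>

lemma thin_diff_interior:
  assumes A: "A \<in> S d"
  shows "A - interior_list d A \<in> S d" "thin d (A - interior_list d A)"
proof -
  have "Df d (\<lambda>xs. xs \<in> A \<and> \<not> xs \<in> interior_list d A)"
    by (intro Df_conj Df_not Df_in A interior_list_definable)
  moreover have "{xs \<in> Rn d. xs \<in> A \<and> \<not> xs \<in> interior_list d A} = A - interior_list d A"
    using dim[OF A] by auto
  ultimately show *: "A - interior_list d A \<in> S d" by (simp add: Df_def)
  show "thin d (A - interior_list d A)"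
  proof (rule ccontr)
    assume "\<not> thin d (A - interior_list d A)"
    then obtain a r where a: "length a = d" "r > 0" "cube d a r \<subseteq> A - interior_list d A"
      using thin_or_cube[OF *] by blast
    then have "a \<in> interior_list d A" by (auto simp: interior_list_def)
    moreover have "a \<in> cube d a r" using a by (simp add: cube_def)
    ultimately show False using a(3) by blast
  qed
qed

text \<open>On each piece one coordinate is a function of the others, so a thin set is parametrized
  by fewer coordinates. Over base points with uncountable fibre the induction applies; all other
  fibres are finite, and their points are separated by rational intervals.\<close>

lemma thin_cover:
  "E \<in> S r \<Longrightarrow> thin r E \<Longrightarrow> \<exists>\<C>. countable \<C> \<and> E \<subseteq> \<Union>\<C> \<and>
     (\<forall>C\<in>\<C>. C \<in> S r \<and> (\<exists>i<r. inj_on (dropi i) C))"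
proof (induction r arbitrary: E)
  case 0
  then have "E = {}" using dim[OF 0(1)] by (auto simp: Rn_def)
  then show ?case by (intro exI[of _ "{}"]) auto
next
  case (Suc r)
  \<comment> \<open>The base points with uncountable fibre, written as a formula: such a fibre
    contains an interval, whose end points are quantified.\<close>
  define T where "T = {xs \<in> Rn r. \<exists>p. \<exists>q. p < q \<and> (\<forall>t. p < t \<and> t < q \<longrightarrow> xs @ [t] \<in> E)}"
  have T1: "T \<in> S r"
  proof -
    have "Df r (\<lambda>xs. \<exists>p. \<exists>q. p < q \<and> (\<forall>t. p < t \<and> t < q \<longrightarrow> xs @ [t] \<in> E))"
    proof (intro Df_ex Df_conj Df_all Df_imp)
      show "Df (Suc (Suc (Suc r))) (\<lambda>ys. take r (take (Suc r) (take (Suc (Suc r)) ys)) @ [ys ! Suc (Suc r)] \<in> E)"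
        by (rule Df_imp_cong[OF Df_snoc[OF Suc.prems(1), of "Suc (Suc (Suc r))" "Suc (Suc r)"]]) (simp_all add: min_def)
      show "Df (Suc (Suc r)) (\<lambda>ys. take (Suc r) ys ! r < ys ! Suc r)"
        by (rule Df_imp_cong[of _ "\<lambda>ys. ys ! r < ys ! Suc r"]) (simp_all add: Df_less Fn_var)
      show "Df (Suc (Suc (Suc r))) (\<lambda>ys. take (Suc r) (take (Suc (Suc r)) ys) ! r < ys ! Suc (Suc r))"
        by (rule Df_imp_cong[of _ "\<lambda>ys. ys ! r < ys ! Suc (Suc r)"]) (simp_all add: Df_less Fn_var)
      show "Df (Suc (Suc (Suc r))) (\<lambda>ys. ys ! Suc (Suc r) < take (Suc (Suc r)) ys ! Suc r)"
        by (rule Df_imp_cong[of _ "\<lambda>ys. ys ! Suc (Suc r) < ys ! Suc r"]) (simp_all add: Df_less Fn_var)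
    qed
    then show ?thesis by (simp add: T_def Df_def)
  qed
  have T_eq: "T = {xs \<in> Rn r. uncountable {t. xs @ [t] \<in> E}}"
  proof (intro equalityI subsetI)
    fix xs assume "xs \<in> T"
    then have xs: "length xs = r" and "\<exists>p q. p < q \<and> {p<..<q} \<subseteq> {t. xs @ [t] \<in> E}"
      by (auto simp: T_def subset_iff)
    then obtain p q where pq: "p < q" "{p<..<q} \<subseteq> {t. xs @ [t] \<in> E}" by blast
    then show "xs \<in> {xs \<in> Rn r. uncountable {t. xs @ [t] \<in> E}}"
      using xs uncountable_open_interval[of p q] countable_subset[OF pq(2)] by auto
  next
    fix xs assume "xs \<in> {xs \<in> Rn r. uncountable {t. xs @ [t] \<in> E}}"
    then show "xs \<in> T"
      using Df1_uncountable[OF Df_fibre[OF Suc.prems(1)], of xs] by (auto simp: T_def)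
  qed
  have "thin r T" using Suc.prems(2) T_eq by simp
  from Suc.IH[OF T1 this] obtain \<C> where \<C>: "countable \<C>" "T \<subseteq> \<Union>\<C>"
     "\<And>C. C \<in> \<C> \<Longrightarrow> C \<in> S r" "\<And>C. C \<in> \<C> \<Longrightarrow> \<exists>i<r. inj_on (dropi i) C" by blast
  \<comment> \<open>The part of \<open>E\<close> over a piece \<open>C\<close>: the coordinate
    determined on \<open>C\<close> stays determined, since the last entry is kept when it is
    dropped.\<close>
  define D where "D C = {ys \<in> Rn (Suc r). ys \<in> E \<and> take r ys \<in> C}" for C
  \<comment> \<open>Points alone in their fibre between \<open>p\<close> and \<open>q\<close>, so
    that the last entry is determined by the others.\<close>
  define G where "G p q = {ys \<in> Rn (Suc r). ys \<in> E \<and> p < ys ! r \<and> ys ! r < q \<and>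
     (\<forall>s. p < s \<and> s < q \<and> take r ys @ [s] \<in> E \<longrightarrow> s = ys ! r)}" for p q
  have D: "D C \<in> S (Suc r) \<and> (\<exists>i<Suc r. inj_on (dropi i) (D C))" if C: "C \<in> \<C>" for C
  proof
    show "D C \<in> S (Suc r)"
      unfolding D_def Df_def[symmetric]
      by (intro Df_conj Df_in Suc.prems(1) Df_take_Suc[OF Df_in[OF \<C>(3)[OF C]]])
    obtain i where i: "i < r" "inj_on (dropi i) C" using \<C>(4)[OF C] by blast
    have "inj_on (dropi i) (D C)"
    proof (rule inj_onI)
      fix ys zs assume a: "ys \<in> D C" "zs \<in> D C" "dropi i ys = dropi i zs"
      obtain y t where y: "ys = y @ [t]" "length y = r" using a(1) by (auto simp: D_def length_Suc_conv_rev)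
      obtain z s where z: "zs = z @ [s]" "length z = r" using a(2) by (auto simp: D_def length_Suc_conv_rev)
      have "dropi i y @ [t] = dropi i z @ [s]" using a(3) y z i by (simp add: dropi_def)
      then show "ys = zs" using inj_onD[OF i(2), of y z] a y z by (auto simp: D_def)
    qed
    then show "\<exists>i<Suc r. inj_on (dropi i) (D C)" using i(1) by (intro exI[of _ i]) simp
  qed
  have G: "G p q \<in> S (Suc r) \<and> (\<exists>i<Suc r. inj_on (dropi i) (G p q))" for p q
  proof
    have "Df (Suc (Suc r)) (\<lambda>zs. take r (take (Suc r) zs) @ [zs ! Suc r] \<in> E)"
      by (rule Df_imp_cong[OF Df_snoc[OF Suc.prems(1), of "Suc (Suc r)" "Suc r"]]) (simp_all add: min_def)
    moreover have "Df (Suc (Suc r)) (\<lambda>zs. zs ! Suc r = take (Suc r) zs ! r)"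
      by (rule Df_imp_cong[of _ "\<lambda>zs. zs ! Suc r = zs ! r"]) (simp_all add: Df_eq Fn_var)
    ultimately show "G p q \<in> S (Suc r)"
      unfolding G_def Df_def[symmetric]
      by (intro Df_conj Df_in Suc.prems(1) Df_all Df_imp Df_less Fn_const Fn_var) auto
    have "inj_on (dropi r) (G p q)"
    proof (rule inj_onI)
      fix ys zs assume a: "ys \<in> G p q" "zs \<in> G p q" "dropi r ys = dropi r zs"
      obtain y t where y: "ys = y @ [t]" "length y = r" using a(1) by (auto simp: G_def length_Suc_conv_rev)
      obtain z s where z: "zs = z @ [s]" "length z = r" using a(2) by (auto simp: G_def length_Suc_conv_rev)
      have "y = z" using a(3) y z by (simp add: dropi_def)
      then show "ys = zs" using a(1,2) y z by (auto simp: G_def nth_append)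
    qed
    then show "\<exists>i<Suc r. inj_on (dropi i) (G p q)" by auto
  qed
  let ?\<C> = "D ` \<C> \<union> (\<lambda>(p, q). G p q) ` (\<rat> \<times> \<rat>)"
  have "countable ?\<C>" using \<C>(1) countable_rat by (intro countable_Un countable_image countable_SIGMA) auto
  moreover have "E \<subseteq> \<Union>?\<C>"
  proof
    fix ys assume ys: "ys \<in> E"
    then have "length ys = Suc r" using dim[OF Suc.prems(1)] by auto
    then obtain xs t where xs: "ys = xs @ [t]" "length xs = r" by (auto simp: length_Suc_conv_rev)
    show "ys \<in> \<Union>?\<C>"
    proof (cases "xs \<in> T")
      case True
      then obtain C where "C \<in> \<C>" "xs \<in> C" using \<C>(2) by blast
      then have "ys \<in> D C" using ys xs by (simp add: D_def)
      then show ?thesis using \<open>C \<in> \<C>\<close> by blast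
    next
      case False
      then have "countable {s. xs @ [s] \<in> E}" using T_eq xs by auto
      then have fin: "finite {s. xs @ [s] \<in> E}" using Df1_countable[OF Df_fibre[OF Suc.prems(1) xs(2)]] by blast
      \<comment> \<open>Finiteness of the fibre isolates \<open>t\<close>; rational bounds within
        \<open>d\<close> of it then select \<open>t\<close> alone.\<close>
      obtain d where d: "d > 0" "\<And>s. s \<in> {s. xs @ [s] \<in> E} \<Longrightarrow> s \<noteq> t \<Longrightarrow> d \<le> dist t s"
        using finite_set_avoid[OF fin, of t] by blast
      obtain p where p: "p \<in> \<rat>" "t - d < p" "p < t" using Rats_dense_in_real[of "t - d" t] d by auto
      obtain q where q: "q \<in> \<rat>" "t < q" "q < t + d" using Rats_dense_in_real[of t "t + d"] d by auto
      have "ys \<in> G p q"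
        using ys xs p q d by (fastforce simp: G_def nth_append dist_real_def)
      then show ?thesis using p q by blast
    qed
  qed
  moreover have "\<forall>C\<in>?\<C>. C \<in> S (Suc r) \<and> (\<exists>i<Suc r. inj_on (dropi i) C)" using D G by auto
  ultimately show ?case by blast
qed

end

section \<open>Generic differentiability of definable functions\<close>

text \<open>Multiplying by \<open>h\<close> says for both signs of \<open>h\<close> that the
  difference quotient is at most \<open>q\<close>. Such local bounds chain together over the
  interval by the Bolzano subdivision principle.\<close>

lemma increment_le:
  fixes \<phi> :: "real \<Rightarrow> real"
  assumes "a \<le> b" and loc: "\<And>t. a \<le> t \<Longrightarrow> t \<le> b \<Longrightarrow>
    \<exists>e>0. \<forall>h. -e < h \<and> h < e \<longrightarrow> h * (\<phi> (t + h) - \<phi> t) \<le> q * (h * h)"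
  shows "\<phi> b - \<phi> a \<le> q * (b - a)"
  using assms(1)
proof (induction rule: Bolzano)
  case (trans a b c)
  then show ?case by (simp add: algebra_simps)
next
  case (local x)
  obtain e where e: "e > 0" "\<And>h. -e < h \<Longrightarrow> h < e \<Longrightarrow> h * (\<phi> (x + h) - \<phi> x) \<le> q * (h * h)"
    using loc[OF local] by blast
  have "\<phi> d - \<phi> c \<le> q * (d - c)" if c: "c \<le> x" and d: "x \<le> d" and cd: "d - c < e" for c d
  proof -
    have "\<phi> x - \<phi> c \<le> q * (x - c)"
    proof (cases "c = x")
      case False
      have "(c - x) * (\<phi> c - \<phi> x) \<le> q * ((c - x) * (c - x))"
        using e(2)[of "c - x"] c d cd by simp
      then have "(x - c) * (\<phi> x - \<phi> c) \<le> (x - c) * (q * (x - c))" by (simp add: algebra_simps)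
      then show ?thesis using c False by (simp add: mult_le_cancel_left)
    qed simp
    moreover have "\<phi> d - \<phi> x \<le> q * (d - x)"
    proof (cases "d = x")
      case False
      have "(d - x) * (\<phi> d - \<phi> x) \<le> q * ((d - x) * (d - x))"
        using e(2)[of "d - x"] c d cd by simp
      then have "(d - x) * (\<phi> d - \<phi> x) \<le> (d - x) * (q * (d - x))" by (simp add: algebra_simps)
      then show ?thesis using d False by (simp add: mult_le_cancel_left)
    qed simp
    ultimately show ?thesis by (simp add: algebra_simps)
  qed
  then show ?case using e(1) by blast
qed

lemma increment_ge:
  fixes \<phi> :: "real \<Rightarrow> real"
  assumes "a \<le> b" and loc: "\<And>t. a \<le> t \<Longrightarrow> t \<le> b \<Longrightarrow>
    \<exists>e>0. \<forall>h. -e < h \<and> h < e \<longrightarrow> q * (h * h) \<le> h * (\<phi> (t + h) - \<phi> t)"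
  shows "q * (b - a) \<le> \<phi> b - \<phi> a"
proof -
  have "- \<phi> b - (- \<phi> a) \<le> (- q) * (b - a)"
  proof (rule increment_le[OF assms(1)])
    fix t assume "a \<le> t" "t \<le> b"
    then obtain e where "e > 0" "\<forall>h. -e < h \<and> h < e \<longrightarrow> q * (h * h) \<le> h * (\<phi> (t + h) - \<phi> t)"
      using loc by blast
    then show "\<exists>e>0. \<forall>h. -e < h \<and> h < e \<longrightarrow> h * (- \<phi> (t + h) - - \<phi> t) \<le> - q * (h * h)"
      by (intro exI[of _ e]) (auto simp: algebra_simps)
  qed
  then show ?thesis by simp
qed

text \<open>Choose around each strict local minimum a rational interval on which it is the strict
  minimum; two of them with the same interval would each lie below the other.\<close>

lemma countable_strict_local_min:
  fixes \<psi> :: "real \<Rightarrow> real"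
  shows "countable {t. \<exists>e>0. \<forall>h. 0 < h \<and> h < e \<longrightarrow> \<psi> t < \<psi> (t + h) \<and> \<psi> t < \<psi> (t - h)}"
proof -
  let ?M = "{t. \<exists>e>0. \<forall>h. 0 < h \<and> h < e \<longrightarrow> \<psi> t < \<psi> (t + h) \<and> \<psi> t < \<psi> (t - h)}"
  have "\<forall>t\<in>?M. \<exists>z. fst z \<in> \<rat> \<and> snd z \<in> \<rat> \<and> fst z < t \<and> t < snd z \<and>
      (\<forall>s. fst z < s \<and> s < snd z \<and> s \<noteq> t \<longrightarrow> \<psi> t < \<psi> s)"
  proof
    fix t assume t: "t \<in> ?M"
    obtain e where e: "e > 0" "\<And>h. 0 < h \<Longrightarrow> h < e \<Longrightarrow> \<psi> t < \<psi> (t + h) \<and> \<psi> t < \<psi> (t - h)"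
      using t by blast
    obtain p where p: "p \<in> \<rat>" "t - e < p" "p < t" using Rats_dense_in_real[of "t - e" t] e by auto
    obtain q where q: "q \<in> \<rat>" "t < q" "q < t + e" using Rats_dense_in_real[of t "t + e"] e by auto
    have "\<psi> t < \<psi> s" if "p < s" "s < q" "s \<noteq> t" for s
    proof (cases "s < t")
      case True then show ?thesis using e(2)[of "t - s"] p q that by simp
    next
      case False then show ?thesis using e(2)[of "s - t"] p q that by simp
    qed
    then show "\<exists>z. fst z \<in> \<rat> \<and> snd z \<in> \<rat> \<and> fst z < t \<and> t < snd z \<and>
      (\<forall>s. fst z < s \<and> s < snd z \<and> s \<noteq> t \<longrightarrow> \<psi> t < \<psi> s)"
      using p q by (intro exI[of _ "(p, q)"]) simp
  qed
  from bchoice[OF this] obtain Z where Z: "\<And>t. t \<in> ?M \<Longrightarrow> fst (Z t) \<in> \<rat> \<and> snd (Z t) \<in> \<rat> \<and>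
      fst (Z t) < t \<and> t < snd (Z t) \<and> (\<forall>s. fst (Z t) < s \<and> s < snd (Z t) \<and> s \<noteq> t \<longrightarrow> \<psi> t < \<psi> s)"
    by blast
  have "inj_on Z ?M"
  proof (rule inj_onI, rule ccontr)
    fix s t assume s: "s \<in> ?M" "t \<in> ?M" "Z s = Z t" "s \<noteq> t"
    have "\<psi> t < \<psi> s" using Z[OF s(1)] Z[OF s(2)] s(3,4) by simp
    moreover have "\<psi> s < \<psi> t" using Z[OF s(1)] Z[OF s(2)] s(3,4) by simp
    ultimately show False by simp
  qed
  moreover have "countable (Z ` ?M)"
  proof (rule countable_subset)
    show "Z ` ?M \<subseteq> \<rat> \<times> \<rat>"
    proof
      fix z assume "z \<in> Z ` ?M"
      then obtain t where t: "t \<in> ?M" "z = Z t" by (elim imageE)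
      show "z \<in> \<rat> \<times> \<rat>" using Z[OF t(1)] t(2) by (simp add: mem_Times_iff)
    qed
    show "countable (\<rat> \<times> (\<rat> :: real set))" by (intro countable_SIGMA countable_rat)
  qed
  ultimately show ?thesis using countable_image_inj_on by blast
qed

text \<open>Squares instead of absolute values, so that the condition is visibly definable.\<close>

definition pdiff :: "(real \<Rightarrow> real) \<Rightarrow> real \<Rightarrow> bool" where
  "pdiff \<phi> t \<longleftrightarrow> (\<exists>D. \<forall>e. 0 < e \<longrightarrow> (\<exists>d. 0 < d \<and> (\<forall>h. -d < h \<and> h < d \<longrightarrow>
     (\<phi> (t + h) - \<phi> t - D * h) * (\<phi> (t + h) - \<phi> t - D * h) \<le> (e * e) * (h * h))))"

text \<open>If points of the interval come arbitrarily close to 0 from the right, convexity puts a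
  whole right neighbourhood of 0 inside it.\<close>

lemma interval_eventually_at_right:
  fixes I :: "real set"
  assumes "is_interval I"
  shows "(\<forall>\<^sub>F h in at_right 0. h \<in> I) \<or> (\<forall>\<^sub>F h in at_right 0. h \<notin> I)"
proof (cases "\<forall>b>0. \<exists>h\<in>I. 0 < h \<and> h < b")
  case True
  have "\<exists>h\<in>I. 0 < h \<and> h < (1::real)" using True by simp
  then obtain h1 where h1: "h1 \<in> I" "0 < h1" by blast
  have "h \<in> I" if "0 < h" "h < h1" for h
  proof -
    obtain h2 where "h2 \<in> I" "h2 < h" using True \<open>0 < h\<close> by blast
    then show ?thesis using assms h1 that unfolding is_interval_1 by (meson less_imp_le)
  qed
  then show ?thesis using h1 by (auto simp: eventually_at_right_field)
next
  case False
  then show ?thesis by (auto simp: eventually_at_right_field)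
qed

text \<open>
  \<open>R q\<close> and \<open>L q\<close> say that all difference quotients of small step to the right, respectively
  to the left, exceed \<open>q\<close>; \<open>R' q\<close> and \<open>L' q\<close> say that they are smaller than \<open>q\<close>.
\<close>

lemma pdiff_cases:
  fixes \<phi> :: "real \<Rightarrow> real" and t :: real
  defines "R \<equiv> \<lambda>q. \<forall>\<^sub>F h in at_right 0. q * h < \<phi> (t + h) - \<phi> t"
    and "R' \<equiv> \<lambda>q. \<forall>\<^sub>F h in at_right 0. \<phi> (t + h) - \<phi> t < q * h"
    and "L \<equiv> \<lambda>q. \<forall>\<^sub>F h in at_right 0. q * h < \<phi> t - \<phi> (t - h)"
    and "L' \<equiv> \<lambda>q. \<forall>\<^sub>F h in at_right 0. \<phi> t - \<phi> (t - h) < q * h"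
  assumes triR: "\<And>q. R q \<or> (\<forall>\<^sub>F h in at_right 0. \<not> q * h < \<phi> (t + h) - \<phi> t)"
    and triR': "\<And>q. R' q \<or> (\<forall>\<^sub>F h in at_right 0. \<not> \<phi> (t + h) - \<phi> t < q * h)"
    and triL: "\<And>q. L q \<or> (\<forall>\<^sub>F h in at_right 0. \<not> q * h < \<phi> t - \<phi> (t - h))"
    and triL': "\<And>q. L' q \<or> (\<forall>\<^sub>F h in at_right 0. \<not> \<phi> t - \<phi> (t - h) < q * h)"
    and nmin: "\<And>q. q \<in> \<rat> \<Longrightarrow> \<not> (R q \<and> L' q)" and nmax: "\<And>q. q \<in> \<rat> \<Longrightarrow> \<not> (R' q \<and> L q)"
  shows "pdiff \<phi> t \<or> (\<forall>q. R q \<and> L q) \<or> (\<forall>q. R' q \<and> L' q)"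
proof -
  have pos: "\<forall>\<^sub>F h in at_right 0. (0::real) < h" by (rule eventually_at_right_less)
  have lin: "\<forall>\<^sub>F h in at_right 0. p * h < q * h" if "p < q" for p q :: real
    using pos by eventually_elim (use that in simp)
  have NR: "R' q'" if "\<not> R q" "q < q'" for q q'
  proof -
    have "\<forall>\<^sub>F h in at_right 0. \<not> q * h < \<phi> (t + h) - \<phi> t" using triR that by blast
    with lin[OF that(2)] show ?thesis unfolding R'_def by eventually_elim simp
  qed
  have NL: "L' q'" if "\<not> L q" "q < q'" for q q'
  proof -
    have "\<forall>\<^sub>F h in at_right 0. \<not> q * h < \<phi> t - \<phi> (t - h)" using triL that by blast
    with lin[OF that(2)] show ?thesis unfolding L'_def by eventually_elim simp
  qed
  have NL': "L q'" if "\<not> L' q" "q' < q" for q q'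
  proof -
    have "\<forall>\<^sub>F h in at_right 0. \<not> \<phi> t - \<phi> (t - h) < q * h" using triL' that by blast
    with lin[OF that(2)] show ?thesis unfolding L_def by eventually_elim simp
  qed
  have monoR: "R q'" if "R q" "q' < q" for q q'
    using that(1) lin[OF that(2)] unfolding R_def by eventually_elim simp
  show ?thesis
  proof (cases "\<forall>q. R q")
    case True
    \<comment> \<open>The right derivative is infinite. A rational \<open>q'\<close> with
      \<open>L' q'\<close> would make \<open>t\<close> a strict local minimum of
      \<open>\<phi>\<close> minus the line of slope \<open>q'\<close>, which \<open>nmin\<close>
      excludes; so the left quotients are unbounded too.\<close>
    have "L q" for q
    proof -
      obtain q' where "q' \<in> \<rat>" "q < q'" using Rats_dense_in_real[of q "q + 1"] by auto
      then show ?thesis using NL' nmin True by blast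
    qed
    then show ?thesis using True by blast
  next
    case nall: False
    show ?thesis
    proof (cases "\<exists>q. R q")
      case False
      have R'all: "R' q" for q using NR[of "q - 1" q] False by auto
      have "L' q" for q
      proof -
        obtain q' where "q' \<in> \<rat>" "q' < q" using Rats_dense_in_real[of "q - 1" q] by auto
        then show ?thesis using NL nmax R'all by blast
      qed
      then show ?thesis using R'all by blast
    next
      case True
      then obtain q0 where q0: "R q0" by blast
      obtain q1 where q1: "\<not> R q1" using nall by blast
      let ?Q = "{q. R q}"
      have bdd: "bdd_above ?Q"
      proof (rule bdd_aboveI[of _ q1])
        fix q assume "q \<in> ?Q"
        then show "q \<le> q1" using monoR q1 by (metis mem_Collect_eq not_le)
      qed
      \<comment> \<open>The right derivative, as a cut. A left derivative different from it would
        leave a rational slope in between, and \<open>t\<close> would be a strict local extremum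
        after subtracting that slope.\<close>
      define D where "D = Sup ?Q"
      have Rlt: "R p" if pD: "p < D" for p
      proof -
        have "?Q \<noteq> {}" using q0 by blast
        then obtain q where "q \<in> ?Q" "p < q" using less_cSup_iff[of ?Q p] bdd pD[unfolded D_def] by blast
        then show ?thesis using monoR by blast
      qed
      have nRgt: "\<not> R q" if "D < q" for q
      proof
        assume "R q"
        then have "q \<le> D" unfolding D_def by (intro cSup_upper bdd) simp
        then show False using that by simp
      qed
      have R'gt: "R' q" if Dq: "D < q" for q
      proof -
        obtain q' where q': "D < q'" "q' < q" using dense[OF Dq] by blast
        show ?thesis using NR[of q' q] nRgt[of q'] q' by blast
      qed
      have Llt: "L p" if pD: "p < D" for p
      proof -
        obtain q where "q \<in> \<rat>" "p < q" "q < D" using Rats_dense_in_real[OF pD] by blast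
        then show ?thesis using NL'[of q p] nmin[of q] Rlt[of q] by blast
      qed
      have L'gt: "L' p" if pD: "D < p" for p
      proof -
        obtain q where "q \<in> \<rat>" "D < q" "q < p" using Rats_dense_in_real[OF pD] by blast
        then show ?thesis using NL[of q p] nmax[of q] R'gt[of q] by blast
      qed
      have "pdiff \<phi> t" unfolding pdiff_def
      proof (rule exI[of _ D], intro allI impI)
        fix e :: real assume e: "0 < e"
        have "R (D - e)" "R' (D + e)" "L (D - e)" "L' (D + e)"
          using e by (auto intro: Rlt R'gt Llt L'gt)
        then have "\<forall>\<^sub>F h in at_right 0. (D - e) * h < \<phi> (t + h) - \<phi> t \<and> \<phi> (t + h) - \<phi> t < (D + e) * h
           \<and> (D - e) * h < \<phi> t - \<phi> (t - h) \<and> \<phi> t - \<phi> (t - h) < (D + e) * h"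
          unfolding R_def R'_def L_def L'_def by (simp add: eventually_conj)
        then obtain d where d: "d > 0" "\<And>h. 0 < h \<Longrightarrow> h < d \<Longrightarrow> (D - e) * h < \<phi> (t + h) - \<phi> t \<and> \<phi> (t + h) - \<phi> t < (D + e) * h
           \<and> (D - e) * h < \<phi> t - \<phi> (t - h) \<and> \<phi> t - \<phi> (t - h) < (D + e) * h"
          unfolding eventually_at_right_field by blast
        show "\<exists>d. 0 < d \<and> (\<forall>h. -d < h \<and> h < d \<longrightarrow>
           (\<phi> (t + h) - \<phi> t - D * h) * (\<phi> (t + h) - \<phi> t - D * h) \<le> (e * e) * (h * h))"
        proof (intro exI[of _ d] conjI allI impI)
          fix h assume h: "- d < h \<and> h < d"
          have "\<bar>\<phi> (t + h) - \<phi> t - D * h\<bar> \<le> \<bar>e * h\<bar>"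
          proof -
            consider "h = 0" | "h > 0" | "h < 0" by linarith
            then show ?thesis
            proof cases
              case 2
              then show ?thesis using d(2)[of h] h e by (simp add: abs_mult algebra_simps abs_le_iff)
            next
              case 3
              then show ?thesis using d(2)[of "- h"] h e by (simp add: abs_mult algebra_simps abs_le_iff)
            qed simp
          qed
          then have "(\<phi> (t + h) - \<phi> t - D * h)\<^sup>2 \<le> (e * h)\<^sup>2" by (simp add: abs_le_square_iff)
          then show "(\<phi> (t + h) - \<phi> t - D * h) * (\<phi> (t + h) - \<phi> t - D * h) \<le> (e * e) * (h * h)"
            by (simp add: power2_eq_square algebra_simps)
        qed (rule d(1))
      qed
      then show ?thesis ..
    qed
  qed
qed

text \<open>Rebuilt over \<open>[0..<r]\<close>, so the result has length \<open>r\<close> for every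
  \<open>xs\<close> and its definability is an instance of substitution.\<close>

definition upd :: "nat \<Rightarrow> real list \<Rightarrow> nat \<Rightarrow> real \<Rightarrow> real list" where
  "upd r xs i t = map (\<lambda>j. if j = i then t else xs ! j) [0..<r]"

lemma length_upd [simp]: "length (upd r xs i t) = r"
  by (simp add: upd_def)

lemma nth_upd [simp]: "j < r \<Longrightarrow> upd r xs i t ! j = (if j = i then t else xs ! j)"
  by (simp add: upd_def)

lemma upd_upd [simp]: "upd r (upd r xs i s) i t = upd r xs i t"
  by (rule nth_equalityI) auto

lemma upd_same: "length xs = r \<Longrightarrow> upd r xs i (xs ! i) = xs"
  by (rule nth_equalityI) auto

text \<open>Total differentiability of a function of lists, with \<open>c\<close> as gradient and
  the sum of absolute values as norm.\<close>

definition ldiff :: "nat \<Rightarrow> (real list \<Rightarrow> real) \<Rightarrow> real list \<Rightarrow> bool" where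
  "ldiff r g xs \<longleftrightarrow> (\<exists>c. \<forall>e>0. \<exists>d>0. \<forall>ys\<in>cube r xs d.
     \<bar>g ys - g xs - (\<Sum>i<r. c i * (ys ! i - xs ! i))\<bar> \<le> e * (\<Sum>i<r. \<bar>ys ! i - xs ! i\<bar>))"

text \<open>Going from \<open>xs\<close> to \<open>ys\<close> one coordinate at a time, each
  increment is controlled by bounds on the one-variable difference quotients that hold throughout
  the cube. Such bounds near \<open>c i\<close> replace continuity of the partial
  derivatives.\<close>

lemma telescope_bound:
  fixes g :: "real list \<Rightarrow> real"
  assumes xs: "length xs = r" and ys: "ys \<in> cube r xs d"
    and U: "\<And>i zs. i < r \<Longrightarrow> zs \<in> cube r xs d \<Longrightarrow> \<exists>e>0. \<forall>h. -e < h \<and> h < e \<longrightarrow>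
        h * (g (upd r zs i (zs ! i + h)) - g zs) \<le> q i * (h * h)"
    and L: "\<And>i zs. i < r \<Longrightarrow> zs \<in> cube r xs d \<Longrightarrow> \<exists>e>0. \<forall>h. -e < h \<and> h < e \<longrightarrow>
        p i * (h * h) \<le> h * (g (upd r zs i (zs ! i + h)) - g zs)"
    and c: "\<And>i. i < r \<Longrightarrow> c i - e \<le> p i \<and> q i \<le> c i + e"
  shows "\<bar>g ys - g xs - (\<Sum>i<r. c i * (ys ! i - xs ! i))\<bar> \<le> e * (\<Sum>i<r. \<bar>ys ! i - xs ! i\<bar>)"
proof -
  have ly: "length ys = r" using ys by (simp add: cube_def)
  have yx: "\<bar>ys ! i - xs ! i\<bar> < d" if "i < r" for i using ys that by (simp add: cube_def)
  \<comment> \<open>The staircase from \<open>xs\<close> to \<open>ys\<close>: the first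
    \<open>k\<close> coordinates have already been changed.\<close>
  define w where "w k = take k ys @ drop k xs" for k
  have lw: "length (w k) = r" if "k \<le> r" for k using that xs ly by (simp add: w_def)
  have nw: "w k ! i = (if i < k then ys ! i else xs ! i)" if "k \<le> r" "i < r" for k i
    using that xs ly by (auto simp: w_def nth_append)
  have step: "\<bar>g (w (Suc k)) - g (w k) - c k * (ys ! k - xs ! k)\<bar> \<le> e * \<bar>ys ! k - xs ! k\<bar>" if k: "k < r" for k
  proof -
    define \<phi> where "\<phi> t = g (upd r (w k) k t)" for t
    have 0: "\<phi> (xs ! k) = g (w k)" unfolding \<phi>_def
      by (rule arg_cong[of _ _ g], rule nth_equalityI) (use k lw nw in auto)
    have 1: "\<phi> (ys ! k) = g (w (Suc k))" unfolding \<phi>_def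
      by (rule arg_cong[of _ _ g], rule nth_equalityI) (use k lw nw in auto)
    have inc: "upd r (w k) k t \<in> cube r xs d" if "\<bar>t - xs ! k\<bar> < d" for t
      using that k nw yx yx[of k] by (auto simp: cube_def)
    have locU: "\<exists>e>0. \<forall>h. -e < h \<and> h < e \<longrightarrow> h * (\<phi> (t + h) - \<phi> t) \<le> q k * (h * h)" if "\<bar>t - xs ! k\<bar> < d" for t
      using U[OF k inc[OF that]] k unfolding \<phi>_def by simp
    have locL: "\<exists>e>0. \<forall>h. -e < h \<and> h < e \<longrightarrow> p k * (h * h) \<le> h * (\<phi> (t + h) - \<phi> t)" if "\<bar>t - xs ! k\<bar> < d" for t
      using L[OF k inc[OF that]] k unfolding \<phi>_def by simp
    have main: "\<bar>\<phi> b - \<phi> a - c k * (b - a)\<bar> \<le> e * (b - a)"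
      if ab: "a \<le> b" "\<And>t. a \<le> t \<Longrightarrow> t \<le> b \<Longrightarrow> \<bar>t - xs ! k\<bar> < d" for a b
    proof -
      have "\<phi> b - \<phi> a \<le> q k * (b - a)" by (rule increment_le[OF ab(1) locU[OF ab(2)]])
      moreover have "p k * (b - a) \<le> \<phi> b - \<phi> a" by (rule increment_ge[OF ab(1) locL[OF ab(2)]])
      moreover have "q k * (b - a) \<le> (c k + e) * (b - a)" "(c k - e) * (b - a) \<le> p k * (b - a)"
        using c[OF k] ab(1) by (auto intro!: mult_right_mono)
      ultimately show ?thesis by (simp add: algebra_simps abs_le_iff)
    qed
    show ?thesis
    proof (cases "xs ! k \<le> ys ! k")
      case True
      have "\<bar>\<phi> (ys ! k) - \<phi> (xs ! k) - c k * (ys ! k - xs ! k)\<bar> \<le> e * (ys ! k - xs ! k)"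
        by (rule main[OF True]) (use yx[OF k] in auto)
      then show ?thesis using True 0 1 by simp
    next
      case False
      have "\<bar>\<phi> (xs ! k) - \<phi> (ys ! k) - c k * (xs ! k - ys ! k)\<bar> \<le> e * (xs ! k - ys ! k)"
        by (rule main) (use yx[OF k] False in auto)
      then show ?thesis using False 0 1 by (simp add: algebra_simps abs_le_iff)
    qed
  qed
  have "w 0 = xs" "w r = ys" using xs ly by (auto simp: w_def)
  then have "g ys - g xs = (\<Sum>k<r. g (w (Suc k)) - g (w k))"
    by (simp add: sum_lessThan_telescope[of "\<lambda>k. g (w k)"])
  then have "\<bar>g ys - g xs - (\<Sum>i<r. c i * (ys ! i - xs ! i))\<bar> =
      \<bar>\<Sum>k<r. g (w (Suc k)) - g (w k) - c k * (ys ! k - xs ! k)\<bar>"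
    by (simp add: sum_subtractf)
  also have "\<dots> \<le> (\<Sum>k<r. \<bar>g (w (Suc k)) - g (w k) - c k * (ys ! k - xs ! k)\<bar>)" by (rule sum_abs)
  also have "\<dots> \<le> (\<Sum>k<r. e * \<bar>ys ! k - xs ! k\<bar>)" using step by (intro sum_mono) auto
  finally show ?thesis by (simp add: sum_distrib_left)
qed

context o_minimal_structure
begin

text \<open>A finite union of intervals either contains or misses a right neighbourhood of 0.
  Applied to difference quotients this takes the place of the monotonicity theorem.\<close>

lemma Df_eventually:
  assumes "Df 1 (\<lambda>ys. P (ys ! 0))"
  shows "(\<forall>\<^sub>F h in at_right 0. P h) \<or> (\<forall>\<^sub>F h in at_right 0. \<not> P h)"
proof -
  obtain F where F: "finite F" "\<And>I. I \<in> F \<Longrightarrow> is_interval I" "{t. P t} = \<Union>F"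
    using Df1_intervals[OF assms] by blast
  have P: "P t \<longleftrightarrow> (\<exists>I\<in>F. t \<in> I)" for t using F(3) by blast
  show ?thesis
  proof (cases "\<exists>I\<in>F. \<forall>\<^sub>F h in at_right 0. h \<in> I")
    case True
    then obtain I where "I \<in> F" "\<forall>\<^sub>F h in at_right 0. h \<in> I" by blast
    then have "\<forall>\<^sub>F h in at_right 0. P h" by (auto simp: P elim!: eventually_mono)
    then show ?thesis ..
  next
    case False
    then have "\<forall>I\<in>F. \<forall>\<^sub>F h in at_right 0. h \<notin> I" using interval_eventually_at_right F(2) by blast
    then have "\<forall>\<^sub>F h in at_right 0. \<forall>I\<in>F. h \<notin> I" using F(1) by (intro eventually_ball_finite) auto
    then show ?thesis by (simp add: P)
  qed
qed

lemma Fn1: "Fn 1 (\<lambda>ys. \<phi> (ys ! 0)) \<Longrightarrow> Fn m a \<Longrightarrow> Fn m (\<lambda>xs. \<phi> (a xs))"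
  using Fn_subst[of 1 "\<lambda>ys. \<phi> (ys ! 0)" m "\<lambda>j. a"] by simp

text \<open>The set is definable, so if it were uncountable it would contain an interval. There all
  difference quotients exceed every prescribed slope locally, hence also globally, which is absurd
  for a slope above the mean slope.\<close>

lemma countable_infinite_derivative:
  assumes \<phi>: "Fn 1 (\<lambda>ys. \<phi> (ys ! 0))"
  shows "countable {t. \<forall>q. (\<forall>\<^sub>F h in at_right 0. q * h < \<phi> (t + h) - \<phi> t) \<and>
     (\<forall>\<^sub>F h in at_right 0. q * h < \<phi> t - \<phi> (t - h))}"
proof -
  define P where "P t \<longleftrightarrow> (\<forall>q. \<exists>b. 0 < b \<and> (\<forall>h. 0 < h \<and> h < b \<longrightarrow> q * h < \<phi> (t + h) - \<phi> t \<and> q * h < \<phi> t - \<phi> (t - h)))" for t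
  have eq: "(\<forall>q. (\<forall>\<^sub>F h in at_right 0. q * h < \<phi> (t + h) - \<phi> t) \<and>
     (\<forall>\<^sub>F h in at_right 0. q * h < \<phi> t - \<phi> (t - h))) \<longleftrightarrow> P t" for t
    unfolding P_def eventually_conj_iff[symmetric] unfolding eventually_at_right_field by (simp only: imp_conjL)
  have "Df 1 (\<lambda>ys. P (ys ! 0))"
    unfolding P_def
    by (intro Df_ex Df_all Df_imp Df_conj; simp; intro Df_less Fn_mult Fn_diff Fn_add Fn1[OF \<phi>] Fn_const Fn_var; simp)
  moreover have "\<not> (\<exists>p q. p < q \<and> (\<forall>t. p < t \<and> t < q \<longrightarrow> P t))"
  proof
    assume "\<exists>p q. p < q \<and> (\<forall>t. p < t \<and> t < q \<longrightarrow> P t)"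
    then obtain p q where pq: "p < q" "\<And>t. p < t \<Longrightarrow> t < q \<Longrightarrow> P t" by blast
    obtain a where a: "p < a" "a < q" using dense pq(1) by blast
    obtain b where b: "a < b" "b < q" using dense a(2) by blast
    \<comment> \<open>The mean slope between \<open>a\<close> and \<open>b\<close>, plus 1.\<close>
    define s where "s = (\<phi> b - \<phi> a) / (b - a) + 1"
    have "s * (b - a) \<le> \<phi> b - \<phi> a"
    proof (rule increment_ge)
      fix t assume "a \<le> t" "t \<le> b"
      then have "P t" using pq(2) a b by auto
      then obtain d where d: "d > 0" "\<And>h. 0 < h \<Longrightarrow> h < d \<Longrightarrow> s * h < \<phi> (t + h) - \<phi> t \<and> s * h < \<phi> t - \<phi> (t - h)"
        unfolding P_def by blast
      show "\<exists>e>0. \<forall>h. -e < h \<and> h < e \<longrightarrow> s * (h * h) \<le> h * (\<phi> (t + h) - \<phi> t)"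
      proof (intro exI[of _ d] conjI allI impI)
        fix h assume h: "- d < h \<and> h < d"
        consider "h = 0" | "h > 0" | "h < 0" by linarith
        then show "s * (h * h) \<le> h * (\<phi> (t + h) - \<phi> t)"
        proof cases
          case 2
          then have "h * (s * h) \<le> h * (\<phi> (t + h) - \<phi> t)" using d(2)[of h] h by (intro mult_left_mono) auto
          then show ?thesis by (simp add: mult.left_commute)
        next
          case 3
          then have "(- h) * (s * (- h)) \<le> (- h) * (\<phi> t - \<phi> (t + h))"
            using d(2)[of "- h"] h by (intro mult_left_mono) auto
          then show ?thesis by (simp add: algebra_simps)
        qed simp
      qed (rule d(1))
    qed (use b in simp)
    moreover have "s * (b - a) = \<phi> b - \<phi> a + (b - a)" using b by (simp add: s_def distrib_right)
    ultimately show False using b by linarith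
  qed
  ultimately have "countable {t. P t}" using Df1_uncountable by blast
  then show ?thesis unfolding eq .
qed

text \<open>By \<open>pdiff_cases\<close> a point of nondifferentiability is a strict local extremum
  of \<open>\<phi>\<close> minus a line of rational slope, or a point with two-sided infinite
  derivative; each kind is countable.\<close>

lemma countable_not_pdiff:
  assumes \<phi>: "Fn 1 (\<lambda>ys. \<phi> (ys ! 0))"
  shows "countable {t. \<not> pdiff \<phi> t}"
proof -
  let ?R = "\<lambda>t q. \<forall>\<^sub>F h in at_right 0. q * h < \<phi> (t + h) - \<phi> t"
  let ?R' = "\<lambda>t q. \<forall>\<^sub>F h in at_right 0. \<phi> (t + h) - \<phi> t < q * h"
  let ?L = "\<lambda>t q. \<forall>\<^sub>F h in at_right 0. q * h < \<phi> t - \<phi> (t - h)"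
  let ?L' = "\<lambda>t q. \<forall>\<^sub>F h in at_right 0. \<phi> t - \<phi> (t - h) < q * h"
  let ?A = "\<Union>q\<in>\<rat>. {t. ?R t q \<and> ?L' t q}" and ?B = "\<Union>q\<in>\<rat>. {t. ?R' t q \<and> ?L t q}"
  let ?P = "{t. \<forall>q. ?R t q \<and> ?L t q}" and ?M = "{t. \<forall>q. ?R' t q \<and> ?L' t q}"
  have "countable ?A"
  proof (intro countable_UN countable_rat)
    fix q :: real
    have "{t. ?R t q \<and> ?L' t q} \<subseteq> {t. \<exists>e>0. \<forall>h. 0 < h \<and> h < e \<longrightarrow>
      \<phi> t - q * t < \<phi> (t + h) - q * (t + h) \<and> \<phi> t - q * t < \<phi> (t - h) - q * (t - h)}"
      unfolding eventually_conj_iff[symmetric] unfolding eventually_at_right_field by (auto simp: algebra_simps)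
    then show "countable {t. ?R t q \<and> ?L' t q}"
      using countable_strict_local_min[of "\<lambda>t. \<phi> t - q * t"] by (rule countable_subset)
  qed
  moreover have "countable ?B"
  proof (intro countable_UN countable_rat)
    fix q :: real
    have "{t. ?R' t q \<and> ?L t q} \<subseteq> {t. \<exists>e>0. \<forall>h. 0 < h \<and> h < e \<longrightarrow>
      q * t - \<phi> t < q * (t + h) - \<phi> (t + h) \<and> q * t - \<phi> t < q * (t - h) - \<phi> (t - h)}"
      unfolding eventually_conj_iff[symmetric] unfolding eventually_at_right_field by (auto simp: algebra_simps)
    then show "countable {t. ?R' t q \<and> ?L t q}"
      using countable_strict_local_min[of "\<lambda>t. q * t - \<phi> t"] by (rule countable_subset)
  qed
  moreover have "countable ?P" by (rule countable_infinite_derivative[OF \<phi>])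
  moreover have "countable ?M"
  proof -
    have "?M \<subseteq> {t. \<forall>q. (\<forall>\<^sub>F h in at_right 0. q * h < (- \<phi> (t + h)) - (- \<phi> t)) \<and>
       (\<forall>\<^sub>F h in at_right 0. q * h < (- \<phi> t) - (- \<phi> (t - h)))}"
    proof (clarify, intro conjI)
      fix t q assume *: "\<forall>q. ?R' t q \<and> ?L' t q"
      have r: "?R' t (- q)" and l: "?L' t (- q)" using * by blast+
      show "\<forall>\<^sub>F h in at_right 0. q * h < (- \<phi> (t + h)) - (- \<phi> t)"
        by (rule eventually_mono[OF r]) simp
      show "\<forall>\<^sub>F h in at_right 0. q * h < (- \<phi> t) - (- \<phi> (t - h))"
        by (rule eventually_mono[OF l]) simp
    qed
    then show ?thesis
      using countable_infinite_derivative[of "\<lambda>t. - \<phi> t", OF Fn_uminus[OF \<phi>]] by (rule countable_subset)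
  qed
  moreover have "{t. \<not> pdiff \<phi> t} \<subseteq> ?A \<union> ?B \<union> ?P \<union> ?M"
  proof
    fix t assume t: "t \<in> {t. \<not> pdiff \<phi> t}"
    show "t \<in> ?A \<union> ?B \<union> ?P \<union> ?M"
    proof (rule ccontr)
      assume n: "t \<notin> ?A \<union> ?B \<union> ?P \<union> ?M"
      have "pdiff \<phi> t \<or> (\<forall>q. ?R t q \<and> ?L t q) \<or> (\<forall>q. ?R' t q \<and> ?L' t q)"
      proof (rule pdiff_cases)
        fix q :: real
        show "?R t q \<or> (\<forall>\<^sub>F h in at_right 0. \<not> q * h < \<phi> (t + h) - \<phi> t)"
          by (rule Df_eventually) (intro Df_less Fn_mult Fn_diff Fn_add Fn1[OF \<phi>] Fn_const Fn_var; simp)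
        show "?R' t q \<or> (\<forall>\<^sub>F h in at_right 0. \<not> \<phi> (t + h) - \<phi> t < q * h)"
          by (rule Df_eventually) (intro Df_less Fn_mult Fn_diff Fn_add Fn1[OF \<phi>] Fn_const Fn_var; simp)
        show "?L t q \<or> (\<forall>\<^sub>F h in at_right 0. \<not> q * h < \<phi> t - \<phi> (t - h))"
          by (rule Df_eventually) (intro Df_less Fn_mult Fn_diff Fn_add Fn1[OF \<phi>] Fn_const Fn_var; simp)
        show "?L' t q \<or> (\<forall>\<^sub>F h in at_right 0. \<not> \<phi> t - \<phi> (t - h) < q * h)"
          by (rule Df_eventually) (intro Df_less Fn_mult Fn_diff Fn_add Fn1[OF \<phi>] Fn_const Fn_var; simp)
      qed (use n in blast)+
      then show False using n t by blast
    qed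
  qed
  ultimately show ?thesis by (meson countable_Un countable_subset)
qed

lemma Fn_upd:
  assumes g: "Fn r g" and "r \<le> m" and t: "Fn m t"
  shows "Fn m (\<lambda>zs. g (upd r (take r zs) i (t zs)))"
proof -
  have "Fn m (\<lambda>zs. g (map (\<lambda>j. (if j = i then t else (\<lambda>zs. zs ! j)) zs) [0..<r]))"
    using assms by (intro Fn_subst[OF g]) (auto intro: Fn_var)
  then show ?thesis
  proof (rule Fn_imp_cong)
    fix zs :: "real list"
    have "upd r (take r zs) i (t zs) = map (\<lambda>j. (if j = i then t else (\<lambda>zs. zs ! j)) zs) [0..<r]"
      by (rule nth_equalityI) auto
    then show "g (upd r (take r zs) i (t zs)) = g (map (\<lambda>j. (if j = i then t else (\<lambda>zs. zs ! j)) zs) [0..<r])" by simp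
  qed
qed

text \<open>Besides the points without partial derivatives, the noninterior points of all sets where
  a rational number bounds the difference quotients are discarded. At a remaining point, rational
  bounds close to the partial derivatives hold on a whole cube, and \<open>telescope_bound\<close>
  applies.\<close>

lemma generic_ldiff:
  assumes g: "Fn r g"
  shows "\<exists>\<E>. countable \<E> \<and> (\<forall>E\<in>\<E>. E \<in> S r \<and> thin r E) \<and> (\<forall>xs\<in>Rn r - \<Union>\<E>. ldiff r g xs)"
proof -
  define E where "E i = {xs \<in> Rn r. \<not> pdiff (\<lambda>t. g (upd r xs i t)) (xs ! i)}" for i
  \<comment> \<open>Writing \<open>xs\<close> as \<open>upd r xs i (xs ! i)\<close> gives both
    values of \<open>g\<close> the same shape for the definability rules.\<close>
  define U where "U i q = {xs \<in> Rn r. \<exists>e. 0 < e \<and> (\<forall>h. -e < h \<and> h < e \<longrightarrow>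
      h * (g (upd r xs i (xs ! i + h)) - g (upd r xs i (xs ! i))) \<le> q * (h * h))}" for i q
  define L where "L i q = {xs \<in> Rn r. \<exists>e. 0 < e \<and> (\<forall>h. -e < h \<and> h < e \<longrightarrow>
      q * (h * h) \<le> h * (g (upd r xs i (xs ! i + h)) - g (upd r xs i (xs ! i))))}" for i q
  have ES: "E i \<in> S r" if i: "i < r" for i
  proof -
    have "Df r (\<lambda>xs. \<not> pdiff (\<lambda>t. g (upd r xs i t)) (xs ! i))"
      unfolding pdiff_def
      using i by (intro Df_not Df_ex Df_all Df_imp Df_conj; simp add: min_def;
        intro Df_less Df_le Fn_mult Fn_diff Fn_add Fn_upd[OF g] Fn_uminus Fn_const Fn_var; simp)
    then show ?thesis by (simp add: E_def Df_def)
  qed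
  have US: "U i q \<in> S r" if i: "i < r" for i q
  proof -
    have "Df r (\<lambda>xs. \<exists>e. 0 < e \<and> (\<forall>h. -e < h \<and> h < e \<longrightarrow>
      h * (g (upd r xs i (xs ! i + h)) - g (upd r xs i (xs ! i))) \<le> q * (h * h)))"
      using i by (intro Df_not Df_ex Df_all Df_imp Df_conj; simp add: min_def;
        intro Df_less Df_le Fn_mult Fn_diff Fn_add Fn_upd[OF g] Fn_uminus Fn_const Fn_var; simp)
    then show ?thesis by (simp add: U_def Df_def)
  qed
  have LS: "L i q \<in> S r" if i: "i < r" for i q
  proof -
    have "Df r (\<lambda>xs. \<exists>e. 0 < e \<and> (\<forall>h. -e < h \<and> h < e \<longrightarrow>
      q * (h * h) \<le> h * (g (upd r xs i (xs ! i + h)) - g (upd r xs i (xs ! i)))))"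
      using i by (intro Df_not Df_ex Df_all Df_imp Df_conj; simp add: min_def;
        intro Df_less Df_le Fn_mult Fn_diff Fn_add Fn_upd[OF g] Fn_uminus Fn_const Fn_var; simp)
    then show ?thesis by (simp add: L_def Df_def)
  qed
  \<comment> \<open>A cube in \<open>E i\<close> would contain a segment along axis \<open>i\<close>
    of uncountably many points of nondifferentiability of one definable function of one
    variable.\<close>
  have Ethin: "thin r (E i)" if i: "i < r" for i
  proof (rule ccontr)
    assume "\<not> thin r (E i)"
    then obtain a d where a: "length a = r" "d > 0" "cube r a d \<subseteq> E i"
      using thin_or_cube[OF ES[OF i]] by blast
    have "Fn 1 (\<lambda>ys. g (map (\<lambda>j. (if j = i then (\<lambda>ys. ys ! 0) else (\<lambda>ys. a ! j)) ys) [0..<r]))"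
      by (intro Fn_subst[OF g]) (auto intro: Fn_var Fn_const)
    moreover have "map (\<lambda>j. (if j = i then (\<lambda>ys. ys ! 0) else (\<lambda>ys. a ! j)) ys) [0..<r] = upd r a i (ys ! 0)" for ys
      by (rule nth_equalityI) auto
    ultimately have "Fn 1 (\<lambda>ys. g (upd r a i (ys ! 0)))" by simp
    then have "countable {t. \<not> pdiff (\<lambda>t. g (upd r a i t)) t}" by (rule countable_not_pdiff)
    moreover have "{a ! i - d<..<a ! i + d} \<subseteq> {t. \<not> pdiff (\<lambda>t. g (upd r a i t)) t}"
    proof
      fix t assume "t \<in> {a ! i - d<..<a ! i + d}"
      then have "upd r a i t \<in> cube r a d" using a(1,2) by (auto simp: cube_def)
      then have "upd r a i t \<in> E i" using a(3) by blast
      then show "t \<in> {t. \<not> pdiff (\<lambda>t. g (upd r a i t)) t}" using i by (simp add: E_def)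
    qed
    ultimately have "countable {a ! i - d<..<a ! i + d}" by (rule countable_subset[rotated])
    then show False using uncountable_open_interval[of "a ! i - d" "a ! i + d"] a(2) by simp
  qed
  define \<E> where "\<E> = E ` {..<r} \<union> (\<lambda>(i, q). U i q - interior_list r (U i q)) ` ({..<r} \<times> \<rat>)
     \<union> (\<lambda>(i, q). L i q - interior_list r (L i q)) ` ({..<r} \<times> \<rat>)"
  have "countable \<E>"
    unfolding \<E>_def by (intro countable_Un countable_image countable_SIGMA countable_rat countable_finite) auto
  moreover have "\<forall>E\<in>\<E>. E \<in> S r \<and> thin r E"
    unfolding \<E>_def using ES Ethin thin_diff_interior US LS by auto
  moreover have "\<forall>xs\<in>Rn r - \<Union>\<E>. ldiff r g xs"
  proof
    fix xs assume xs: "xs \<in> Rn r - \<Union>\<E>"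
    have l: "length xs = r" using xs by simp
    have "pdiff (\<lambda>t. g (upd r xs i t)) (xs ! i)" if "i < r" for i
      using xs that unfolding \<E>_def E_def by auto
    then have "\<forall>i\<in>{..<r}. \<exists>D. \<forall>e. 0 < e \<longrightarrow> (\<exists>d. 0 < d \<and> (\<forall>h. -d < h \<and> h < d \<longrightarrow>
     (g (upd r xs i (xs ! i + h)) - g (upd r xs i (xs ! i)) - D * h) * (g (upd r xs i (xs ! i + h)) - g (upd r xs i (xs ! i)) - D * h) \<le> (e * e) * (h * h)))"
      unfolding pdiff_def by simp
    from bchoice[OF this] obtain c where c: "\<And>i e. i < r \<Longrightarrow> 0 < e \<Longrightarrow> \<exists>d. 0 < d \<and> (\<forall>h. -d < h \<and> h < d \<longrightarrow>
     (g (upd r xs i (xs ! i + h)) - g (upd r xs i (xs ! i)) - c i * h) * (g (upd r xs i (xs ! i + h)) - g (upd r xs i (xs ! i)) - c i * h) \<le> (e * e) * (h * h))"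
      by auto
    have bound: "\<exists>d. 0 < d \<and> (\<forall>h. -d < h \<and> h < d \<longrightarrow>
       (c i - e) * (h * h) \<le> h * (g (upd r xs i (xs ! i + h)) - g (upd r xs i (xs ! i))) \<and>
       h * (g (upd r xs i (xs ! i + h)) - g (upd r xs i (xs ! i))) \<le> (c i + e) * (h * h))" if i: "i < r" "0 < e" for i e
    proof -
      obtain d where d: "d > 0" "\<And>h. -d < h \<Longrightarrow> h < d \<Longrightarrow>
        (g (upd r xs i (xs ! i + h)) - g (upd r xs i (xs ! i)) - c i * h) * (g (upd r xs i (xs ! i + h)) - g (upd r xs i (xs ! i)) - c i * h) \<le> (e * e) * (h * h)"
        using c[OF i] by blast
      show ?thesis
      proof (intro exI[of _ d] conjI allI impI)
        fix h assume h: "- d < h \<and> h < d"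
        let ?X = "g (upd r xs i (xs ! i + h)) - g (upd r xs i (xs ! i)) - c i * h"
        have "?X\<^sup>2 \<le> (e * h)\<^sup>2" using d(2)[of h] h by (simp add: power2_eq_square algebra_simps)
        then have "\<bar>?X\<bar> \<le> \<bar>e * h\<bar>" by (simp add: abs_le_square_iff)
        then have "\<bar>h\<bar> * \<bar>?X\<bar> \<le> \<bar>h\<bar> * \<bar>e * h\<bar>" by (rule mult_left_mono) simp
        moreover have "\<bar>h * ?X\<bar> = \<bar>h\<bar> * \<bar>?X\<bar>" by (rule abs_mult)
        moreover have "\<bar>h\<bar> * \<bar>e * h\<bar> = e * (h * h)" using i(2) by (simp add: abs_mult)
        ultimately have "\<bar>h * ?X\<bar> \<le> e * (h * h)" by simp
        then show "(c i - e) * (h * h) \<le> h * (g (upd r xs i (xs ! i + h)) - g (upd r xs i (xs ! i)))"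
          "h * (g (upd r xs i (xs ! i + h)) - g (upd r xs i (xs ! i))) \<le> (c i + e) * (h * h)"
          by (auto simp: abs_le_iff algebra_simps)
      qed (rule d(1))
    qed
    show "ldiff r g xs"
      unfolding ldiff_def
    proof (intro exI[of _ c] allI impI)
      fix e :: real assume e: "e > 0"
      have "\<exists>p q d. c i - e \<le> p \<and> q \<le> c i + e \<and> 0 < d \<and> cube r xs d \<subseteq> U i q \<and> cube r xs d \<subseteq> L i p" if i: "i < r" for i
      proof -
        \<comment> \<open>Strict inequality around \<open>c i\<close> turns differentiability at
          \<open>xs\<close> into membership in \<open>U i q\<close> and \<open>L i p\<close>;
          discarding noninterior points spreads both to a cube.\<close>
        obtain q where q: "q \<in> \<rat>" "c i < q" "q < c i + e" using Rats_dense_in_real[of "c i" "c i + e"] e by auto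
        obtain p where p: "p \<in> \<rat>" "c i - e < p" "p < c i" using Rats_dense_in_real[of "c i - e" "c i"] e by auto
        have "xs \<in> U i q" using bound[OF i, of "q - c i"] q l by (auto simp: U_def)
        then have "xs \<in> interior_list r (U i q)" using xs i q by (auto simp: \<E>_def)
        then obtain d1 where d1: "d1 > 0" "cube r xs d1 \<subseteq> U i q" by (auto simp: interior_list_def)
        have "xs \<in> L i p" using bound[OF i, of "c i - p"] p l by (auto simp: L_def)
        then have "xs \<in> interior_list r (L i p)" using xs i p by (auto simp: \<E>_def)
        then obtain d2 where d2: "d2 > 0" "cube r xs d2 \<subseteq> L i p" by (auto simp: interior_list_def)
        have "cube r xs (min d1 d2) \<subseteq> cube r xs d1" "cube r xs (min d1 d2) \<subseteq> cube r xs d2"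
          by (auto simp: cube_def)
        then show ?thesis using p q d1 d2
          by (intro exI[of _ p] exI[of _ q] exI[of _ "min d1 d2"]) auto
      qed
      then have "\<forall>i\<in>{..<r}. \<exists>p q d. c i - e \<le> p \<and> q \<le> c i + e \<and> 0 < d \<and> cube r xs d \<subseteq> U i q \<and> cube r xs d \<subseteq> L i p" by blast
      then obtain p q d where pqd: "\<And>i. i < r \<Longrightarrow> c i - e \<le> p i \<and> q i \<le> c i + e \<and> 0 < d i \<and> cube r xs (d i) \<subseteq> U i (q i) \<and> cube r xs (d i) \<subseteq> L i (p i)"
        by (metis lessThan_iff)
      define \<delta> where "\<delta> = Min (insert 1 (d ` {..<r}))"
      have \<delta>: "\<delta> > 0" "\<And>i. i < r \<Longrightarrow> \<delta> \<le> d i" using pqd by (auto simp: \<delta>_def)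
      have sub: "cube r xs \<delta> \<subseteq> cube r xs (d i)" if "i < r" for i
        using \<delta>(2)[OF that] by (force simp: cube_def)
      have "\<bar>g ys - g xs - (\<Sum>i<r. c i * (ys ! i - xs ! i))\<bar> \<le> e * (\<Sum>i<r. \<bar>ys ! i - xs ! i\<bar>)" if ys: "ys \<in> cube r xs \<delta>" for ys
      proof (rule telescope_bound[OF l ys])
        fix i zs assume i: "i < r" and zs: "zs \<in> cube r xs \<delta>"
        have lz: "length zs = r" using zs by (simp add: cube_def)
        have "zs \<in> U i (q i)" "zs \<in> L i (p i)" using sub[OF i] pqd[OF i] zs by blast+
        then show "\<exists>e>0. \<forall>h. -e < h \<and> h < e \<longrightarrow> h * (g (upd r zs i (zs ! i + h)) - g zs) \<le> q i * (h * h)"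
          "\<exists>e>0. \<forall>h. -e < h \<and> h < e \<longrightarrow> p i * (h * h) \<le> h * (g (upd r zs i (zs ! i + h)) - g zs)"
          using upd_same[OF lz] by (auto simp: U_def L_def)
      qed (use pqd in blast)
      then show "\<exists>d>0. \<forall>ys\<in>cube r xs d. \<bar>g ys - g xs - (\<Sum>i<r. c i * (ys ! i - xs ! i))\<bar> \<le> e * (\<Sum>i<r. \<bar>ys ! i - xs ! i\<bar>)"
        using \<delta>(1) by blast
    qed
  qed
  ultimately show ?thesis by blast
qed

end

section \<open>The bad part of the graph is small: o-minimal structures\<close>

lemma ldiff_imp_pointwise_lipschitz:
  assumes "ldiff r g xs"
  shows "\<exists>d>0. \<exists>B\<ge>0. \<forall>ys\<in>cube r xs d. \<bar>g ys - g xs\<bar> \<le> B * (\<Sum>i<r. \<bar>ys ! i - xs ! i\<bar>)"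
proof -
  obtain c where c: "\<And>e. e > 0 \<Longrightarrow> \<exists>d>0. \<forall>ys\<in>cube r xs d.
     \<bar>g ys - g xs - (\<Sum>i<r. c i * (ys ! i - xs ! i))\<bar> \<le> e * (\<Sum>i<r. \<bar>ys ! i - xs ! i\<bar>)"
    using assms unfolding ldiff_def by blast
  obtain d where d: "d > 0" "\<And>ys. ys \<in> cube r xs d \<Longrightarrow>
     \<bar>g ys - g xs - (\<Sum>i<r. c i * (ys ! i - xs ! i))\<bar> \<le> 1 * (\<Sum>i<r. \<bar>ys ! i - xs ! i\<bar>)"
    using c[of 1] by auto
  define B where "B = (\<Sum>i<r. \<bar>c i\<bar>) + 1"
  have B: "B \<ge> 0" by (simp add: B_def sum_nonneg)
  have "\<bar>g ys - g xs\<bar> \<le> B * (\<Sum>i<r. \<bar>ys ! i - xs ! i\<bar>)" if ys: "ys \<in> cube r xs d" for ys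
  proof -
    let ?s = "\<Sum>i<r. \<bar>ys ! i - xs ! i\<bar>"
    have "\<bar>\<Sum>i<r. c i * (ys ! i - xs ! i)\<bar> \<le> (\<Sum>i<r. \<bar>c i * (ys ! i - xs ! i)\<bar>)" by (rule sum_abs)
    also have "\<dots> \<le> (\<Sum>i<r. \<bar>c i\<bar> * ?s)"
    proof (rule sum_mono)
      fix i assume "i \<in> {..<r}"
      then have "\<bar>ys ! i - xs ! i\<bar> \<le> ?s" by (intro member_le_sum) auto
      then show "\<bar>c i * (ys ! i - xs ! i)\<bar> \<le> \<bar>c i\<bar> * ?s" by (simp add: abs_mult mult_left_mono)
    qed
    also have "\<dots> = (\<Sum>i<r. \<bar>c i\<bar>) * ?s" by (simp add: sum_distrib_right)
    finally have "\<bar>\<Sum>i<r. c i * (ys ! i - xs ! i)\<bar> \<le> (\<Sum>i<r. \<bar>c i\<bar>) * ?s" .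
    moreover have "B * ?s = (\<Sum>i<r. \<bar>c i\<bar>) * ?s + ?s" by (simp add: B_def distrib_right)
    ultimately show ?thesis using d(2)[OF ys] by linarith
  qed
  then show ?thesis using d(1) B by blast
qed

text \<open>The first \<open>n\<close> functions give the source point, the next \<open>n\<close>
  the target point; ranks start at 1 and functions at 0.\<close>

definition pt :: "(nat \<Rightarrow> 'a \<Rightarrow> real) \<Rightarrow> 'a \<Rightarrow> (real ^ 'n::{finite, linorder}) \<times> (real ^ 'n::_)" where
  "pt \<theta> xs = ((\<chi> i. \<theta> (rk i - 1) xs), (\<chi> i. \<theta> (CARD('n) + (rk i - 1)) xs))"

lemma norm_pt_diff_le:
  "norm (pt \<theta> xs - pt \<theta> ys :: (real ^ 'n::{finite, linorder}) \<times> (real ^ 'n::_)) \<le>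
    (\<Sum>j<2 * CARD('n). \<bar>\<theta> j xs - \<theta> j ys\<bar>)"
proof -
  let ?n = "CARD('n)" and ?a = "\<lambda>j. \<bar>\<theta> j xs - \<theta> j ys\<bar>"
  let ?d = "pt \<theta> xs - pt \<theta> ys :: (real ^ 'n::_) \<times> (real ^ 'n::_)"
  have "norm ?d \<le> norm (fst ?d) + norm (snd ?d)"
    using norm_Pair_le[of "fst ?d" "snd ?d"] by (simp only: prod.collapse)
  moreover have "norm (fst ?d) \<le> (\<Sum>j<?n. ?a j)"
  proof -
    have "norm (fst ?d) \<le> (\<Sum>i\<in>UNIV. \<bar>vec_nth (fst ?d) i\<bar>)" by (rule norm_le_l1_cart)
    also have "\<dots> = (\<Sum>k<?n. ?a k)" by (subst sum_idx) (auto simp: pt_def intro!: sum.cong)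
    finally show ?thesis .
  qed
  moreover have "norm (snd ?d) \<le> (\<Sum>j<?n. ?a (?n + j))"
  proof -
    have "norm (snd ?d) \<le> (\<Sum>i\<in>UNIV. \<bar>vec_nth (snd ?d) i\<bar>)" by (rule norm_le_l1_cart)
    also have "\<dots> = (\<Sum>k<?n. ?a (?n + k))" by (subst sum_idx) (auto simp: pt_def intro!: sum.cong)
    finally show ?thesis .
  qed
  moreover have "(\<Sum>j<2 * ?n. ?a j) = (\<Sum>j<?n. ?a j) + (\<Sum>j<?n. ?a (?n + j))"
  proof -
    have "(\<Sum>j<?n + ?n. ?a j) = (\<Sum>j<?n. ?a j) + (\<Sum>j=?n..<?n + ?n. ?a j)"
      using sum.atLeastLessThan_concat[of 0 ?n "?n + ?n" ?a] by (simp add: atLeast0LessThan)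
    also have "(\<Sum>j=?n..<?n + ?n. ?a j) = (\<Sum>j<?n. ?a (?n + j))"
      using sum.shift_bounds_nat_ivl[of ?a 0 ?n ?n] by (simp add: atLeast0LessThan add.commute)
    finally show ?thesis by (simp add: mult_2)
  qed
  ultimately show ?thesis by linarith
qed

text \<open>With \<open>r < n\<close> coordinates, padding by zeros embeds \<open>X\<close> in a
  hyperplane of \<open>\<real>\<^sup>n\<close>, a null set, on which the graph map is pointwise
  Lipschitz. The type of \<open>X\<close> is left open because both lists and functions on
  \<open>nat\<close> occur as parameters.\<close>

lemma small_parametrized:
  assumes r: "r < CARD('n::{finite, linorder})"
    and lip: "\<And>u j. u \<in> X \<Longrightarrow> j < 2 * CARD('n) \<Longrightarrow> \<exists>d>0. \<exists>B\<ge>0. \<forall>v\<in>X.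
      (\<forall>i<r. \<bar>\<pi> i v - \<pi> i u\<bar> < d) \<longrightarrow> \<bar>\<theta> j v - \<theta> j u\<bar> \<le> B * (\<Sum>i<r. \<bar>\<pi> i v - \<pi> i u\<bar>)"
    and inj: "\<And>u v. u \<in> X \<Longrightarrow> v \<in> X \<Longrightarrow> (\<And>i. i < r \<Longrightarrow> \<pi> i u = \<pi> i v) \<Longrightarrow> u = v"
  shows "small (pt \<theta> ` X :: ((real ^ 'n::_) \<times> (real ^ 'n::_)) set)"
proof -
  let ?n = "CARD('n)"
  \<comment> \<open>Zeros fill the coordinates beyond \<open>r\<close>; coordinate
    \<open>r + 1\<close> exists because \<open>r < n\<close>, and it is 0 on the whole
    image.\<close>
  define \<iota> where "\<iota> u = (\<chi> i. if rk i \<le> r then \<pi> (rk i - 1) u else 0 :: real ^ 'n::_)" for u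
  have \<iota>nth: "vec_nth (\<iota> u) (idx (Suc i)) = \<pi> i u" if "i < r" for i u
    using that r by (simp add: \<iota>_def)
  have inj\<iota>: "inj_on \<iota> X"
  proof (rule inj_onI)
    fix u v assume "u \<in> X" "v \<in> X" "\<iota> u = \<iota> v"
    then show "u = v" using \<iota>nth by (intro inj) metis+
  qed
  define N where "N = \<iota> ` X"
  define T where "T = the_inv_into X \<iota>"
  have T: "T (\<iota> u) = u" if "u \<in> X" for u
    using that inj\<iota> by (simp add: T_def the_inv_into_f_f)
  have "N \<subseteq> {v. v \<bullet> axis (idx (Suc r)) 1 = 0}"
    using r by (auto simp: N_def inner_axis \<iota>_def)
  moreover have "negligible {v :: real ^ 'n::_. v \<bullet> axis (idx (Suc r)) 1 = 0}"
    by (rule negligible_standard_hyperplane) (simp add: axis_in_Basis_iff)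
  ultimately have N: "negligible N" using negligible_subset by blast
  have "small ((\<lambda>v. pt \<theta> (T v)) ` N :: ((real ^ 'n::_) \<times> (real ^ 'n::_)) set)"
  proof (rule small_image[OF N])
    fix x assume "x \<in> N"
    then obtain u where u: "u \<in> X" "x = \<iota> u" by (auto simp: N_def)
    have "\<forall>j\<in>{..<2 * ?n}. \<exists>z. fst z > 0 \<and> snd z \<ge> 0 \<and> (\<forall>v\<in>X.
      (\<forall>i<r. \<bar>\<pi> i v - \<pi> i u\<bar> < fst z) \<longrightarrow> \<bar>\<theta> j v - \<theta> j u\<bar> \<le> snd z * (\<Sum>i<r. \<bar>\<pi> i v - \<pi> i u\<bar>))"
    proof
      fix j assume "j \<in> {..<2 * ?n}"
      then obtain d B where "d > 0" "B \<ge> 0" "\<forall>v\<in>X.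
        (\<forall>i<r. \<bar>\<pi> i v - \<pi> i u\<bar> < d) \<longrightarrow> \<bar>\<theta> j v - \<theta> j u\<bar> \<le> B * (\<Sum>i<r. \<bar>\<pi> i v - \<pi> i u\<bar>)"
        using lip[OF u(1), of j] by auto
      then show "\<exists>z. fst z > 0 \<and> snd z \<ge> 0 \<and> (\<forall>v\<in>X.
        (\<forall>i<r. \<bar>\<pi> i v - \<pi> i u\<bar> < fst z) \<longrightarrow> \<bar>\<theta> j v - \<theta> j u\<bar> \<le> snd z * (\<Sum>i<r. \<bar>\<pi> i v - \<pi> i u\<bar>))"
        by (intro exI[of _ "(d, B)"]) simp
    qed
    from bchoice[OF this] obtain z where z: "\<And>j. j < 2 * ?n \<Longrightarrow> fst (z j) > 0 \<and> snd (z j) \<ge> 0 \<and> (\<forall>v\<in>X.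
      (\<forall>i<r. \<bar>\<pi> i v - \<pi> i u\<bar> < fst (z j)) \<longrightarrow> \<bar>\<theta> j v - \<theta> j u\<bar> \<le> snd (z j) * (\<Sum>i<r. \<bar>\<pi> i v - \<pi> i u\<bar>))"
      by blast
    define d where "d = Min (insert 1 ((\<lambda>j. fst (z j)) ` {..<2 * ?n}))"
    have d: "d > 0" using z by (auto simp: d_def)
    have dz: "d \<le> fst (z j)" if "j < 2 * ?n" for j
      unfolding d_def by (rule Min_le) (use that in auto)
    define B where "B = (\<Sum>j<2 * ?n. snd (z j) * real r)"
    have "norm (pt \<theta> (T y) - pt \<theta> (T x) :: (real ^ 'n::_) \<times> (real ^ 'n::_)) \<le> B * norm (y - x)"
      if y: "y \<in> N" "norm (y - x) < d" for y
    proof -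
      obtain v where v: "v \<in> X" "y = \<iota> v" using y(1) by (auto simp: N_def)
      have comp: "\<bar>\<pi> i v - \<pi> i u\<bar> \<le> norm (y - x)" if "i < r" for i
        using component_le_norm_cart[of "y - x" "idx (Suc i)"] \<iota>nth[OF that] u v by simp
      have sum: "(\<Sum>i<r. \<bar>\<pi> i v - \<pi> i u\<bar>) \<le> real r * norm (y - x)"
        using sum_bounded_above[of "{..<r}" "\<lambda>i. \<bar>\<pi> i v - \<pi> i u\<bar>" "norm (y - x)"] comp by simp
      have "norm (pt \<theta> (T y) - pt \<theta> (T x) :: (real ^ 'n::_) \<times> (real ^ 'n::_)) \<le> (\<Sum>j<2 * ?n. \<bar>\<theta> j v - \<theta> j u\<bar>)"
        using norm_pt_diff_le[of \<theta> v u] T u v by simp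
      also have "\<dots> \<le> (\<Sum>j<2 * ?n. snd (z j) * real r * norm (y - x))"
      proof (rule sum_mono)
        fix j assume j: "j \<in> {..<2 * ?n}"
        have "\<forall>i<r. \<bar>\<pi> i v - \<pi> i u\<bar> < fst (z j)"
        proof (intro allI impI)
          fix i assume "i < r"
          then have "\<bar>\<pi> i v - \<pi> i u\<bar> \<le> norm (y - x)" by (rule comp)
          then show "\<bar>\<pi> i v - \<pi> i u\<bar> < fst (z j)" using dz[of j] j y(2) by simp
        qed
        then have "\<bar>\<theta> j v - \<theta> j u\<bar> \<le> snd (z j) * (\<Sum>i<r. \<bar>\<pi> i v - \<pi> i u\<bar>)"
          using z[of j] j v(1) by simp
        also have "\<dots> \<le> snd (z j) * (real r * norm (y - x))"
          using z[of j] j by (intro mult_left_mono sum) auto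
        finally show "\<bar>\<theta> j v - \<theta> j u\<bar> \<le> snd (z j) * real r * norm (y - x)" by (simp add: mult.assoc)
      qed
      also have "\<dots> = B * norm (y - x)" by (simp add: B_def sum_distrib_right)
      finally show ?thesis .
    qed
    then show "\<exists>d>0. \<exists>B. \<forall>y\<in>N. norm (y - x) < d \<longrightarrow>
        norm (pt \<theta> (T y) - pt \<theta> (T x) :: (real ^ 'n::_) \<times> (real ^ 'n::_)) \<le> B * norm (y - x)"
      using d by blast
  qed
  moreover have "pt \<theta> ` X \<subseteq> (\<lambda>v. pt \<theta> (T v)) ` N"
  proof
    fix z assume "z \<in> pt \<theta> ` X"
    then obtain u where u: "u \<in> X" "z = pt \<theta> u" by blast
    show "z \<in> (\<lambda>v. pt \<theta> (T v)) ` N"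
      by (rule image_eqI[of _ _ "\<iota> u"]) (use u T[OF u(1)] in \<open>simp_all add: N_def\<close>)
  qed
  ultimately show ?thesis by (rule small_subset)
qed

section \<open>Transfer between lists and vectors\<close>

definition unvec :: "real list \<Rightarrow> real ^ 'n::{finite, linorder}" where
  "unvec xs = (\<chi> i. xs ! (rk i - 1))"

lemma length_vec_list [simp]: "length (vec_list (v :: real ^ 'n::{finite, linorder})) = CARD('n)"
  by (simp add: vec_list_def)

lemma nth_vec_list [simp]:
  "k < CARD('n) \<Longrightarrow> vec_list (v :: real ^ 'n::{finite, linorder}) ! k = vec_nth v (idx (Suc k))"
  by (simp add: vec_list_def del: upt_Suc)

lemma unvec_vec_list [simp]: "unvec (vec_list v) = (v :: real ^ 'n::{finite, linorder})"
proof -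
  have "rk i - 1 < CARD('n)" "Suc (rk i - 1) = rk i" for i :: 'n
    using rk_range[of i] by auto
  then show ?thesis by (simp add: unvec_def Finite_Cartesian_Product.vec_eq_iff)
qed

text \<open>Agreement of \<open>g j\<close> with the components on an open set is enough, so
  extending the components by 0 off that set is harmless.\<close>

lemma differentiable_if_components:
  fixes f :: "real ^ 'n::{finite, linorder} \<Rightarrow> real ^ 'n::_"
  assumes "\<And>j. j < CARD('n) \<Longrightarrow> ldiff CARD('n) (g j) (vec_list p)"
    and S: "open S" "p \<in> S" "\<And>q j. q \<in> S \<Longrightarrow> j < CARD('n) \<Longrightarrow> g j (vec_list q) = vec_nth (f q) (idx (Suc j))"
  shows "f differentiable (at p)"
proof -
  let ?n = "CARD('n)"
  have "\<forall>j\<in>{..<?n}. \<exists>c. \<forall>e>0. \<exists>d>0. \<forall>ys\<in>cube ?n (vec_list p) d.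
     \<bar>g j ys - g j (vec_list p) - (\<Sum>i<?n. c i * (ys ! i - vec_list p ! i))\<bar> \<le> e * (\<Sum>i<?n. \<bar>ys ! i - vec_list p ! i\<bar>)"
    using assms(1) unfolding ldiff_def by simp
  from bchoice[OF this] obtain c where c: "\<And>j e. j < ?n \<Longrightarrow> e > 0 \<Longrightarrow> \<exists>d>0. \<forall>ys\<in>cube ?n (vec_list p) d.
     \<bar>g j ys - g j (vec_list p) - (\<Sum>i<?n. c j i * (ys ! i - vec_list p ! i))\<bar> \<le> e * (\<Sum>i<?n. \<bar>ys ! i - vec_list p ! i\<bar>)"
    by blast
  have "((\<lambda>q. vec_nth (f q) l) has_derivative (\<lambda>h. \<Sum>i<?n. c (rk l - 1) i * vec_nth h (idx (Suc i)))) (at p)" for l :: 'n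
    unfolding has_derivative_at_alt
  proof (intro conjI allI impI)
    show "bounded_linear (\<lambda>h. \<Sum>i<?n. c (rk l - 1) i * vec_nth h (idx (Suc i)))"
      by (intro bounded_linear_sum bounded_linear_const_mult bounded_linear_vec_nth)
    fix e :: real assume e: "e > 0"
    let ?j = "rk l - 1"
    have j: "?j < ?n" "Suc ?j = rk l" using rk_range[of l] by auto
    \<comment> \<open>A sum of \<open>n\<close> coordinate differences is at most \<open>n\<close>
      times the norm, hence the tolerance \<open>e / n\<close>.\<close>
    obtain d where d: "d > 0" "\<And>ys. ys \<in> cube ?n (vec_list p) d \<Longrightarrow>
     \<bar>g ?j ys - g ?j (vec_list p) - (\<Sum>i<?n. c ?j i * (ys ! i - vec_list p ! i))\<bar> \<le> (e / ?n) * (\<Sum>i<?n. \<bar>ys ! i - vec_list p ! i\<bar>)"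
      using c[OF j(1), of "e / ?n"] e by auto
    obtain d' where d': "d' > 0" "ball p d' \<subseteq> S" using S openE by blast
    show "\<exists>d>0. \<forall>y. norm (y - p) < d \<longrightarrow> norm (vec_nth (f y) l - vec_nth (f p) l -
       (\<Sum>i<?n. c ?j i * vec_nth (y - p) (idx (Suc i)))) \<le> e * norm (y - p)"
    proof (intro exI[of _ "min d d'"] conjI allI impI)
      fix y assume y: "norm (y - p) < min d d'"
      have comp: "\<bar>vec_nth y i - vec_nth p i\<bar> \<le> norm (y - p)" for i
        using component_le_norm_cart[of "y - p" i] by simp
      have "vec_list y \<in> cube ?n (vec_list p) d"
      proof -
        have "\<bar>vec_nth y i - vec_nth p i\<bar> < d" for i using comp[of i] y by simp
        then show ?thesis by (simp add: cube_def)
      qed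
      from d(2)[OF this] have "\<bar>g ?j (vec_list y) - g ?j (vec_list p) - (\<Sum>i<?n. c ?j i * (vec_list y ! i - vec_list p ! i))\<bar>
         \<le> (e / ?n) * (\<Sum>i<?n. \<bar>vec_list y ! i - vec_list p ! i\<bar>)" .
      moreover have "(\<Sum>i<?n. \<bar>vec_list y ! i - vec_list p ! i\<bar>) \<le> ?n * norm (y - p)"
        using sum_bounded_above[of "{..<?n}" "\<lambda>i. \<bar>vec_list y ! i - vec_list p ! i\<bar>" "norm (y - p)"] comp by simp
      then have "(e / ?n) * (\<Sum>i<?n. \<bar>vec_list y ! i - vec_list p ! i\<bar>) \<le> (e / ?n) * (?n * norm (y - p))"
        by (rule mult_left_mono) (use e in simp)
      ultimately have "\<bar>g ?j (vec_list y) - g ?j (vec_list p) - (\<Sum>i<?n. c ?j i * (vec_list y ! i - vec_list p ! i))\<bar> \<le> e * norm (y - p)"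
        by simp
      moreover have "g ?j (vec_list y) = vec_nth (f y) l" "g ?j (vec_list p) = vec_nth (f p) l"
        using S(3)[of y ?j] S(3)[of p ?j] y d' S(2) j by (auto simp: dist_norm norm_minus_commute subset_iff)
      moreover have "(\<Sum>i<?n. c ?j i * (vec_list y ! i - vec_list p ! i)) = (\<Sum>i<?n. c ?j i * vec_nth (y - p) (idx (Suc i)))"
        by (intro sum.cong) auto
      ultimately show "norm (vec_nth (f y) l - vec_nth (f p) l - (\<Sum>i<?n. c ?j i * vec_nth (y - p) (idx (Suc i)))) \<le> e * norm (y - p)"
        by simp
    qed (use d d' in simp)
  qed
  then have "((\<lambda>q. \<chi> l. vec_nth (f q) l) has_derivative (\<lambda>h. \<chi> l. \<Sum>i<?n. c (rk l - 1) i * vec_nth h (idx (Suc i)))) (at p)"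
    by (rule has_derivative_vec_lambda)
  then show ?thesis by (auto simp: differentiable_def)
qed

context o_minimal_structure
begin

lemma Df_ins:
  assumes C: "C \<in> S (Suc r)" and i: "i \<le> r" and m: "r \<le> m" "l < m"
  shows "Df m (\<lambda>ws. ins i (ws ! l) (take r ws) \<in> C)"
proof -
  let ?\<sigma> = "\<lambda>j. if j < i then j else if j = i then l else j - 1"
  have "Df m (\<lambda>ws. map (\<lambda>j. ws ! ?\<sigma> j) [0..<Suc r] \<in> C)"
    using assms by (intro Df_reindex[OF Df_in[OF C]]) auto
  then show ?thesis
  proof (rule Df_imp_cong)
    fix ws :: "real list" assume l: "length ws = m"
    have "ins i (ws ! l) (take r ws) = map (\<lambda>j. ws ! ?\<sigma> j) [0..<Suc r]"
      using l i m by (intro nth_equalityI) (auto simp: length_ins nth_ins simp del: upt_Suc)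
    then show "(ins i (ws ! l) (take r ws) \<in> C) = (map (\<lambda>j. ws ! ?\<sigma> j) [0..<Suc r] \<in> C)" by (simp only:)
  qed
qed

lemma Fn_ins:
  assumes g: "Fn (Suc r) g" and i: "i \<le> r" and m: "r \<le> m" "l < m"
  shows "Fn m (\<lambda>ws. g (ins i (ws ! l) (take r ws)))"
proof -
  let ?\<sigma> = "\<lambda>j. if j < i then j else if j = i then l else j - 1"
  have "Fn m (\<lambda>ws. g (map (\<lambda>j. (\<lambda>ws. ws ! ?\<sigma> j) ws) [0..<Suc r]))"
    using assms by (intro Fn_subst[OF g] Fn_var) auto
  then show ?thesis
  proof (rule Fn_imp_cong)
    fix ws :: "real list" assume l: "length ws = m"
    have "ins i (ws ! l) (take r ws) = map (\<lambda>j. ws ! ?\<sigma> j) [0..<Suc r]"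
      using l i m by (intro nth_equalityI) (auto simp: length_ins nth_ins simp del: upt_Suc)
    then show "g (ins i (ws ! l) (take r ws)) = g (map (\<lambda>j. ws ! ?\<sigma> j) [0..<Suc r])" by (simp only:)
  qed
qed

text \<open>A thin set loses one dimension: on each piece given by \<open>thin_cover\<close> the
  dropped coordinate is a definable function of the rest, and the claim in dimension
  \<open>r\<close> applies to the projected piece.\<close>

lemma small_thin_image:
  assumes IH: "\<And>X \<theta>. X \<in> S r \<Longrightarrow> (\<And>j. j < 2 * CARD('n::{finite, linorder}) \<Longrightarrow> Fn r (\<theta> j)) \<Longrightarrow>
      small (pt \<theta> ` X :: ((real ^ 'n::_) \<times> (real ^ 'n::_)) set)"
    and E: "E \<in> S (Suc r)" "thin (Suc r) E" and \<theta>: "\<And>j. j < 2 * CARD('n) \<Longrightarrow> Fn (Suc r) (\<theta> j)"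
  shows "small (pt \<theta> ` E :: ((real ^ 'n::_) \<times> (real ^ 'n::_)) set)"
proof -
  obtain \<C> where \<C>: "countable \<C>" "E \<subseteq> \<Union>\<C>" "\<And>C. C \<in> \<C> \<Longrightarrow> C \<in> S (Suc r)"
      "\<And>C. C \<in> \<C> \<Longrightarrow> \<exists>i<Suc r. inj_on (dropi i) C"
    using thin_cover[OF E] by blast
  have "small (pt \<theta> ` C :: ((real ^ 'n::_) \<times> (real ^ 'n::_)) set)" if C: "C \<in> \<C>" for C
  proof -
    obtain i where i: "i \<le> r" "inj_on (dropi i) C" using \<C>(4)[OF C] by (auto simp: less_Suc_eq_le)
    have CS: "C \<in> S (Suc r)" by (rule \<C>(3)[OF C])
    have lenC: "length c = Suc r" if "c \<in> C" for c using dim[OF CS] that by auto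
    define X where "X = {xs \<in> Rn r. \<exists>t. ins i t xs \<in> C}"
    \<comment> \<open>The restored point is unique by injectivity; the value 0 off the projection
      makes the function total, as definability of functions requires.\<close>
    define \<theta>' where "\<theta>' j xs = (if \<exists>t. ins i t xs \<in> C then \<theta> j (ins i (THE t. ins i t xs \<in> C) xs) else 0)" for j xs
    have uniq: "t = t'" if "length xs = r" "ins i t xs \<in> C" "ins i t' xs \<in> C" for t t' xs
    proof -
      have "ins i t xs = ins i t' xs"
        using inj_onD[OF i(2) _ that(2,3)] dropi_ins[of i xs] i(1) that(1) by simp
      then have "ins i t xs ! i = ins i t' xs ! i" by simp
      then show ?thesis using i(1) that(1) by (simp add: nth_ins)
    qed
    have the: "(THE t. ins i t xs \<in> C) = t" if "length xs = r" "ins i t xs \<in> C" for t xs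
      using uniq that by (intro the_equality) auto
    have "Df r (\<lambda>xs. \<exists>t. ins i t xs \<in> C)"
      by (rule Df_ex) (rule Df_ins[OF CS i(1)], auto)
    then have "X \<in> S r" by (simp add: X_def Df_def)
    moreover have "Fn r (\<theta>' j)" if j: "j < 2 * CARD('n)" for j
    proof (rule Fn_Df_graph)
      let ?Q = "\<lambda>xs y. (\<exists>t. ins i t xs \<in> C \<and> y = \<theta> j (ins i t xs)) \<or> (\<not> (\<exists>t. ins i t xs \<in> C) \<and> y = 0)"
      have 1: "Df (Suc (Suc r)) (\<lambda>ws. ins i (ws ! Suc r) (take r (take (Suc r) ws)) \<in> C)"
        by (rule Df_imp_cong[OF Df_ins[OF CS i(1), of "Suc (Suc r)" "Suc r"]]) (simp_all add: min_def)
      have 2: "Df (Suc (Suc r)) (\<lambda>ws. take (Suc r) ws ! r = \<theta> j (ins i (ws ! Suc r) (take r (take (Suc r) ws))))"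
      proof (rule Df_imp_cong)
        show "Df (Suc (Suc r)) (\<lambda>ws. ws ! r = \<theta> j (ins i (ws ! Suc r) (take r ws)))"
          by (intro Df_eq Fn_var Fn_ins \<theta> j i) auto
      qed (simp add: min_def)
      show "Df (Suc r) (\<lambda>xs. ?Q (take r xs) (xs ! r))"
        by (intro Df_disj Df_conj Df_not Df_ex 1 2 Df_eq Fn_var Fn_const) auto
      fix xs :: "real list" and y assume "length xs = r"
      then show "?Q xs y \<longleftrightarrow> y = \<theta>' j xs"
        using the[of xs] by (auto simp: \<theta>'_def)
    qed
    ultimately have "small (pt \<theta>' ` X :: ((real ^ 'n::_) \<times> (real ^ 'n::_)) set)" by (rule IH)
    moreover have "pt \<theta> ` C \<subseteq> (pt \<theta>' ` X :: ((real ^ 'n::_) \<times> (real ^ 'n::_)) set)"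
    proof
      fix z :: "(real ^ 'n::_) \<times> (real ^ 'n::_)" assume "z \<in> pt \<theta> ` C"
      then obtain c where c: "c \<in> C" "z = pt \<theta> c" by blast
      let ?xs = "dropi i c"
      have li: "i < length c" using lenC[OF c(1)] i(1) by simp
      have ins: "ins i (c ! i) ?xs = c" by (rule ins_dropi[OF li])
      have len: "length ?xs = r" using lenC[OF c(1)] length_dropi[OF li] by simp
      have ex: "\<exists>t. ins i t ?xs \<in> C" using ins c(1) by metis
      then have "?xs \<in> X" using len by (simp add: X_def)
      moreover have "\<theta>' j ?xs = \<theta> j c" for j
        using the[OF len, of "c ! i"] ins c(1) ex by (simp add: \<theta>'_def)
      ultimately show "z \<in> pt \<theta>' ` X"
        using c(2) by (intro image_eqI[of _ _ ?xs]) (simp add: pt_def)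
    qed
    ultimately show ?thesis by (rule small_subset)
  qed
  then have "small (\<Union>C\<in>\<C>. pt \<theta> ` C :: ((real ^ 'n::_) \<times> (real ^ 'n::_)) set)"
    by (rule small_UN[OF \<C>(1)])
  then show ?thesis by (rule small_subset) (use \<C>(2) in blast)
qed

text \<open>Where all \<open>\<theta> j\<close> are differentiable the image is small because
  \<open>r < n\<close>; the exceptional sets are thin, hence handled by the claim in one dimension
  less.\<close>

lemma small_definable_image:
  assumes "r < CARD('n::{finite, linorder})" "X \<in> S r" "\<And>j. j < 2 * CARD('n) \<Longrightarrow> Fn r (\<theta> j)"
  shows "small (pt \<theta> ` X :: ((real ^ 'n::_) \<times> (real ^ 'n::_)) set)"
  using assms
proof (induction r arbitrary: X \<theta>)
  case r: (0 X \<theta>)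
  show ?case
  proof (rule small_subset[OF small_parametrized])
    show "0 < CARD('n)" by simp
    \<comment> \<open>In dimension 0 the empty list is the only possible parameter.\<close>
    show "pt \<theta> ` X \<subseteq> pt \<theta> ` {[]}" using dim[OF r(2)] by (auto simp: Rn_def)
    show "\<exists>d>0. \<exists>B\<ge>0. \<forall>v\<in>{[]}. (\<forall>i<0. \<bar>v ! i - u ! i\<bar> < d) \<longrightarrow> \<bar>\<theta> j v - \<theta> j u\<bar> \<le> B * (\<Sum>i<0. \<bar>v ! i - u ! i\<bar>)"
      if "u \<in> {[]}" for u j
      using that by (intro exI[of _ 1]) auto
  qed auto
next
  case (Suc r X \<theta>)
  let ?n = "CARD('n)"
  have "\<forall>j\<in>{..<2 * ?n}. \<exists>\<E>. countable \<E> \<and> (\<forall>E\<in>\<E>. E \<in> S (Suc r) \<and> thin (Suc r) E) \<and>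
      (\<forall>xs\<in>Rn (Suc r) - \<Union>\<E>. ldiff (Suc r) (\<theta> j) xs)"
    using generic_ldiff[OF Suc.prems(3)] by blast
  then obtain \<E> where \<E>0: "\<forall>j\<in>{..<2 * ?n}. countable (\<E> j) \<and> (\<forall>E\<in>\<E> j. E \<in> S (Suc r) \<and> thin (Suc r) E) \<and>
      (\<forall>xs\<in>Rn (Suc r) - \<Union>(\<E> j). ldiff (Suc r) (\<theta> j) xs)"
    by (rule bchoice[THEN exE])
  then have \<E>: "\<And>j. j < 2 * ?n \<Longrightarrow> countable (\<E> j)"
      "\<And>j E. j < 2 * ?n \<Longrightarrow> E \<in> \<E> j \<Longrightarrow> E \<in> S (Suc r) \<and> thin (Suc r) E"
      "\<And>j xs. j < 2 * ?n \<Longrightarrow> xs \<in> Rn (Suc r) - \<Union>(\<E> j) \<Longrightarrow> ldiff (Suc r) (\<theta> j) xs"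
    by (simp_all only: lessThan_iff Ball_def)
  let ?G = "{xs \<in> Rn (Suc r). \<forall>j<2 * ?n. ldiff (Suc r) (\<theta> j) xs}"
  have G: "small (pt \<theta> ` ?G :: ((real ^ 'n::_) \<times> (real ^ 'n::_)) set)"
  proof (rule small_parametrized[OF Suc.prems(1)])
    fix u j assume u: "u \<in> ?G" and j: "j < 2 * ?n"
    obtain d B where "d > 0" "B \<ge> 0" "\<And>ys. ys \<in> cube (Suc r) u d \<Longrightarrow>
        \<bar>\<theta> j ys - \<theta> j u\<bar> \<le> B * (\<Sum>i<Suc r. \<bar>ys ! i - u ! i\<bar>)"
      using ldiff_imp_pointwise_lipschitz[of "Suc r" "\<theta> j" u] u j by blast
    then show "\<exists>d>0. \<exists>B\<ge>0. \<forall>v\<in>?G. (\<forall>i<Suc r. \<bar>v ! i - u ! i\<bar> < d) \<longrightarrow>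
        \<bar>\<theta> j v - \<theta> j u\<bar> \<le> B * (\<Sum>i<Suc r. \<bar>v ! i - u ! i\<bar>)"
      by (intro exI[of _ d] conjI exI[of _ B] ballI impI) (auto simp: cube_def)
  next
    fix u v assume "u \<in> ?G" "v \<in> ?G" "\<And>i. i < Suc r \<Longrightarrow> u ! i = v ! i"
    then show "u = v" by (intro nth_equalityI) auto
  qed
  have bad: "small (\<Union>j\<in>{..<2 * ?n}. \<Union>E\<in>\<E> j. pt \<theta> ` E :: ((real ^ 'n::_) \<times> (real ^ 'n::_)) set)"
  proof (intro small_UN)
    fix j E assume j: "j \<in> {..<2 * ?n}" and E: "E \<in> \<E> j"
    show "small (pt \<theta> ` E :: ((real ^ 'n::_) \<times> (real ^ 'n::_)) set)"
    proof (rule small_thin_image)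
      show "small (pt \<theta>' ` X' :: ((real ^ 'n::_) \<times> (real ^ 'n::_)) set)"
        if "X' \<in> S r" "\<And>j. j < 2 * ?n \<Longrightarrow> Fn r (\<theta>' j)" for X' \<theta>'
        using Suc.IH[of X' \<theta>'] Suc.prems(1) that by simp
    qed (use \<E>(2)[of j E] j E Suc.prems(3) in auto)
  qed (use \<E>(1) in auto)
  have "pt \<theta> ` X \<subseteq> pt \<theta> ` ?G \<union> (\<Union>j\<in>{..<2 * ?n}. \<Union>E\<in>\<E> j. pt \<theta> ` E :: ((real ^ 'n::_) \<times> (real ^ 'n::_)) set)"
  proof
    fix z :: "(real ^ 'n::_) \<times> (real ^ 'n::_)" assume "z \<in> pt \<theta> ` X"
    then obtain xs where xs: "xs \<in> X" "z = pt \<theta> xs" by blast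
    have l: "length xs = Suc r" using dim[OF Suc.prems(2)] xs by auto
    show "z \<in> pt \<theta> ` ?G \<union> (\<Union>j\<in>{..<2 * ?n}. \<Union>E\<in>\<E> j. pt \<theta> ` E)"
    proof (cases "\<exists>j<2 * ?n. xs \<in> \<Union>(\<E> j)")
      case True
      then obtain j E where "j < 2 * ?n" "E \<in> \<E> j" "xs \<in> E" by blast
      then show ?thesis using xs(2) by blast
    next
      case False
      then have "xs \<in> ?G" using \<E>(3) l by simp
      then show ?thesis using xs(2) by blast
    qed
  qed
  then show ?case by (rule small_subset[OF small_Un[OF G bad]])
qed

text \<open>The components of \<open>f\<close> are generically differentiable, so the bad points lie
  in countably many thin subsets of \<open>\<real>\<^sup>n\<close>, whose images under the graph map
  are small although the ambient dimension is \<open>n\<close> itself.\<close>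

lemma small_bad_part:
  fixes f :: "real ^ 'n::{finite, linorder} \<Rightarrow> real ^ 'n::_"
  assumes U: "open U" and graph: "graph_on U f \<in> S (CARD('n) + CARD('n))"
  shows "small {(p, f p) | p. p \<in> nondiff_set U f}"
proof -
  let ?n = "CARD('n)" and ?A = "graph_on U f"
  define V where "V = vec_list ` U"
  \<comment> \<open>Components of \<open>f\<close> extended by 0; as \<open>U\<close> is open this
    does not affect differentiability at its points.\<close>
  define g where "g j xs = (if xs \<in> V then vec_nth (f (unvec xs)) (idx (Suc j)) else 0)" for j xs
  have A: "xs @ ys \<in> ?A \<longleftrightarrow> xs \<in> V \<and> ys = vec_list (f (unvec xs))" if l: "length xs = ?n" "length ys = ?n" for xs ys
  proof
    assume "xs @ ys \<in> ?A"
    then obtain p where "p \<in> U" "xs @ ys = vec_list p @ vec_list (f p)" by (auto simp: graph_on_def)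
    then show "xs \<in> V \<and> ys = vec_list (f (unvec xs))" using l by (auto simp: V_def)
  next
    assume *: "xs \<in> V \<and> ys = vec_list (f (unvec xs))"
    then obtain p where "p \<in> U" "xs = vec_list p" by (auto simp: V_def)
    then show "xs @ ys \<in> ?A" using * by (auto simp: graph_on_def)
  qed
  have V: "(\<exists>ys. length ys = ?n \<and> xs @ ys \<in> ?A) \<longleftrightarrow> xs \<in> V" if "length xs = ?n" for xs
    using A[OF that, of "vec_list (f (unvec xs))"] A[OF that] by (intro iffI exI[of _ "vec_list (f (unvec xs))"]) auto
  have VDf: "Df ?n (\<lambda>xs. \<exists>ys. length ys = ?n \<and> xs @ ys \<in> ?A)"
    by (rule Df_ex_list) (use Df_in[OF graph] in simp)
  have g: "Fn ?n (g j)" if j: "j < ?n" for j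
  proof (rule Fn_Df_graph)
    let ?Q = "\<lambda>xs y. (\<exists>ys. length ys = ?n \<and> (xs @ ys \<in> ?A \<and> y = ys ! j)) \<or>
        (\<not> (\<exists>ys. length ys = ?n \<and> xs @ ys \<in> ?A) \<and> y = 0)"
    have 1: "Df (Suc ?n + ?n) (\<lambda>ws. take ?n (take (Suc ?n) ws) @ drop (Suc ?n) ws \<in> ?A)"
    proof (rule Df_imp_cong)
      show "Df (Suc ?n + ?n) (\<lambda>ws. map (\<lambda>i. ws ! (if i < ?n then i else Suc i)) [0..<?n + ?n] \<in> ?A)"
        by (rule Df_reindex[OF Df_in[OF graph]]) auto
      fix ws :: "real list" assume l: "length ws = Suc ?n + ?n"
      have "take ?n (take (Suc ?n) ws) @ drop (Suc ?n) ws = map (\<lambda>i. ws ! (if i < ?n then i else Suc i)) [0..<?n + ?n]"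
        by (rule nth_equalityI) (use l in \<open>auto simp: nth_append min_def\<close>)
      then show "(take ?n (take (Suc ?n) ws) @ drop (Suc ?n) ws \<in> ?A) = (map (\<lambda>i. ws ! (if i < ?n then i else Suc i)) [0..<?n + ?n] \<in> ?A)"
        by (simp only:)
    qed
    have 2: "Df (Suc ?n + ?n) (\<lambda>ws. take (Suc ?n) ws ! ?n = drop (Suc ?n) ws ! j)"
    proof (rule Df_imp_cong)
      show "Df (Suc ?n + ?n) (\<lambda>ws. ws ! ?n = ws ! (Suc ?n + j))"
        using j by (intro Df_eq Fn_var) auto
    qed (use j in simp)
    have 3: "Df (Suc ?n) (\<lambda>xs. \<not> (\<exists>ys. length ys = ?n \<and> take ?n xs @ ys \<in> ?A))"
      by (rule Df_take_Suc[OF Df_not[OF VDf]])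
    show "Df (Suc ?n) (\<lambda>xs. ?Q (take ?n xs) (xs ! ?n))"
      by (intro Df_disj Df_conj 3 Df_eq Fn_var Fn_const Df_ex_list 1 2) auto
    fix xs :: "real list" and y assume l: "length xs = ?n"
    have "(\<exists>ys. length ys = ?n \<and> (xs @ ys \<in> ?A \<and> y = ys ! j)) \<longleftrightarrow> xs \<in> V \<and> y = vec_list (f (unvec xs)) ! j"
      using A[OF l, of "vec_list (f (unvec xs))"] A[OF l] by (intro iffI exI[of _ "vec_list (f (unvec xs))"]) auto
    then show "?Q xs y \<longleftrightarrow> y = g j xs" using V[OF l] j by (auto simp: g_def)
  qed
  have "\<forall>j\<in>{..<?n}. \<exists>\<E>. countable \<E> \<and> (\<forall>E\<in>\<E>. E \<in> S ?n \<and> thin ?n E) \<and>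
      (\<forall>xs\<in>Rn ?n - \<Union>\<E>. ldiff ?n (g j) xs)"
    using generic_ldiff[OF g] by blast
  then obtain \<E> where \<E>0: "\<forall>j\<in>{..<?n}. countable (\<E> j) \<and> (\<forall>E\<in>\<E> j. E \<in> S ?n \<and> thin ?n E) \<and>
      (\<forall>xs\<in>Rn ?n - \<Union>(\<E> j). ldiff ?n (g j) xs)"
    by (rule bchoice[THEN exE])
  then have \<E>: "\<And>j. j < ?n \<Longrightarrow> countable (\<E> j)"
      "\<And>j E. j < ?n \<Longrightarrow> E \<in> \<E> j \<Longrightarrow> E \<in> S ?n \<and> thin ?n E"
      "\<And>j xs. j < ?n \<Longrightarrow> xs \<in> Rn ?n - \<Union>(\<E> j) \<Longrightarrow> ldiff ?n (g j) xs"
    by (simp_all only: lessThan_iff Ball_def)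
  \<comment> \<open>The graph map in list form: \<open>n\<close> coordinates followed by
    \<open>n\<close> values.\<close>
  define \<theta> where "\<theta> j xs = (if j < ?n then xs ! j else g (j - ?n) xs)" for j xs
  have pt: "pt \<theta> (vec_list p) = (p, f p)" if "p \<in> U" for p
  proof -
    have r: "rk i - 1 < ?n" "Suc (rk i - 1) = rk i" for i :: 'n using rk_range[of i] by auto
    have "vec_list p \<in> V" using that by (simp add: V_def)
    then show ?thesis using r by (simp add: pt_def \<theta>_def g_def Finite_Cartesian_Product.vec_eq_iff)
  qed
  have "small (\<Union>j\<in>{..<?n}. \<Union>E\<in>\<E> j. pt \<theta> ` E :: ((real ^ 'n::_) \<times> (real ^ 'n::_)) set)"
  proof (intro small_UN)
    fix j E assume j: "j \<in> {..<?n}" and E: "E \<in> \<E> j"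
    obtain r where r: "?n = Suc r" using gr0_conv_Suc[of ?n] by auto
    show "small (pt \<theta> ` E :: ((real ^ 'n::_) \<times> (real ^ 'n::_)) set)"
    proof (rule small_thin_image[where r = r])
      show "small (pt \<theta>' ` X' :: ((real ^ 'n::_) \<times> (real ^ 'n::_)) set)"
        if "X' \<in> S r" "\<And>j. j < 2 * ?n \<Longrightarrow> Fn r (\<theta>' j)" for X' \<theta>'
        by (rule small_definable_image) (use r that in simp_all)
      show "E \<in> S (Suc r)" "thin (Suc r) E" using \<E>(2)[of j E] j E r by auto
      fix j assume j: "j < 2 * ?n"
      have "Fn ?n (\<theta> j)"
      proof (cases "j < ?n")
        case True then show ?thesis by (simp add: \<theta>_def[abs_def] Fn_var)
      next
        case False then show ?thesis using g[of "j - ?n"] j by (simp add: \<theta>_def[abs_def])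
      qed
      then show "Fn (Suc r) (\<theta> j)" using r by simp
    qed
  qed (use \<E>(1) in auto)
  moreover have "{(p, f p) | p. p \<in> nondiff_set U f} \<subseteq> (\<Union>j\<in>{..<?n}. \<Union>E\<in>\<E> j. pt \<theta> ` E)"
  proof
    fix z assume "z \<in> {(p, f p) | p. p \<in> nondiff_set U f}"
    then obtain p where p: "z = (p, f p)" "p \<in> U" "\<not> f differentiable (at p)"
      by (auto simp: nondiff_set_def)
    have "\<exists>j<?n. vec_list p \<in> \<Union>(\<E> j)"
    proof (rule ccontr)
      assume "\<not> (\<exists>j<?n. vec_list p \<in> \<Union>(\<E> j))"
      then have "ldiff ?n (g j) (vec_list p)" if "j < ?n" for j using \<E>(3) that by simp
      then have "f differentiable (at p)"
      proof (rule differentiable_if_components[OF _ U p(2)])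
        show "g j (vec_list q) = vec_nth (f q) (idx (Suc j))" if "q \<in> U" for q j
          using that by (simp add: g_def V_def)
      qed
      then show False using p(3) by simp
    qed
    then obtain j E where "j < ?n" "E \<in> \<E> j" "vec_list p \<in> E" by blast
    then show "z \<in> (\<Union>j\<in>{..<?n}. \<Union>E\<in>\<E> j. pt \<theta> ` E)" using pt[OF p(2)] p(1) by force
  qed
  ultimately show ?thesis by (rule small_subset)
qed

end

section \<open>Separately holomorphic functions\<close>

text \<open>Discs of radius \<open>\<rho>\<close> about points of the smaller disc stay inside the
  larger one, so the Cauchy inequalities bound the first and second derivatives uniformly; the mean
  value inequality along segments gives the rest.\<close>

lemma cauchy_estimates:
  assumes g: "g holomorphic_on ball c R" and M: "\<And>v. v \<in> ball c R \<Longrightarrow> cmod (g v) \<le> M"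
    and s: "s < R" and u: "u \<in> ball c s" and v: "v \<in> ball c s"
  defines "\<rho> \<equiv> (R - s) / 2"
  shows "cmod (deriv g u) \<le> M / \<rho>"
    and "cmod (g v - g u) \<le> M / \<rho> * cmod (v - u)"
    and "cmod (g v - g u - deriv g u * (v - u)) \<le> 2 * M / \<rho>\<^sup>2 * (cmod (v - u))\<^sup>2"
proof -
  have \<rho>: "\<rho> > 0" using s by (simp add: \<rho>_def)
  have sub: "cball x \<rho> \<subseteq> ball c R" if "x \<in> ball c s" for x
  proof
    fix y assume "y \<in> cball x \<rho>"
    then have "dist c y < s + \<rho>" using that dist_triangle[of c y x] by simp
    then show "y \<in> ball c R" using s by (simp add: \<rho>_def field_simps)
  qed
  have D: "cmod ((deriv ^^ n) g x) \<le> fact n * M / \<rho> ^ n" if x: "x \<in> ball c s" for x n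
  proof (rule Cauchy_inequality)
    show "g holomorphic_on ball x \<rho>"
      by (rule holomorphic_on_subset[OF g]) (use sub[OF x] ball_subset_cball in blast)
    show "continuous_on (cball x \<rho>) g"
      by (rule continuous_on_subset[OF holomorphic_on_imp_continuous_on[OF g] sub[OF x]])
    show "cmod (g y) \<le> M" if "cmod (x - y) = \<rho>" for y
      by (rule M, rule subsetD[OF sub[OF x]]) (simp add: dist_norm that)
  qed (rule \<rho>)
  have D1: "cmod (deriv g x) \<le> M / \<rho>" if "x \<in> ball c s" for x using D[OF that, of 1] by simp
  have D2: "cmod (deriv (deriv g) x) \<le> 2 * M / \<rho>\<^sup>2" if "x \<in> ball c s" for x
    using D[OF that, of 2] by (simp add: numeral_2_eq_2)
  have ss: "ball c s \<subseteq> ball c R" using s by (intro subset_ball) simp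
  have seg: "closed_segment u v \<subseteq> ball c s" using u v by (intro closed_segment_subset) auto
  have der: "(g has_field_derivative deriv g x) (at x within T)" if "x \<in> ball c s" for x T
    using g that ss by (intro has_field_derivative_at_within[OF holomorphic_derivI[of g "ball c R"]]) auto
  have der2: "(deriv g has_field_derivative deriv (deriv g) x) (at x within T)" if "x \<in> ball c s" for x T
    using g that ss by (intro has_field_derivative_at_within[OF holomorphic_derivI[of "deriv g" "ball c R"]] holomorphic_deriv) auto
  show "cmod (deriv g u) \<le> M / \<rho>" by (rule D1[OF u])
  show "cmod (g v - g u) \<le> M / \<rho> * cmod (v - u)"
    by (rule field_differentiable_bound[of "ball c s" g "deriv g"]) (use der D1 u v in auto)
  have L: "cmod (deriv g x - deriv g u) \<le> 2 * M / \<rho>\<^sup>2 * cmod (v - u)" if x: "x \<in> closed_segment u v" for x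
  proof -
    have "cmod (deriv g x - deriv g u) \<le> 2 * M / \<rho>\<^sup>2 * cmod (x - u)"
      by (rule field_differentiable_bound[of "ball c s" "deriv g" "deriv (deriv g)"]) (use der2 D2 u x seg in auto)
    also have "\<dots> \<le> 2 * M / \<rho>\<^sup>2 * cmod (v - u)"
    proof (rule mult_left_mono)
      show "cmod (x - u) \<le> cmod (v - u)" using segment_bound1[OF x] by (simp add: norm_minus_commute)
      have "0 \<le> cmod (deriv (deriv g) u)" by simp
      then show "0 \<le> 2 * M / \<rho>\<^sup>2" using D2[OF u] by linarith
    qed
    finally show ?thesis .
  qed
  \<comment> \<open>The mean value inequality for \<open>g\<close> minus its linear part at
    \<open>u\<close>, whose derivative is small on the segment by \<open>L\<close>.\<close>
  have "cmod ((g v - deriv g u * v) - (g u - deriv g u * u)) \<le> 2 * M / \<rho>\<^sup>2 * cmod (v - u) * cmod (v - u)"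
  proof (rule field_differentiable_bound[of "closed_segment u v" _ "\<lambda>x. deriv g x - deriv g u"])
    fix x assume x: "x \<in> closed_segment u v"
    show "((\<lambda>v. g v - deriv g u * v) has_field_derivative deriv g x - deriv g u) (at x within closed_segment u v)"
      using x seg by (auto intro!: derivative_eq_intros der)
    show "cmod (deriv g x - deriv g u) \<le> 2 * M / \<rho>\<^sup>2 * cmod (v - u)" by (rule L[OF x])
  qed auto
  then show "cmod (g v - g u - deriv g u * (v - u)) \<le> 2 * M / \<rho>\<^sup>2 * (cmod (v - u))\<^sup>2"
    by (simp add: algebra_simps power2_eq_square)
qed

text \<open>
  Points of \<open>\<complex>\<^sup>I\<close> are functions on \<open>nat\<close> of which only the values on the finite set \<open>I\<close> matter;
  this makes eliminating a coordinate a mere change of \<open>I\<close>.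
\<close>

definition pd :: "nat set \<Rightarrow> (nat \<Rightarrow> complex) \<Rightarrow> real \<Rightarrow> (nat \<Rightarrow> complex) set" where
  "pd I a r = {z. \<forall>i\<in>I. cmod (z i - a i) < r}"

text \<open>Boundedness gives Cauchy estimates uniform in all coordinates, through which separate
  holomorphy yields joint regularity. Dependence on \<open>I\<close> alone gives the number of
  coordinates a meaning, and real values at real points allow a return to real charts.\<close>

definition an :: "nat set \<Rightarrow> ((nat \<Rightarrow> complex) \<Rightarrow> complex) \<Rightarrow> (nat \<Rightarrow> complex) \<Rightarrow> real \<Rightarrow> bool" where
  "an I F a r \<longleftrightarrow> (\<exists>M. \<forall>z\<in>pd I a r. cmod (F z) \<le> M) \<and>
     (\<forall>z\<in>pd I a r. \<forall>i\<in>I. (\<lambda>w. F (z(i := w))) holomorphic_on ball (a i) r) \<and>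
     (\<forall>z z'. (\<forall>i\<in>I. z i = z' i) \<longrightarrow> F z = F z') \<and>
     (\<forall>z\<in>pd I a r. (\<forall>i\<in>I. z i \<in> \<real>) \<longrightarrow> F z \<in> \<real>)"

lemma an_bounded: "an I F a r \<Longrightarrow> \<exists>M\<ge>0. \<forall>z\<in>pd I a r. cmod (F z) \<le> M"
proof -
  assume "an I F a r"
  then obtain M where "\<forall>z\<in>pd I a r. cmod (F z) \<le> M" unfolding an_def by blast
  then show ?thesis by (intro exI[of _ "max M 0"]) (auto simp: le_max_iff_disj)
qed

lemma an_hol: "an I F a r \<Longrightarrow> z \<in> pd I a r \<Longrightarrow> i \<in> I \<Longrightarrow> (\<lambda>w. F (z(i := w))) holomorphic_on ball (a i) r"
  unfolding an_def by blast

lemma an_dep: "an I F a r \<Longrightarrow> (\<And>i. i \<in> I \<Longrightarrow> z i = z' i) \<Longrightarrow> F z = F z'"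
  unfolding an_def by blast

lemma an_real: "an I F a r \<Longrightarrow> z \<in> pd I a r \<Longrightarrow> (\<And>i. i \<in> I \<Longrightarrow> z i \<in> \<real>) \<Longrightarrow> F z \<in> \<real>"
  unfolding an_def by blast

lemma pd_upd: "z \<in> pd I a r \<Longrightarrow> w \<in> ball (a i) r \<Longrightarrow> z(i := w) \<in> pd I a r"
  by (auto simp: pd_def dist_norm norm_minus_commute)

lemma pd_coord: "z \<in> pd I a r \<Longrightarrow> i \<in> I \<Longrightarrow> z i \<in> ball (a i) r"
  by (auto simp: pd_def dist_norm norm_minus_commute)

lemma pd_mono: "s \<le> r \<Longrightarrow> pd I a s \<subseteq> pd I a r"
  by (auto simp: pd_def)

lemma pd_center: "r > 0 \<Longrightarrow> a \<in> pd I a r"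
  by (simp add: pd_def)

lemma pd_shrink:
  assumes "finite I" "z \<in> pd I a r" "r > 0"
  shows "\<exists>s. 0 < s \<and> s < r \<and> z \<in> pd I a s"
proof -
  let ?m = "Max (insert 0 ((\<lambda>i. cmod (z i - a i)) ` I))"
  have m: "0 \<le> ?m" "?m < r" using assms by (auto simp: pd_def)
  have "cmod (z i - a i) \<le> ?m" if "i \<in> I" for i by (rule Max_ge) (use assms that in auto)
  then have "z \<in> pd I a ((?m + r) / 2)" using m by (force simp: pd_def)
  then show ?thesis using m assms(3) by (intro exI[of _ "(?m + r) / 2"]) auto
qed

lemma an_recenter:
  assumes F: "an I F a r" and b: "\<And>i. i \<in> I \<Longrightarrow> cmod (b i - a i) + s \<le> r"
  shows "an I F b s"
proof -
  have sub: "pd I b s \<subseteq> pd I a r"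
  proof
    fix z assume z: "z \<in> pd I b s"
    have "cmod (z i - a i) < r" if "i \<in> I" for i
    proof -
      have "cmod (z i - b i) < s" using z that by (simp add: pd_def)
      then show ?thesis using b[OF that] norm_triangle_ineq[of "z i - b i" "b i - a i"] by simp
    qed
    then show "z \<in> pd I a r" by (simp add: pd_def)
  qed
  have sub1: "ball (b i) s \<subseteq> ball (a i) r" if "i \<in> I" for i
  proof
    fix w assume "w \<in> ball (b i) s"
    then show "w \<in> ball (a i) r"
      using b[OF that] dist_triangle[of "a i" w "b i"] by (simp add: dist_norm norm_minus_commute)
  qed
  obtain M where "\<forall>z\<in>pd I a r. cmod (F z) \<le> M" using an_bounded[OF F] by blast
  then have "\<exists>M. \<forall>z\<in>pd I b s. cmod (F z) \<le> M" using sub by blast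
  moreover have "\<forall>z\<in>pd I b s. \<forall>i\<in>I. (\<lambda>w. F (z(i := w))) holomorphic_on ball (b i) s"
    using an_hol[OF F] sub sub1 by (meson holomorphic_on_subset subsetD)
  moreover have "\<forall>z z'. (\<forall>i\<in>I. z i = z' i) \<longrightarrow> F z = F z'" using an_dep[OF F] by blast
  moreover have "\<forall>z\<in>pd I b s. (\<forall>i\<in>I. z i \<in> \<real>) \<longrightarrow> F z \<in> \<real>" using an_real[OF F] sub by blast
  ultimately show ?thesis unfolding an_def by blast
qed

lemma an_shrink: "an I F a r \<Longrightarrow> s \<le> r \<Longrightarrow> an I F a s"
  by (rule an_recenter) auto

text \<open>Coordinates are changed one at a time, each change being controlled by the one-variable
  Cauchy estimate with the same bound \<open>M\<close>; \<open>J\<close> collects those that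
  differ.\<close>

lemma an_lipschitz:
  assumes F: "an I F a r" and I: "finite I" and s: "s < r"
  shows "\<exists>C\<ge>0. \<forall>z\<in>pd I a s. \<forall>z'\<in>pd I a s. cmod (F z' - F z) \<le> C * (\<Sum>i\<in>I. cmod (z' i - z i))"
proof -
  obtain M where M: "M \<ge> 0" "\<And>z. z \<in> pd I a r \<Longrightarrow> cmod (F z) \<le> M" using an_bounded[OF F] by blast
  define C where "C = M / ((r - s) / 2)"
  have C: "C \<ge> 0" using M s by (simp add: C_def)
  have sub: "pd I a s \<subseteq> pd I a r" by (rule pd_mono) (use s in simp)
  have "cmod (F z' - F z) \<le> C * (\<Sum>i\<in>J. cmod (z' i - z i))"
    if "finite J" "J \<subseteq> I" "z \<in> pd I a s" "z' \<in> pd I a s" "\<And>i. i \<in> I - J \<Longrightarrow> z' i = z i" for J z z'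
    using that
  proof (induction J arbitrary: z' rule: finite_induct)
    case empty
    then show ?case using an_dep[OF F, of z' z] by simp
  next
    case (insert j J)
    let ?z = "z'(j := z j)"
    have j: "j \<in> I" using insert.prems by simp
    have zb: "?z \<in> pd I a s" using insert.prems j by (intro pd_upd pd_coord) auto
    have "cmod (F ?z - F z) \<le> C * (\<Sum>i\<in>J. cmod (?z i - z i))"
      by (rule insert.IH[of ?z]) (use insert.prems zb in \<open>simp_all del: fun_upd_apply, auto\<close>)
    moreover have "(\<Sum>i\<in>J. cmod (?z i - z i)) = (\<Sum>i\<in>J. cmod (z' i - z i))"
      using insert.hyps by (intro sum.cong) auto
    moreover have "cmod (F (z'(j := z' j)) - F (z'(j := z j))) \<le> C * cmod (z' j - z j)"
      unfolding C_def
    proof (rule cauchy_estimates(2))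
      show "(\<lambda>w. F (z'(j := w))) holomorphic_on ball (a j) r"
        by (rule an_hol[OF F]) (use insert.prems sub j in auto)
      show "cmod (F (z'(j := v))) \<le> M" if "v \<in> ball (a j) r" for v
        by (rule M(2), rule pd_upd) (use insert.prems sub that in auto)
    qed (use s j insert.prems pd_coord in auto)
    moreover have "cmod (F z' - F z) \<le> cmod (F z' - F ?z) + cmod (F ?z - F z)"
      using norm_triangle_ineq[of "F z' - F ?z" "F ?z - F z"] by simp
    ultimately show ?case using insert.hyps by (simp add: distrib_left)
  qed
  from this[OF I order_refl] show ?thesis using C by blast
qed

definition D :: "nat \<Rightarrow> ((nat \<Rightarrow> complex) \<Rightarrow> complex) \<Rightarrow> (nat \<Rightarrow> complex) \<Rightarrow> complex" where
  "D k F z = deriv (\<lambda>w. F (z(k := w))) (z k)"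

lemma D_upd: "D k F (z(k := w)) = deriv (\<lambda>w. F (z(k := w))) w"
  by (simp add: D_def)

text \<open>The Cauchy estimates depend on \<open>F\<close> only through its bound, so one constant
  serves all points and coordinates.\<close>

lemma an_taylor1:
  assumes F: "an I F a r" and s: "s < r"
  shows "\<exists>B\<ge>0. \<forall>z\<in>pd I a s. \<forall>k\<in>I. \<forall>w\<in>ball (a k) s.
    cmod (D k F z) \<le> B \<and> cmod (F (z(k := w)) - F z - D k F z * (w - z k)) \<le> B * (cmod (w - z k))\<^sup>2"
proof -
  obtain M where M: "M \<ge> 0" "\<And>z. z \<in> pd I a r \<Longrightarrow> cmod (F z) \<le> M" using an_bounded[OF F] by blast
  have sub: "pd I a s \<subseteq> pd I a r" by (rule pd_mono) (use s in simp)
  let ?\<rho> = "(r - s) / 2"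
  let ?B = "M / ?\<rho> + 2 * M / ?\<rho>\<^sup>2"
  have 0: "M / ?\<rho> \<ge> 0" "2 * M / ?\<rho>\<^sup>2 \<ge> 0" using M s by auto
  have "cmod (D k F z) \<le> M / ?\<rho>" and "cmod (F (z(k := w)) - F z - D k F z * (w - z k)) \<le> 2 * M / ?\<rho>\<^sup>2 * (cmod (w - z k))\<^sup>2"
    if z: "z \<in> pd I a s" and k: "k \<in> I" and w: "w \<in> ball (a k) s" for z k w
  proof -
    have h: "(\<lambda>w. F (z(k := w))) holomorphic_on ball (a k) r"
      by (rule an_hol[OF F]) (use z sub k in auto)
    have b: "cmod (F (z(k := v))) \<le> M" if "v \<in> ball (a k) r" for v
      by (rule M(2), rule pd_upd) (use z sub that in auto)
    from cauchy_estimates[OF h b s pd_coord[OF z k] w]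
    show "cmod (D k F z) \<le> M / ?\<rho>" "cmod (F (z(k := w)) - F z - D k F z * (w - z k)) \<le> 2 * M / ?\<rho>\<^sup>2 * (cmod (w - z k))\<^sup>2"
      by (simp_all add: D_def)
  qed
  then have "cmod (D k F z) \<le> ?B \<and> cmod (F (z(k := w)) - F z - D k F z * (w - z k)) \<le> ?B * (cmod (w - z k))\<^sup>2"
    if "z \<in> pd I a s" "k \<in> I" "w \<in> ball (a k) s" for z k w
    using that 0 mult_nonneg_nonneg[OF 0(1), of "(cmod (w - z k))\<^sup>2"] by (fastforce simp: distrib_right)
  then show ?thesis using 0 by (intro exI[of _ ?B]) auto
qed

text \<open>The second-order Taylor bound makes the error of the difference quotient at most a
  constant times the step. The steps are real, so that quotients at real points are real.\<close>

lemma D_quotient_limit: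
  assumes F: "an I F a r" and s: "0 < s" "s < r" and k: "k \<in> I"
  defines "h \<equiv> \<lambda>m. complex_of_real ((r - s) / (2 * (real m + 1)))"
  shows "uniform_limit (pd I a s) (\<lambda>m z. (F (z(k := z k + h m)) - F z) / h m) (D k F) sequentially"
    and "z \<in> pd I a s \<Longrightarrow> z(k := z k + h m) \<in> pd I a r" and "h m \<noteq> 0" and "h m \<in> \<real>"
proof -
  \<comment> \<open>Halfway radius: steps of size at most \<open>t - s\<close> lead from the
    polydisc of radius \<open>s\<close> into the one of radius \<open>t\<close>.\<close>
  define t where "t = (s + r) / 2"
  have t: "s < t" "t < r" using s by (auto simp: t_def)
  have hm: "cmod (h m) \<le> t - s" "h m \<noteq> 0" for m
  proof -
    have "(r - s) / (2 * (real m + 1)) \<le> (r - s) / 2" using s by (intro divide_left_mono) auto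
    moreover have "cmod (h m) = (r - s) / (2 * (real m + 1))"
      unfolding h_def norm_of_real using s by simp
    moreover have "(r - s) / 2 = t - s" by (simp add: t_def field_simps)
    ultimately show "cmod (h m) \<le> t - s" by simp
    show "h m \<noteq> 0" using s by (simp add: h_def del: of_real_divide of_real_diff)
  qed
  have zt: "z k + h m \<in> ball (a k) t" if "z \<in> pd I a s" for z m
  proof -
    have "cmod (z k - a k) < s" using that k by (simp add: pd_def)
    then show ?thesis using hm(1)[of m] norm_triangle_ineq[of "z k - a k" "h m"]
      by (simp add: dist_norm norm_minus_commute algebra_simps)
  qed
  show "h m \<noteq> 0" by (rule hm)
  show "h m \<in> \<real>" by (simp add: h_def)
  show "z(k := z k + h m) \<in> pd I a r" if "z \<in> pd I a s"
    by (rule pd_upd) (use that zt[OF that, of m] t pd_mono[of s r I a] in auto)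
  obtain B where B: "B \<ge> 0" "\<And>z w. z \<in> pd I a t \<Longrightarrow> w \<in> ball (a k) t \<Longrightarrow>
      cmod (F (z(k := w)) - F z - D k F z * (w - z k)) \<le> B * (cmod (w - z k))\<^sup>2"
    using an_taylor1[OF F t(2)] k by blast
  have est: "cmod ((F (z(k := z k + h m)) - F z) / h m - D k F z) \<le> B * cmod (h m)" if z: "z \<in> pd I a s" for z m
  proof -
    have "cmod (F (z(k := z k + h m)) - F z - D k F z * h m) \<le> B * (cmod (h m))\<^sup>2"
      using B(2)[OF _ zt[OF z], of z m] z pd_mono[of s t I a] t by auto
    moreover have "F (z(k := z k + h m)) - F z - D k F z * h m = h m * ((F (z(k := z k + h m)) - F z) / h m - D k F z)"
      using hm(2)[of m] by (simp add: field_simps)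
    ultimately have "cmod (h m) * cmod ((F (z(k := z k + h m)) - F z) / h m - D k F z) \<le> cmod (h m) * (B * cmod (h m))"
      by (simp add: norm_mult power2_eq_square mult.left_commute)
    then show ?thesis using hm(2)[of m] by simp
  qed
  have "(\<lambda>m. (r - s) / (2 * (real m + 1))) \<longlonglongrightarrow> 0" by real_asymp
  then have "(\<lambda>m. complex_of_real ((r - s) / (2 * (real m + 1)))) \<longlonglongrightarrow> complex_of_real 0" by (rule tendsto_of_real)
  then have "h \<longlonglongrightarrow> 0" unfolding h_def by (simp only: of_real_0)
  then have lim: "(\<lambda>m. B * cmod (h m)) \<longlonglongrightarrow> 0" by (intro tendsto_mult_right_zero tendsto_norm_zero)
  show "uniform_limit (pd I a s) (\<lambda>m z. (F (z(k := z k + h m)) - F z) / h m) (D k F) sequentially"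
  proof (rule uniform_limitI)
    fix e :: real assume "e > 0"
    then have "\<forall>\<^sub>F m in sequentially. B * cmod (h m) < e" using lim by (rule order_tendstoD(2)[rotated])
    then show "\<forall>\<^sub>F m in sequentially. \<forall>z\<in>pd I a s. dist ((F (z(k := z k + h m)) - F z) / h m) (D k F z) < e"
    proof eventually_elim
      case (elim m)
      then show ?case using est[of _ m] by (fastforce simp: dist_norm)
    qed
  qed
qed

lemma holomorphic_uniform_limit_ball:
  assumes f: "\<And>m::nat. f m holomorphic_on ball c r" and lim: "uniform_limit (ball c r) f g sequentially"
  shows "g holomorphic_on ball c r"
proof (rule holomorphic_uniform_sequence[where f = f])
  fix x assume "x \<in> ball c r"
  then obtain d where d: "d > 0" "cball x d \<subseteq> ball c r" using open_contains_cball open_ball by blast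
  then show "\<exists>d>0. cball x d \<subseteq> ball c r \<and> uniform_limit (cball x d) f g sequentially"
    using uniform_limit_on_subset[OF lim] by blast
qed (use f in auto)

text \<open>In coordinate \<open>k\<close> this is one-variable theory; in the others the derivative
  is a uniform limit of holomorphic difference quotients. Real values survive because the reals are
  closed.\<close>

lemma an_D:
  assumes F: "an I F a r" and s: "0 < s" "s < r" and k: "k \<in> I"
  shows "an I (D k F) a s"
proof -
  define h where "h = (\<lambda>m. complex_of_real ((r - s) / (2 * (real m + 1))))"
  let ?Q = "\<lambda>m z. (F (z(k := z k + h m)) - F z) / h m"
  have hd: "complex_of_real ((r - s) / (2 * (real m + 1))) = h m" for m by (simp add: h_def)
  note Q = D_quotient_limit[OF F s k, unfolded hd]
  have sub: "pd I a s \<subseteq> pd I a r" by (rule pd_mono) (use s in simp)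
  have bs: "ball (a i) s \<subseteq> ball (a i) r" for i using s by (intro subset_ball) simp
  obtain B where "\<And>z w. z \<in> pd I a s \<Longrightarrow> w \<in> ball (a k) s \<Longrightarrow> cmod (D k F z) \<le> B"
    using an_taylor1[OF F s(2)] k by blast
  then have "\<exists>B. \<forall>z\<in>pd I a s. cmod (D k F z) \<le> B" using pd_coord[OF _ k] by blast
  moreover have "(\<lambda>w. D k F (z(i := w))) holomorphic_on ball (a i) s" if z: "z \<in> pd I a s" and i: "i \<in> I" for z i
  proof (cases "i = k")
    case True
    have "deriv (\<lambda>w. F (z(k := w))) holomorphic_on ball (a k) r"
      by (rule holomorphic_deriv[OF an_hol[OF F]]) (use z sub k in auto)
    then show ?thesis using True bs holomorphic_on_subset by (auto simp: D_upd)
  next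
    case False
    show ?thesis
    proof (rule holomorphic_uniform_limit_ball)
      fix m
      have zk: "z(k := z k + h m) \<in> pd I a r" by (rule Q(2)[OF z])
      have "(\<lambda>w. F ((z(k := z k + h m))(i := w))) holomorphic_on ball (a i) s"
        by (rule holomorphic_on_subset[OF an_hol[OF F zk i] bs])
      moreover have "(\<lambda>w. F (z(i := w))) holomorphic_on ball (a i) s"
        by (rule holomorphic_on_subset[OF an_hol[OF F _ i] bs]) (use z sub in auto)
      moreover have "(\<lambda>w. ?Q m (z(i := w))) = (\<lambda>w. (F ((z(k := z k + h m))(i := w)) - F (z(i := w))) / h m)"
        using False by (simp add: fun_upd_twist)
      ultimately show "(\<lambda>w. ?Q m (z(i := w))) holomorphic_on ball (a i) s"
        using Q(3) by (auto intro!: holomorphic_intros)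
    next
      show "uniform_limit (ball (a i) s) (\<lambda>m w. ?Q m (z(i := w))) (\<lambda>w. D k F (z(i := w))) sequentially"
        by (rule uniform_limit_compose'[OF Q(1)]) (use z pd_upd in auto)
    qed
  qed
  moreover have "D k F z = D k F z'" if "\<And>i. i \<in> I \<Longrightarrow> z i = z' i" for z z'
  proof -
    have "F (z(k := w)) = F (z'(k := w))" for w by (rule an_dep[OF F]) (use that in simp)
    then show ?thesis using that[OF k] by (simp add: D_def)
  qed
  moreover have "D k F z \<in> \<real>" if z: "z \<in> pd I a s" and re: "\<And>i. i \<in> I \<Longrightarrow> z i \<in> \<real>" for z
  proof (rule Lim_in_closed_set)
    show "closed (\<real> :: complex set)" by (rule closed_complex_Reals)
    show "(\<lambda>m. ?Q m z) \<longlonglongrightarrow> D k F z" by (rule tendsto_uniform_limitI[OF Q(1) z])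
    show "\<forall>\<^sub>F m in sequentially. ?Q m z \<in> \<real>"
    proof (rule always_eventually, rule allI)
      fix m
      have "F (z(k := z k + h m)) \<in> \<real>"
        by (rule an_real[OF F Q(2)[OF z]]) (use re Q(4) k in auto)
      moreover have "F z \<in> \<real>" by (rule an_real[OF F]) (use z sub re in auto)
      ultimately show "?Q m z \<in> \<real>" using Q(4) by simp
    qed
  qed simp
  ultimately show ?thesis unfolding an_def by blast
qed

text \<open>Changing one coordinate at a time, the derivative at the intermediate point is replaced
  by the one at \<open>z\<close> at the cost of its Lipschitz bound, which is of second order in
  total.\<close>

lemma an_taylor:
  assumes F: "an I F a r" and I: "finite I" and s: "0 < s" "s < r"
  shows "\<exists>K\<ge>0. \<forall>z\<in>pd I a s. \<forall>z'\<in>pd I a s.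
    cmod (F z' - F z - (\<Sum>i\<in>I. D i F z * (z' i - z i))) \<le> K * (\<Sum>i\<in>I. cmod (z' i - z i))\<^sup>2"
proof -
  define t where "t = (s + r) / 2"
  have t: "s < t" "t < r" using s by (auto simp: t_def)
  obtain B where B: "B \<ge> 0" "\<And>z k w. z \<in> pd I a s \<Longrightarrow> k \<in> I \<Longrightarrow> w \<in> ball (a k) s \<Longrightarrow>
      cmod (F (z(k := w)) - F z - D k F z * (w - z k)) \<le> B * (cmod (w - z k))\<^sup>2"
    using an_taylor1[OF F s(2)] by blast
  have "\<forall>k\<in>I. \<exists>C\<ge>0. \<forall>z\<in>pd I a s. \<forall>z'\<in>pd I a s. cmod (D k F z' - D k F z) \<le> C * (\<Sum>i\<in>I. cmod (z' i - z i))"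
    using an_lipschitz[OF an_D[OF F _ t(2)] I t(1)] s t by auto
  from bchoice[OF this] obtain C where C: "\<And>k. k \<in> I \<Longrightarrow> C k \<ge> 0"
     "\<And>k z z'. k \<in> I \<Longrightarrow> z \<in> pd I a s \<Longrightarrow> z' \<in> pd I a s \<Longrightarrow> cmod (D k F z' - D k F z) \<le> C k * (\<Sum>i\<in>I. cmod (z' i - z i))"
    by blast
  \<comment> \<open>Lipschitz constants of all partial derivatives plus the one-variable Taylor
    constant.\<close>
  define K where "K = (\<Sum>k\<in>I. C k) + B"
  have K: "K \<ge> 0" "\<And>k. k \<in> I \<Longrightarrow> C k + B \<le> K"
    using C(1) B(1) I by (auto simp: K_def sum_nonneg intro!: member_le_sum)
  have "cmod (F z' - F z - (\<Sum>i\<in>J. D i F z * (z' i - z i))) \<le> K * (\<Sum>i\<in>I. cmod (z' i - z i)) * (\<Sum>i\<in>J. cmod (z' i - z i))"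
    if "finite J" "J \<subseteq> I" "z \<in> pd I a s" "z' \<in> pd I a s" "\<And>i. i \<in> I - J \<Longrightarrow> z' i = z i" for J z z'
    using that
  proof (induction J arbitrary: z' rule: finite_induct)
    case empty
    then show ?case using an_dep[OF F, of z' z] by simp
  next
    case (insert j J)
    let ?z = "z'(j := z j)"
    let ?S = "\<Sum>i\<in>I. cmod (z' i - z i)" and ?h = "cmod (z' j - z j)"
    have j: "j \<in> I" using insert.prems by simp
    have zb: "?z \<in> pd I a s" using insert.prems j by (intro pd_upd pd_coord) auto
    have S0: "?S \<ge> 0" by (simp add: sum_nonneg)
    have hS: "?h \<le> ?S" by (rule member_le_sum) (use j I in auto)
    have SS: "(\<Sum>i\<in>I. cmod (?z i - z i)) \<le> ?S" by (intro sum_mono) auto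
    have "cmod (F ?z - F z - (\<Sum>i\<in>J. D i F z * (?z i - z i))) \<le> K * (\<Sum>i\<in>I. cmod (?z i - z i)) * (\<Sum>i\<in>J. cmod (?z i - z i))"
      by (rule insert.IH[of ?z]) (use insert.prems zb in \<open>simp_all del: fun_upd_apply, auto\<close>)
    also have "\<dots> \<le> K * ?S * (\<Sum>i\<in>J. cmod (?z i - z i))"
      using SS K(1) by (intro mult_right_mono mult_left_mono) (auto simp: sum_nonneg)
    also have "(\<Sum>i\<in>J. cmod (?z i - z i)) = (\<Sum>i\<in>J. cmod (z' i - z i))"
      using insert.hyps by (intro sum.cong) auto
    finally have 1: "cmod (F ?z - F z - (\<Sum>i\<in>J. D i F z * (?z i - z i))) \<le> K * ?S * (\<Sum>i\<in>J. cmod (z' i - z i))" .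
    have e1: "(\<Sum>i\<in>J. D i F z * (?z i - z i)) = (\<Sum>i\<in>J. D i F z * (z' i - z i))"
      using insert.hyps by (intro sum.cong) auto
    have "cmod (F (?z(j := z' j)) - F ?z - D j F ?z * (z' j - ?z j)) \<le> B * (cmod (z' j - ?z j))\<^sup>2"
      by (rule B(2)[OF zb j]) (use pd_coord insert.prems j in auto)
    then have 2: "cmod (F z' - F ?z - D j F ?z * (z' j - z j)) \<le> B * ?h\<^sup>2" by simp
    have "cmod (D j F ?z - D j F z) \<le> C j * (\<Sum>i\<in>I. cmod (?z i - z i))"
      by (rule C(2)[OF j]) (use insert.prems zb in auto)
    also have "\<dots> \<le> C j * ?S" using SS C(1)[OF j] by (rule mult_left_mono)
    finally have "cmod ((D j F ?z - D j F z) * (z' j - z j)) \<le> C j * ?S * ?h"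
      by (simp add: norm_mult mult_right_mono)
    moreover have "B * ?h\<^sup>2 \<le> B * ?S * ?h"
      using hS B(1) by (simp add: power2_eq_square mult_left_mono mult_right_mono mult.assoc[symmetric])
    moreover have "C j * ?S * ?h + B * ?S * ?h \<le> K * ?S * ?h"
      using K(2)[OF j] S0 by (simp add: distrib_right[symmetric] mult_right_mono)
    ultimately have 3: "cmod (F z' - F ?z - D j F ?z * (z' j - z j)) + cmod ((D j F ?z - D j F z) * (z' j - z j)) \<le> K * ?S * ?h"
      using 2 by linarith
    let ?P = "F ?z - F z - (\<Sum>i\<in>J. D i F z * (z' i - z i))" and ?Q = "F z' - F ?z - D j F ?z * (z' j - z j)"
      and ?R = "(D j F ?z - D j F z) * (z' j - z j)"
    have "(\<Sum>i\<in>insert j J. D i F z * (z' i - z i)) = D j F z * (z' j - z j) + (\<Sum>i\<in>J. D i F z * (z' i - z i))"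
      using insert.hyps by simp
    then have eq: "F z' - F z - (\<Sum>i\<in>insert j J. D i F z * (z' i - z i)) = ?P + (?Q + ?R)"
      by (simp only:) (simp add: left_diff_distrib)
    have "cmod (?P + (?Q + ?R)) \<le> cmod ?P + (cmod ?Q + cmod ?R)"
      using norm_triangle_ineq[of ?P "?Q + ?R"] norm_triangle_ineq[of ?Q ?R] by linarith
    then have "cmod (F z' - F z - (\<Sum>i\<in>insert j J. D i F z * (z' i - z i))) \<le> cmod ?P + (cmod ?Q + cmod ?R)"
      by (simp only: eq)
    then have "cmod (F z' - F z - (\<Sum>i\<in>insert j J. D i F z * (z' i - z i))) \<le> K * ?S * (\<Sum>i\<in>J. cmod (z' i - z i)) + K * ?S * ?h"
      using 1[unfolded e1] 3 by linarith
    moreover have "K * ?S * (\<Sum>i\<in>insert j J. cmod (z' i - z i)) = K * ?S * (\<Sum>i\<in>J. cmod (z' i - z i)) + K * ?S * ?h"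
      using insert.hyps by (simp add: distrib_left)
    ultimately show ?case by simp
  qed
  from this[OF I order_refl] show ?thesis
    using K(1) by (intro exI[of _ K]) (auto simp: power2_eq_square mult.assoc)
qed

text \<open>The set \<open>J\<close> may omit \<open>k\<close>, which eliminates a coordinate, or
  contain it, which reuses its place for a new one. Holomorphy in a coordinate is a chain rule in
  two variables, derived from the Taylor bound in coordinate \<open>k\<close>.\<close>

lemma an_subst:
  assumes F: "an I F a r" and I: "finite I" and k: "k \<in> I" and chi: "an J chi b r'"
    and J: "I - {k} \<subseteq> J" and ab: "\<And>i. i \<in> I - {k} \<Longrightarrow> b i = a i" and r': "0 < r'" "r' \<le> r"
    and val: "\<And>z. z \<in> pd J b r' \<Longrightarrow> cmod (chi z - a k) < r"
  shows "an J (\<lambda>z. F (z(k := chi z))) b r'"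
proof -
  have inpd: "z(k := chi z) \<in> pd I a r" if z: "z \<in> pd J b r'" for z
  proof -
    have "cmod (z i - a i) < r" if "i \<in> I" "i \<noteq> k" for i
    proof -
      have "cmod (z i - b i) < r'" using z J that by (auto simp: pd_def)
      then show ?thesis using ab[of i] that r' by simp
    qed
    then show ?thesis using val[OF z] by (simp add: pd_def)
  qed
  obtain M where "\<forall>z\<in>pd I a r. cmod (F z) \<le> M" using an_bounded[OF F] by blast
  then have "\<exists>M. \<forall>z\<in>pd J b r'. cmod (F (z(k := chi z))) \<le> M" using inpd by blast
  moreover have "(\<lambda>w. F ((z(i := w))(k := chi (z(i := w))))) holomorphic_on ball (b i) r'"
    if z: "z \<in> pd J b r'" and i: "i \<in> J" for z i
  proof -
    define c where "c w = chi (z(i := w))" for w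
    have zi: "z(i := w) \<in> pd J b r'" if "w \<in> ball (b i) r'" for w by (rule pd_upd[OF z that])
    have c: "c holomorphic_on ball (b i) r'" unfolding c_def by (rule an_hol[OF chi z i])
    have cval: "c w \<in> ball (a k) r" if "w \<in> ball (b i) r'" for w
      using val[OF zi[OF that]] by (simp add: c_def dist_norm norm_minus_commute)
    show ?thesis
    proof (cases "i = k \<or> i \<notin> I")
      case True
      \<comment> \<open>Here coordinate \<open>i\<close> reaches \<open>F\<close> only through
        \<open>chi\<close>, so the claim is a composition of one-variable functions.\<close>
      have eq: "F ((z(i := w))(k := v)) = F (z(k := v))" for w v
        by (rule an_dep[OF F]) (use True in auto)
      have "(\<lambda>v. F (z(k := v))) holomorphic_on ball (a k) r"
        using an_hol[OF F inpd[OF z] k] by simp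
      then have "((\<lambda>v. F (z(k := v))) \<circ> c) holomorphic_on ball (b i) r'"
        by (rule holomorphic_on_compose_gen[OF c]) (use cval in auto)
      then show ?thesis by (simp add: eq comp_def c_def)
    next
      case False
      then have ik: "i \<noteq> k" "i \<in> I" by auto
      have "(\<lambda>w. F ((z(i := w))(k := c w))) field_differentiable (at \<zeta>)" if \<zeta>: "\<zeta> \<in> ball (b i) r'" for \<zeta>
      proof -
        define z0 where "z0 = (z(i := \<zeta>))(k := c \<zeta>)"
        have z0: "z0 \<in> pd I a r" using inpd[OF zi[OF \<zeta>]] by (simp add: z0_def c_def)
        obtain s where s: "0 < s" "s < r" "z0 \<in> pd I a s" using pd_shrink[OF I z0] r' by auto
        have upd: "(z(i := w))(k := v) = (z0(i := w))(k := v)" for w v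
          using ik by (auto simp: z0_def fun_eq_iff)
        have upd0: "(z0(i := w))(k := c \<zeta>) = z0(i := w)" for w using ik by (auto simp: z0_def fun_eq_iff)
        define A where "A w = F (z0(i := w))" for w
        define P where "P w = D k F (z0(i := w))" for w
        obtain B where B: "\<And>z w. z \<in> pd I a s \<Longrightarrow> w \<in> ball (a k) s \<Longrightarrow>
           cmod (F (z(k := w)) - F z - D k F z * (w - z k)) \<le> B * (cmod (w - z k))\<^sup>2"
          using an_taylor1[OF F s(2)] k by blast
        have \<zeta>s: "\<zeta> \<in> ball (a i) s" using pd_coord[OF s(3) ik(2)] ik by (simp add: z0_def)
        have cs: "c \<zeta> \<in> ball (a k) s" using pd_coord[OF s(3) k] by (simp add: z0_def)
        have derA: "(A has_field_derivative deriv A \<zeta>) (at \<zeta>)"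
          unfolding A_def
          by (rule holomorphic_derivI[OF an_hol[OF F z0 ik(2)]]) (use \<zeta>s s in auto)
        have derc: "(c has_field_derivative deriv c \<zeta>) (at \<zeta>)"
          by (rule holomorphic_derivI[OF c]) (use \<zeta> in auto)
        have contP: "P \<midarrow>\<zeta>\<rightarrow> P \<zeta>"
        proof -
          have "P holomorphic_on ball (a i) s"
            unfolding P_def by (rule an_hol[OF an_D[OF F s(1,2) k] s(3) ik(2)])
          then have "continuous_on (ball (a i) s) P" by (rule holomorphic_on_imp_continuous_on)
          then show ?thesis using \<zeta>s by (simp add: continuous_on_eq_continuous_at isCont_def)
        qed
        have contc: "c \<midarrow>\<zeta>\<rightarrow> c \<zeta>" using DERIV_isCont[OF derc] by (simp add: isCont_def)
        let ?q = "\<lambda>w. (c w - c \<zeta>) / (w - \<zeta>)"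
        \<comment> \<open>The error of linearizing \<open>F\<close> in coordinate \<open>k\<close>.
          The difference quotient splits into the direct part from \<open>A\<close>, the part
          \<open>P w\<close> times the quotient of \<open>c\<close>, and \<open>E w\<close>, which
          tends to 0 by the quadratic bound.\<close>
        define E where "E w = (F ((z0(i := w))(k := c w)) - A w - P w * (c w - c \<zeta>)) / (w - \<zeta>)" for w
        have q: "?q \<midarrow>\<zeta>\<rightarrow> deriv c \<zeta>" using derc by (simp add: has_field_derivative_iff)
        have "((\<lambda>w. B * cmod (?q w) * cmod (c w - c \<zeta>)) \<longlongrightarrow> B * cmod (deriv c \<zeta>) * cmod (c \<zeta> - c \<zeta>)) (at \<zeta>)"
          by (intro tendsto_intros q contc)
        then have lim0: "((\<lambda>w. B * cmod (?q w) * cmod (c w - c \<zeta>)) \<longlongrightarrow> 0) (at \<zeta>)" by simp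
        have near1: "\<forall>\<^sub>F w in at \<zeta>. w \<in> ball (a i) s"
          using \<zeta>s by (intro eventually_at_in_open') auto
        have near2: "\<forall>\<^sub>F w in at \<zeta>. c w \<in> ball (a k) s"
          using contc cs by (intro topological_tendstoD) auto
        have "\<forall>\<^sub>F w in at \<zeta>. cmod (E w) \<le> B * cmod (?q w) * cmod (c w - c \<zeta>)"
          using near1 near2
        proof eventually_elim
          case (elim w)
          have w: "z0(i := w) \<in> pd I a s" by (rule pd_upd[OF s(3) elim(1)])
          have z0k: "(z0(i := w)) k = c \<zeta>" using ik by (simp add: z0_def)
          have "cmod (F ((z0(i := w))(k := c w)) - A w - P w * (c w - c \<zeta>)) \<le> B * (cmod (c w - c \<zeta>))\<^sup>2"
            using B[OF w elim(2)] z0k by (simp only: A_def P_def)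
          then have "cmod (E w) \<le> B * (cmod (c w - c \<zeta>))\<^sup>2 / cmod (w - \<zeta>)"
            unfolding E_def norm_divide by (rule divide_right_mono) simp
          then show ?case by (simp add: norm_divide power2_eq_square)
        qed
        then have E0: "E \<midarrow>\<zeta>\<rightarrow> 0" by (rule Lim_null_comparison[OF _ lim0])
        have A\<zeta>: "A \<zeta> = F ((z0(i := \<zeta>))(k := c \<zeta>))" by (simp add: A_def upd0)
        have "(\<lambda>w. (A w - A \<zeta>) / (w - \<zeta>) + P w * ?q w + E w) \<midarrow>\<zeta>\<rightarrow> deriv A \<zeta> + P \<zeta> * deriv c \<zeta> + 0"
          using derA by (intro tendsto_intros q contP E0) (simp add: has_field_derivative_iff)
        moreover have "(A w - A \<zeta>) / (w - \<zeta>) + P w * ?q w + E w = (F ((z0(i := w))(k := c w)) - A \<zeta>) / (w - \<zeta>)" for w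
          by (simp add: E_def add_divide_distrib[symmetric])
        ultimately have "((\<lambda>w. F ((z0(i := w))(k := c w))) has_field_derivative (deriv A \<zeta> + P \<zeta> * deriv c \<zeta>)) (at \<zeta>)"
          by (simp add: has_field_derivative_iff A\<zeta>[symmetric])
        then show ?thesis unfolding upd by (auto simp: field_differentiable_def)
      qed
      then show ?thesis
        unfolding holomorphic_on_def c_def by (blast intro: field_differentiable_at_within)
    qed
  qed
  moreover have "F (z(k := chi z)) = F (z'(k := chi z'))" if zz: "\<And>i. i \<in> J \<Longrightarrow> z i = z' i" for z z'
  proof -
    have "chi z = chi z'" by (rule an_dep[OF chi zz])
    then show ?thesis by (intro an_dep[OF F]) (use zz J in auto)
  qed
  moreover have "F (z(k := chi z)) \<in> \<real>" if z: "z \<in> pd J b r'" and re: "\<And>i. i \<in> J \<Longrightarrow> z i \<in> \<real>" for z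
    by (rule an_real[OF F inpd[OF z]]) (use re J an_real[OF chi z re] in auto)
  ultimately show ?thesis unfolding an_def by blast
qed

section \<open>Closure properties for the fixed-point iteration\<close>

lemma an_const: "c \<in> \<real> \<Longrightarrow> an I (\<lambda>z. c) a r"
  unfolding an_def by (auto intro!: exI[of _ "cmod c"] holomorphic_intros)

lemma an_coord: "k \<in> I \<Longrightarrow> an I (\<lambda>z. z k) a r"
proof -
  assume k: "k \<in> I"
  have "cmod (z k) \<le> cmod (a k) + r" if "z \<in> pd I a r" for z
    using that k norm_triangle_ineq[of "z k - a k" "a k"] by (fastforce simp: pd_def)
  moreover have "(\<lambda>w. (z(i := w)) k) holomorphic_on ball (a i) r" for z i
    by (cases "i = k") (auto intro!: holomorphic_intros)
  ultimately show ?thesis using k unfolding an_def by blast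
qed

lemma an_diff: "an I F a r \<Longrightarrow> an I G a r \<Longrightarrow> an I (\<lambda>z. F z - G z) a r"
proof -
  assume F: "an I F a r" and G: "an I G a r"
  obtain M N where "\<forall>z\<in>pd I a r. cmod (F z) \<le> M" "\<forall>z\<in>pd I a r. cmod (G z) \<le> N"
    using an_bounded[OF F] an_bounded[OF G] by blast
  then have "\<forall>z\<in>pd I a r. cmod (F z - G z) \<le> M + N" by (metis add_mono norm_triangle_le_diff)
  moreover have "\<forall>z\<in>pd I a r. \<forall>i\<in>I. (\<lambda>w. F (z(i := w)) - G (z(i := w))) holomorphic_on ball (a i) r"
    using an_hol[OF F] an_hol[OF G] by (auto intro!: holomorphic_intros)
  moreover have "\<forall>z z'. (\<forall>i\<in>I. z i = z' i) \<longrightarrow> F z - G z = F z' - G z'"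
    using F G unfolding an_def by metis
  moreover have "\<forall>z\<in>pd I a r. (\<forall>i\<in>I. z i \<in> \<real>) \<longrightarrow> F z - G z \<in> \<real>"
    using an_real[OF F] an_real[OF G] by (simp add: Reals_diff)
  ultimately show ?thesis unfolding an_def by blast
qed

lemma an_cdiv: "an I F a r \<Longrightarrow> c \<in> \<real> \<Longrightarrow> an I (\<lambda>z. F z / c) a r"
proof -
  assume F: "an I F a r" and c: "c \<in> \<real>"
  obtain M where "\<forall>z\<in>pd I a r. cmod (F z) \<le> M" using an_bounded[OF F] by blast
  then have "\<forall>z\<in>pd I a r. cmod (F z / c) \<le> M / cmod c" by (simp add: norm_divide divide_right_mono)
  moreover have "(\<lambda>w. F (z(i := w)) / c) holomorphic_on ball (a i) r" if "z \<in> pd I a r" "i \<in> I" for z i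
  proof (cases "c = 0")
    case False
    then show ?thesis using an_hol[OF F that] by (auto intro!: holomorphic_intros)
  qed simp
  moreover have "\<forall>z z'. (\<forall>i\<in>I. z i = z' i) \<longrightarrow> F z / c = F z' / c"
    using F unfolding an_def by metis
  moreover have "\<forall>z\<in>pd I a r. (\<forall>i\<in>I. z i \<in> \<real>) \<longrightarrow> F z / c \<in> \<real>"
    using an_real[OF F] c by (simp add: Reals_divide)
  ultimately show ?thesis unfolding an_def by blast
qed

text \<open>Convergence controls \<open>g\<close> on the polydisc only, so its independence of other
  coordinates everywhere is a separate assumption.\<close>

lemma an_uniform_limit:
  assumes f: "\<And>m::nat. an I (f m) a r" and lim: "uniform_limit (pd I a r) f g sequentially"
    and dep: "\<And>z z'. (\<And>i. i \<in> I \<Longrightarrow> z i = z' i) \<Longrightarrow> g z = g z'"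
  shows "an I g a r"
proof -
  have "\<forall>\<^sub>F m in sequentially. \<forall>z\<in>pd I a r. dist (f m z) (g z) < 1"
    using lim by (rule uniform_limitD) simp
  then obtain m where m: "\<And>z. z \<in> pd I a r \<Longrightarrow> dist (f m z) (g z) < 1"
    by (auto simp: eventually_sequentially)
  obtain M where M: "\<forall>z\<in>pd I a r. cmod (f m z) \<le> M" using an_bounded[OF f] by blast
  have "cmod (g z) \<le> M + 1" if "z \<in> pd I a r" for z
    using m[OF that] bspec[OF M that] norm_triangle_ineq2[of "g z" "f m z"] by (simp add: dist_norm norm_minus_commute)
  moreover have "(\<lambda>w. g (z(i := w))) holomorphic_on ball (a i) r" if z: "z \<in> pd I a r" and i: "i \<in> I" for z i
  proof (rule holomorphic_uniform_limit_ball)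
    show "(\<lambda>w. f m (z(i := w))) holomorphic_on ball (a i) r" for m by (rule an_hol[OF f z i])
    show "uniform_limit (ball (a i) r) (\<lambda>m w. f m (z(i := w))) (\<lambda>w. g (z(i := w))) sequentially"
      by (rule uniform_limit_compose'[OF lim]) (use z pd_upd in auto)
  qed
  moreover have "g z \<in> \<real>" if z: "z \<in> pd I a r" and re: "\<And>i. i \<in> I \<Longrightarrow> z i \<in> \<real>" for z
  proof (rule Lim_in_closed_set)
    show "closed (\<real> :: complex set)" by (rule closed_complex_Reals)
    show "(\<lambda>m. f m z) \<longlonglongrightarrow> g z" by (rule tendsto_uniform_limitI[OF lim z])
    show "\<forall>\<^sub>F m in sequentially. f m z \<in> \<real>"
      using an_real[OF f z re] by (simp add: always_eventually)
  qed simp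
  ultimately show ?thesis using dep unfolding an_def by blast
qed

text \<open>
  The solution of \<open>h (z(k := w)) = t\<close> is the fixed point of \<open>w \<mapsto> w - (h (z(k := w)) - t) / A\<close>, a
  uniform limit of functions obtained by substitution; the coordinate \<open>k\<close> of \<open>z\<close> plays the role
  of \<open>t\<close>.
\<close>

lemma an_implicit:
  assumes h: "an I h a r" and I: "finite I" and r: "0 < r" and k: "k \<in> I"
    and a: "\<And>i. i \<in> I \<Longrightarrow> a i \<in> \<real>" and nz: "D k h a \<noteq> 0"
  shows "\<exists>chi r' s. 0 < r' \<and> r' \<le> r \<and> 0 < s \<and> s \<le> r \<and> an I chi (a(k := h a)) r' \<and>
    (\<forall>z\<in>pd I (a(k := h a)) r'. cmod (chi z - a k) < r \<and> h (z(k := chi z)) = z k) \<and>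
    (\<forall>z\<in>pd I a s. z(k := h z) \<in> pd I (a(k := h a)) r' \<and> chi (z(k := h z)) = z k)"
proof -
  define A where "A = D k h a"
  define n where "n = real (card I)"
  define b where "b = a(k := h a)"
  have hr2: "0 < r / 2" "r / 2 < r" "r / 4 < r / 2" using r by auto
  have n: "n \<ge> 1" using k I by (auto simp: n_def Suc_le_eq card_gt_0_iff)
  \<comment> \<open>Division by a real number keeps the iterates real at real points.\<close>
  have Areal: "A \<in> \<real>" unfolding A_def
    by (rule an_real[OF an_D[OF h hr2(1,2) k]]) (use a r pd_center in auto)
  obtain C where C: "C \<ge> 0" "\<And>z z'. z \<in> pd I a (r / 4) \<Longrightarrow> z' \<in> pd I a (r / 4) \<Longrightarrow>
      cmod (D k h z' - D k h z) \<le> C * (\<Sum>i\<in>I. cmod (z' i - z i))"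
    using an_lipschitz[OF an_D[OF h hr2(1,2) k] I hr2(3)] by blast
  obtain C0 where C0: "C0 \<ge> 0" "\<And>z z'. z \<in> pd I a (r / 2) \<Longrightarrow> z' \<in> pd I a (r / 2) \<Longrightarrow>
      cmod (h z' - h z) \<le> C0 * (\<Sum>i\<in>I. cmod (z' i - z i))"
    using an_lipschitz[OF h I hr2(2)] by blast
  have sum_le: "(\<Sum>i\<in>I. cmod (z i - a i)) \<le> n * \<rho>" if "z \<in> pd I a \<rho>" for z \<rho>
    unfolding n_def using that by (intro sum_bounded_above) (auto simp: pd_def)
  \<comment> \<open>On this polydisc the derivative in coordinate \<open>k\<close> stays within half
    of \<open>cmod A\<close> from \<open>A\<close>, which makes the contraction factor 1/2.\<close>
  define \<rho> where "\<rho> = min (r / 4) (cmod A / 2 / ((C + 1) * n))"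
  have Apos: "cmod A > 0" using nz by (simp add: A_def)
  have \<rho>: "0 < \<rho>" "\<rho> \<le> r / 4" "C * n * \<rho> \<le> cmod A / 2"
  proof -
    show "0 < \<rho>" using r Apos C(1) n by (auto simp: \<rho>_def)
    show "\<rho> \<le> r / 4" unfolding \<rho>_def by (rule min.cobounded1)
    have "C * n * \<rho> \<le> (C + 1) * n * \<rho>" using \<open>0 < \<rho>\<close> n by (simp add: distrib_right)
    also have "\<dots> \<le> (C + 1) * n * (cmod A / 2 / ((C + 1) * n))"
      using C(1) n by (intro mult_left_mono) (auto simp: \<rho>_def)
    also have "\<dots> = cmod A / 2" using C(1) n by simp
    finally show "C * n * \<rho> \<le> cmod A / 2" .
  qed
  have DA: "cmod (D k h z - A) \<le> cmod A / 2" if z: "z \<in> pd I a \<rho>" for z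
  proof -
    have "cmod (D k h z - A) \<le> C * (\<Sum>i\<in>I. cmod (z i - a i))"
      unfolding A_def by (rule C(2)) (use z pd_mono[OF \<rho>(2)] r pd_center in auto)
    also have "\<dots> \<le> C * (n * \<rho>)" using sum_le[OF z] C(1) by (rule mult_left_mono)
    finally show ?thesis using \<rho>(3) by simp
  qed
  \<comment> \<open>The map moves the centre by at most \<open>\<rho> / 4\<close>; with contraction
    factor 1/2 the closed disc of radius \<open>\<rho> / 2\<close> is then mapped into
    itself.\<close>
  define r' where "r' = min (\<rho> / 2) (\<rho> * cmod A / 4 / (C0 * n + 1))"
  have C0n: "C0 * n \<ge> 0" using C0(1) n by simp
  have cancel: "(C0 * n + 1) * (y / (C0 * n + 1)) = y" for y
  proof -
    have "C0 * n + 1 \<noteq> 0" using C0n by linarith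
    then show ?thesis by simp
  qed
  have r': "0 < r'" "r' \<le> \<rho> / 2" "C0 * n * r' + r' \<le> \<rho> * cmod A / 4"
  proof -
    show "0 < r'" using \<rho> Apos C0n by (auto simp: r'_def add_nonneg_pos)
    show "r' \<le> \<rho> / 2" unfolding r'_def by (rule min.cobounded1)
    have "C0 * n * r' + r' = (C0 * n + 1) * r'" by (simp add: distrib_right)
    also have "\<dots> \<le> (C0 * n + 1) * (\<rho> * cmod A / 4 / (C0 * n + 1))"
      using C0n by (intro mult_left_mono) (auto simp: r'_def)
    also have "\<dots> = \<rho> * cmod A / 4" by (rule cancel)
    finally show "C0 * n * r' + r' \<le> \<rho> * cmod A / 4" .
  qed
  define T where "T z w = w - (h (z(k := w)) - z k) / A" for z w
  let ?B = "cball (a k) (\<rho> / 2)"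
  have zk: "z(k := w) \<in> pd I a \<rho>" if z: "z \<in> pd I b r'" and w: "w \<in> ball (a k) \<rho>" for z w
    using z w r' \<rho>(1) by (fastforce simp: pd_def b_def dist_norm norm_minus_commute split: if_splits)
  have B\<rho>: "?B \<subseteq> ball (a k) \<rho>" using \<rho>(1) by auto
  have contr: "cmod (T z w - T z w') \<le> 1 / 2 * cmod (w - w')"
    if z: "z \<in> pd I b r'" and w: "w \<in> ball (a k) \<rho>" "w' \<in> ball (a k) \<rho>" for z w w'
  proof (rule field_differentiable_bound[of "ball (a k) \<rho>" _ "\<lambda>w. 1 - D k h (z(k := w)) / A"])
    fix v assume v: "v \<in> ball (a k) \<rho>"
    have zv: "z(k := v) \<in> pd I a \<rho>" by (rule zk[OF z v])
    have zvr: "z(k := v) \<in> pd I a r" using zv pd_mono[of \<rho> r I a] \<rho>(2) r by auto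
    have "(\<lambda>w. h (z(k := w))) holomorphic_on ball (a k) r"
      using an_hol[OF h zvr k] by simp
    then have "((\<lambda>w. h (z(k := w))) has_field_derivative D k h (z(k := v))) (at v)"
      unfolding D_upd by (rule holomorphic_derivI) (use pd_coord[OF zvr k] in auto)
    then have "(T z has_field_derivative 1 - D k h (z(k := v)) / A) (at v)"
      unfolding T_def[abs_def] using Apos by (auto intro!: derivative_eq_intros)
    then show "(T z has_field_derivative 1 - D k h (z(k := v)) / A) (at v within ball (a k) \<rho>)"
      by (rule has_field_derivative_at_within)
    have "1 - D k h (z(k := v)) / A = (A - D k h (z(k := v))) / A" using Apos by (simp add: diff_divide_distrib)
    then have "cmod (1 - D k h (z(k := v)) / A) = cmod (D k h (z(k := v)) - A) / cmod A"
      by (simp add: norm_divide norm_minus_commute)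
    also have "\<dots> \<le> (cmod A / 2) / cmod A" using DA[OF zv] by (rule divide_right_mono) simp
    also have "\<dots> = 1 / 2" using Apos by simp
    finally show "cmod (1 - D k h (z(k := v)) / A) \<le> 1 / 2" .
  qed (use w in auto)
  have Tcenter: "cmod (T z (a k) - a k) \<le> \<rho> / 4" if z: "z \<in> pd I b r'" for z
  proof -
    have z1: "z(k := a k) \<in> pd I a r'"
      using z r'(1) by (fastforce simp: pd_def b_def split: if_splits)
    have "cmod (h (z(k := a k)) - h a) \<le> C0 * (\<Sum>i\<in>I. cmod ((z(k := a k)) i - a i))"
      by (rule C0(2)) (use z1 pd_mono[of r' "r / 2" I a] r'(2) \<rho>(2) r pd_center in auto)
    also have "\<dots> \<le> C0 * (n * r')" using sum_le[OF z1] C0(1) by (rule mult_left_mono)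
    finally have 1: "cmod (h (z(k := a k)) - h a) \<le> C0 * n * r'" by simp
    have 2: "cmod (h a - z k) \<le> r'" using z k by (auto simp: pd_def b_def norm_minus_commute)
    have "cmod (h (z(k := a k)) - z k) \<le> \<rho> * cmod A / 4"
      using 1 2 r'(3) norm_triangle_ineq[of "h (z(k := a k)) - h a" "h a - z k"] by simp
    then have "cmod (h (z(k := a k)) - z k) / cmod A \<le> (\<rho> * cmod A / 4) / cmod A"
      by (rule divide_right_mono) simp
    moreover have "cmod (T z (a k) - a k) = cmod (h (z(k := a k)) - z k) / cmod A"
      by (simp add: T_def norm_divide)
    ultimately show ?thesis using Apos by simp
  qed
  have Tmap: "T z w \<in> ?B" if z: "z \<in> pd I b r'" and w: "w \<in> ?B" for z w
  proof -
    have "cmod (T z w - T z (a k)) \<le> 1 / 2 * cmod (w - a k)"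
      by (rule contr[OF z]) (use w B\<rho> \<rho> in auto)
    moreover have "cmod (w - a k) \<le> \<rho> / 2" using w by (simp add: dist_norm norm_minus_commute)
    ultimately have "cmod (T z w - a k) \<le> \<rho> / 2"
      using Tcenter[OF z] norm_triangle_ineq[of "T z w - T z (a k)" "T z (a k) - a k"] by simp
    then show ?thesis by (simp add: dist_norm norm_minus_commute)
  qed
  define chi where "chi z = (SOME w. w \<in> ?B \<and> T z w = w)" for z
  have ex1: "\<exists>!w\<in>?B. T z w = w" if z: "z \<in> pd I b r'" for z
  proof (rule Banach_fix[where c = "1 / 2"])
    show "dist (T z w) (T z w') \<le> 1 / 2 * dist w w'" if "w \<in> ?B" "w' \<in> ?B" for w w'
      unfolding dist_norm by (rule contr[OF z]) (use that B\<rho> in blast)+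
  qed (use Tmap[OF z] \<rho>(1) complete_eq_closed in auto)
  have chi: "chi z \<in> ?B" "T z (chi z) = chi z" if z: "z \<in> pd I b r'" for z
    using someI_ex[of "\<lambda>w. w \<in> ?B \<and> T z w = w"] ex1[OF z] unfolding chi_def by blast+
  \<comment> \<open>Iterates of the contraction starting at the constant \<open>a k\<close>; each is
    obtained from the previous one by substitution into \<open>h\<close>, and they converge
    geometrically, uniformly in \<open>z\<close>.\<close>
  define f where "f m = rec_nat (\<lambda>z. a k) (\<lambda>_ g z. T z (g z)) m" for m :: nat
  have f0: "f 0 = (\<lambda>z. a k)" and fS: "f (Suc m) = (\<lambda>z. T z (f m z))" for m
    by (simp_all add: f_def)
  have fB: "f m z \<in> ?B" if z: "z \<in> pd I b r'" for m z
    by (induction m) (use \<rho>(1) Tmap[OF z] in \<open>auto simp: f0 fS simp del: mem_cball\<close>)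
  have near: "cmod (f m z - chi z) \<le> (1 / 2) ^ m * \<rho>" if z: "z \<in> pd I b r'" for m z
  proof (induction m)
    case 0
    then show ?case using chi(1)[OF z] \<rho>(1) by (simp add: f0 dist_norm)
  next
    case (Suc m)
    have "cmod (T z (f m z) - T z (chi z)) \<le> 1 / 2 * cmod (f m z - chi z)"
      by (rule contr[OF z]) (use fB[OF z] chi(1)[OF z] B\<rho> in blast)+
    then show ?case using Suc chi(2)[OF z] by (simp add: fS)
  qed
  have fan: "an I (f m) b r'" for m
  proof (induction m)
    case 0
    then show ?case using a[OF k] by (simp add: f0 an_const)
  next
    case (Suc m)
    have "an I (\<lambda>z. h (z(k := f m z))) b r'"
    proof (rule an_subst[OF h I k Suc])
      show "cmod (f m z - a k) < r" if "z \<in> pd I b r'" for z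
        using fB[OF that, of m] \<rho> r by (simp add: dist_norm norm_minus_commute)
    qed (use r' \<rho> r in \<open>auto simp: b_def\<close>)
    then have "an I (\<lambda>z. f m z - (h (z(k := f m z)) - z k) / A) b r'"
      by (intro an_diff an_cdiv an_coord Suc k Areal)
    then show ?case by (simp add: fS T_def)
  qed
  have "an I chi b r'"
  proof (rule an_uniform_limit[OF fan])
    have "(\<lambda>m. (1 / 2 :: real) ^ m * \<rho>) \<longlonglongrightarrow> 0 * \<rho>" by (intro tendsto_mult_right LIMSEQ_power_zero) simp
    then have lim: "(\<lambda>m. (1 / 2 :: real) ^ m * \<rho>) \<longlonglongrightarrow> 0" by simp
    show "uniform_limit (pd I b r') f chi sequentially"
    proof (rule uniform_limitI)
      fix e :: real assume "e > 0"
      with lim have "\<forall>\<^sub>F m in sequentially. (1 / 2) ^ m * \<rho> < e" by (rule order_tendstoD(2))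
      then show "\<forall>\<^sub>F m in sequentially. \<forall>z\<in>pd I b r'. dist (f m z) (chi z) < e"
      proof eventually_elim
        case (elim m)
        show ?case
        proof
          fix z assume z: "z \<in> pd I b r'"
          show "dist (f m z) (chi z) < e"
            unfolding dist_norm using near[OF z, of m] elim by (rule le_less_trans)
        qed
      qed
    qed
    fix z z' :: "nat \<Rightarrow> complex" assume zz: "\<And>i. i \<in> I \<Longrightarrow> z i = z' i"
    have "h (z(k := w)) = h (z'(k := w))" for w by (rule an_dep[OF h]) (use zz in simp)
    then have "T z = T z'" using zz[OF k] by (simp add: T_def fun_eq_iff)
    then show "chi z = chi z'" by (simp add: chi_def)
  qed
  moreover have "cmod (chi z - a k) < r \<and> h (z(k := chi z)) = z k" if z: "z \<in> pd I b r'" for z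
    using chi[OF z] \<rho> r Apos by (auto simp: T_def dist_norm norm_minus_commute)
  \<comment> \<open>So small that \<open>h z\<close> stays within \<open>r'\<close> of
    \<open>h a\<close>; uniqueness of the fixed point then shows that \<open>chi\<close> recovers
    the coordinate \<open>k\<close> from the value of \<open>h\<close>.\<close>
  moreover define s where "s = min r' (r' / 2 / (C0 * n + 1))"
  have s: "0 < s" "s \<le> r'" "C0 * n * s < r'"
  proof -
    show "0 < s" "s \<le> r'" using r' C0n by (auto simp: s_def add_nonneg_pos)
    have "C0 * n * s \<le> (C0 * n + 1) * s" using \<open>0 < s\<close> by simp
    also have "\<dots> \<le> (C0 * n + 1) * (r' / 2 / (C0 * n + 1))"
      using C0n by (intro mult_left_mono) (auto simp: s_def)
    also have "\<dots> = r' / 2" by (rule cancel)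
    finally show "C0 * n * s < r'" using r'(1) by simp
  qed
  have "z(k := h z) \<in> pd I b r' \<and> chi (z(k := h z)) = z k" if z: "z \<in> pd I a s" for z
  proof -
    have "cmod (h z - h a) \<le> C0 * (\<Sum>i\<in>I. cmod (z i - a i))"
      by (rule C0(2)) (use z pd_mono[of s "r / 2" I a] s r' \<rho> r pd_center in auto)
    also have "\<dots> \<le> C0 * (n * s)" using sum_le[OF z] C0(1) by (rule mult_left_mono)
    finally have "cmod (h z - h a) < r'" using s(3) by simp
    then have z': "z(k := h z) \<in> pd I b r'"
      using z s(2) by (fastforce simp: pd_def b_def)
    have "cmod (z k - a k) < s" using z k by (simp add: pd_def)
    then have "z k \<in> ?B" using s(2) r'(2) by (simp add: dist_norm norm_minus_commute)
    moreover have "T (z(k := h z)) (z k) = z k" by (simp add: T_def)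
    ultimately show ?thesis using chi[OF z'] ex1[OF z'] z' by blast
  qed
  ultimately show ?thesis
    unfolding b_def[symmetric] using r' \<rho> s r by (intro exI[of _ chi] exI[of _ r'] exI[of _ s]) auto
qed

section \<open>Iterated partial derivatives and flatness\<close>

primrec Dw :: "nat list \<Rightarrow> ((nat \<Rightarrow> complex) \<Rightarrow> complex) \<Rightarrow> (nat \<Rightarrow> complex) \<Rightarrow> complex" where
  "Dw [] F = F"
| "Dw (k # w) F = D k (Dw w F)"

text \<open>Each differentiation shrinks the polydisc; any radius below \<open>r\<close> is reached
  by stopping halfway before it.\<close>

lemma an_Dw:
  assumes "an I F a r"
  shows "set w \<subseteq> I \<Longrightarrow> 0 < s \<Longrightarrow> s < r \<Longrightarrow> an I (Dw w F) a s"
proof (induction w arbitrary: s)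
  case Nil
  then show ?case using an_shrink[OF assms, of s] by simp
next
  case (Cons k w)
  have "an I (Dw w F) a ((s + r) / 2)" by (rule Cons.IH) (use Cons.prems in auto)
  then show ?case using an_D[of I "Dw w F" a "(s + r) / 2" s k] Cons.prems by simp
qed

text \<open>The identity theorem, one coordinate at a time. All words are treated at once, since the
  power series in the next coordinate is made of further derivatives of the same kind.\<close>

lemma an_flat:
  assumes F: "an I F a r" and I: "finite I" and r: "0 < r"
    and flat: "\<And>w. set w \<subseteq> I \<Longrightarrow> Dw w F a = 0" and z: "z \<in> pd I a r"
  shows "F z = 0"
proof -
  obtain s where s: "0 < s" "s < r" "z \<in> pd I a s" using pd_shrink[OF I z r] by blast
  have an: "an I (Dw w F) a s" if "set w \<subseteq> I" for w by (rule an_Dw[OF F that s(1,2)])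
  \<comment> \<open>\<open>J\<close> is the set of coordinates allowed to differ from the
    centre.\<close>
  have "\<forall>w z. set w \<subseteq> I \<longrightarrow> z \<in> pd I a s \<longrightarrow> (\<forall>i\<in>I - J. z i = a i) \<longrightarrow> Dw w F z = 0"
    if "finite J" "J \<subseteq> I" for J
    using that
  proof (induction J rule: finite_induct)
    case empty
    then show ?case using an_dep[OF an] flat by (metis Diff_empty)
  next
    case (insert j J)
    show ?case
    proof (intro allI impI)
      fix w z assume w: "set w \<subseteq> I" and z: "z \<in> pd I a s" and za: "\<forall>i\<in>I - insert j J. z i = a i"
      have j: "j \<in> I" using insert.prems by simp
      define g where "g v = Dw w F (z(j := v))" for v
      have iter: "(deriv ^^ m) g = (\<lambda>v. Dw (replicate m j @ w) F (z(j := v)))" for m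
      proof (induction m)
        case 0
        have "g = (\<lambda>v. Dw w F (z(j := v)))" by (rule ext) (rule g_def)
        then show ?case by (simp only: funpow.simps id_apply replicate.simps append_Nil)
      next
        case (Suc m)
        show ?case unfolding funpow.simps comp_apply Suc.IH
          by (rule ext) (simp add: D_upd del: fun_upd_apply)
      qed
      have "g (z j) = 0"
      proof (rule holomorphic_fun_eq_0_on_ball[of g "a j" s "z j"])
        show "g holomorphic_on ball (a j) s" unfolding g_def[abs_def] by (rule an_hol[OF an[OF w] z j])
        show "z j \<in> ball (a j) s" by (rule pd_coord[OF z j])
        fix m
        have "Dw (replicate m j @ w) F (z(j := a j)) = 0"
        proof -
          have "z(j := a j) \<in> pd I a s" by (rule pd_upd[OF z]) (use s in simp)
          moreover have "\<forall>i\<in>I - J. (z(j := a j)) i = a i" using za by auto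
          moreover have "set (replicate m j @ w) \<subseteq> I" using w j by auto
          ultimately show ?thesis using insert.IH insert.prems by blast
        qed
        then show "(deriv ^^ m) g (a j) = 0" by (simp add: iter)
      qed
      then show "Dw w F z = 0" by (simp add: g_def)
    qed
  qed
  from this[OF I order_refl] show ?thesis using s(3) by (metis Diff_cancel Dw.simps(1) empty_iff empty_subsetI list.set(1))
qed

text \<open>Lengthening the word from its tail, the first derivative that does not vanish at
  \<open>z\<close> is a partial derivative of one that does: the latter defines a smooth
  hypersurface through \<open>z\<close>.\<close>

lemma not_flat:
  assumes "F z = 0" "set w \<subseteq> I" "Dw w F z \<noteq> 0"
  shows "\<exists>w' k. set w' \<subseteq> I \<and> k \<in> I \<and> Dw w' F z = 0 \<and> D k (Dw w' F) z \<noteq> 0"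
  using assms(2,3)
proof (induction w)
  case Nil
  then show ?case using assms(1) by simp
next
  case (Cons k w)
  show ?case
  proof (cases "Dw w F z = 0")
    case True
    then show ?thesis using Cons.prems by (intro exI[of _ w] exI[of _ k]) simp
  next
    case False
    then show ?thesis using Cons by simp
  qed
qed

section \<open>Complex extension of real power series\<close>

definition envl :: "real list \<Rightarrow> nat \<Rightarrow> real" where
  "envl xs = (\<lambda>i. if i < length xs then xs ! i else 0)"

definition cz :: "(nat \<Rightarrow> real) \<Rightarrow> nat \<Rightarrow> complex" where
  "cz u = (\<lambda>i. complex_of_real (u i))"

text \<open>Absolute convergence at the single real point with all coordinates
  \<open>b ! i + r\<close> dominates the series on the complex polydisc of radius \<open>r\<close>,
  so the M-test gives a bounded, separately holomorphic extension.\<close>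

lemma an_power_series:
  assumes g: "real_analytic_at N g b" and b: "length b = N"
  shows "\<exists>F r. r > 0 \<and> an {..<N} F (cz (envl b)) r \<and> (\<forall>xs\<in>cube N b r. F (cz (envl xs)) = complex_of_real (g xs))"
proof -
  obtain \<rho> c where \<rho>: "\<rho> > 0" and sums: "\<And>xs. xs \<in> cube N b \<rho> \<Longrightarrow>
      ((\<lambda>\<alpha>. c \<alpha> * (\<Prod>i<N. (xs ! i - b ! i) ^ (\<alpha> ! i))) has_sum g xs) {\<alpha>. length \<alpha> = N}"
    using g unfolding real_analytic_at_def by blast
  let ?A = "{\<alpha> :: nat list. length \<alpha> = N}" and ?a = "cz (envl b)"
  \<comment> \<open>Half the radius, so that the corner \<open>b + r\<close> still lies in the open
    cube of convergence.\<close>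
  define r where "r = \<rho> / 2"
  have r: "0 < r" "r < \<rho>" using \<rho> by (auto simp: r_def)
  have ai: "?a i = complex_of_real (b ! i)" if "i < N" for i using that b by (simp add: cz_def envl_def)
  define t where "t \<alpha> z = complex_of_real (c \<alpha>) * (\<Prod>i<N. (z i - ?a i) ^ (\<alpha> ! i))" for \<alpha> and z :: "nat \<Rightarrow> complex"
  define M where "M \<alpha> = \<bar>c \<alpha> * (\<Prod>i<N. r ^ (\<alpha> ! i))\<bar>" for \<alpha> :: "nat list"
  define F where "F z = infsum (\<lambda>\<alpha>. t \<alpha> z) ?A" for z
  define Y where "Y = {z. \<forall>i<N. cmod (z i - ?a i) \<le> r}"
  have Msum: "M summable_on ?A"
  proof -
    let ?x = "map (\<lambda>i. b ! i + r) [0..<N]"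
    have "?x \<in> cube N b \<rho>" using r by (auto simp: cube_def)
    from has_sum_imp_summable[OF sums[OF this]]
    have "(\<lambda>\<alpha>. norm (c \<alpha> * (\<Prod>i<N. (?x ! i - b ! i) ^ (\<alpha> ! i)))) summable_on ?A"
      by (subst (asm) summable_on_iff_abs_summable_on_real)
    moreover have "norm (c \<alpha> * (\<Prod>i<N. (?x ! i - b ! i) ^ (\<alpha> ! i))) = M \<alpha>" for \<alpha>
      unfolding M_def real_norm_def by (intro arg_cong[of _ _ abs] arg_cong[of _ _ "(*) (c \<alpha>)"] prod.cong) auto
    ultimately show ?thesis by simp
  qed
  have tM: "cmod (t \<alpha> z) \<le> M \<alpha>" if "z \<in> Y" for \<alpha> z
  proof -
    have "cmod (\<Prod>i<N. (z i - ?a i) ^ (\<alpha> ! i)) \<le> (\<Prod>i<N. r ^ (\<alpha> ! i))"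
      unfolding prod_norm[symmetric] norm_power using that by (intro prod_mono) (auto simp: Y_def intro!: power_mono)
    moreover have "(\<Prod>i<N. r ^ (\<alpha> ! i)) \<ge> 0" using r by (intro prod_nonneg) auto
    ultimately show ?thesis by (simp add: t_def M_def norm_mult abs_mult mult_left_mono)
  qed
  have ulim: "uniform_limit Y (\<lambda>X z. \<Sum>\<alpha>\<in>X. t \<alpha> z) F (finite_subsets_at_top ?A)"
    unfolding F_def by (rule Weierstrass_m_test_general[OF tM Msum])
  have pdY: "pd {..<N} ?a r \<subseteq> Y" by (auto simp: pd_def Y_def less_imp_le)
  have "\<exists>K. \<forall>z\<in>pd {..<N} ?a r. cmod (F z) \<le> K"
  proof -
    have "\<forall>\<^sub>F X in finite_subsets_at_top ?A. \<forall>z\<in>Y. dist (\<Sum>\<alpha>\<in>X. t \<alpha> z) (F z) < 1"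
      using ulim by (rule uniform_limitD) simp
    from eventually_happens'[OF finite_subsets_at_top_neq_bot this]
    obtain X where X: "\<And>z. z \<in> Y \<Longrightarrow> dist (\<Sum>\<alpha>\<in>X. t \<alpha> z) (F z) < 1"
      by blast
    have "cmod (F z) \<le> (\<Sum>\<alpha>\<in>X. M \<alpha>) + 1" if z: "z \<in> Y" for z
    proof -
      have "cmod (\<Sum>\<alpha>\<in>X. t \<alpha> z) \<le> (\<Sum>\<alpha>\<in>X. M \<alpha>)" by (rule sum_norm_le) (rule tM[OF z])
      then show ?thesis using X[OF z] norm_triangle_ineq2[of "F z" "\<Sum>\<alpha>\<in>X. t \<alpha> z"]
        by (simp add: dist_norm norm_minus_commute)
    qed
    then show ?thesis using pdY by blast
  qed
  moreover have "(\<lambda>w. F (z(i := w))) holomorphic_on ball (?a i) r" if z: "z \<in> pd {..<N} ?a r" and i: "i \<in> {..<N}" for z i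
  proof -
    have hol: "(\<lambda>w. \<Sum>\<alpha>\<in>X. t \<alpha> (z(i := w))) holomorphic_on UNIV" for X
    proof -
      have "(\<lambda>w. (z(i := w)) l) holomorphic_on UNIV" for l
        by (cases "l = i") (auto intro!: holomorphic_intros)
      then show ?thesis unfolding t_def by (intro holomorphic_intros)
    qed
    have "uniform_limit (cball (?a i) r) (\<lambda>X w. \<Sum>\<alpha>\<in>X. t \<alpha> (z(i := w))) (\<lambda>w. F (z(i := w))) (finite_subsets_at_top ?A)"
    proof (rule uniform_limit_compose'[OF ulim], rule funcsetI)
      fix w assume "w \<in> cball (?a i) r"
      then show "z(i := w) \<in> Y" using z by (auto simp: Y_def pd_def dist_norm norm_minus_commute less_imp_le)
    qed
    then show ?thesis
    proof (rule holomorphic_uniform_limit[rotated])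
      show "\<forall>\<^sub>F X in finite_subsets_at_top ?A. continuous_on (cball (?a i) r) (\<lambda>w. \<Sum>\<alpha>\<in>X. t \<alpha> (z(i := w))) \<and>
          (\<lambda>w. \<Sum>\<alpha>\<in>X. t \<alpha> (z(i := w))) holomorphic_on ball (?a i) r"
        by (intro always_eventually allI conjI holomorphic_on_imp_continuous_on)
          (rule holomorphic_on_subset[OF hol subset_UNIV])+
    qed (auto simp: finite_subsets_at_top_neq_bot)
  qed
  moreover have "F z = F z'" if "\<And>i. i \<in> {..<N} \<Longrightarrow> z i = z' i" for z z'
  proof -
    have "t \<alpha> z = t \<alpha> z'" for \<alpha> unfolding t_def using that by (intro arg_cong[of _ _ "(*) _"] prod.cong) auto
    then show ?thesis by (simp add: F_def)
  qed
  moreover have eq: "F (cz (envl xs)) = complex_of_real (g xs)" if xs: "xs \<in> cube N b r" for xs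
  proof -
    have l: "length xs = N" using xs by (simp add: cube_def)
    have "xs \<in> cube N b \<rho>" using xs r by (auto simp: cube_def)
    from has_sum_of_real[OF sums[OF this]]
    have "((\<lambda>\<alpha>. complex_of_real (c \<alpha> * (\<Prod>i<N. (xs ! i - b ! i) ^ (\<alpha> ! i)))) has_sum complex_of_real (g xs)) ?A" .
    moreover have "complex_of_real (c \<alpha> * (\<Prod>i<N. (xs ! i - b ! i) ^ (\<alpha> ! i))) = t \<alpha> (cz (envl xs))" for \<alpha>
      unfolding t_def of_real_mult of_real_prod using l b
      by (intro arg_cong[of _ _ "(*) _"] prod.cong) (auto simp: cz_def envl_def)
    ultimately show ?thesis by (simp add: F_def infsumI)
  qed
  moreover have "F z \<in> \<real>" if z: "z \<in> pd {..<N} ?a r" and re: "\<And>i. i \<in> {..<N} \<Longrightarrow> z i \<in> \<real>" for z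
  proof -
    define xs where "xs = map (\<lambda>i. Re (z i)) [0..<N]"
    have zi: "z i = complex_of_real (xs ! i)" if "i < N" for i
      using re[of i] that by (simp add: xs_def complex_is_Real_iff complex_eq_iff)
    have "xs \<in> cube N b r"
    proof -
      have "\<bar>xs ! i - b ! i\<bar> < r" if "i < N" for i
      proof -
        have "cmod (z i - ?a i) < r" using z that by (simp add: pd_def)
        then have "cmod (complex_of_real (xs ! i - b ! i)) < r" using zi[OF that] ai[OF that] by simp
        then show ?thesis by (simp only: norm_of_real)
      qed
      then show ?thesis by (simp add: cube_def xs_def)
    qed
    moreover have "F z = F (cz (envl xs))"
      by (rule \<open>\<And>z z'. (\<And>i. i \<in> {..<N} \<Longrightarrow> z i = z' i) \<Longrightarrow> F z = F z'\<close>) (use zi in \<open>simp add: cz_def envl_def xs_def\<close>)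
    ultimately show ?thesis using eq by simp
  qed
  ultimately have "an {..<N} F ?a r" unfolding an_def by blast
  then show ?thesis using r(1) eq by blast
qed

section \<open>The bad part of the graph is small: subanalytic maps\<close>

lemma an_continuous:
  assumes F: "an I F a r" and I: "finite I" and r: "0 < r" and e: "e > 0"
  shows "\<exists>s>0. s \<le> r \<and> (\<forall>z\<in>pd I a s. cmod (F z - F a) < e)"
proof -
  obtain C where C: "C \<ge> 0" "\<And>z z'. z \<in> pd I a (r / 2) \<Longrightarrow> z' \<in> pd I a (r / 2) \<Longrightarrow>
      cmod (F z' - F z) \<le> C * (\<Sum>i\<in>I. cmod (z' i - z i))"
    using an_lipschitz[OF F I, of "r / 2"] r by auto
  define c where "c = C * real (card I) + 1"
  have c: "c > 0" using C(1) by (simp add: c_def add_nonneg_pos)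
  define s where "s = min (r / 2) (e / c)"
  have s: "s > 0" using r e c by (simp add: s_def)
  have s2: "s \<le> r / 2" unfolding s_def by (rule min.cobounded1)
  have "cmod (F z - F a) < e" if z: "z \<in> pd I a s" for z
  proof -
    have "cmod (F z - F a) \<le> C * (\<Sum>i\<in>I. cmod (z i - a i))"
      by (rule C(2)) (use z pd_mono[OF s2] r pd_center in auto)
    also have "\<dots> \<le> C * (real (card I) * s)"
    proof (rule mult_left_mono)
      show "(\<Sum>i\<in>I. cmod (z i - a i)) \<le> real (card I) * s"
        using z by (intro sum_bounded_above) (auto simp: pd_def)
    qed (rule C(1))
    also have "\<dots> < c * s" using s by (simp add: c_def distrib_right)
    also have "\<dots> \<le> c * (e / c)" using c by (intro mult_left_mono) (auto simp: s_def)
    also have "\<dots> = e" using c by simp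
    finally show ?thesis .
  qed
  then show ?thesis using s s2 r by (intro exI[of _ s]) auto
qed

lemma D_zero_constant:
  assumes F: "an I F a r" and k: "k \<in> I" and D0: "\<And>z. z \<in> pd I a r \<Longrightarrow> D k F z = 0"
    and z: "z \<in> pd I a r" and w: "w \<in> ball (a k) r"
  shows "F (z(k := w)) = F z"
proof -
  have "cmod (F (z(k := w)) - F (z(k := z k))) \<le> 0 * cmod (w - z k)"
  proof (rule field_differentiable_bound[of "ball (a k) r" _ "\<lambda>v. D k F (z(k := v))"])
    fix v assume v: "v \<in> ball (a k) r"
    show "((\<lambda>v. F (z(k := v))) has_field_derivative D k F (z(k := v))) (at v within ball (a k) r)"
      unfolding D_upd
      by (rule has_field_derivative_at_within[OF holomorphic_derivI[OF an_hol[OF F z k]]]) (use v in auto)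
    show "cmod (D k F (z(k := v))) \<le> 0" using D0[OF pd_upd[OF z v]] by simp
  qed (use w pd_coord[OF z k] in auto)
  then show ?thesis by simp
qed

section \<open>Real neighbourhoods and zero sets\<close>

definition near :: "nat set \<Rightarrow> (nat \<Rightarrow> real) \<Rightarrow> real \<Rightarrow> (nat \<Rightarrow> real) set" where
  "near I u r = {v. \<forall>i\<in>I. \<bar>v i - u i\<bar> < r}"

lemma near_center: "r > 0 \<Longrightarrow> u \<in> near I u r"
  by (simp add: near_def)

lemma near_mono: "s \<le> r \<Longrightarrow> near I u s \<subseteq> near I u r"
  by (auto simp: near_def)

lemma near_trans: "v \<in> near I u s \<Longrightarrow> near I v t \<subseteq> near I u (s + t)"
proof
  fix w assume "v \<in> near I u s" "w \<in> near I v t"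
  then have "\<bar>v i - u i\<bar> < s" "\<bar>w i - v i\<bar> < t" if "i \<in> I" for i using that by (auto simp: near_def)
  then have "\<bar>w i - u i\<bar> < s + t" if "i \<in> I" for i using that by fastforce
  then show "w \<in> near I u (s + t)" by (simp add: near_def)
qed

lemma cmod_cz_diff: "cmod (cz v i - cz u i) = \<bar>v i - u i\<bar>"
  unfolding cz_def of_real_diff[symmetric] norm_of_real ..

lemma cz_in_pd: "cz v \<in> pd I (cz u) r \<longleftrightarrow> v \<in> near I u r"
  by (simp add: pd_def near_def cmod_cz_diff)

lemma cz_real [simp]: "cz u i \<in> \<real>"
  by (simp add: cz_def)

lemma cz_upd: "c \<in> \<real> \<Longrightarrow> (cz u)(i := c) = cz (u(i := Re c))"
  by (auto simp: cz_def fun_eq_iff complex_is_Real_iff complex_eq_iff)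

text \<open>Only finitely many coordinates are restricted, so the set is open in the product
  topology, where every family of open sets has a countable subfamily with the same union.\<close>

lemma open_near: "finite I \<Longrightarrow> open (near I u r)"
proof -
  assume I: "finite I"
  have "open {v :: nat \<Rightarrow> real. \<bar>v i - u i\<bar> < r}" for i
    by (intro open_Collect_less continuous_intros continuous_on_product_coordinates)
  then have "open (\<Inter>i\<in>I. {v. \<bar>v i - u i\<bar> < r})" using I by (intro open_INT) auto
  moreover have "near I u r = (\<Inter>i\<in>I. {v. \<bar>v i - u i\<bar> < r})" by (auto simp: near_def)
  ultimately show ?thesis by simp
qed

definition zs :: "((nat \<Rightarrow> complex) \<Rightarrow> complex) set \<Rightarrow> (nat \<Rightarrow> real) set" where
  "zs G = {v. \<forall>g\<in>G. g (cz v) = 0}"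

text \<open>The alternative behind every elimination: an equation is void near the point, or the
  point lies on a smooth hypersurface on which some derivative vanishes.\<close>

lemma flat_or_hypersurface:
  assumes "an I g a r" "finite I" "0 < r" "g a = 0"
  shows "(\<forall>z\<in>pd I a r. g z = 0) \<or> (\<exists>w k. set w \<subseteq> I \<and> k \<in> I \<and> Dw w g a = 0 \<and> D k (Dw w g) a \<noteq> 0)"
  using an_flat[OF assms(1-3)] not_flat[of g a, OF assms(4)] by blast

text \<open>\<open>B\<close> stands for the semianalytic set in a higher-dimensional space whose
  projection is a piece of the graph.\<close>

locale graph_cover =
  fixes U :: "(real ^ 'n::{finite, linorder}) set" and f :: "real ^ 'n::_ \<Rightarrow> real ^ 'n::_"
    and B :: "real list set" and N :: nat
  assumes N: "2 * CARD('n) \<le> N"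
    and B: "\<And>b. b \<in> B \<Longrightarrow> \<exists>p\<in>U. take (2 * CARD('n)) b = vec_list p @ vec_list (f p)"
begin

text \<open>Empty unless the graph point below \<open>b\<close> is bad, and then that single
  point.\<close>

definition gr :: "real list \<Rightarrow> ((real ^ 'n::_) \<times> (real ^ 'n::_)) set" where
  "gr b = {(p, f p) | p. p \<in> nondiff_set U f \<and> take (2 * CARD('n)) b = vec_list p @ vec_list (f p)}"

definition ep :: "(nat \<Rightarrow> (nat \<Rightarrow> complex) \<Rightarrow> complex) \<Rightarrow> (nat \<Rightarrow> real) \<Rightarrow> real list" where
  "ep \<eta> u = map (\<lambda>j. Re (\<eta> j (cz u))) [0..<N]"

definition Sm :: "(nat \<Rightarrow> (nat \<Rightarrow> complex) \<Rightarrow> complex) \<Rightarrow> (nat \<Rightarrow> real) set \<Rightarrow> bool" where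
  "Sm \<eta> W \<longleftrightarrow> small (\<Union>u\<in>W. gr (ep \<eta> u))"

text \<open>
  \<open>\<eta>\<close> is a chart of \<open>B\<close> near \<open>u\<close>, defined on the common zero set of \<open>G\<close>.
\<close>

definition data where
  "data I \<eta> G u r \<longleftrightarrow> 0 < r \<and> (\<forall>j<N. an I (\<eta> j) (cz u) r) \<and> (\<forall>g\<in>G. an I g (cz u) r) \<and>
     (\<forall>v\<in>near I u r. v \<in> zs G \<longrightarrow> ep \<eta> v \<in> B)"

section \<open>Smallness is local in the parameter space\<close>

lemma Sm_subset: "Sm \<eta> W \<Longrightarrow> V \<subseteq> W \<Longrightarrow> Sm \<eta> V"
  unfolding Sm_def by (erule small_subset) blast

lemma Sm_UN: "countable A \<Longrightarrow> (\<And>i. i \<in> A \<Longrightarrow> Sm \<eta> (W i)) \<Longrightarrow> Sm \<eta> (\<Union>i\<in>A. W i)"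
proof -
  assume "countable A" "\<And>i. i \<in> A \<Longrightarrow> Sm \<eta> (W i)"
  then have "small (\<Union>i\<in>A. \<Union>u\<in>W i. gr (ep \<eta> u))" unfolding Sm_def by (rule small_UN)
  then show ?thesis unfolding Sm_def by (rule small_subset) blast
qed

lemma Sm_Un: "Sm \<eta> V \<Longrightarrow> Sm \<eta> W \<Longrightarrow> Sm \<eta> (V \<union> W)"
  unfolding Sm_def by (simp add: small_Un)

text \<open>A countable subfamily of the given neighbourhoods covers \<open>W\<close>, and countable
  unions of small sets are small.\<close>

lemma Sm_local:
  assumes I: "finite I" and loc: "\<And>u. u \<in> W \<Longrightarrow> \<exists>s>0. Sm \<eta> (W \<inter> near I u s)"
  shows "Sm \<eta> W"
proof -
  have "\<forall>u\<in>W. \<exists>s. s > 0 \<and> Sm \<eta> (W \<inter> near I u s)" using loc by blast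
  from bchoice[OF this] obtain s where s: "\<And>u. u \<in> W \<Longrightarrow> s u > 0" "\<And>u. u \<in> W \<Longrightarrow> Sm \<eta> (W \<inter> near I u (s u))"
    by blast
  have "\<And>T. T \<in> (\<lambda>u. near I u (s u)) ` W \<Longrightarrow> open T" using open_near[OF I] by blast
  then obtain \<F> where \<F>: "\<F> \<subseteq> (\<lambda>u. near I u (s u)) ` W" "countable \<F>" "\<Union>\<F> = \<Union>((\<lambda>u. near I u (s u)) ` W)"
    by (rule Lindelof)
  have "Sm \<eta> (\<Union>T\<in>\<F>. W \<inter> T)"
    by (rule Sm_UN[OF \<F>(2)]) (use \<F>(1) s(2) in blast)
  moreover have "W \<subseteq> (\<Union>T\<in>\<F>. W \<inter> T)"
  proof
    fix u assume u: "u \<in> W"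
    then have "u \<in> \<Union>\<F>" using \<F>(3) s(1) near_center by blast
    then show "u \<in> (\<Union>T\<in>\<F>. W \<inter> T)" using u by blast
  qed
  ultimately show ?thesis by (rule Sm_subset)
qed

lemma data_recenter:
  assumes d: "data I \<eta> G u r" and v: "v \<in> near I u (r - s)" and s: "0 < s" "s \<le> r"
  shows "data I \<eta> G v s"
proof -
  have *: "cmod (cz v i - cz u i) + s \<le> r" if "i \<in> I" for i
    using v that by (auto simp: cmod_cz_diff near_def)
  have "near I v s \<subseteq> near I u r"
    using v by (force simp: near_def)
  moreover have "an I F (cz v) s" if "an I F (cz u) r" for F by (rule an_recenter[OF that *])
  ultimately show ?thesis using d s(1) unfolding data_def by blast
qed

lemma ep_cong: "(\<And>j. j < N \<Longrightarrow> \<eta> j (cz u) = \<eta>' j (cz v)) \<Longrightarrow> ep \<eta> u = ep \<eta>' v"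
  by (simp add: ep_def)

text \<open>On a hypersurface \<open>h = 0\<close> with \<open>\<partial>h/\<partial>z\<^sub>k \<noteq> 0\<close> the coordinate \<open>k\<close> can be eliminated.\<close>

lemma hypersurface_small:
  assumes IH: "\<And>I' \<eta>' G' u' r'. finite I' \<Longrightarrow> card I' < card I \<Longrightarrow> finite G' \<Longrightarrow> data I' \<eta>' G' u' r' \<Longrightarrow>
      \<exists>s>0. Sm \<eta>' (near I' u' s \<inter> zs G')"
    and I: "finite I" and G: "finite G" and d: "data I \<eta> G u r" and h: "an I h (cz u) r"
    and k: "k \<in> I" and h0: "h (cz u) = 0" and Dh: "D k h (cz u) \<noteq> 0"
  shows "\<exists>s>0. Sm \<eta> (near I u s \<inter> zs G \<inter> {v. h (cz v) = 0})"
proof -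
  have r: "0 < r" and \<eta>: "\<And>j. j < N \<Longrightarrow> an I (\<eta> j) (cz u) r" and g: "\<And>g. g \<in> G \<Longrightarrow> an I g (cz u) r"
    and inB: "\<And>v. v \<in> near I u r \<Longrightarrow> v \<in> zs G \<Longrightarrow> ep \<eta> v \<in> B"
    using d by (auto simp: data_def)
  \<comment> \<open>The implicit function takes the value of \<open>h\<close> as its coordinate
    \<open>k\<close>, so its centre has \<open>h (cz u) = 0\<close> there.\<close>
  let ?b = "(cz u)(k := 0)" and ?J = "I - {k}"
  obtain X r' s where X: "0 < r'" "r' \<le> r" "0 < s" "s \<le> r" "an I X ?b r'"
    "\<And>z. z \<in> pd I ?b r' \<Longrightarrow> cmod (X z - cz u k) < r \<and> h (z(k := X z)) = z k"
    "\<And>z. z \<in> pd I (cz u) s \<Longrightarrow> z(k := h z) \<in> pd I ?b r' \<and> X (z(k := h z)) = z k"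
    using an_implicit[OF h I r k _ Dh] unfolding h0 by (metis cz_real)
  \<comment> \<open>The solution of \<open>h = 0\<close>, with the level fixed at 0, no longer
    depends on coordinate \<open>k\<close>.\<close>
  define X0 where "X0 z = X (z(k := 0))" for z
  have X0: "an ?J X0 (cz u) r'"
    unfolding X0_def
    by (rule an_subst[OF X(5) I k an_const]) (use X(1) in auto)
  have pdb: "z(k := 0) \<in> pd I ?b r'" if "z \<in> pd ?J (cz u) r'" for z
    using that X(1) by (auto simp: pd_def)
  have val: "cmod (X0 z - cz u k) < r" if "z \<in> pd ?J (cz u) r'" for z
    using X(6)[OF pdb[OF that]] by (simp add: X0_def)
  have sub: "an ?J (\<lambda>z. F (z(k := X0 z))) (cz u) r'" if "an I F (cz u) r" for F
    by (rule an_subst[OF that I k X0 _ _ X(1,2) val]) auto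
  define \<eta>' where "\<eta>' j z = \<eta> j (z(k := X0 z))" for j z
  define G' where "G' = (\<lambda>g z. g (z(k := X0 z))) ` G"
  have lift: "\<exists>v'. v' \<in> near I u r \<and> cz v' = (cz v)(k := X0 (cz v))" if v: "v \<in> near ?J u r'" for v
  proof (intro exI conjI)
    have vp: "cz v \<in> pd ?J (cz u) r'" using v by (simp add: cz_in_pd)
    have re: "X0 (cz v) \<in> \<real>" by (rule an_real[OF X0 vp]) simp
    show e: "cz (v(k := Re (X0 (cz v)))) = (cz v)(k := X0 (cz v))" by (rule cz_upd[OF re, symmetric])
    have "(cz v)(k := X0 (cz v)) \<in> pd I (cz u) r"
      using vp val[OF vp] X(2) by (auto simp: pd_def intro: less_le_trans)
    then show "v(k := Re (X0 (cz v))) \<in> near I u r" by (simp only: cz_in_pd[symmetric] e)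
  qed
  have "data ?J \<eta>' G' u r'"
    unfolding data_def
  proof (intro conjI allI impI ballI)
    show "0 < r'" by (rule X(1))
    show "an ?J (\<eta>' j) (cz u) r'" if "j < N" for j unfolding \<eta>'_def by (rule sub[OF \<eta>[OF that]])
    show "an ?J g' (cz u) r'" if "g' \<in> G'" for g' using that sub g by (auto simp: G'_def)
    fix v assume v: "v \<in> near ?J u r'" "v \<in> zs G'"
    obtain v' where v': "v' \<in> near I u r" "cz v' = (cz v)(k := X0 (cz v))" using lift[OF v(1)] by blast
    have "v' \<in> zs G" using v(2) by (simp add: zs_def G'_def v'(2))
    then have "ep \<eta> v' \<in> B" by (rule inB[OF v'(1)])
    moreover have "ep \<eta>' v = ep \<eta> v'" by (rule ep_cong) (simp add: \<eta>'_def v'(2))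
    ultimately show "ep \<eta>' v \<in> B" by simp
  qed
  moreover have "card ?J < card I" by (rule card_Diff1_less[OF I k])
  ultimately obtain t where t: "t > 0" "Sm \<eta>' (near ?J u t \<inter> zs G')"
    using IH[of ?J G' \<eta>' u r'] I G by (auto simp: G'_def)
  let ?s = "min s t"
  have "(\<Union>v\<in>near I u ?s \<inter> zs G \<inter> {v. h (cz v) = 0}. gr (ep \<eta> v)) \<subseteq> (\<Union>v\<in>near ?J u t \<inter> zs G'. gr (ep \<eta>' v))"
  proof (rule UN_least)
    fix v assume v: "v \<in> near I u ?s \<inter> zs G \<inter> {v. h (cz v) = 0}"
    then have "cz v \<in> pd I (cz u) s" using near_mono[of ?s s I u] by (auto simp: cz_in_pd)
    \<comment> \<open>At a point with \<open>h = 0\<close>, replacing coordinate \<open>k\<close> by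
      the value of \<open>h\<close> is replacing it by 0, so \<open>X0\<close> recovers the original
      coordinate.\<close>
    from X(7)[OF this] have "X0 (cz v) = cz v k" using v by (simp add: X0_def)
    then have e: "(cz v)(k := X0 (cz v)) = cz v" by simp
    have "v \<in> near ?J u t \<inter> zs G'" using v by (auto simp: near_def zs_def G'_def e)
    moreover have "ep \<eta> v = ep \<eta>' v" by (rule ep_cong) (simp add: \<eta>'_def e)
    ultimately show "gr (ep \<eta> v) \<subseteq> (\<Union>v\<in>near ?J u t \<inter> zs G'. gr (ep \<eta>' v))" by auto
  qed
  then have "Sm \<eta> (near I u ?s \<inter> zs G \<inter> {v. h (cz v) = 0})"
    using t(2) unfolding Sm_def by (rule small_subset[rotated])
  then show ?thesis using X(3) t(1) by (intro exI[of _ ?s]) simp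
qed

lemma nth_ep: "j < N \<Longrightarrow> ep \<eta> u ! j = Re (\<eta> j (cz u))"
  by (simp add: ep_def)

lemma ep_eq_graph:
  assumes "take (2 * CARD('n)) (ep \<eta> u) = vec_list p @ vec_list (f p)" and "j < CARD('n)"
  shows "vec_nth p (idx (Suc j)) = Re (\<eta> j (cz u))"
    and "vec_nth (f p) (idx (Suc j)) = Re (\<eta> (CARD('n) + j) (cz u))"
proof -
  have "take (2 * CARD('n)) (ep \<eta> u) ! i = Re (\<eta> i (cz u))" if "i < 2 * CARD('n)" for i
    using that N by (simp add: nth_ep)
  then have "(vec_list p @ vec_list (f p)) ! i = Re (\<eta> i (cz u))" if "i < 2 * CARD('n)" for i
    using that assms(1) by simp
  from this[of j] this[of "CARD('n) + j"] assms(2)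
  show "vec_nth p (idx (Suc j)) = Re (\<eta> j (cz u))"
    "vec_nth (f p) (idx (Suc j)) = Re (\<eta> (CARD('n) + j) (cz u))"
    by (simp_all add: nth_append)
qed

lemma vec_eq_idx: "(\<And>j. j < CARD('n) \<Longrightarrow> vec_nth p (idx (Suc j)) = vec_nth q (idx (Suc j))) \<Longrightarrow> p = (q :: real ^ 'n::_)"
proof -
  assume *: "\<And>j. j < CARD('n) \<Longrightarrow> vec_nth p (idx (Suc j)) = vec_nth q (idx (Suc j))"
  have "vec_nth p i = vec_nth q i" for i
    using *[of "rk i - 1"] rk_range[of i] by simp
  then show ?thesis by (simp add: Finite_Cartesian_Product.vec_eq_iff)
qed

lemma gr_subset_pt:
  "gr (ep \<eta> u) \<subseteq> {pt (\<lambda>j u. Re (\<eta> j (cz u))) u}"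
proof
  fix z assume "z \<in> gr (ep \<eta> u)"
  then obtain p where p: "z = (p, f p)" "take (2 * CARD('n)) (ep \<eta> u) = vec_list p @ vec_list (f p)"
    by (auto simp: gr_def)
  have "vec_nth p i = Re (\<eta> (rk i - 1) (cz u)) \<and> vec_nth (f p) i = Re (\<eta> (CARD('n) + (rk i - 1)) (cz u))" for i
    using ep_eq_graph[OF p(2), of "rk i - 1"] rk_range[of i] by simp
  then show "z \<in> {pt (\<lambda>j u. Re (\<eta> j (cz u))) u}"
    by (simp add: p(1) pt_def Finite_Cartesian_Product.vec_eq_iff)
qed

text \<open>With fewer than \<open>n\<close> parameters the graph map is Lipschitz in them by
  \<open>an_lipschitz\<close>, and \<open>small_parametrized\<close> applies.\<close>

lemma small_low_dimension:
  assumes I: "finite I" and card: "card I < CARD('n)" and \<eta>: "\<And>j. j < N \<Longrightarrow> an I (\<eta> j) (cz u) r" and s: "s < r"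
  shows "Sm \<eta> (near I u s)"
proof -
  \<comment> \<open>Values outside \<open>I\<close> are set to 0, so that the coordinates in
    \<open>I\<close> determine the parameter.\<close>
  define X where "X = {v \<in> near I u s. \<forall>i. i \<notin> I \<longrightarrow> v i = 0}"
  let ?\<theta> = "\<lambda>j u. Re (\<eta> j (cz u))"
  obtain e where e: "bij_betw e {0..<card I} I" using ex_bij_betw_nat_finite[OF I] by blast
  have "small (pt ?\<theta> ` X :: ((real ^ 'n::_) \<times> (real ^ 'n::_)) set)"
  proof (rule small_parametrized[OF card, where \<pi> = "\<lambda>i v. v (e i)"])
    fix v j assume v: "v \<in> X" and j: "j < 2 * CARD('n)"
    obtain C where C: "C \<ge> 0" "\<And>z z'. z \<in> pd I (cz u) s \<Longrightarrow> z' \<in> pd I (cz u) s \<Longrightarrow>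
        cmod (\<eta> j z' - \<eta> j z) \<le> C * (\<Sum>i\<in>I. cmod (z' i - z i))"
      using an_lipschitz[OF \<eta>[of j] I s] j N by auto
    have "\<bar>?\<theta> j w - ?\<theta> j v\<bar> \<le> C * (\<Sum>i<card I. \<bar>w (e i) - v (e i)\<bar>)" if w: "w \<in> X" for w
    proof -
      have "\<bar>?\<theta> j w - ?\<theta> j v\<bar> \<le> cmod (\<eta> j (cz w) - \<eta> j (cz v))"
        using abs_Re_le_cmod[of "\<eta> j (cz w) - \<eta> j (cz v)"] by simp
      also have "\<dots> \<le> C * (\<Sum>i\<in>I. cmod (cz w i - cz v i))"
        by (rule C(2)) (use v w in \<open>simp_all add: X_def cz_in_pd\<close>)
      also have "(\<Sum>i\<in>I. cmod (cz w i - cz v i)) = (\<Sum>i<card I. \<bar>w (e i) - v (e i)\<bar>)"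
        using sum.reindex_bij_betw[OF e, of "\<lambda>i. \<bar>w i - v i\<bar>"] by (simp add: cmod_cz_diff atLeast0LessThan)
      finally show ?thesis .
    qed
    then show "\<exists>d>0. \<exists>B\<ge>0. \<forall>w\<in>X. (\<forall>i<card I. \<bar>w (e i) - v (e i)\<bar> < d) \<longrightarrow>
        \<bar>?\<theta> j w - ?\<theta> j v\<bar> \<le> B * (\<Sum>i<card I. \<bar>w (e i) - v (e i)\<bar>)"
      using C(1) by (intro exI[of _ 1] conjI exI[of _ C]) auto
  next
    fix v w assume vw: "v \<in> X" "w \<in> X" "\<And>i. i < card I \<Longrightarrow> v (e i) = w (e i)"
    show "v = w"
    proof
      fix i show "v i = w i"
      proof (cases "i \<in> I")
        case True
        then have "i \<in> e ` {0..<card I}" using bij_betw_imp_surj_on[OF e] by simp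
        then obtain l where "l < card I" "i = e l" by auto
        then show ?thesis using vw(3) by blast
      next
        case False then show ?thesis using vw(1,2) by (simp add: X_def)
      qed
    qed
  qed
  moreover have "(\<Union>v\<in>near I u s. gr (ep \<eta> v)) \<subseteq> pt ?\<theta> ` X"
  proof (rule UN_least)
    fix v assume v: "v \<in> near I u s"
    let ?w = "\<lambda>i. if i \<in> I then v i else 0"
    have "?w \<in> X" using v by (simp add: X_def near_def)
    moreover have "ep \<eta> v = ep \<eta> ?w"
      by (rule ep_cong, rule an_dep[OF \<eta>]) (simp_all add: cz_def)
    ultimately show "gr (ep \<eta> v) \<subseteq> pt ?\<theta> ` X" using gr_subset_pt[of \<eta> ?w] by auto
  qed
  ultimately show ?thesis unfolding Sm_def by (rule small_subset)
qed

text \<open>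
  \<open>\<eta> k = z (\<kappa> k)\<close> for all \<open>k < n\<close> means that the source coordinates of the graph point are among
  the coordinates of the parametrization, so the remaining components exhibit \<open>f\<close> as analytic.
\<close>

lemma no_bad_point:
  assumes I: "finite I" and d: "data I \<eta> {} u r" and \<kappa>: "inj_on \<kappa> {..<CARD('n)}" "\<kappa> ` {..<CARD('n)} \<subseteq> I"
    and match: "\<And>k z. k < CARD('n) \<Longrightarrow> z \<in> pd I (cz u) r \<Longrightarrow> \<eta> k z = z (\<kappa> k)"
    and v: "v \<in> near I u (r / 2)"
  shows "gr (ep \<eta> v) = {}"
proof (rule ccontr)
  let ?n = "CARD('n)"
  have r: "0 < r" and \<eta>: "\<And>j. j < N \<Longrightarrow> an I (\<eta> j) (cz u) r" and inB: "\<And>v. v \<in> near I u r \<Longrightarrow> ep \<eta> v \<in> B"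
    using d by (auto simp: data_def zs_def)
  assume "gr (ep \<eta> v) \<noteq> {}"
  then obtain p where p: "p \<in> nondiff_set U f" "take (2 * ?n) (ep \<eta> v) = vec_list p @ vec_list (f p)"
    by (auto simp: gr_def)
  have vu: "near I v (r / 2) \<subseteq> near I u r" using near_trans[OF v, of "r / 2"] by simp
  have vr: "v \<in> near I u r" using vu near_center[of "r / 2" v I] r by auto
  have pk: "vec_nth p (idx (Suc k)) = v (\<kappa> k)" if "k < ?n" for k
    using ep_eq_graph(1)[OF p(2) that] match[OF that, of "cz v"] vr by (simp add: cz_in_pd) (simp add: cz_def)
  define \<kappa>' where "\<kappa>' = the_inv_into {..<?n} \<kappa>"
  have \<kappa>': "\<kappa>' (\<kappa> k) = k" if "k < ?n" for k using that \<kappa>(1) by (simp add: \<kappa>'_def the_inv_into_f_f)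
  \<comment> \<open>The parameter over the source point \<open>xs\<close>: matched coordinates are
    filled from \<open>xs\<close>, all others stay as in \<open>v\<close>.\<close>
  define env where "env xs i = (if i \<in> \<kappa> ` {..<?n} then xs ! \<kappa>' i else v i)" for xs :: "real list" and i
  have env\<kappa>: "env xs (\<kappa> k) = xs ! k" if "k < ?n" for xs k using that \<kappa>' by (simp add: env_def)
  have envp: "env (vec_list p) = v" using pk \<kappa>' by (auto simp: env_def fun_eq_iff)
  have env_near: "env xs \<in> near I v s" if "xs \<in> cube ?n (vec_list p) s" "s > 0" for xs s
    using that pk \<kappa>' by (auto simp: near_def env_def cube_def)
  define g where "g j xs = Re (\<eta> (?n + j) (cz (env xs)))" for j xs
  have "f differentiable (at p)"
  proof (rule differentiable_if_components)
    show "open (ball p (r / 2))" "p \<in> ball p (r / 2)" using r by auto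
    fix q j assume q: "q \<in> ball p (r / 2)" and j: "j < ?n"
    have "vec_list q \<in> cube ?n (vec_list p) (r / 2)"
    proof -
      have "\<bar>vec_nth q i - vec_nth p i\<bar> < r / 2" for i
        using component_le_norm_cart[of "q - p" i] q by (simp add: dist_norm norm_minus_commute)
      then show ?thesis by (simp add: cube_def)
    qed
    then have en: "env (vec_list q) \<in> near I u r" using env_near[of _ "r / 2"] r vu by auto
    then obtain p' where p': "p' \<in> U" "take (2 * ?n) (ep \<eta> (env (vec_list q))) = vec_list p' @ vec_list (f p')"
      using B[OF inB] by blast
    \<comment> \<open>The point of \<open>B\<close> with parameter \<open>env (vec_list q)\<close>
      lies over the graph, and its source coordinates are the matched ones, that is
      \<open>q\<close>; its remaining components are therefore those of \<open>f q\<close>.\<close>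
    have "p' = q"
    proof (rule vec_eq_idx)
      fix k assume k: "k < ?n"
      show "vec_nth p' (idx (Suc k)) = vec_nth q (idx (Suc k))"
        using ep_eq_graph(1)[OF p'(2) k] match[OF k, of "cz (env (vec_list q))"] en env\<kappa>[OF k, of "vec_list q"] k
        by (simp add: cz_in_pd) (simp add: cz_def)
    qed
    then show "g j (vec_list q) = vec_nth (f q) (idx (Suc j))"
      using ep_eq_graph(2)[OF p'(2) j] by (simp add: g_def)
  next
    fix j assume j: "j < ?n"
    let ?F = "\<eta> (?n + j)"
    have F: "an I ?F (cz v) (r / 2)"
      using data_recenter[OF d, of v "r / 2"] v r j N by (auto simp: data_def)
    obtain K where K: "K \<ge> 0" "\<And>z z'. z \<in> pd I (cz v) (r / 4) \<Longrightarrow> z' \<in> pd I (cz v) (r / 4) \<Longrightarrow>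
       cmod (?F z' - ?F z - (\<Sum>i\<in>I. D i ?F z * (z' i - z i))) \<le> K * (\<Sum>i\<in>I. cmod (z' i - z i))\<^sup>2"
      using an_taylor[OF F I, of "r / 4"] r by auto
    \<comment> \<open>Only matched coordinates of \<open>env xs\<close> vary with \<open>xs\<close>,
      so the partial derivatives in these form the gradient; values being real, real parts are
      taken.\<close>
    define c where "c k = Re (D (\<kappa> k) ?F (cz v))" for k
    have est: "\<bar>g j ys - g j (vec_list p) - (\<Sum>k<?n. c k * (ys ! k - vec_list p ! k))\<bar> \<le> K * (\<Sum>k<?n. \<bar>ys ! k - vec_list p ! k\<bar>)\<^sup>2"
      if ys: "ys \<in> cube ?n (vec_list p) (r / 4)" for ys
    proof -
      let ?z' = "cz (env ys)"
      have z': "?z' \<in> pd I (cz v) (r / 4)" using env_near[OF ys] r by (simp add: cz_in_pd)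
      have zz: "cz v \<in> pd I (cz v) (r / 4)" using r by (intro pd_center) simp
      have red: "(\<Sum>i\<in>I. H i) = (\<Sum>k<?n. H (\<kappa> k))" if H: "\<And>i. i \<notin> \<kappa> ` {..<?n} \<Longrightarrow> H i = 0" for H :: "nat \<Rightarrow> 'b::comm_monoid_add"
      proof -
        have "(\<Sum>i\<in>I. H i) = (\<Sum>i\<in>\<kappa> ` {..<?n}. H i)"
          by (rule sum.mono_neutral_right[OF I \<kappa>(2)]) (use H in auto)
        also have "\<dots> = (\<Sum>k<?n. H (\<kappa> k))" using sum.reindex[OF \<kappa>(1), of H] by simp
        finally show ?thesis .
      qed
      have diff0: "?z' i = cz v i" if "i \<notin> \<kappa> ` {..<?n}" for i using that by (auto simp: cz_def env_def)
      have diffk: "?z' (\<kappa> k) - cz v (\<kappa> k) = complex_of_real (ys ! k - vec_list p ! k)" if "k < ?n" for k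
        using env\<kappa>[OF that, of ys] pk[OF that] that by (simp add: cz_def)
      have S1: "(\<Sum>i\<in>I. D i ?F (cz v) * (?z' i - cz v i)) = (\<Sum>k<?n. D (\<kappa> k) ?F (cz v) * complex_of_real (ys ! k - vec_list p ! k))"
        by (subst red) (auto simp: diff0 diffk simp del: of_real_diff intro!: sum.cong)
      have S2: "(\<Sum>i\<in>I. cmod (?z' i - cz v i)) = (\<Sum>k<?n. \<bar>ys ! k - vec_list p ! k\<bar>)"
        by (subst red) (auto simp: diff0 diffk simp del: of_real_diff intro!: sum.cong)
      have re: "Re (?F ?z' - ?F (cz v) - (\<Sum>i\<in>I. D i ?F (cz v) * (?z' i - cz v i))) =
          g j ys - g j (vec_list p) - (\<Sum>k<?n. c k * (ys ! k - vec_list p ! k))"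
        unfolding S1 by (simp add: g_def envp c_def del: of_real_diff)
      have "\<bar>g j ys - g j (vec_list p) - (\<Sum>k<?n. c k * (ys ! k - vec_list p ! k))\<bar> \<le>
          cmod (?F ?z' - ?F (cz v) - (\<Sum>i\<in>I. D i ?F (cz v) * (?z' i - cz v i)))"
        unfolding re[symmetric] by (rule abs_Re_le_cmod)
      also have "\<dots> \<le> K * (\<Sum>i\<in>I. cmod (?z' i - cz v i))\<^sup>2" by (rule K(2)[OF zz z'])
      finally show ?thesis unfolding S2 .
    qed
    show "ldiff ?n (g j) (vec_list p)"
      unfolding ldiff_def
    proof (intro exI[of _ c] allI impI)
      fix e :: real assume e: "e > 0"
      \<comment> \<open>Chosen so that on the cube of radius \<open>d \<le> e / q\<close> one factor
        of the quadratic Taylor error, times \<open>K\<close>, is at most \<open>e\<close>.\<close>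
      define q where "q = (K + 1) * real ?n"
      have q: "q > 0" using K(1) by (simp add: q_def)
      define d where "d = min (r / 4) (e / q)"
      have d: "d > 0" using r e q by (simp add: d_def)
      have d4: "d \<le> r / 4" unfolding d_def by (rule min.cobounded1)
      show "\<exists>d>0. \<forall>ys\<in>cube ?n (vec_list p) d. \<bar>g j ys - g j (vec_list p) - (\<Sum>i<?n. c i * (ys ! i - vec_list p ! i))\<bar>
          \<le> e * (\<Sum>i<?n. \<bar>ys ! i - vec_list p ! i\<bar>)"
      proof (intro exI[of _ d] conjI ballI)
        fix ys assume ys: "ys \<in> cube ?n (vec_list p) d"
        let ?T = "\<Sum>i<?n. \<bar>ys ! i - vec_list p ! i\<bar>"
        have T0: "?T \<ge> 0" by (simp add: sum_nonneg)
        have "\<bar>ys ! i - vec_list p ! i\<bar> \<le> d" if "i < ?n" for i using ys that by (auto simp: cube_def less_imp_le)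
        then have "?T \<le> real ?n * d"
          using sum_bounded_above[of "{..<?n}" "\<lambda>i. \<bar>ys ! i - vec_list p ! i\<bar>" d] by simp
        then have "K * ?T \<le> K * (real ?n * d)" using K(1) by (rule mult_left_mono)
        also have "\<dots> \<le> q * d" using d by (simp add: q_def distrib_right)
        also have "\<dots> \<le> q * (e / q)" using q by (intro mult_left_mono) (auto simp: d_def)
        also have "\<dots> = e" using q by simp
        finally have "K * ?T * ?T \<le> e * ?T" using T0 by (rule mult_right_mono)
        moreover have "ys \<in> cube ?n (vec_list p) (r / 4)" using ys d4 by (force simp: cube_def)
        ultimately show "\<bar>g j ys - g j (vec_list p) - (\<Sum>i<?n. c i * (ys ! i - vec_list p ! i))\<bar> \<le> e * ?T"
          using est[of ys] by (simp add: power2_eq_square mult.assoc)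
      qed (rule d)
    qed
  qed
  then show False using p(1) by (simp add: nondiff_set_def)
qed

text \<open>The source coordinates in \<open>K\<close> already are parameters, via
  \<open>\<kappa>\<close>. Near each point either another source coordinate can be made a parameter,
  or a hypersurface lowers the dimension, or the source coordinates do not depend on the unmatched
  parameters. In the last case such a parameter can be frozen, because a graph point is determined
  by its source point.\<close>

lemma matched_small:
  assumes IH: "\<And>I' \<eta>' G' u' r'. finite I' \<Longrightarrow> card I' < card I \<Longrightarrow> finite G' \<Longrightarrow> data I' \<eta>' G' u' r' \<Longrightarrow>
      \<exists>s>0. Sm \<eta>' (near I' u' s \<inter> zs G')"
    and I: "finite I"
  shows "K \<subseteq> {..<CARD('n)} \<Longrightarrow> inj_on \<kappa> K \<Longrightarrow> \<kappa> ` K \<subseteq> I \<Longrightarrow> data I \<eta> {} u r \<Longrightarrow>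
    (\<And>k z. k \<in> K \<Longrightarrow> z \<in> pd I (cz u) r \<Longrightarrow> \<eta> k z = z (\<kappa> k)) \<Longrightarrow> \<exists>s>0. Sm \<eta> (near I u s)"
proof (induction "CARD('n) - card K" arbitrary: K \<kappa> \<eta> u r rule: less_induct)
  case less
  let ?n = "CARD('n)"
  note K = less.prems(1) and \<kappa> = less.prems(2,3) and d = less.prems(4) and match = less.prems(5)
  have r: "0 < r" and \<eta>: "\<And>j. j < N \<Longrightarrow> an I (\<eta> j) (cz u) r" and inB: "\<And>v. v \<in> near I u r \<Longrightarrow> ep \<eta> v \<in> B"
    using d by (auto simp: data_def zs_def)
  have finK: "finite K" using K finite_subset by blast
  show ?case
  proof (cases "K = {..<?n}")
    case True
    have "gr (ep \<eta> v) = {}" if "v \<in> near I u (r / 2)" for v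
      by (rule no_bad_point[OF I d _ _ _ that]) (use True \<kappa> match in auto)
    then show ?thesis using r by (intro exI[of _ "r / 2"]) (simp add: Sm_def)
  next
    case False
    have cardK: "card K < ?n" using psubset_card_mono[of "{..<?n}" K] K False by auto
    let ?R = "{..<?n} - K" and ?L = "I - \<kappa> ` K"
    define W where "W = near I u (r / 2)"
    \<comment> \<open>Some unmatched source coordinate varies to first order with a free parameter,
      which it can replace.\<close>
    define Wa where "Wa = {v \<in> W. \<exists>k\<in>?R. \<exists>i\<in>?L. D i (\<eta> k) (cz v) \<noteq> 0}"
    \<comment> \<open>A derivative of such a coordinate vanishes here without being flat, which puts
      the point on a smooth hypersurface.\<close>
    define Wb where "Wb k i w l = {v \<in> W. Dw w (D i (\<eta> k)) (cz v) = 0 \<and> D l (Dw w (D i (\<eta> k))) (cz v) \<noteq> 0}" for k i w l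
    \<comment> \<open>Near the point no unmatched source coordinate depends on any free
      parameter.\<close>
    define Wc where "Wc = {v \<in> W. \<forall>k\<in>?R. \<forall>i\<in>?L. \<forall>z\<in>pd I (cz v) (r / 4). D i (\<eta> k) z = 0}"
    define Q where "Q = {(k, i, w, l). k \<in> ?R \<and> i \<in> ?L \<and> set w \<subseteq> I \<and> l \<in> I}"
    have dv: "data I \<eta> {} v (r / 2)" if "v \<in> W" for v
      using data_recenter[OF d, of v "r / 2"] that r by (simp add: W_def)
    have dvs: "data I \<eta> {} v s" if "v \<in> W" "0 < s" "s \<le> r / 2" for v s
      using data_recenter[OF dv[OF that(1)], of v s] that near_center[of "r / 2 - s" v I]
      by (cases "s = r / 2") (use dv[OF that(1)] in auto)
    have an\<eta>: "an I (\<eta> j) (cz v) s" if "v \<in> W" "j < N" "0 < s" "s \<le> r / 2" for v j s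
      using dvs[OF that(1,3,4)] that(2) by (simp add: data_def)
    have RN: "k < N" if "k \<in> ?R" for k using that N by auto
    have anD: "an I (D i (\<eta> k)) (cz v) (r / 4)" if "v \<in> W" "k \<in> ?R" "i \<in> ?L" for v k i
      by (rule an_D[OF an\<eta>[OF that(1) RN[OF that(2)], of "r / 2"]]) (use r that in auto)
    have cover: "W \<subseteq> Wa \<union> (\<Union>(k, i, w, l)\<in>Q. Wb k i w l) \<union> Wc"
    proof
      fix v assume v: "v \<in> W"
      show "v \<in> Wa \<union> (\<Union>(k, i, w, l)\<in>Q. Wb k i w l) \<union> Wc"
      proof (rule ccontr)
        assume n: "v \<notin> Wa \<union> (\<Union>(k, i, w, l)\<in>Q. Wb k i w l) \<union> Wc"
        have "\<forall>z\<in>pd I (cz v) (r / 4). D i (\<eta> k) z = 0" if k: "k \<in> ?R" and i: "i \<in> ?L" for k i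
        proof -
          have 0: "D i (\<eta> k) (cz v) = 0" using n v k i by (auto simp: Wa_def)
          have "(\<forall>z\<in>pd I (cz v) (r / 4). D i (\<eta> k) z = 0) \<or>
            (\<exists>w l. set w \<subseteq> I \<and> l \<in> I \<and> Dw w (D i (\<eta> k)) (cz v) = 0 \<and> D l (Dw w (D i (\<eta> k))) (cz v) \<noteq> 0)"
            by (rule flat_or_hypersurface[OF anD[OF v k i] I _ 0]) (use r in simp)
          then show ?thesis
          proof
            assume "\<exists>w l. set w \<subseteq> I \<and> l \<in> I \<and> Dw w (D i (\<eta> k)) (cz v) = 0 \<and> D l (Dw w (D i (\<eta> k))) (cz v) \<noteq> 0"
            then obtain w l where "set w \<subseteq> I" "l \<in> I" "v \<in> Wb k i w l" using v by (auto simp: Wb_def)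
            moreover then have "(k, i, w, l) \<in> Q" using k i by (simp add: Q_def)
            ultimately have "v \<in> (\<Union>(k, i, w, l)\<in>Q. Wb k i w l)" by blast
            then show ?thesis using n by blast
          qed
        qed
        then have "v \<in> Wc" using v by (simp add: Wc_def)
        then show False using n by blast
      qed
    qed
    have "Sm \<eta> Wa"
    proof (rule Sm_local[OF I])
      fix v assume "v \<in> Wa"
      then obtain k0 i0 where v: "v \<in> W" and k0: "k0 \<in> ?R" and i0: "i0 \<in> ?L" and nz: "D i0 (\<eta> k0) (cz v) \<noteq> 0"
        by (auto simp: Wa_def)
      have i0I: "i0 \<in> I" using i0 by simp
      have r2: "0 < r / 2" using r by simp
      let ?h = "\<eta> k0"
      have h: "an I ?h (cz v) (r / 2)" by (rule an\<eta>[OF v RN[OF k0] r2 order_refl])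
      \<comment> \<open>The centre in the new chart, where place \<open>i0\<close> holds the value
        of \<open>\<eta> k0\<close>; the number of parameters is unchanged, but \<open>k0\<close>
        becomes matched.\<close>
      define v' where "v' = v(i0 := Re (?h (cz v)))"
      have hre: "?h (cz v1) \<in> \<real>" if "v1 \<in> near I v (r / 2)" for v1
        by (rule an_real[OF h]) (use that in \<open>simp_all add: cz_in_pd\<close>)
      have v': "(cz v)(i0 := ?h (cz v)) = cz v'"
        unfolding v'_def by (rule cz_upd[OF hre[OF near_center[OF r2]]])
      obtain X r' s where X: "0 < r'" "r' \<le> r / 2" "0 < s" "s \<le> r / 2" "an I X (cz v') r'"
        "\<And>z. z \<in> pd I (cz v') r' \<Longrightarrow> cmod (X z - cz v i0) < r / 2 \<and> ?h (z(i0 := X z)) = z i0"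
        "\<And>z. z \<in> pd I (cz v) s \<Longrightarrow> z(i0 := ?h z) \<in> pd I (cz v') r' \<and> X (z(i0 := ?h z)) = z i0"
        using an_implicit[OF h I r2 i0I _ nz] unfolding v' by (metis cz_real)
      have v'i: "cz v' i = cz v i" if "i \<noteq> i0" for i using that by (simp add: v'_def cz_def)
      define \<eta>' where "\<eta>' j z = \<eta> j (z(i0 := X z))" for j z
      have inpd: "z(i0 := X z) \<in> pd I (cz v) (r / 2)" if "z \<in> pd I (cz v') r'" for z
      proof -
        have "cmod (z i - cz v i) < r / 2" if "i \<in> I" "i \<noteq> i0" for i
        proof -
          have "cmod (z i - cz v' i) < r'" using \<open>z \<in> pd I (cz v') r'\<close> that(1) by (simp add: pd_def)
          then show ?thesis using v'i[OF that(2)] X(2) by simp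
        qed
        then show ?thesis using X(6)[OF that] by (simp add: pd_def)
      qed
      have data': "data I \<eta>' {} v' r'"
        unfolding data_def
      proof (intro conjI allI impI ballI)
        show "0 < r'" by (rule X(1))
        fix j assume "j < N"
        then show "an I (\<eta>' j) (cz v') r'"
          unfolding \<eta>'_def
          by (intro an_subst[OF an\<eta>[OF v _ r2 order_refl] I i0I X(5) _ _ X(1,2)]) (use X(6) v'i in auto)
      next
        fix v1 assume v1: "v1 \<in> near I v' r'"
        then have p1: "cz v1 \<in> pd I (cz v') r'" by (simp add: cz_in_pd)
        have re: "X (cz v1) \<in> \<real>" by (rule an_real[OF X(5) p1]) simp
        note e = cz_upd[OF re, of v1 i0]
        have "v1(i0 := Re (X (cz v1))) \<in> near I v (r / 2)"
          using inpd[OF p1] by (simp only: e cz_in_pd)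
        moreover have "ep \<eta>' v1 = ep \<eta> (v1(i0 := Re (X (cz v1))))"
          by (rule ep_cong) (simp add: \<eta>'_def e)
        ultimately show "ep \<eta>' v1 \<in> B" using dv[OF v] by (simp add: data_def zs_def)
      qed simp
      have pdsub: "pd I (cz v) (r / 2) \<subseteq> pd I (cz u) r"
      proof
        fix z assume z: "z \<in> pd I (cz v) (r / 2)"
        have "cmod (z i - cz u i) < r" if i: "i \<in> I" for i
        proof -
          have "cmod (z i - cz v i) < r / 2" "cmod (cz v i - cz u i) < r / 2"
            using z v i by (auto simp: pd_def W_def near_def cmod_cz_diff)
          then show ?thesis using norm_triangle_ineq[of "z i - cz v i" "cz v i - cz u i"] by simp
        qed
        then show "z \<in> pd I (cz u) r" by (simp add: pd_def)
      qed
      let ?K = "insert k0 K" and ?\<kappa> = "\<kappa>(k0 := i0)"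
      have k0K: "k0 \<notin> K" using k0 by simp
      have img: "?\<kappa> ` K = \<kappa> ` K" using k0K by (intro image_cong) auto
      have "\<exists>s>0. Sm \<eta>' (near I v' s)"
      proof (rule less.hyps[OF _ _ _ _ data'])
        show "?n - card ?K < ?n - card K" using k0K finK cardK by simp
        show "?K \<subseteq> {..<?n}" using K k0 by auto
        show "inj_on ?\<kappa> ?K"
          using \<kappa>(1) i0 k0K img by (simp add: inj_on_insert inj_on_fun_updI)
        show "?\<kappa> ` ?K \<subseteq> I" by (rule image_subsetI) (use \<kappa>(2) i0I in auto)
        fix k z assume k: "k \<in> ?K" and z: "z \<in> pd I (cz v') r'"
        show "\<eta>' k z = z (?\<kappa> k)"
        proof (cases "k = k0")
          case True then show ?thesis using X(6)[OF z] by (simp add: \<eta>'_def)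
        next
          case False
          then have "k \<in> K" "\<kappa> k \<noteq> i0" using k i0 by auto
          then show ?thesis using match[of k "z(i0 := X z)"] inpd[OF z] pdsub False by (auto simp: \<eta>'_def)
        qed
      qed
      then obtain t where t: "t > 0" "Sm \<eta>' (near I v' t)" by blast
      \<comment> \<open>Continuity keeps the new parameter within \<open>t\<close> of its value at
        the centre, so nearby old parameters lie in the small part of the new chart.\<close>
      obtain q where q: "q > 0" "q \<le> r / 2" "\<And>z. z \<in> pd I (cz v) q \<Longrightarrow> cmod (?h z - ?h (cz v)) < t"
        using an_continuous[OF h I r2 t(1)] by blast
      let ?s = "min s (min t q)"
      have "(\<Union>v1\<in>Wa \<inter> near I v ?s. gr (ep \<eta> v1)) \<subseteq> (\<Union>v1\<in>near I v' t. gr (ep \<eta>' v1))"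
      proof (rule UN_least)
        fix v1 assume "v1 \<in> Wa \<inter> near I v ?s"
        then have v1: "v1 \<in> near I v s" "v1 \<in> near I v t" "v1 \<in> near I v q"
          unfolding near_def by auto
        have re: "?h (cz v1) \<in> \<real>" using hre v1(3) near_mono[OF q(2)] by blast
        define v2 where "v2 = v1(i0 := Re (?h (cz v1)))"
        have e: "(cz v1)(i0 := ?h (cz v1)) = cz v2" unfolding v2_def by (rule cz_upd[OF re])
        have X2: "X (cz v2) = cz v1 i0"
          using X(7)[of "cz v1"] v1(1) unfolding e by (simp add: cz_in_pd)
        have "(cz v2)(i0 := cz v1 i0) = cz v1" unfolding e[symmetric] by simp
        then have "(cz v2)(i0 := X (cz v2)) = cz v1" by (simp only: X2)
        then have "ep \<eta> v1 = ep \<eta>' v2" by (intro ep_cong) (simp add: \<eta>'_def)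
        moreover have "v2 \<in> near I v' t"
        proof -
          have "cmod (((cz v1)(i0 := ?h (cz v1))) i - cz v' i) < t" if i: "i \<in> I" for i
          proof (cases "i = i0")
            case True
            have "cz v' i0 = ?h (cz v)" using v'[THEN fun_cong, of i0] by simp
            then show ?thesis using True q(3)[of "cz v1"] v1(3) by (simp add: cz_in_pd)
          next
            case False
            then show ?thesis using v'i[OF False] v1(2) i by (simp add: cmod_cz_diff near_def)
          qed
          then have "cz v2 \<in> pd I (cz v') t" unfolding e[symmetric] by (simp add: pd_def)
          then show ?thesis by (simp add: cz_in_pd)
        qed
        ultimately show "gr (ep \<eta> v1) \<subseteq> (\<Union>v1\<in>near I v' t. gr (ep \<eta>' v1))" by auto
      qed
      then have "Sm \<eta> (Wa \<inter> near I v ?s)" using t(2) unfolding Sm_def by (rule small_subset[rotated])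
      then show "\<exists>s>0. Sm \<eta> (Wa \<inter> near I v s)" using X(3) t(1) q(1) by (intro exI[of _ ?s]) simp
    qed
    moreover have "Sm \<eta> (\<Union>(k, i, w, l)\<in>Q. Wb k i w l)"
    proof (rule Sm_UN)
      \<comment> \<open>Indices and words range over a countable type.\<close>
      show "countable Q" by (rule countableI_type)
      fix x assume "x \<in> Q"
      then obtain k i w l where x: "x = (k, i, w, l)" and k: "k \<in> ?R" and i: "i \<in> ?L" and w: "set w \<subseteq> I" and l: "l \<in> I"
        by (auto simp: Q_def)
      have "Sm \<eta> (Wb k i w l)"
      proof (rule Sm_local[OF I])
        fix v assume v: "v \<in> Wb k i w l"
        then have vW: "v \<in> W" by (simp add: Wb_def)
        let ?h = "Dw w (D i (\<eta> k))"
        have r8: "0 < r / 8" "r / 8 < r / 4" "r / 8 \<le> r / 2" using r by auto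
        have "\<exists>s>0. Sm \<eta> (near I v s \<inter> zs {} \<inter> {v. ?h (cz v) = 0})"
        proof (rule hypersurface_small[OF IH I])
          show "data I \<eta> {} v (r / 8)" by (rule dvs[OF vW r8(1,3)])
          show "an I ?h (cz v) (r / 8)" by (rule an_Dw[OF anD[OF vW k i] w r8(1,2)])
          show "?h (cz v) = 0" "D l ?h (cz v) \<noteq> 0" using v by (auto simp: Wb_def)
        qed (use l in auto)
        then obtain s where s: "s > 0" "Sm \<eta> (near I v s \<inter> zs {} \<inter> {v. ?h (cz v) = 0})" by blast
        have "Wb k i w l \<inter> near I v s \<subseteq> near I v s \<inter> zs {} \<inter> {v. ?h (cz v) = 0}"
          by (auto simp: Wb_def zs_def)
        then show "\<exists>s>0. Sm \<eta> (Wb k i w l \<inter> near I v s)" using s Sm_subset by blast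
      qed
      then show "Sm \<eta> (case x of (k, i, w, l) \<Rightarrow> Wb k i w l)" by (simp add: x)
    qed
    moreover have "Sm \<eta> Wc"
    proof (rule Sm_local[OF I])
      fix v assume "v \<in> Wc"
      then have v: "v \<in> W" and flat: "\<And>k i z. k \<in> ?R \<Longrightarrow> i \<in> ?L \<Longrightarrow> z \<in> pd I (cz v) (r / 4) \<Longrightarrow> D i (\<eta> k) z = 0"
        by (auto simp: Wc_def)
      have r4: "0 < r / 4" "r / 4 \<le> r / 2" using r by auto
      have dv4: "data I \<eta> {} v (r / 4)" by (rule dvs[OF v r4])
      have an4: "an I (\<eta> j) (cz v) (r / 4)" if "j < N" for j by (rule an\<eta>[OF v that r4])
      show "\<exists>s>0. Sm \<eta> (Wc \<inter> near I v s)"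
      proof (cases "?L = {}")
        case True
        \<comment> \<open>No free parameter is left, and fewer than \<open>n\<close> are matched, so
          the dimension itself is too low.\<close>
        then have "I = \<kappa> ` K" using \<kappa>(2) by auto
        then have "card I = card K" using \<kappa>(1) by (simp add: card_image)
        then have "Sm \<eta> (near I v (r / 8))"
          by (intro small_low_dimension[OF I _ an4]) (use cardK r in auto)
        then show ?thesis using r Sm_subset by (intro exI[of _ "r / 8"]) (auto intro: Sm_subset)
      next
        case False
        then obtain i0 where i0: "i0 \<in> ?L" by blast
        then have i0I: "i0 \<in> I" by simp
        let ?J = "I - {i0}"
        \<comment> \<open>The chart with the free parameter \<open>i0\<close> frozen at its value at
          \<open>v\<close>; it has one parameter less, and the induction on \<open>card I\<close>
          restarts the matching from nothing.\<close>
        define \<eta>' where "\<eta>' j z = \<eta> j (z(i0 := cz v i0))" for j z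
        have vv: "(cz v1)(i0 := cz v i0) = cz (v1(i0 := v i0))" for v1 by (auto simp: cz_def)
        have frz: "v1(i0 := v i0) \<in> near I v (r / 4)" if "v1 \<in> near ?J v (r / 4)" for v1
          using that r4 by (auto simp: near_def)
        have epf: "ep \<eta>' v1 = ep \<eta> (v1(i0 := v i0))" for v1
          by (rule ep_cong) (simp add: \<eta>'_def vv)
        have "data ?J \<eta>' {} v (r / 4)"
          unfolding data_def
        proof (intro conjI allI impI ballI)
          show "0 < r / 4" by (rule r4)
          fix j assume "j < N"
          then show "an ?J (\<eta>' j) (cz v) (r / 4)"
            unfolding \<eta>'_def
            by (intro an_subst[OF an4 I i0I an_const]) (use r4 in auto)
        next
          fix v1 assume "v1 \<in> near ?J v (r / 4)"
          then show "ep \<eta>' v1 \<in> B"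
            using frz dv4 unfolding epf by (simp add: data_def zs_def)
        qed simp
        moreover have "card ?J < card I" by (rule card_Diff1_less[OF I i0I])
        ultimately obtain t where t: "t > 0" "Sm \<eta>' (near ?J v t)"
          using IH[of ?J "{}" \<eta>' v "r / 4"] I by (auto simp: zs_def)
        let ?s = "min t (r / 4)"
        have "(\<Union>v1\<in>Wc \<inter> near I v ?s. gr (ep \<eta> v1)) \<subseteq> (\<Union>v1\<in>near ?J v t. gr (ep \<eta>' v1))"
        proof (rule UN_least)
          fix v1 assume "v1 \<in> Wc \<inter> near I v ?s"
          then have v1: "v1 \<in> near I v t" "v1 \<in> near I v (r / 4)"
            unfolding near_def by auto
          have v1J: "v1 \<in> near ?J v t" "v1 \<in> near ?J v (r / 4)" using v1 by (auto simp: near_def)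
          have pd1: "cz v1 \<in> pd I (cz v) (r / 4)" using v1(2) by (simp add: cz_in_pd)
          \<comment> \<open>Matched coordinates ignore \<open>i0\<close> because it is not in the
            image of \<open>\<kappa>\<close>, unmatched ones because their derivative in
            \<open>i0\<close> vanishes identically.\<close>
          have same: "\<eta> k (cz v1) = \<eta>' k (cz v1)" if k: "k < ?n" for k
          proof (cases "k \<in> K")
            case True
            have "near I v (r / 4) \<subseteq> near I u r"
              using near_trans[of v I u "r / 2" "r / 4"] near_mono[of "r / 2 + r / 4" r I u] v r by (auto simp: W_def)
            then have "cz v1 \<in> pd I (cz u) r" "(cz v1)(i0 := cz v i0) \<in> pd I (cz u) r"
              using v1(2) frz[OF v1J(2)] unfolding vv by (auto simp: cz_in_pd)
            moreover have "\<kappa> k \<noteq> i0" using True i0 by auto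
            ultimately show ?thesis using match[OF True] by (simp add: \<eta>'_def)
          next
            case False
            then have kR: "k \<in> ?R" using k by simp
            have "\<eta> k ((cz v1)(i0 := cz v i0)) = \<eta> k (cz v1)"
              by (rule D_zero_constant[OF an4[OF RN[OF kR]] i0I flat[OF kR i0] pd1]) (use r4 in auto)
            then show ?thesis by (simp add: \<eta>'_def)
          qed
          have "gr (ep \<eta> v1) \<subseteq> gr (ep \<eta>' v1)"
          proof
            fix z assume "z \<in> gr (ep \<eta> v1)"
            then obtain p where p: "z = (p, f p)" "p \<in> nondiff_set U f" "take (2 * ?n) (ep \<eta> v1) = vec_list p @ vec_list (f p)"
              by (auto simp: gr_def)
            have "ep \<eta>' v1 \<in> B" using frz[OF v1J(2)] dv4 unfolding epf by (simp add: data_def zs_def)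
            then obtain p' where p': "take (2 * ?n) (ep \<eta>' v1) = vec_list p' @ vec_list (f p')" using B by blast
            \<comment> \<open>Freezing may move the point of \<open>B\<close>, but not its source
              coordinates, hence not the graph point below it.\<close>
            have "p = p'"
              by (rule vec_eq_idx) (simp add: ep_eq_graph(1)[OF p(3)] ep_eq_graph(1)[OF p'] same)
            then show "z \<in> gr (ep \<eta>' v1)" using p p' by (auto simp: gr_def)
          qed
          then show "gr (ep \<eta> v1) \<subseteq> (\<Union>v1\<in>near ?J v t. gr (ep \<eta>' v1))" using v1J(1) by auto
        qed
        then have "Sm \<eta> (Wc \<inter> near I v ?s)" using t(2) unfolding Sm_def by (rule small_subset[rotated])
        then show ?thesis using t(1) r4 by (intro exI[of _ ?s]) simp
      qed
    qed
    ultimately have "Sm \<eta> (Wa \<union> (\<Union>(k, i, w, l)\<in>Q. Wb k i w l) \<union> Wc)" by (intro Sm_Un)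
    then have "Sm \<eta> W" using cover by (rule Sm_subset)
    then show ?thesis using r by (intro exI[of _ "r / 2"]) (simp add: W_def)
  qed
qed

text \<open>Outer induction on the number of parameters, inner induction on the number of equations;
  once no equation is left, \<open>matched_small\<close> takes over.\<close>

lemma data_small:
  "finite I \<Longrightarrow> finite G \<Longrightarrow> data I \<eta> G u r \<Longrightarrow> \<exists>s>0. Sm \<eta> (near I u s \<inter> zs G)"
proof (induction "card I" arbitrary: I G \<eta> u r rule: less_induct)
  case less
  have IH: "\<exists>s>0. Sm \<eta>' (near I' u' s \<inter> zs G')"
    if "finite I'" "card I' < card I" "finite G'" "data I' \<eta>' G' u' r'" for I' \<eta>' G' u' r'
    using less.hyps[OF that(2,1,3,4)] .
  note I = less.prems(1)
  show ?case using less.prems(2,3)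
  proof (induction G arbitrary: \<eta> u r rule: finite_induct)
    case empty
    have "\<exists>s>0. Sm \<eta> (near I u s)"
      by (rule matched_small[OF IH I, where K = "{}" and \<kappa> = id]) (use empty in auto)
    then show ?case by (simp add: zs_def)
  next
    case (insert g G)
    note d = insert.prems
    have r: "0 < r" and g: "an I g (cz u) r" using d by (auto simp: data_def)
    define W where "W = near I u (r / 2) \<inter> zs (insert g G)"
    \<comment> \<open>Here the equation \<open>g = 0\<close> holds identically nearby and can be
      discarded.\<close>
    define Wf where "Wf = {v \<in> W. \<forall>z\<in>pd I (cz v) (r / 2). g z = 0}"
    \<comment> \<open>Here \<open>g\<close> is not flat, and the vanishing of one of its derivatives
      eliminates a coordinate while all equations are kept.\<close>
    define Wb where "Wb w l = {v \<in> W. Dw w g (cz v) = 0 \<and> D l (Dw w g) (cz v) \<noteq> 0}" for w l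
    define Q where "Q = {(w, l). set w \<subseteq> I \<and> l \<in> I}"
    have dv: "data I \<eta> (insert g G) v (r / 2)" if "v \<in> W" for v
      using data_recenter[OF d, of v "r / 2"] that r by (simp add: W_def)
    have gv: "an I g (cz v) (r / 2)" if "v \<in> W" for v using dv[OF that] by (simp add: data_def)
    have cover: "W \<subseteq> Wf \<union> (\<Union>(w, l)\<in>Q. Wb w l)"
    proof
      fix v assume v: "v \<in> W"
      then have "g (cz v) = 0" by (simp add: W_def zs_def)
      then have "(\<forall>z\<in>pd I (cz v) (r / 2). g z = 0) \<or>
          (\<exists>w l. set w \<subseteq> I \<and> l \<in> I \<and> Dw w g (cz v) = 0 \<and> D l (Dw w g) (cz v) \<noteq> 0)"
        using flat_or_hypersurface[OF gv[OF v] I] r by simp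
      then show "v \<in> Wf \<union> (\<Union>(w, l)\<in>Q. Wb w l)"
        using v by (auto simp: Wf_def Wb_def Q_def)
    qed
    have "Sm \<eta> Wf"
    proof (rule Sm_local[OF I])
      fix v assume v: "v \<in> Wf"
      then have vW: "v \<in> W" and g0: "\<And>z. z \<in> pd I (cz v) (r / 2) \<Longrightarrow> g z = 0" by (auto simp: Wf_def)
      have "data I \<eta> G v (r / 2)"
        using dv[OF vW] g0 by (auto simp: data_def zs_def cz_in_pd)
      then obtain s where s: "s > 0" "Sm \<eta> (near I v s \<inter> zs G)" using insert.IH by blast
      have "Wf \<inter> near I v s \<subseteq> near I v s \<inter> zs G" by (auto simp: Wf_def W_def zs_def)
      then show "\<exists>s>0. Sm \<eta> (Wf \<inter> near I v s)" using s Sm_subset by blast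
    qed
    moreover have "Sm \<eta> (\<Union>(w, l)\<in>Q. Wb w l)"
    proof (rule Sm_UN)
      show "countable Q" by (rule countableI_type)
      fix x assume "x \<in> Q"
      then obtain w l where x: "x = (w, l)" and w: "set w \<subseteq> I" and l: "l \<in> I" by (auto simp: Q_def)
      have "Sm \<eta> (Wb w l)"
      proof (rule Sm_local[OF I])
        fix v assume v: "v \<in> Wb w l"
        then have vW: "v \<in> W" by (simp add: Wb_def)
        let ?h = "Dw w g"
        have r4: "0 < r / 4" "r / 4 < r / 2" using r by auto
        have "\<exists>s>0. Sm \<eta> (near I v s \<inter> zs (insert g G) \<inter> {v. ?h (cz v) = 0})"
        proof (rule hypersurface_small[OF IH I])
          show "data I \<eta> (insert g G) v (r / 4)"
            by (rule data_recenter[OF dv[OF vW]]) (use r4 near_center[of "r / 2 - r / 4" v I] in auto)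
          show "an I ?h (cz v) (r / 4)" by (rule an_Dw[OF gv[OF vW] w r4])
          show "?h (cz v) = 0" "D l ?h (cz v) \<noteq> 0" using v by (auto simp: Wb_def)
        qed (use l insert.hyps in auto)
        then obtain s where s: "s > 0" "Sm \<eta> (near I v s \<inter> zs (insert g G) \<inter> {v. ?h (cz v) = 0})" by blast
        have "Wb w l \<inter> near I v s \<subseteq> near I v s \<inter> zs (insert g G) \<inter> {v. ?h (cz v) = 0}"
          by (auto simp: Wb_def W_def)
        then show "\<exists>s>0. Sm \<eta> (Wb w l \<inter> near I v s)" using s Sm_subset by blast
      qed
      then show "Sm \<eta> (case x of (w, l) \<Rightarrow> Wb w l)" by (simp add: x)
    qed
    ultimately have "Sm \<eta> (Wf \<union> (\<Union>(w, l)\<in>Q. Wb w l))" by (rule Sm_Un)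
    then have "Sm \<eta> W" using cover by (rule Sm_subset)
    then show ?case using r by (intro exI[of _ "r / 2"]) (simp add: W_def)
  qed
qed

end

context graph_cover
begin

text \<open>The starting chart: all \<open>N\<close> coordinates are parameters,
  \<open>\<eta>\<close> is the identity, and the equations of one of the finitely many basic pieces
  form \<open>G\<close>. Strict inequalities persist near a point of the piece and are absorbed into
  the radius.\<close>

lemma semianalytic_small:
  assumes semi: "semianalytic N B"
  shows "small (\<Union>b\<in>B. gr b)"
proof -
  let ?I = "{..<N}" and ?\<eta> = "\<lambda>j (z :: nat \<Rightarrow> complex). z j"
  have len: "length b = N" if "b \<in> B" for b using semi that by (auto simp: semianalytic_def)
  have ep: "ep ?\<eta> u = map u [0..<N]" for u by (simp add: ep_def cz_def)
  have ep_envl: "ep ?\<eta> (envl xs) = xs" if "length xs = N" for xs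
    unfolding ep by (rule nth_equalityI) (use that in \<open>auto simp: envl_def\<close>)
  have near_cube: "map v [0..<N] \<in> cube N b s" if "v \<in> near ?I (envl b) s" "length b = N" for v b s
    using that by (auto simp: near_def cube_def envl_def)
  have cube_near: "xs \<in> cube N b s" if "envl xs \<in> near ?I (envl b) s" "length b = N" "length xs = N" for xs b s
    using that by (auto simp: near_def cube_def envl_def)
  have "Sm ?\<eta> (envl ` B)"
  proof (rule Sm_local[where I = ?I])
    fix u assume "u \<in> envl ` B"
    then obtain b where b: "b \<in> B" "u = envl b" by blast
    obtain r \<F> where r: "r > 0" and fin: "finite \<F>"
      and an\<F>: "\<And>G H. (G, H) \<in> \<F> \<Longrightarrow> finite G \<and> finite H \<and> (\<forall>g\<in>G \<union> H. \<forall>c\<in>cube N b r. real_analytic_at N g c)"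
      and B\<F>: "B \<inter> cube N b r = (\<Union>(G, H)\<in>\<F>. {xs \<in> cube N b r. (\<forall>g\<in>G. g xs = 0) \<and> (\<forall>h\<in>H. h xs > 0)})"
    proof -
      have "b \<in> Rn N" using len[OF b(1)] by simp
      then obtain r \<F> where "r > 0" "finite \<F> \<and>
        (\<forall>(G, H) \<in> \<F>. finite G \<and> finite H \<and> (\<forall>g \<in> G \<union> H. \<forall>c \<in> cube N b r. real_analytic_at N g c)) \<and>
        B \<inter> cube N b r = (\<Union>(G, H) \<in> \<F>. {xs \<in> cube N b r. (\<forall>g \<in> G. g xs = 0) \<and> (\<forall>h \<in> H. h xs > 0)})"
        using semi unfolding semianalytic_def by blast
      then show ?thesis using that[of r \<F>] by fast
    qed
    define X where "X G H = {xs \<in> cube N b r. (\<forall>g\<in>G. g xs = 0) \<and> (\<forall>h\<in>H. h xs > 0)}"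
      for G H :: "(real list \<Rightarrow> real) set"
    have "Sm ?\<eta> (envl ` X G H)" if GH: "(G, H) \<in> \<F>" for G H
    proof (rule Sm_local[where I = ?I])
      fix u' assume "u' \<in> envl ` X G H"
      then obtain c where c: "c \<in> X G H" "u' = envl c" by blast
      have ccube: "c \<in> cube N b r" using c by (simp add: X_def)
      have lc: "length c = N" using ccube by (simp add: cube_def)
      have lb: "length b = N" by (rule len[OF b(1)])
      have "\<forall>g\<in>G \<union> H. \<exists>z. snd z > 0 \<and> an ?I (fst z) (cz (envl c)) (snd z) \<and>
          (\<forall>xs\<in>cube N c (snd z). fst z (cz (envl xs)) = complex_of_real (g xs))"
      proof
        fix g assume "g \<in> G \<union> H"
        then have "real_analytic_at N g c" using an\<F>[OF GH] ccube by blast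
        from an_power_series[OF this lc] obtain F s where "s > 0" "an ?I F (cz (envl c)) s"
          "\<forall>xs\<in>cube N c s. F (cz (envl xs)) = complex_of_real (g xs)" by blast
        then show "\<exists>z. snd z > 0 \<and> an ?I (fst z) (cz (envl c)) (snd z) \<and>
          (\<forall>xs\<in>cube N c (snd z). fst z (cz (envl xs)) = complex_of_real (g xs))"
          by (intro exI[of _ "(F, s)"]) simp
      qed
      from bchoice[OF this] obtain Z where Z: "\<forall>g\<in>G \<union> H. snd (Z g) > 0 \<and> an ?I (fst (Z g)) (cz (envl c)) (snd (Z g)) \<and>
          (\<forall>xs\<in>cube N c (snd (Z g)). fst (Z g) (cz (envl xs)) = complex_of_real (g xs))" ..
      \<comment> \<open>Strict positivity at \<open>c\<close> persists on a cube by continuity of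
        the analytic extension.\<close>
      have "\<forall>h\<in>H. \<exists>s. s > 0 \<and> s \<le> snd (Z h) \<and> (\<forall>xs\<in>cube N c s. h xs > 0)"
      proof
        fix h assume h: "h \<in> H"
        then have Zh: "snd (Z h) > 0" "an ?I (fst (Z h)) (cz (envl c)) (snd (Z h))"
          "\<And>xs. xs \<in> cube N c (snd (Z h)) \<Longrightarrow> fst (Z h) (cz (envl xs)) = complex_of_real (h xs)"
          using Z by auto
        have hc: "h c > 0" using c h by (simp add: X_def)
        obtain s where s: "s > 0" "s \<le> snd (Z h)"
          "\<And>z. z \<in> pd ?I (cz (envl c)) s \<Longrightarrow> cmod (fst (Z h) z - fst (Z h) (cz (envl c))) < h c"
          using an_continuous[OF Zh(2) finite_lessThan Zh(1) hc] by blast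
        have "h xs > 0" if xs: "xs \<in> cube N c s" for xs
        proof -
          have lx: "length xs = N" using xs by (simp add: cube_def)
          have "envl xs \<in> near ?I (envl c) s" using xs lc lx by (auto simp: near_def cube_def envl_def)
          then have "cmod (fst (Z h) (cz (envl xs)) - fst (Z h) (cz (envl c))) < h c"
            by (intro s(3)) (simp add: cz_in_pd)
          moreover have "xs \<in> cube N c (snd (Z h))" using xs s(2) by (force simp: cube_def)
          moreover have "c \<in> cube N c (snd (Z h))" using lc Zh(1) by (simp add: cube_def)
          ultimately have "cmod (complex_of_real (h xs - h c)) < h c" using Zh(3) by simp
          then have "\<bar>h xs - h c\<bar> < h c" by (simp only: norm_of_real)
          then show ?thesis by linarith
        qed
        then show "\<exists>s. s > 0 \<and> s \<le> snd (Z h) \<and> (\<forall>xs\<in>cube N c s. h xs > 0)" using s by blast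
      qed
      from bchoice[OF this] obtain S where S: "\<forall>h\<in>H. S h > 0 \<and> S h \<le> snd (Z h) \<and> (\<forall>xs\<in>cube N c (S h). h xs > 0)" ..
      obtain d where d: "d > 0" "cube N c d \<subseteq> cube N b r"
      proof -
        let ?d = "Min (insert 1 ((\<lambda>i. r - \<bar>c ! i - b ! i\<bar>) ` ?I))"
        have 1: "?d > 0" using ccube by (auto simp: cube_def)
        have 2: "?d \<le> r - \<bar>c ! i - b ! i\<bar>" if "i < N" for i by (rule Min_le) (use that in auto)
        have "cube N c ?d \<subseteq> cube N b r"
        proof
          fix xs assume xs: "xs \<in> cube N c ?d"
          have "\<bar>xs ! i - b ! i\<bar> < r" if "i < N" for i
          proof -
            have "\<bar>xs ! i - c ! i\<bar> < ?d" using xs that by (simp add: cube_def)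
            then show ?thesis using 2[OF that] by linarith
          qed
          then show "xs \<in> cube N b r" using xs by (simp add: cube_def)
        qed
        then show ?thesis using 1 that by blast
      qed
      have finGH: "finite G" "finite H" using an\<F>[OF GH] by auto
      \<comment> \<open>One radius for staying in the cube of the local description, for all
        extensions, and for all inequalities; inserting \<open>d\<close> keeps the set
        nonempty.\<close>
      define \<delta> where "\<delta> = Min (insert d ((\<lambda>g. snd (Z g)) ` G \<union> S ` H))"
      have \<delta>: "\<delta> > 0" unfolding \<delta>_def using d(1) Z S finGH by (subst Min_gr_iff) auto
      have \<delta>d: "\<delta> \<le> d" unfolding \<delta>_def using finGH by (intro Min_le) auto
      have \<delta>G: "\<delta> \<le> snd (Z g)" if "g \<in> G" for g unfolding \<delta>_def using finGH that by (intro Min_le) auto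
      have \<delta>H: "\<delta> \<le> S h" if "h \<in> H" for h unfolding \<delta>_def using finGH that by (intro Min_le) auto
      have cube_mono: "xs \<in> cube N c t" if "xs \<in> cube N c \<delta>" "\<delta> \<le> t" for xs t
        using that by (force simp: cube_def)
      define G' where "G' = (\<lambda>g. fst (Z g)) ` G"
      have Zval: "fst (Z g) (cz v) = complex_of_real (g (map v [0..<N]))" if g: "g \<in> G" and v: "v \<in> near ?I (envl c) \<delta>" for g v
      proof -
        have "fst (Z g) (cz v) = fst (Z g) (cz (envl (map v [0..<N])))"
          by (rule an_dep[of ?I _ "cz (envl c)" "snd (Z g)"]) (use Z g in \<open>auto simp: cz_def envl_def\<close>)
        also have "\<dots> = complex_of_real (g (map v [0..<N]))"
          using Z g cube_mono[OF near_cube[OF v lc] \<delta>G[OF g]] by blast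
        finally show ?thesis .
      qed
      have "data ?I ?\<eta> G' (envl c) \<delta>"
        unfolding data_def
      proof (intro conjI allI impI ballI)
        show "0 < \<delta>" by (rule \<delta>)
        show "an ?I (\<lambda>z. z j) (cz (envl c)) \<delta>" if "j < N" for j by (rule an_coord) (use that in simp)
        show "an ?I g' (cz (envl c)) \<delta>" if g': "g' \<in> G'" for g'
        proof -
          obtain g where g: "g \<in> G" "g' = fst (Z g)" using g' by (auto simp: G'_def)
          then have "an ?I (fst (Z g)) (cz (envl c)) (snd (Z g))" using Z by blast
          then show ?thesis unfolding g(2) by (rule an_shrink) (rule \<delta>G[OF g(1)])
        qed
        fix v assume v: "v \<in> near ?I (envl c) \<delta>" "v \<in> zs G'"
        let ?xs = "map v [0..<N]"
        have xs: "?xs \<in> cube N c \<delta>" by (rule near_cube[OF v(1) lc])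
        have "g ?xs = 0" if "g \<in> G" for g
        proof -
          have "fst (Z g) (cz v) = 0" using v(2) that by (simp add: zs_def G'_def)
          then show ?thesis using Zval[OF that v(1)] by simp
        qed
        moreover have "h ?xs > 0" if "h \<in> H" for h using S that cube_mono[OF xs \<delta>H[OF that]] by blast
        moreover have "?xs \<in> cube N b r" using cube_mono[OF xs \<delta>d] d(2) by blast
        ultimately have "?xs \<in> B \<inter> cube N b r" unfolding B\<F> using GH by blast
        then show "ep ?\<eta> v \<in> B" by (simp add: ep)
      qed
      moreover have "finite G'" using finGH by (simp add: G'_def)
      ultimately obtain s where s: "s > 0" "Sm ?\<eta> (near ?I (envl c) s \<inter> zs G')"
        using data_small[OF finite_lessThan] by blast
      let ?s = "min s \<delta>"
      have "envl ` X G H \<inter> near ?I u' ?s \<subseteq> near ?I (envl c) s \<inter> zs G'"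
      proof
        fix v assume v: "v \<in> envl ` X G H \<inter> near ?I u' ?s"
        then obtain xs where xs: "xs \<in> X G H" "v = envl xs" by blast
        have lx: "length xs = N" using xs by (simp add: X_def cube_def)
        have vn: "v \<in> near ?I (envl c) s" "v \<in> near ?I (envl c) \<delta>" using v c(2) by (auto simp: near_def)
        have "map v [0..<N] = xs" using ep_envl[OF lx] ep xs(2) by simp
        then have "v \<in> zs G'" using Zval[OF _ vn(2)] xs(1) by (auto simp: zs_def G'_def X_def)
        then show "v \<in> near ?I (envl c) s \<inter> zs G'" using vn by simp
      qed
      then have "Sm ?\<eta> (envl ` X G H \<inter> near ?I u' ?s)" by (rule Sm_subset[OF s(2)])
      then show "\<exists>s>0. Sm ?\<eta> (envl ` X G H \<inter> near ?I u' s)" using s(1) \<delta> by (intro exI[of _ ?s]) simp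
    qed simp
    then have "Sm ?\<eta> (\<Union>(G, H)\<in>\<F>. envl ` X G H)" using fin by (intro Sm_UN) (auto intro: countable_finite)
    moreover have "envl ` B \<inter> near ?I u r \<subseteq> (\<Union>(G, H)\<in>\<F>. envl ` X G H)"
    proof
      fix v assume v: "v \<in> envl ` B \<inter> near ?I u r"
      then obtain xs where xs: "xs \<in> B" "v = envl xs" by blast
      have "xs \<in> B \<inter> cube N b r" using cube_near[of xs b r] v xs b len by auto
      then show "v \<in> (\<Union>(G, H)\<in>\<F>. envl ` X G H)" unfolding B\<F> X_def[symmetric] using xs(2) by auto
    qed
    ultimately have "Sm ?\<eta> (envl ` B \<inter> near ?I u r)" by (rule Sm_subset)
    then show "\<exists>s>0. Sm ?\<eta> (envl ` B \<inter> near ?I u s)" using r by blast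
  qed simp
  then show ?thesis unfolding Sm_def
    by (rule small_subset) (use ep_envl len in auto)
qed

end

text \<open>The local description at the single point \<open>(0, f 0)\<close> suffices, because by
  continuity the graph over a neighbourhood of 0 stays in the corresponding cube.\<close>

lemma subanalytic_small:
  fixes f :: "real ^ 'n::{finite, linorder} \<Rightarrow> real ^ 'n::_"
  assumes U: "open U" "0 \<in> U" and f: "continuous_on U f"
    and sub: "subanalytic (CARD('n) + CARD('n)) (graph_on U f)"
  shows "\<exists>\<rho>>0. small {(p, f p) | p. p \<in> nondiff_set U f \<and> norm p < \<rho>}"
proof -
  let ?n = "CARD('n)" and ?a = "vec_list (0 :: real ^ 'n::_) @ vec_list (f 0)"
  have "?a \<in> Rn (?n + ?n)" by simp
  then obtain r l B R where r: "r > 0" and semi: "semianalytic (?n + ?n + l) B"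
    and graph: "graph_on U f \<inter> cube (?n + ?n) ?a r = take (?n + ?n) ` B"
    using sub unfolding subanalytic_def by blast
  interpret graph_cover U f B "?n + ?n + l"
  proof
    fix b assume "b \<in> B"
    then have "take (?n + ?n) b \<in> graph_on U f" using graph by blast
    then show "\<exists>p\<in>U. take (2 * ?n) b = vec_list p @ vec_list (f p)"
      by (auto simp: graph_on_def mult_2)
  qed simp
  have cont: "isCont f 0" using f U by (simp add: continuous_on_eq_continuous_at)
  obtain d1 where d1: "d1 > 0" "\<And>p. norm p < d1 \<Longrightarrow> norm (f p - f 0) < r"
    using cont r unfolding continuous_at_eps_delta by (auto simp: dist_norm)
  \<comment> \<open>Below \<open>r\<close> for the source coordinates, below \<open>d1\<close> so
    that the values stay within \<open>r\<close> of \<open>f 0\<close>.\<close>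
  define \<rho> where "\<rho> = min r d1"
  have "{(p, f p) | p. p \<in> nondiff_set U f \<and> norm p < \<rho>} \<subseteq> (\<Union>b\<in>B. gr b)"
  proof
    fix z assume "z \<in> {(p, f p) | p. p \<in> nondiff_set U f \<and> norm p < \<rho>}"
    then obtain p where p: "z = (p, f p)" "p \<in> nondiff_set U f" "norm p < \<rho>" by blast
    have pU: "p \<in> U" using p(2) by (simp add: nondiff_set_def)
    have "\<bar>vec_nth p i\<bar> < r" for i
      using component_le_norm_cart[of p i] p(3) by (simp add: \<rho>_def)
    moreover have "\<bar>vec_nth (f p) i - vec_nth (f 0) i\<bar> < r" for i
      using component_le_norm_cart[of "f p - f 0" i] d1(2)[of p] p(3) by (simp add: \<rho>_def)
    ultimately have "vec_list p @ vec_list (f p) \<in> cube (?n + ?n) ?a r"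
      by (auto simp: cube_def nth_append)
    then have "vec_list p @ vec_list (f p) \<in> take (?n + ?n) ` B"
      unfolding graph[symmetric] using pU by (auto simp: graph_on_def)
    then obtain b where b: "b \<in> B" "take (2 * ?n) b = vec_list p @ vec_list (f p)" by (auto simp: mult_2)
    then have "z \<in> gr b" using p by (auto simp: gr_def)
    then show "z \<in> (\<Union>b\<in>B. gr b)" using b(1) by blast
  qed
  then have "small {(p, f p) | p. p \<in> nondiff_set U f \<and> norm p < \<rho>}"
    by (rule small_subset[OF semianalytic_small[OF semi]])
  moreover have "\<rho> > 0" using r d1 by (simp add: \<rho>_def)
  ultimately show ?thesis by blast
qed

theorem theorem3p11:
  fixes f :: "real ^ 'n::{finite, linorder} \<Rightarrow> real ^ 'n::_"
    and U V W :: "(real ^ 'n::_) set"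
    and x y :: "real ^ 'n::_ \<Rightarrow> real ^ 'n::_"
  assumes "open U" and "0 \<in> U" and "continuous_on U f" and "f 0 = 0" and "tame_on U f"
    and "coordinate_system 0 V x" and "coordinate_system 0 W y"
    and "\<forall>j \<in> {1..<CARD('n)}. \<exists>K L. K > 0 \<and> L > 0 \<and>
           (\<forall>\<^sub>F p in nhds 0. p \<notin> nondiff_set U f \<longrightarrow>
              K \<le> jacobian_minor V x y f j p \<and> jacobian_minor V x y f j p \<le> L)"
    and "\<exists>K>0. \<forall>\<^sub>F p in nhds 0. p \<notin> nondiff_set U f \<longrightarrow>
           K \<le> jacobian_minor V x y f CARD('n) p"
  shows "\<exists>U' W' g. open U' \<and> 0 \<in> U' \<and> U' \<subseteq> U \<and> open W' \<and> 0 \<in> W' \<and> homeomorphism U' W' f g"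
proof -
  have "\<exists>\<rho>>0. small {(p, f p) | p. p \<in> nondiff_set U f \<and> norm p < \<rho>}"
  proof (cases "subanalytic (CARD('n) + CARD('n)) (graph_on U f)")
    case True
    then show ?thesis by (rule subanalytic_small[OF assms(1-3)])
  next
    case False
    then obtain S where S: "o_minimal_structure S" "graph_on U f \<in> S (CARD('n) + CARD('n))"
      using \<open>tame_on U f\<close> unfolding tame_on_def by blast
    \<comment> \<open>In the o-minimal case the whole bad part is small, so any radius will
      do.\<close>
    have "small {(p, f p) | p. p \<in> nondiff_set U f \<and> norm p < 1}"
      by (rule small_subset[OF o_minimal_structure.small_bad_part[OF S(1) assms(1) S(2)]]) blast
    then show ?thesis by (intro exI[of _ 1]) simp
  qed
  then obtain \<rho> where "\<rho> > 0" "small {(p, f p) | p. p \<in> nondiff_set U f \<and> norm p < \<rho>}" by blast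
  then show ?thesis
    by (rule homeomorphism_germ_if_small[OF assms(1-4) _ _ assms(6-9)])
qed

end
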